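(* Let $\alpha>0$ and $k\ge0$. Let $\mu$ be a probability measure on $[a,b]$ with Lebesgue density $m=\frac{d\mu}{d\mathscr{L}}\in W^{k+1,\infty}$ satisfying $0<\operatorname{ess\,inf}m\le \operatorname{ess\,sup}m<\infty$, and let $u_0\in W^{k+2,\infty}$ with $u_0(a)=u_0(b)=0$. For every $t\ge0$ let $\Phi_t$ be the minimizer of $F_\alpha^{f_\alpha^{tu_0},\mu}$ in $\mathscr{H}$. Then $t\mapsto\Phi_t$ is in $C^2([0,\infty);W^{k+2,\infty})$ and solves the Lagrangian pressureless information geometric regularization (IGR) equation $$\begin{cases}\ddot\Phi_t\,m-\alpha\,\partial_x\big([\partial_x\Phi_t]^{-2}\,[\partial_x\ddot\Phi_t]\,m\big)+2\alpha\,\partial_x\big([\partial_x\Phi_t]^{-3}\,[\partial_x\dot\Phi_t]^2\,m\big)=0,\\ \dot\Phi_0=u_0,\quad \Phi_0=\mathrm{Id},\quad \forall t\ge0:\ \Phi_t(a)=a,\ \Phi_t(b)=b.\end{cases}$$ The analogous result holds with $W^{k+1,\infty},W^{k+2,\infty}$ replaced by $C^{k+1},C^{k+2}$ (i.e. $m\in C^{k+1}$, $u_0\in C^{k+2}$ imply $t\mapsto\Phi_t\in C^2([0,\infty);C^{k+2})$ and the same equation).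
   Context: Fix reals $a<b$; function spaces are on $[a,b]$, $\mathscr{L}$ is Lebesgue measure, dots denote derivatives in $t$. The Helly space is $\mathscr{H}=\{\Phi:[a,b]\to[a,b]\ :\ \Phi \text{ monotone (non-decreasing)},\ \Phi(a)=a,\ \Phi(b)=b\}$. $\mathsf{Ent}(\nu)=\int \frac{d\nu}{d\mathscr{L}}\log\frac{d\nu}{d\mathscr{L}}\,d\mathscr{L}$ if $\nu\ll\mathscr{L}$ and $+\infty$ otherwise. For a linear functional $f$ and $\Phi\in\mathscr{H}$, $F_\alpha^{f,\mu}(\Phi)=\int_a^b\frac{(\Phi(x)-x)^2}{2}\,d\mu(x)+\alpha\,\mathsf{Ent}(\Phi_\#\mu)-f(\Phi)$. For a velocity $w$, $f_\alpha^{w}(\Phi)=\int_a^b \Phi\, w+\alpha\,\partial_x\Phi\,\partial_x w\,d\mu-\int_a^b\alpha\,\partial_x\Phi\,d\mu$; for $\Phi\in\mathscr{H}$ not weakly differentiable this is understood via integration by parts: $f_\alpha^w(\Phi)=\int_a^b\Phi\,[\,w m-\alpha\partial_x(m\,\partial_x w)+\alpha\,\partial_x m\,]\,dx+\alpha[m\,(\partial_x w)\Phi]_a^b-\alpha[m\Phi]_a^b$. *)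

theory Defs
  imports "HOL-Probability.Probability"
begin

section \<open>Sobolev and classical function spaces on a compact interval\<close>

text \<open>Functions on [a,b] are total functions on the reals of which only the values on [a,b] matter.\<close>

abbreviation leb :: "real \<Rightarrow> real \<Rightarrow> real measure" where
  "leb a b \<equiv> restrict_space lborel {a..b}"

definition test_function :: "real \<Rightarrow> real \<Rightarrow> (real \<Rightarrow> real) \<Rightarrow> bool" where
  "test_function a b \<phi> \<longleftrightarrow>
     (\<forall>n x. (deriv ^^ n) \<phi> field_differentiable (at x)) \<and>
     (\<exists>c d. a < c \<and> d < b \<and> (\<forall>x. x \<notin> {c..d} \<longrightarrow> \<phi> x = 0))"

definition locally_integrable :: "real \<Rightarrow> real \<Rightarrow> (real \<Rightarrow> real) \<Rightarrow> bool" where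
  "locally_integrable a b f \<longleftrightarrow> (\<forall>c d. a < c \<longrightarrow> d < b \<longrightarrow> set_integrable lborel {c..d} f)"

text \<open>\<open>g\<close> is (a Borel representative of) the \<open>n\<close>-th weak derivative of \<open>f\<close> on the open interval.\<close>

definition is_weak_deriv :: "real \<Rightarrow> real \<Rightarrow> nat \<Rightarrow> (real \<Rightarrow> real) \<Rightarrow> (real \<Rightarrow> real) \<Rightarrow> bool" where
  "is_weak_deriv a b n f g \<longleftrightarrow> locally_integrable a b f \<and> locally_integrable a b g \<and>
     (\<forall>\<phi>. test_function a b \<phi> \<longrightarrow>
        (LINT x:{a<..<b}|lborel. f x * (deriv ^^ n) \<phi> x) =
        (-1) ^ n * (LINT x:{a<..<b}|lborel. g x * \<phi> x))"

text \<open>A weak derivative is determined only almost everywhere. Where it has a representative that is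
  continuous on [a,b], that one is chosen, so that its values at the endpoints are meaningful.\<close>

definition wderiv :: "real \<Rightarrow> real \<Rightarrow> nat \<Rightarrow> (real \<Rightarrow> real) \<Rightarrow> real \<Rightarrow> real" where
  "wderiv a b n f = (SOME g. is_weak_deriv a b n f g \<and>
     ((\<exists>h. is_weak_deriv a b n f h \<and> continuous_on {a..b} h) \<longrightarrow> continuous_on {a..b} g))"

definition Linf_norm :: "real \<Rightarrow> real \<Rightarrow> (real \<Rightarrow> real) \<Rightarrow> ennreal" where
  "Linf_norm a b f = esssup (leb a b) (\<lambda>x. ennreal \<bar>f x\<bar>)"

definition Linf :: "real \<Rightarrow> real \<Rightarrow> (real \<Rightarrow> real) set" where
  "Linf a b = {f. f \<in> borel_measurable (leb a b) \<and> Linf_norm a b f < \<infinity>}"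

text \<open>The space \<open>W\<close> of order \<open>k\<close> and exponent \<open>\<infinity>\<close>. For \<open>k \<ge> 1\<close> every class has a
  representative continuous on [a,b]; the elements are these representatives.\<close>

definition sobolev_inf :: "real \<Rightarrow> real \<Rightarrow> nat \<Rightarrow> (real \<Rightarrow> real) set" where
  "sobolev_inf a b k = {f. (0 < k \<longrightarrow> continuous_on {a..b} f) \<and>
     (\<forall>n\<le>k. \<exists>g. is_weak_deriv a b n f g \<and> g \<in> Linf a b)}"

definition sobolev_inf_norm :: "real \<Rightarrow> real \<Rightarrow> nat \<Rightarrow> (real \<Rightarrow> real) \<Rightarrow> ennreal" where
  "sobolev_inf_norm a b k f = (\<Sum>n\<le>k. Linf_norm a b (wderiv a b n f))"

definition cderiv :: "real \<Rightarrow> real \<Rightarrow> (real \<Rightarrow> real) \<Rightarrow> real \<Rightarrow> real" where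
  "cderiv a b f x = vector_derivative f (at x within {a..b})"

definition C_space :: "real \<Rightarrow> real \<Rightarrow> nat \<Rightarrow> (real \<Rightarrow> real) set" where
  "C_space a b k = {f.
     (\<forall>n<k. \<forall>x\<in>{a..b}. (cderiv a b ^^ n) f differentiable (at x within {a..b})) \<and>
     continuous_on {a..b} ((cderiv a b ^^ k) f)}"

definition C_norm :: "real \<Rightarrow> real \<Rightarrow> nat \<Rightarrow> (real \<Rightarrow> real) \<Rightarrow> ennreal" where
  "C_norm a b k f = (\<Sum>n\<le>k. SUP x\<in>{a..b}. ennreal \<bar>(cderiv a b ^^ n) f x\<bar>)"

definition essinf :: "'a measure \<Rightarrow> ('a \<Rightarrow> ereal) \<Rightarrow> ereal" where
  "essinf M f = - esssup M (\<lambda>x. - f x)"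

section \<open>Curves of class C2 in a function space\<close>

text \<open>\<open>u\<close> takes values in \<open>X\<close>, is twice continuously differentiable on \<open>S\<close> with respect to the
  norm \<open>N\<close> (one-sided at boundary points of \<open>S\<close>), and has derivatives \<open>v\<close> and \<open>w\<close>.\<close>

definition has_curve_deriv ::
  "((real \<Rightarrow> real) \<Rightarrow> ennreal) \<Rightarrow> real set \<Rightarrow> (real \<Rightarrow> real \<Rightarrow> real) \<Rightarrow> (real \<Rightarrow> real \<Rightarrow> real) \<Rightarrow> bool" where
  "has_curve_deriv N S u v \<longleftrightarrow>
     (\<forall>t\<in>S. ((\<lambda>s. N (\<lambda>x. (u s x - u t x) / (s - t) - v t x)) \<longlongrightarrow> 0) (at t within S))"

definition C2_curve ::
  "(real \<Rightarrow> real) set \<Rightarrow> ((real \<Rightarrow> real) \<Rightarrow> ennreal) \<Rightarrow> real set \<Rightarrow>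
   (real \<Rightarrow> real \<Rightarrow> real) \<Rightarrow> (real \<Rightarrow> real \<Rightarrow> real) \<Rightarrow> (real \<Rightarrow> real \<Rightarrow> real) \<Rightarrow> bool" where
  "C2_curve X N S u v w \<longleftrightarrow>
     (\<forall>t\<in>S. u t \<in> X \<and> v t \<in> X \<and> w t \<in> X) \<and>
     has_curve_deriv N S u v \<and> has_curve_deriv N S v w \<and>
     (\<forall>t\<in>S. ((\<lambda>s. N (\<lambda>x. w s x - w t x)) \<longlongrightarrow> 0) (at t within S))"

section \<open>The variational problem\<close>

text \<open>Functions are extensional, so that equality in the Helly space is equality on [a,b].\<close>

definition helly :: "real \<Rightarrow> real \<Rightarrow> (real \<Rightarrow> real) set" where
  "helly a b = {\<Phi> \<in> {a..b} \<rightarrow>\<^sub>E {a..b}. mono_on {a..b} \<Phi> \<and> \<Phi> a = a \<and> \<Phi> b = b}"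

text \<open>The integral is split into positive and negative part, because the Bochner integral of a
  nonintegrable function is \<open>0\<close>. On an interval of finite length the negative part is finite.\<close>

definition Ent :: "real measure \<Rightarrow> real measure \<Rightarrow> ereal" where
  "Ent L \<nu> = (if absolutely_continuous L \<nu>
     then let h = (\<lambda>x. let r = enn2real (RN_deriv L \<nu> x) in r * ln r) in
       enn2ereal (\<integral>\<^sup>+ x. ennreal (h x) \<partial>L) - enn2ereal (\<integral>\<^sup>+ x. ennreal (- h x) \<partial>L)
     else \<infinity>)"

definition energy ::
  "real \<Rightarrow> real \<Rightarrow> real \<Rightarrow> ((real \<Rightarrow> real) \<Rightarrow> real) \<Rightarrow> real measure \<Rightarrow> (real \<Rightarrow> real) \<Rightarrow> ereal" where
  "energy a b \<alpha> f \<mu> \<Phi> =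
     ereal (\<integral>x. (\<Phi> x - x)\<^sup>2 / 2 \<partial>\<mu>) + ereal \<alpha> * Ent (leb a b) (distr \<mu> (leb a b) \<Phi>) - ereal (f \<Phi>)"

text \<open>Weak differentiability on the open interval does not see a jump of a monotone function at
  \<open>a\<close> or \<open>b\<close>, which the integrated-by-parts formula does account for; continuity on [a,b]
  excludes such jumps in the first case, and makes the two formulas consistent.\<close>

definition velocity_functional ::
  "real \<Rightarrow> real \<Rightarrow> real \<Rightarrow> real measure \<Rightarrow> (real \<Rightarrow> real) \<Rightarrow> (real \<Rightarrow> real) \<Rightarrow> (real \<Rightarrow> real) \<Rightarrow> real" where
  "velocity_functional a b \<alpha> \<mu> m w \<Phi> = (let d = wderiv a b 1 in
     if continuous_on {a..b} \<Phi> \<and> (\<exists>g. is_weak_deriv a b 1 \<Phi> g)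
     then (\<integral>x. \<Phi> x * w x + \<alpha> * d \<Phi> x * d w x \<partial>\<mu>) - (\<integral>x. \<alpha> * d \<Phi> x \<partial>\<mu>)
     else (\<integral>x. \<Phi> x * (w x * m x - \<alpha> * d (\<lambda>y. m y * d w y) x + \<alpha> * d m x) \<partial>leb a b)
       + \<alpha> * (m b * d w b * \<Phi> b - m a * d w a * \<Phi> a)
       - \<alpha> * (m b * \<Phi> b - m a * \<Phi> a))"

definition is_minimizer_at ::
  "real \<Rightarrow> real \<Rightarrow> real \<Rightarrow> real measure \<Rightarrow> (real \<Rightarrow> real) \<Rightarrow> (real \<Rightarrow> real) \<Rightarrow> real \<Rightarrow> (real \<Rightarrow> real) \<Rightarrow> bool" where
  "is_minimizer_at a b \<alpha> \<mu> m u0 t \<Phi> \<longleftrightarrow>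
     is_arg_min (energy a b \<alpha> (velocity_functional a b \<alpha> \<mu> m (\<lambda>x. t * u0 x)) \<mu>)
       (\<lambda>\<Psi>. \<Psi> \<in> helly a b) \<Phi>"

section \<open>The Lagrangian pressureless IGR equation\<close>

text \<open>The equation at one fixed time for position \<open>\<Phi>\<close>, velocity \<open>V\<close> and acceleration \<open>A\<close>. The
  parameters are the spatial derivative \<open>d\<close> (weak or classical), a space \<open>Y\<close> of functions
  differentiable in that sense, and the quantifier \<open>Q\<close> over points (almost all or all). Since
  \<open>inverse 0 = 0\<close>, nonvanishing of \<open>d \<Phi>\<close> is part of the meaning of the negative powers.\<close>

definition igr_equation ::
  "((real \<Rightarrow> real) \<Rightarrow> real \<Rightarrow> real) \<Rightarrow> (real \<Rightarrow> real) set \<Rightarrow> ((real \<Rightarrow> bool) \<Rightarrow> bool) \<Rightarrow>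
   real \<Rightarrow> (real \<Rightarrow> real) \<Rightarrow> (real \<Rightarrow> real) \<Rightarrow> (real \<Rightarrow> real) \<Rightarrow> (real \<Rightarrow> real) \<Rightarrow> bool" where
  "igr_equation d Y Q \<alpha> m \<Phi> V A \<longleftrightarrow>
     (let p = (\<lambda>y. inverse (d \<Phi> y) ^ 2 * d A y * m y);
          q = (\<lambda>y. inverse (d \<Phi> y) ^ 3 * (d V y)\<^sup>2 * m y)
      in Q (\<lambda>x. d \<Phi> x \<noteq> 0) \<and> p \<in> Y \<and> q \<in> Y \<and>
         Q (\<lambda>x. A x * m x - \<alpha> * d p x + 2 * \<alpha> * d q x = 0))"

definition solves_igr ::
  "((real \<Rightarrow> real) \<Rightarrow> real \<Rightarrow> real) \<Rightarrow> (real \<Rightarrow> real) set \<Rightarrow> ((real \<Rightarrow> bool) \<Rightarrow> bool) \<Rightarrow>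
   real \<Rightarrow> real \<Rightarrow> real \<Rightarrow> (real \<Rightarrow> real) \<Rightarrow> (real \<Rightarrow> real) \<Rightarrow>
   (real \<Rightarrow> real \<Rightarrow> real) \<Rightarrow> (real \<Rightarrow> real \<Rightarrow> real) \<Rightarrow> (real \<Rightarrow> real \<Rightarrow> real) \<Rightarrow> bool" where
  "solves_igr d Y Q a b \<alpha> m u0 \<Phi> V A \<longleftrightarrow>
     (\<forall>t\<ge>0. igr_equation d Y Q \<alpha> m (\<Phi> t) (V t) (A t)) \<and>
     (\<forall>x\<in>{a..b}. V 0 x = u0 x) \<and> (\<forall>x\<in>{a..b}. \<Phi> 0 x = x) \<and>
     (\<forall>t\<ge>0. \<Phi> t a = a \<and> \<Phi> t b = b)"

end

theory Submission
  imports Defs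
begin

text \<open>Write \<open>u1\<close> for the derivative of \<open>u0\<close>. For \<open>\<Phi>\<close> with positive derivative put \<open>q = m / \<Phi>'\<close>, the density
of the pushforward of \<open>\<mu>\<close> seen from the Lagrangian coordinate, so that the entropy is
\<open>\<integral> m ln q\<close>. With \<open>p = q - m (1 - t u1)\<close> the Euler-Lagrange equation of the energy at time \<open>t\<close> is
the first-order boundary value problem
\<open>\<Phi>' = m / q\<close>, \<open>p' = - (m / \<alpha>) (\<Phi> - x - t u0)\<close>, \<open>\<Phi>(a) = a\<close>, \<open>\<Phi>(b) = b\<close>.

\<^emph>\<open>Existence.\<close> The system with \<open>q\<close> replaced by \<open>max \<epsilon> q\<close> is globally Lipschitz, and shooting in the
initial momentum solves it. Since \<open>\<Phi>\<close> stays in \<open>[a,b]\<close>, \<open>q\<close> is Lipschitz with a constant that does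
not depend on \<open>\<epsilon>\<close>; if \<open>q\<close> fell below \<open>\<epsilon>\<close> somewhere, then \<open>\<integral> m / max \<epsilon> q\<close> would be at least of order
\<open>ln (1 / \<epsilon>)\<close>, while it equals \<open>b - a\<close>. So for small \<open>\<epsilon>\<close> the truncation is inactive
(\<open>lower_barrier\<close>, \<open>euler_lagrange_exists\<close>).

\<^emph>\<open>Minimality.\<close> Young's inequality \<open>r ln r \<ge> r ln \<rho> + r - \<rho>\<close>, applied to the density \<open>r\<close> of the
pushforward by a competitor \<open>\<Psi>\<close> and to \<open>\<rho> = q \<circ> \<Psi>\<^sup>-\<^sup>1\<close>, bounds the entropy below by an affine functional
of \<open>\<Psi>\<close> (\<open>entropy_lower_bound\<close>). Inserting the equation for \<open>q'\<close>, the energy of \<open>\<Psi>\<close> is at least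
that of \<open>\<Phi>\<close> plus \<open>\<integral> m (\<Psi> - \<Phi>)\<^sup>2 / 2\<close> (\<open>energy_bound_identity\<close>), which gives minimality and
uniqueness at once.

\<^emph>\<open>Regularity in time.\<close> Difference quotients of solutions at two times solve a linear boundary value
problem \<open>y' = g - c P\<close>, \<open>P' = - h y\<close>, \<open>y(a) = y(b) = 0\<close> with \<open>c, h > 0\<close>. Such a problem is uniquely solvable
and its solution is controlled by \<open>sup \<bar>g\<bar>\<close> (\<open>linear_stability\<close>): Rolle's theorem for \<open>y P\<close> yields a
point where \<open>(y, P)\<close> is controlled, and Gronwall's inequality spreads the bound. Hence velocity and
acceleration can be defined by the formally differentiated problems, and the same estimate shows
that they are the derivatives, with errors of first order in the time step.

\<^emph>\<open>Regularity in space.\<close> Consider curves that are \<open>C\<^sup>2\<close> in time with Lipschitz second derivative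
and whose values are \<open>j\<close>-fold primitives of functions from a base class. They are closed under sums,
products and reciprocals of functions bounded away from \<open>0\<close>. Feeding
\<open>p\<close> and \<open>\<Phi>\<close> alternately into each other's equation gains one derivative at a time (\<open>bootstrap\<close>).
Taking bounded measurable functions as base class gives the Sobolev statement, continuous
functions the classical one.

\<^emph>\<open>The equation.\<close> Let \<open>Z\<close> and \<open>B\<close> be the time derivative of \<open>q\<close> and the second time derivative of \<open>p\<close>. Then
\<open>\<Phi>'\<^sup>-\<^sup>2 A' m = 2 Z\<^sup>2 / q - B\<close> and \<open>\<Phi>'\<^sup>-\<^sup>3 V'\<^sup>2 m = Z\<^sup>2 / q\<close>, so the equation is just \<open>A m + \<alpha> B' = 0\<close>
(\<open>solves_igr_equation\<close>).\<close>

section \<open>Ordinary differential equations on a compact interval\<close>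

lemma nondecreasing_of_deriv_nonneg:
  fixes f :: "real \<Rightarrow> real"
  assumes d: "\<And>x. x \<in> {a..b} \<Longrightarrow> (f has_real_derivative f' x) (at x within {a..b})"
    and nn: "\<And>x. x \<in> {a..b} \<Longrightarrow> 0 \<le> f' x" and xy: "a \<le> x" "x \<le> y" "y \<le> b"
  shows "f x \<le> f y"
proof (rule DERIV_nonneg_imp_increasing_open[OF xy(2)])
  show "continuous_on {x..y} f"
    using DERIV_continuous_on[of "{a..b}" f f'] d continuous_on_subset xy
    by (metis atLeastatMost_subset_iff)
  fix z assume z: "x < z" "z < y"
  have "at z within {a..b} = at z" using z xy by (intro at_within_interior) auto
  then show "\<exists>w. (f has_real_derivative w) (at z) \<and> 0 \<le> w"
    using d[of z] nn[of z] z xy by auto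
qed

text \<open>Two-sided in \<open>x\<close> and \<open>y\<close>: from the bound on \<open>\<bar>z'\<bar>\<close> the function \<open>(z + N) exp (- L x)\<close> decreases and
\<open>(z + N) exp (L x)\<close> increases. The point of departure \<open>x\<close> may thus be in the interior, as it is
for a point supplied by Rolle's theorem.\<close>

lemma gronwall:
  fixes z z' :: "real \<Rightarrow> real"
  assumes d: "\<And>x. x \<in> {a..b} \<Longrightarrow> (z has_real_derivative z' x) (at x within {a..b})"
    and bd: "\<And>x. x \<in> {a..b} \<Longrightarrow> \<bar>z' x\<bar> \<le> L * (z x + N)"
    and xy: "x \<in> {a..b}" "y \<in> {a..b}"
  shows "z y + N \<le> (z x + N) * exp (L * \<bar>y - x\<bar>)"
proof -
  have up: "(z v + N) * exp (L * u) \<le> (z u + N) * exp (L * v)" if "a \<le> u" "u \<le> v" "v \<le> b" for u v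
  proof -
    have "- ((z u + N) * exp (- L * u)) \<le> - ((z v + N) * exp (- L * v))"
    proof (rule nondecreasing_of_deriv_nonneg[where f = "\<lambda>x. - ((z x + N) * exp (- L * x))"
          and f' = "\<lambda>x. - (z' x * exp (- L * x) + (z x + N) * (- L * exp (- L * x)))" and a = a and b = b])
      fix x assume x: "x \<in> {a..b}"
      show "((\<lambda>x. - ((z x + N) * exp (- L * x))) has_real_derivative
          - (z' x * exp (- L * x) + (z x + N) * (- L * exp (- L * x)))) (at x within {a..b})"
        by (rule derivative_eq_intros d[OF x] refl | simp)+
      have "- (z' x * exp (- L * x) + (z x + N) * (- L * exp (- L * x))) = (L * (z x + N) - z' x) * exp (- L * x)"
        by (simp add: algebra_simps)
      then show "0 \<le> - (z' x * exp (- L * x) + (z x + N) * (- L * exp (- L * x)))"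
        using bd[OF x] by simp
    qed (use that in auto)
    then have "(z v + N) * exp (- L * v) * (exp (L * u) * exp (L * v))
       \<le> (z u + N) * exp (- L * u) * (exp (L * u) * exp (L * v))"
      by (intro mult_right_mono) auto
    moreover have "w * exp (- L * v) * (exp (L * u) * exp (L * v)) = w * exp (L * u)"
      "w * exp (- L * u) * (exp (L * u) * exp (L * v)) = w * exp (L * v)" for w
      by (simp_all add: exp_minus)
    ultimately show ?thesis by metis
  qed
  have dn: "(z u + N) * exp (L * u) \<le> (z v + N) * exp (L * v)" if "a \<le> u" "u \<le> v" "v \<le> b" for u v
  proof (rule nondecreasing_of_deriv_nonneg[where f = "\<lambda>x. ((z x + N) * exp (L * x))"
          and f' = "\<lambda>x. (z' x * exp (L * x) + (z x + N) * (L * exp (L * x)))" and a = a and b = b])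
      fix x assume x: "x \<in> {a..b}"
      show "((\<lambda>x. (z x + N) * exp (L * x)) has_real_derivative
          (z' x * exp (L * x) + (z x + N) * (L * exp (L * x)))) (at x within {a..b})"
        by (rule derivative_eq_intros d[OF x] refl | simp)+
      have "(z' x * exp (L * x) + (z x + N) * (L * exp (L * x))) = (L * (z x + N) + z' x) * exp (L * x)"
        by (simp add: algebra_simps)
      then show "0 \<le> (z' x * exp (L * x) + (z x + N) * (L * exp (L * x)))"
        using bd[OF x] by simp
  qed (use that in auto)
  show ?thesis
  proof (cases "x \<le> y")
    case True
    have "(z y + N) * exp (L * x) \<le> (z x + N) * exp (L * (y - x)) * exp (L * x)"
      using up[of x y] True xy by (simp add: mult.assoc algebra_simps flip: exp_add)
    then show ?thesis using True by simp
  next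
    case False
    have "(z y + N) * exp (L * y) \<le> (z x + N) * exp (L * (x - y)) * exp (L * y)"
      using dn[of y x] False xy by (simp add: mult.assoc algebra_simps flip: exp_add)
    then show ?thesis using False by simp
  qed
qed

text \<open>A global solution by one application of Banach's fixed point theorem: in the norm weighted with
\<open>exp (- K (x - a))\<close>, \<open>K > 2 \<bar>L\<bar>\<close>, the integral operator has Lipschitz constant at most \<open>1/2\<close>. The
weight is built into the unknown, and functions are extended by constants outside the interval,
so that the complete space of bounded continuous functions can be used.\<close>

lemma picard_lindelof:
  fixes F :: "real \<Rightarrow> 'a::banach \<Rightarrow> 'a"
  assumes ab: "a \<le> b"
    and cont: "continuous_on ({a..b} \<times> UNIV) (\<lambda>(x, z). F x z)"
    and lip: "\<And>x y z. x \<in> {a..b} \<Longrightarrow> norm (F x y - F x z) \<le> L * norm (y - z)"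
  shows "\<exists>z. z a = z0 \<and> (\<forall>x\<in>{a..b}. (z has_vector_derivative F x (z x)) (at x within {a..b}))"
proof -
  \<comment> \<open>The exponent of the weight.\<close>
  define K where "K = 2 * \<bar>L\<bar> + 1"
  have K: "0 < K" "2 * \<bar>L\<bar> \<le> K" by (simp_all add: K_def)
  define cl where "cl x = max a (min b x)" for x :: real
  have cl: "cl x \<in> {a..b}" "x \<in> {a..b} \<Longrightarrow> cl x = x" for x using ab by (auto simp: cl_def)
  have ccl: "continuous_on UNIV cl" unfolding cl_def by (intro continuous_intros)
  have Fc: "continuous_on {a..b} (\<lambda>s. F s (g s))" if "continuous_on {a..b} g" for g
    using continuous_on_compose2[OF cont, of "{a..b}" "\<lambda>s. (s, g s)"] that
    by (simp add: image_subset_iff continuous_on_Pair continuous_on_id)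
  define G where "G w = (\<lambda>s. F s (exp (K * (s - a)) *\<^sub>R apply_bcontfun w s))" for w :: "real \<Rightarrow>\<^sub>C 'a"
  have Gc: "continuous_on {a..b} (G w)" for w
    unfolding G_def by (rule Fc) (intro continuous_intros continuous_on_apply_bcontfun)
  have Gi: "G w integrable_on {a..x}" if "x \<in> {a..b}" for w x
    using that by (intro integrable_continuous_real continuous_on_subset[OF Gc]) auto
  define T where "T w = (\<lambda>x. exp (- K * (cl x - a)) *\<^sub>R (z0 + integral {a..cl x} (G w)))" for w
  have Ic: "continuous_on {a..b} (\<lambda>x. integral {a..x} (G w))" for w
    using indefinite_integral_continuous_1[OF Gi[of b]] ab by auto
  have H: "continuous_on {a..b} (\<lambda>y. exp (- K * (y - a)) *\<^sub>R (z0 + integral {a..y} (G w)))" for w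
    by (intro continuous_intros Ic)
  have Tb: "T w \<in> bcontfun" for w
  proof -
    obtain B where B: "\<And>y. y \<in> {a..b} \<Longrightarrow> norm (exp (- K * (y - a)) *\<^sub>R (z0 + integral {a..y} (G w))) \<le> B"
      using compact_imp_bounded[OF compact_continuous_image[OF H[of w] compact_Icc]]
      unfolding bounded_iff by blast
    show ?thesis
    proof (rule bcontfun_normI)
      show "continuous_on UNIV (T w)" unfolding T_def
        by (rule continuous_on_compose2[OF H[of w] ccl]) (use cl(1) in auto)
      show "norm (T w x) \<le> B" for x unfolding T_def by (rule B[OF cl(1)])
    qed
  qed
  define TT where "TT w = Bcontfun (T w)" for w
  have TT: "apply_bcontfun (TT w) = T w" for w
    unfolding TT_def by (rule Bcontfun_inverse[OF Tb])
  have contr: "dist (TT w) (TT w') \<le> 1/2 * dist w w'" for w w'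
  proof (rule dist_bound)
    fix x0
    define x where "x = cl x0"
    have x: "x \<in> {a..b}" using cl by (simp add: x_def)
    let ?D = "dist w w'"
    have "norm (integral {a..x} (G w) - integral {a..x} (G w')) = norm (integral {a..x} (\<lambda>s. G w s - G w' s))"
      using Gi[OF x] by (simp add: Henstock_Kurzweil_Integration.integral_diff)
    also have "\<dots> \<le> integral {a..x} (\<lambda>s. \<bar>L\<bar> * ?D * exp (K * (s - a)))"
    proof (rule Henstock_Kurzweil_Integration.integral_norm_bound_integral)
      show "(\<lambda>s. G w s - G w' s) integrable_on {a..x}" using Gi[OF x] by (intro integrable_diff)
      show "(\<lambda>s. \<bar>L\<bar> * ?D * exp (K * (s - a))) integrable_on {a..x}"
        by (intro integrable_continuous_real continuous_intros)
      fix s assume s: "s \<in> {a..x}"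
      have "norm (G w s - G w' s) \<le> L * norm (exp (K * (s - a)) *\<^sub>R apply_bcontfun w s - exp (K * (s - a)) *\<^sub>R apply_bcontfun w' s)"
        unfolding G_def using s x by (intro lip) auto
      also have "\<dots> \<le> \<bar>L\<bar> * (exp (K * (s - a)) * dist (apply_bcontfun w s) (apply_bcontfun w' s))"
        by (simp add: dist_norm mult_right_mono flip: scaleR_diff_right)
      also have "\<dots> \<le> \<bar>L\<bar> * (exp (K * (s - a)) * ?D)"
        by (intro mult_left_mono dist_bounded) auto
      finally show "norm (G w s - G w' s) \<le> \<bar>L\<bar> * ?D * exp (K * (s - a))" by (simp add: mult_ac)
    qed
    also have "integral {a..x} (\<lambda>s. \<bar>L\<bar> * ?D * exp (K * (s - a))) = \<bar>L\<bar> * ?D * (exp (K * (x - a)) / K - 1 / K)"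
    proof (rule integral_unique)
      have "((\<lambda>s. \<bar>L\<bar> * ?D * exp (K * (s - a))) has_integral
          (\<bar>L\<bar> * ?D * exp (K * (x - a)) / K - \<bar>L\<bar> * ?D * exp (K * (a - a)) / K)) {a..x}"
        using x K by (intro fundamental_theorem_of_calculus)
          (auto intro!: derivative_eq_intros simp: has_real_derivative_iff_has_vector_derivative[symmetric])
      then show "((\<lambda>s. \<bar>L\<bar> * ?D * exp (K * (s - a))) has_integral \<bar>L\<bar> * ?D * (exp (K * (x - a)) / K - 1 / K)) {a..x}"
        by (simp add: algebra_simps)
    qed
    also have "\<dots> \<le> \<bar>L\<bar> * ?D * (exp (K * (x - a)) / K)"
      using K by (intro mult_left_mono) auto
    finally have 1: "norm (integral {a..x} (G w) - integral {a..x} (G w')) \<le> \<bar>L\<bar> * ?D * (exp (K * (x - a)) / K)" .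
    have "dist (apply_bcontfun (TT w) x0) (apply_bcontfun (TT w') x0)
       = exp (- K * (x - a)) * norm (integral {a..x} (G w) - integral {a..x} (G w'))"
      unfolding TT T_def x_def[symmetric] dist_norm by (simp flip: scaleR_diff_right)
    also have "\<dots> \<le> exp (- K * (x - a)) * (\<bar>L\<bar> * ?D * (exp (K * (x - a)) / K))"
      by (intro mult_left_mono 1) auto
    also have "\<dots> = (exp (- K * (x - a)) * exp (K * (x - a))) * (\<bar>L\<bar> / K * ?D)" by simp
    also have "exp (- K * (x - a)) * exp (K * (x - a)) = 1" by (simp flip: exp_add)
    also have "1 * (\<bar>L\<bar> / K * ?D) \<le> 1/2 * ?D"
      using K by (simp only: mult_1) (intro mult_right_mono; simp add: field_simps)
    finally show "dist (apply_bcontfun (TT w) x0) (apply_bcontfun (TT w') x0) \<le> 1/2 * ?D" .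
  qed
  obtain w where w: "TT w = w"
    using banach_fix_type[of "1/2" TT] contr by auto
  define z where "z x = z0 + integral {a..x} (G w)" for x
  have zw: "exp (K * (x - a)) *\<^sub>R apply_bcontfun w x = z x" if "x \<in> {a..b}" for x
  proof -
    have "apply_bcontfun w x = exp (- K * (x - a)) *\<^sub>R z x"
      using TT[of w] cl(2)[OF that] unfolding w T_def z_def by (metis)
    then have "exp (K * (x - a)) *\<^sub>R apply_bcontfun w x = (exp (K * (x - a)) * exp (- K * (x - a))) *\<^sub>R z x" by simp
    also have "exp (K * (x - a)) * exp (- K * (x - a)) = 1" by (simp flip: exp_add)
    finally show ?thesis by simp
  qed
  have "(z has_vector_derivative F x (z x)) (at x within {a..b})" if "x \<in> {a..b}" for x
  proof -
    have "((\<lambda>u. integral {a..u} (G w)) has_vector_derivative G w x) (at x within {a..b})"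
      by (rule integral_has_vector_derivative[OF Gc that])
    then have "(z has_vector_derivative G w x) (at x within {a..b})"
      unfolding z_def by (auto intro!: derivative_eq_intros)
    then show ?thesis using zw[OF that] by (simp add: G_def)
  qed
  moreover have "z a = z0" by (simp add: z_def)
  ultimately show ?thesis by blast
qed

section \<open>Linear boundary value problems\<close>

text \<open>The square root of \<open>(1 + 1 / \<kappa>\<^sup>2) exp ((2 C + 1) l)\<close> is what \<open>linear_stability\<close> gives: \<open>1 / \<kappa>\<^sup>2\<close> comes
from the Rolle point and the exponential from Gronwall's inequality for \<open>y\<^sup>2 + p\<^sup>2\<close>.\<close>

definition stability_constant :: "real \<Rightarrow> real \<Rightarrow> real \<Rightarrow> real" where
  "stability_constant \<kappa> C l = sqrt ((1 + 1 / \<kappa>\<^sup>2) * exp ((2 * C + 1) * l))"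

lemma stability_constant_nonneg: "0 \<le> stability_constant \<kappa> C l"
  by (simp add: stability_constant_def)

text \<open>At a zero of \<open>(y p)' = g p - c p\<^sup>2 - h y\<^sup>2\<close>, which exists by Rolle's theorem because \<open>y\<close> vanishes at both
ends, positivity of \<open>c\<close> and \<open>h\<close> bounds \<open>y\<close> and \<open>p\<close> in terms of \<open>g\<close>. From there the bound propagates
to the whole interval by Gronwall's inequality for \<open>y\<^sup>2 + p\<^sup>2\<close>. The boundary values of \<open>p\<close> are
free and are controlled through the zero only.\<close>

lemma linear_stability:
  fixes y p :: "real \<Rightarrow> real"
  assumes ab: "a < b"
    and y: "\<And>x. x \<in> {a..b} \<Longrightarrow> (y has_real_derivative g x - c x * p x) (at x within {a..b})"
    and p: "\<And>x. x \<in> {a..b} \<Longrightarrow> (p has_real_derivative - h x * y x) (at x within {a..b})"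
    and bc: "y a = 0" "y b = 0"
    and c: "\<And>x. x \<in> {a..b} \<Longrightarrow> \<kappa> \<le> c x \<and> c x \<le> C"
    and h: "\<And>x. x \<in> {a..b} \<Longrightarrow> \<kappa> \<le> h x \<and> h x \<le> C"
    and g: "\<And>x. x \<in> {a..b} \<Longrightarrow> \<bar>g x\<bar> \<le> N"
    and \<kappa>: "0 < \<kappa>" and x: "x \<in> {a..b}"
  shows "\<bar>y x\<bar> \<le> stability_constant \<kappa> C (b - a) * N \<and> \<bar>p x\<bar> \<le> stability_constant \<kappa> C (b - a) * N"
proof -
  have N: "0 \<le> N" using g[OF x] by linarith
  have C: "0 < C" using c[OF x] \<kappa> by linarith
  have dyp: "((\<lambda>x. y x * p x) has_real_derivative (g x - c x * p x) * p x + (- h x * y x) * y x) (at x within {a..b})"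
    if "x \<in> {a..b}" for x
    by (rule DERIV_mult'[OF y[OF that] p[OF that], THEN DERIV_cong]) simp
  have "\<exists>x0. a < x0 \<and> x0 < b \<and> (\<lambda>v. ((g x0 - c x0 * p x0) * p x0 + (- h x0 * y x0) * y x0) * v) = (\<lambda>v. 0)"
  proof (rule Rolle_deriv[OF ab, where f = "\<lambda>x. y x * p x"])
    show "continuous_on {a..b} (\<lambda>x. y x * p x)"
      by (rule DERIV_continuous_on[OF dyp])
    fix x assume x: "a < x" "x < b"
    have "at x within {a..b} = at x" using x by (intro at_within_interior) auto
    then show "((\<lambda>x. y x * p x) has_derivative (\<lambda>v. ((g x - c x * p x) * p x + (- h x * y x) * y x) * v)) (at x)"
      using dyp[of x] x by (simp add: has_field_derivative_def)
  qed (use bc in simp)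
  \<comment> \<open>A critical point of \<open>y p\<close>.\<close>
  then obtain x0 where x0': "a < x0" "x0 < b"
      "(\<lambda>v. ((g x0 - c x0 * p x0) * p x0 + (- h x0 * y x0) * y x0) * v) = (\<lambda>v. 0)" by blast
  have x0: "x0 \<in> {a..b}" "(g x0 - c x0 * p x0) * p x0 + (- h x0 * y x0) * y x0 = 0"
    using x0'(1,2) fun_cong[OF x0'(3), of 1] by (auto simp only: mult_1_right atLeastAtMost_iff)
  have "\<kappa> * (y x0)\<^sup>2 \<le> h x0 * (y x0)\<^sup>2" "\<kappa> * (p x0)\<^sup>2 \<le> c x0 * (p x0)\<^sup>2"
    using c[OF x0(1)] h[OF x0(1)] by (auto intro!: mult_right_mono)
  moreover have "g x0 * p x0 \<le> N * \<bar>p x0\<bar>"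
    using mult_right_mono[OF g[OF x0(1)], of "\<bar>p x0\<bar>"] by (simp add: abs_mult[symmetric])
  ultimately have e0: "\<kappa> * ((y x0)\<^sup>2 + (p x0)\<^sup>2) \<le> N * \<bar>p x0\<bar>"
    using x0(2) by (simp add: algebra_simps power2_eq_square)
  have pb: "\<bar>p x0\<bar> \<le> N / \<kappa>"
  proof (cases "p x0 = 0")
    case True then show ?thesis using N \<kappa> by simp
  next
    case False
    have "\<kappa> * (p x0)\<^sup>2 \<le> N * \<bar>p x0\<bar>"
      using e0 mult_nonneg_nonneg[OF less_imp_le[OF \<kappa>] zero_le_power2[of "y x0"]]
      unfolding distrib_left by linarith
    then have "(\<kappa> * \<bar>p x0\<bar>) * \<bar>p x0\<bar> \<le> N * \<bar>p x0\<bar>" by (simp add: power2_eq_square mult.assoc)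
    then have "\<kappa> * \<bar>p x0\<bar> \<le> N" using False by (simp add: mult_le_cancel_right)
    then show ?thesis using \<kappa> by (simp add: field_simps)
  qed
  have "\<kappa> * ((y x0)\<^sup>2 + (p x0)\<^sup>2) \<le> N * (N / \<kappa>)"
    using e0 mult_left_mono[OF pb N] by linarith
  then have z0: "(y x0)\<^sup>2 + (p x0)\<^sup>2 \<le> N\<^sup>2 / \<kappa>\<^sup>2"
    using \<kappa> by (simp add: field_simps power2_eq_square)
  define z where "z x = (y x)\<^sup>2 + (p x)\<^sup>2" for x
  have gr: "z x + N\<^sup>2 \<le> (z x0 + N\<^sup>2) * exp ((2 * C + 1) * \<bar>x - x0\<bar>)"
  proof (rule gronwall[where z = z and a = a and b = b and L = "2 * C + 1"
      and z' = "\<lambda>x. 2 * y x * (g x - c x * p x) + 2 * p x * (- h x * y x)"])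
    fix x assume x: "x \<in> {a..b}"
    show "(z has_real_derivative 2 * y x * (g x - c x * p x) + 2 * p x * (- h x * y x)) (at x within {a..b})"
      unfolding z_def by (rule derivative_eq_intros y[OF x] p[OF x] refl | simp)+
    have "2 * \<bar>y x\<bar> * \<bar>g x\<bar> \<le> (y x)\<^sup>2 + N\<^sup>2"
    proof -
      have "2 * \<bar>y x\<bar> * \<bar>g x\<bar> \<le> (y x)\<^sup>2 + (g x)\<^sup>2"
        using sum_squares_bound[of "\<bar>y x\<bar>" "\<bar>g x\<bar>"] by simp
      also have "(g x)\<^sup>2 \<le> N\<^sup>2" using g[OF x] N by (simp add: power2_le_iff_abs_le)
      finally show ?thesis by simp
    qed
    moreover have "2 * \<bar>y x\<bar> * \<bar>p x\<bar> * (c x + h x) \<le> z x * (2 * C)"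
    proof (rule mult_mono)
      show "2 * \<bar>y x\<bar> * \<bar>p x\<bar> \<le> z x"
        using sum_squares_bound[of "\<bar>y x\<bar>" "\<bar>p x\<bar>"] by (simp add: z_def)
    qed (use c[OF x] h[OF x] \<kappa> in \<open>auto simp: z_def\<close>)
    moreover have "\<bar>2 * y x * (g x - c x * p x) + 2 * p x * (- h x * y x)\<bar>
        \<le> 2 * \<bar>y x\<bar> * \<bar>g x\<bar> + 2 * \<bar>y x\<bar> * \<bar>p x\<bar> * (c x + h x)"
    proof -
      have "2 * y x * (g x - c x * p x) + 2 * p x * (- h x * y x) = 2 * y x * g x - 2 * y x * p x * (c x + h x)"
        by (simp add: algebra_simps)
      also have "\<bar>\<dots>\<bar> \<le> \<bar>2 * y x * g x\<bar> + \<bar>2 * y x * p x * (c x + h x)\<bar>" by (rule abs_triangle_ineq4)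
      finally show ?thesis using c[OF x] h[OF x] \<kappa> by (simp add: abs_mult)
    qed
    moreover have "(2 * C + 1) * (z x + N\<^sup>2) = z x * (2 * C) + ((y x)\<^sup>2 + N\<^sup>2) + (p x)\<^sup>2 + 2 * (C * N\<^sup>2)"
      by (simp add: z_def algebra_simps)
    moreover have "0 \<le> (p x)\<^sup>2" "0 \<le> C * N\<^sup>2" using C by auto
    ultimately show "\<bar>2 * y x * (g x - c x * p x) + 2 * p x * (- h x * y x)\<bar> \<le> (2 * C + 1) * (z x + N\<^sup>2)"
      by linarith
  qed (use x x0 in auto)
  also have "\<dots> \<le> ((N\<^sup>2 / \<kappa>\<^sup>2) + N\<^sup>2) * exp ((2 * C + 1) * (b - a))"
    using z0 x x0 C by (intro mult_mono) (auto simp: z_def intro!: add_nonneg_nonneg)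
  also have "\<dots> = (stability_constant \<kappa> C (b - a) * N)\<^sup>2"
    by (simp add: stability_constant_def power_mult_distrib algebra_simps add_nonneg_nonneg)
  finally have "z x + N\<^sup>2 \<le> (stability_constant \<kappa> C (b - a) * N)\<^sup>2" .
  then have zb: "z x \<le> (stability_constant \<kappa> C (b - a) * N)\<^sup>2"
    using zero_le_power2[of N] by linarith
  have sN: "0 \<le> stability_constant \<kappa> C (b - a) * N"
    using N stability_constant_nonneg by simp
  have "(y x)\<^sup>2 \<le> (stability_constant \<kappa> C (b - a) * N)\<^sup>2" "(p x)\<^sup>2 \<le> (stability_constant \<kappa> C (b - a) * N)\<^sup>2"
    using zb zero_le_power2[of "y x"] zero_le_power2[of "p x"] unfolding z_def by linarith+
  then show ?thesis using sN by (auto simp flip: abs_le_square_iff)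
qed

text \<open>The problem is parametrized by the missing initial value \<open>p0\<close>, for superposition in \<open>linear_bvp\<close>.\<close>

lemma linear_ivp:
  fixes c g h :: "real \<Rightarrow> real"
  assumes ab: "a < b" and cont: "continuous_on {a..b} c" "continuous_on {a..b} g" "continuous_on {a..b} h"
  shows "\<exists>y p. y a = 0 \<and> p a = p0 \<and> (\<forall>x\<in>{a..b}. (y has_real_derivative g x - c x * p x) (at x within {a..b}) \<and>
     (p has_real_derivative - h x * y x) (at x within {a..b}))"
proof -
  define F where "F x z = (g x - c x * snd z, - h x * fst z)" for x and z :: "real \<times> real"
  obtain Bc Bh where B: "\<And>x. x \<in> {a..b} \<Longrightarrow> \<bar>c x\<bar> \<le> Bc" "\<And>x. x \<in> {a..b} \<Longrightarrow> \<bar>h x\<bar> \<le> Bh"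
    using compact_imp_bounded[OF compact_continuous_image[OF cont(1) compact_Icc]]
      compact_imp_bounded[OF compact_continuous_image[OF cont(3) compact_Icc]]
    unfolding bounded_iff by (metis image_eqI real_norm_def)
  have "\<exists>z. z a = (0, p0) \<and> (\<forall>x\<in>{a..b}. (z has_vector_derivative F x (z x)) (at x within {a..b}))"
  proof (rule picard_lindelof[where L = "Bc + Bh"])
    have c': "continuous_on ({a..b} \<times> UNIV) (\<lambda>z. f (fst z))" if "continuous_on {a..b} f" for f :: "real \<Rightarrow> real"
      by (rule continuous_on_compose2[OF that]) (auto intro!: continuous_intros)
    show "continuous_on ({a..b} \<times> UNIV) (\<lambda>(x, z). F x z)"
      unfolding F_def split_beta by (intro continuous_intros c' cont)
    fix x and y z :: "real \<times> real" assume x: "x \<in> {a..b}"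
    have "F x y - F x z = (- (c x * (snd y - snd z)), - (h x * (fst y - fst z)))"
      by (simp add: F_def algebra_simps)
    then have "norm (F x y - F x z) \<le> \<bar>c x\<bar> * \<bar>snd (y - z)\<bar> + \<bar>h x\<bar> * \<bar>fst (y - z)\<bar>"
      using norm_Pair_le[of "- (c x * (snd y - snd z))" "- (h x * (fst y - fst z))"] by (simp add: abs_mult)
    also have "\<dots> \<le> Bc * norm (y - z) + Bh * norm (y - z)"
      using B[OF x] norm_snd_le[of "snd (y - z)" "fst (y - z)"] norm_fst_le[of "fst (y - z)" "snd (y - z)"]
      unfolding prod.collapse by (intro add_mono mult_mono) (auto intro: order_trans[OF abs_ge_zero])
    finally show "norm (F x y - F x z) \<le> (Bc + Bh) * norm (y - z)" by (simp add: algebra_simps)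
  qed (use ab in simp)
  then obtain z where z: "z a = (0, p0)" "\<And>x. x \<in> {a..b} \<Longrightarrow> (z has_vector_derivative F x (z x)) (at x within {a..b})" by blast
  show ?thesis
  proof (intro exI conjI ballI)
    fix x assume x: "x \<in> {a..b}"
    show "((\<lambda>x. fst (z x)) has_real_derivative g x - c x * snd (z x)) (at x within {a..b})"
      using bounded_linear.has_vector_derivative[OF bounded_linear_fst z(2)[OF x]]
      by (simp add: has_real_derivative_iff_has_vector_derivative F_def)
    show "((\<lambda>x. snd (z x)) has_real_derivative - h x * fst (z x)) (at x within {a..b})"
      using bounded_linear.has_vector_derivative[OF bounded_linear_snd z(2)[OF x]]
      by (simp add: has_real_derivative_iff_has_vector_derivative F_def)
  qed (use z in auto)
qed

text \<open>A particular solution is corrected by a multiple of the homogeneous solution \<open>y2\<close> with \<open>y2(a) = 0\<close>,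
\<open>p2(a) = 1\<close>. The multiple exists because \<open>y2(b) \<noteq> 0\<close>; otherwise the stability estimate with \<open>g = 0\<close>
would force \<open>p2 = 0\<close>.\<close>

lemma linear_bvp:
  fixes c g h :: "real \<Rightarrow> real"
  assumes ab: "a < b" and cont: "continuous_on {a..b} c" "continuous_on {a..b} g" "continuous_on {a..b} h"
    and pos: "\<And>x. x \<in> {a..b} \<Longrightarrow> 0 < c x" "\<And>x. x \<in> {a..b} \<Longrightarrow> 0 < h x"
  shows "\<exists>y p. y a = 0 \<and> y b = 0 \<and> (\<forall>x\<in>{a..b}. (y has_real_derivative g x - c x * p x) (at x within {a..b}) \<and>
     (p has_real_derivative - h x * y x) (at x within {a..b}))"
proof -
  obtain y1 p1 where 1: "y1 a = 0" "\<And>x. x \<in> {a..b} \<Longrightarrow> (y1 has_real_derivative g x - c x * p1 x) (at x within {a..b})"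
     "\<And>x. x \<in> {a..b} \<Longrightarrow> (p1 has_real_derivative - h x * y1 x) (at x within {a..b})"
    using linear_ivp[OF ab cont, of 0] by blast
  obtain y2 p2 where 2: "y2 a = 0" "p2 a = 1" "\<And>x. x \<in> {a..b} \<Longrightarrow> (y2 has_real_derivative 0 - c x * p2 x) (at x within {a..b})"
     "\<And>x. x \<in> {a..b} \<Longrightarrow> (p2 has_real_derivative - h x * y2 x) (at x within {a..b})"
    using linear_ivp[OF ab cont(1) _ cont(3), of "\<lambda>_. 0" 1] by auto
  have "y2 b \<noteq> 0"
  proof
    assume y2b: "y2 b = 0"
    obtain lc uc where c: "lc \<in> {a..b}" "uc \<in> {a..b}" "\<And>x. x \<in> {a..b} \<Longrightarrow> c lc \<le> c x \<and> c x \<le> c uc"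
      using continuous_attains_inf[OF compact_Icc _ cont(1)] continuous_attains_sup[OF compact_Icc _ cont(1)] ab
      by (metis atLeastAtMost_iff less_eq_real_def empty_iff)
    obtain lh uh where h: "lh \<in> {a..b}" "uh \<in> {a..b}" "\<And>x. x \<in> {a..b} \<Longrightarrow> h lh \<le> h x \<and> h x \<le> h uh"
      using continuous_attains_inf[OF compact_Icc _ cont(3)] continuous_attains_sup[OF compact_Icc _ cont(3)] ab
      by (metis atLeastAtMost_iff less_eq_real_def empty_iff)
    have "\<bar>p2 a\<bar> \<le> stability_constant (min (c lc) (h lh)) (max (c uc) (h uh)) (b - a) * 0"
      by (rule linear_stability[THEN conjunct2, OF ab 2(3,4,1) y2b])
         (use c h pos ab in \<open>auto simp: min_le_iff_disj le_max_iff_disj\<close>)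
    then show False using 2 by simp
  qed
  define l where "l = y1 b / y2 b"
  have lb: "l * y2 b = y1 b" using \<open>y2 b \<noteq> 0\<close> by (simp add: l_def)
  show ?thesis
  proof (intro exI conjI ballI)
    fix x assume x: "x \<in> {a..b}"
    show "((\<lambda>x. y1 x - l * y2 x) has_real_derivative g x - c x * (p1 x - l * p2 x)) (at x within {a..b})"
      by (rule derivative_eq_intros 1(2)[OF x] 2(3)[OF x] refl | simp add: algebra_simps)+
    show "((\<lambda>x. p1 x - l * p2 x) has_real_derivative - h x * (y1 x - l * y2 x)) (at x within {a..b})"
      by (rule derivative_eq_intros 1(3)[OF x] 2(4)[OF x] refl | simp add: algebra_simps)+
  qed (use 1 2 lb in auto)
qed

section \<open>Existence for the Euler-Lagrange equation\<close>

lemma abs_add_le: "\<bar>x\<bar> \<le> r \<Longrightarrow> \<bar>y\<bar> \<le> s \<Longrightarrow> r + s \<le> t \<Longrightarrow> \<bar>x + y\<bar> \<le> t" for x y r s t :: real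
  by linarith

lemma sum_of_squares_deriv:
  fixes f g :: "real \<Rightarrow> real"
  assumes "(f has_real_derivative f') (at x within S)" "(g has_real_derivative g') (at x within S)"
  shows "((\<lambda>x. (f x)\<^sup>2 + (g x)\<^sup>2) has_real_derivative 2 * f x * f' + 2 * g x * g') (at x within S)"
  by (rule derivative_eq_intros assms refl | simp)+

lemma lipschitz_of_deriv_bounded:
  fixes f :: "real \<Rightarrow> real"
  assumes "\<And>x. x \<in> {a..b} \<Longrightarrow> (f has_real_derivative f' x) (at x within {a..b})"
    and "\<And>x. x \<in> {a..b} \<Longrightarrow> \<bar>f' x\<bar> \<le> B" and "x \<in> {a..b}" "y \<in> {a..b}"
  shows "\<bar>f x - f y\<bar> \<le> B * \<bar>x - y\<bar>"
  using field_differentiable_bound[of "{a..b}" f f' B x y] assms by auto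

text \<open>The left-hand side is the integral of the lower bound \<open>c / (\<epsilon> + \<Lambda> (x - a))\<close>; for \<open>c > 0\<close> and
\<open>a < b\<close> it tends to infinity as \<open>\<epsilon>\<close> tends to \<open>0\<close>.\<close>

lemma logarithmic_growth_right:
  fixes \<Phi> :: "real \<Rightarrow> real"
  assumes d: "\<And>x. x \<in> {a..b} \<Longrightarrow> (\<Phi> has_real_derivative \<Phi>' x) (at x within {a..b})"
    and lb: "\<And>x. x \<in> {a..b} \<Longrightarrow> c / (\<epsilon> + \<Lambda> * (x - a)) \<le> \<Phi>' x"
    and pos: "0 < \<epsilon>" "0 < \<Lambda>" "a \<le> b"
  shows "c / \<Lambda> * ln (1 + \<Lambda> * (b - a) / \<epsilon>) \<le> \<Phi> b - \<Phi> a"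
proof -
  have "\<Phi> a - c / \<Lambda> * ln (\<epsilon> + \<Lambda> * (a - a)) \<le> \<Phi> b - c / \<Lambda> * ln (\<epsilon> + \<Lambda> * (b - a))"
  proof (rule nondecreasing_of_deriv_nonneg[where f = "\<lambda>x. \<Phi> x - c / \<Lambda> * ln (\<epsilon> + \<Lambda> * (x - a))"
        and f' = "\<lambda>x. \<Phi>' x - c / \<Lambda> * (\<Lambda> / (\<epsilon> + \<Lambda> * (x - a)))" and a = a and b = b])
    fix x assume x: "x \<in> {a..b}"
    then have p: "0 < \<epsilon> + \<Lambda> * (x - a)" using pos by (simp add: add_pos_nonneg)
    show "((\<lambda>x. \<Phi> x - c / \<Lambda> * ln (\<epsilon> + \<Lambda> * (x - a))) has_real_derivative
        \<Phi>' x - c / \<Lambda> * (\<Lambda> / (\<epsilon> + \<Lambda> * (x - a)))) (at x within {a..b})"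
      by (rule derivative_eq_intros d[OF x] refl p | simp)+
    show "0 \<le> \<Phi>' x - c / \<Lambda> * (\<Lambda> / (\<epsilon> + \<Lambda> * (x - a)))"
      using lb[OF x] pos by simp
  qed (use pos in auto)
  moreover have "ln (1 + \<Lambda> * (b - a) / \<epsilon>) = ln (\<epsilon> + \<Lambda> * (b - a)) - ln \<epsilon>"
  proof -
    have "1 + \<Lambda> * (b - a) / \<epsilon> = (\<epsilon> + \<Lambda> * (b - a)) / \<epsilon>" using pos by (simp add: field_simps)
    moreover have "0 < \<epsilon> + \<Lambda> * (b - a)" using pos by (simp add: add_pos_nonneg)
    ultimately show ?thesis using pos by (simp add: ln_div)
  qed
  then have "c / \<Lambda> * ln (1 + \<Lambda> * (b - a) / \<epsilon>) = c / \<Lambda> * ln (\<epsilon> + \<Lambda> * (b - a)) - c / \<Lambda> * ln \<epsilon>"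
    by (simp only: right_diff_distrib)
  ultimately show ?thesis by simp
qed

lemma logarithmic_growth_left:
  fixes \<Phi> :: "real \<Rightarrow> real"
  assumes d: "\<And>x. x \<in> {a..b} \<Longrightarrow> (\<Phi> has_real_derivative \<Phi>' x) (at x within {a..b})"
    and lb: "\<And>x. x \<in> {a..b} \<Longrightarrow> c / (\<epsilon> + \<Lambda> * (b - x)) \<le> \<Phi>' x"
    and pos: "0 < \<epsilon>" "0 < \<Lambda>" "a \<le> b"
  shows "c / \<Lambda> * ln (1 + \<Lambda> * (b - a) / \<epsilon>) \<le> \<Phi> b - \<Phi> a"
proof -
  have "c / \<Lambda> * ln (1 + \<Lambda> * (- a - - b) / \<epsilon>) \<le> - \<Phi> (- (- a)) - - \<Phi> (- (- b))"
  proof (rule logarithmic_growth_right[where \<Phi>' = "\<lambda>x. \<Phi>' (- x)"])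
    fix x assume x: "x \<in> {- b..- a}"
    have *: "uminus ` {- b..- a} = {a..b}" by simp
    have minus: "(uminus has_real_derivative - 1) (at x within {- b..- a})"
      by (rule derivative_eq_intros refl)+
    have "((\<lambda>x. \<Phi> (- x)) has_real_derivative \<Phi>' (- x) * (- 1)) (at x within {- b..- a})"
      using DERIV_image_chain[of \<Phi> "\<Phi>' (- x)" uminus x "{- b..- a}" "- 1"] d[of "- x"] x * minus
      by (simp add: o_def)
    then show "((\<lambda>x. - \<Phi> (- x)) has_real_derivative \<Phi>' (- x)) (at x within {- b..- a})"
      by (auto intro!: derivative_eq_intros)
    show "c / (\<epsilon> + \<Lambda> * (x - - b)) \<le> \<Phi>' (- x)" using lb[of "- x"] x by (simp add: algebra_simps)
  qed (use pos in auto)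
  then show ?thesis by simp
qed

text \<open>If \<open>q(x0) < \<epsilon>\<close>, the Lipschitz bound makes \<open>c / max \<epsilon> q\<close> at least \<open>c / (\<epsilon> + \<Lambda> \<bar>x - x0\<bar>)\<close> on the
whole interval, hence also on the longer of the two parts cut off by \<open>x0\<close>, of length at least
\<open>(b - a) / 2\<close>. The logarithmic growth there exceeds the increment \<open>b - a\<close> that \<open>\<Phi>\<close> has at its disposal.\<close>

lemma lower_barrier:
  fixes \<Phi> q :: "real \<Rightarrow> real"
  assumes ab: "a < b" and pos: "0 < c" "0 < \<Lambda>" "0 < \<epsilon>"
    and d: "\<And>x. x \<in> {a..b} \<Longrightarrow> (\<Phi> has_real_derivative \<Phi>' x) (at x within {a..b})"
    and lb: "\<And>x. x \<in> {a..b} \<Longrightarrow> c / max \<epsilon> (q x) \<le> \<Phi>' x"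
    and lip: "\<And>x y. x \<in> {a..b} \<Longrightarrow> y \<in> {a..b} \<Longrightarrow> \<bar>q x - q y\<bar> \<le> \<Lambda> * \<bar>x - y\<bar>"
    and bc: "\<Phi> b - \<Phi> a \<le> b - a"
    and small: "b - a < c / \<Lambda> * ln (1 + \<Lambda> * ((b - a) / 2) / \<epsilon>)"
    and x0: "x0 \<in> {a..b}"
  shows "\<epsilon> \<le> q x0"
proof (rule ccontr)
  assume "\<not> \<epsilon> \<le> q x0"
  then have q0: "q x0 < \<epsilon>" by simp
  have bd: "c / (\<epsilon> + \<Lambda> * \<bar>x - x0\<bar>) \<le> \<Phi>' x" if x: "x \<in> {a..b}" for x
  proof -
    have "max \<epsilon> (q x) \<le> \<epsilon> + \<Lambda> * \<bar>x - x0\<bar>"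
      using lip[OF x x0] q0 pos by (auto simp: max_def)
    then have "c / (\<epsilon> + \<Lambda> * \<bar>x - x0\<bar>) \<le> c / max \<epsilon> (q x)"
      using pos by (intro divide_left_mono) (auto intro!: mult_pos_pos add_pos_nonneg)
    then show ?thesis using lb[OF x] by linarith
  qed
  have mono: "\<Phi> x \<le> \<Phi> y" if "a \<le> x" "x \<le> y" "y \<le> b" for x y
  proof (rule nondecreasing_of_deriv_nonneg[OF d])
    show "0 \<le> \<Phi>' x" if "x \<in> {a..b}" for x
      using lb[OF that] pos by (meson divide_nonneg_pos less_imp_le max.strict_coboundedI1 order_trans)
  qed (use that in auto)
  have half: "c / \<Lambda> * ln (1 + \<Lambda> * ((b - a) / 2) / \<epsilon>) \<le> c / \<Lambda> * ln (1 + \<Lambda> * l / \<epsilon>)" if "(b - a) / 2 \<le> l" for l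
  proof -
    have "\<Lambda> * ((b - a) / 2) / \<epsilon> \<le> \<Lambda> * l / \<epsilon>" "0 < \<Lambda> * ((b - a) / 2) / \<epsilon>"
      using that pos ab by (intro divide_right_mono mult_left_mono, auto)
    then show ?thesis using pos by (intro mult_left_mono) auto
  qed
  show False
  proof (cases "(b - a) / 2 \<le> b - x0")
    case True
    have "c / \<Lambda> * ln (1 + \<Lambda> * (b - x0) / \<epsilon>) \<le> \<Phi> b - \<Phi> x0"
    proof (rule logarithmic_growth_right[where \<Phi>' = \<Phi>'])
      fix x assume x: "x \<in> {x0..b}"
      show "(\<Phi> has_real_derivative \<Phi>' x) (at x within {x0..b})"
        by (rule DERIV_subset[OF d]) (use x x0 in auto)
      show "c / (\<epsilon> + \<Lambda> * (x - x0)) \<le> \<Phi>' x" using bd[of x] x x0 by simp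
    qed (use pos x0 in auto)
    then show False using half[OF True] small bc mono[of a x0] x0 by auto
  next
    case False
    have "c / \<Lambda> * ln (1 + \<Lambda> * (x0 - a) / \<epsilon>) \<le> \<Phi> x0 - \<Phi> a"
    proof (rule logarithmic_growth_left[where \<Phi>' = \<Phi>'])
      fix x assume x: "x \<in> {a..x0}"
      show "(\<Phi> has_real_derivative \<Phi>' x) (at x within {a..x0})"
        by (rule DERIV_subset[OF d]) (use x x0 in auto)
      show "c / (\<epsilon> + \<Lambda> * (x0 - x)) \<le> \<Phi>' x" using bd[of x] x x0 by simp
    qed (use pos x0 in auto)
    then show False using half[of "x0 - a"] False small bc mono[of x0 b] x0 by auto
  qed
qed

lemma small_barrier_exists:
  fixes c \<Lambda> l B :: real
  assumes "0 < c" "0 < \<Lambda>" "0 < l" "0 < B"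
  shows "\<exists>\<epsilon>>0. \<epsilon> \<le> B \<and> l < c / \<Lambda> * ln (1 + \<Lambda> * (l / 2) / \<epsilon>)"
proof -
  \<comment> \<open>The logarithm then exceeds \<open>l \<Lambda> / c\<close>.\<close>
  define \<epsilon> where "\<epsilon> = min B (\<Lambda> * (l / 2) * exp (- (l * \<Lambda> / c)))"
  have e: "0 < \<epsilon>" "\<epsilon> \<le> B" using assms by (auto simp: \<epsilon>_def)
  have "exp (l * \<Lambda> / c) * \<epsilon> \<le> exp (l * \<Lambda> / c) * (\<Lambda> * (l / 2) * exp (- (l * \<Lambda> / c)))"
    by (intro mult_left_mono) (auto simp: \<epsilon>_def)
  also have "\<dots> = \<Lambda> * (l / 2)" by (simp add: exp_minus)
  finally have "exp (l * \<Lambda> / c) < 1 + \<Lambda> * (l / 2) / \<epsilon>" using e by (simp add: field_simps)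
  then have "l * \<Lambda> / c < ln (1 + \<Lambda> * (l / 2) / \<epsilon>)"
    by (metis exp_gt_zero ln_exp ln_less_cancel_iff order_less_trans)
  then have "l < c / \<Lambda> * ln (1 + \<Lambda> * (l / 2) / \<epsilon>)"
    using assms by (simp add: field_simps)
  then show ?thesis using e by blast
qed

text \<open>The data with quantitative bounds: \<open>u1\<close> is the derivative of the initial velocity, and \<open>L\<close> is a
common Lipschitz constant of \<open>m\<close> and \<open>u1\<close>. All later constants are expressed by these numbers.\<close>

locale igr_data =
  fixes a b \<alpha> :: real and m u0 u1 :: "real \<Rightarrow> real" and c0 M U L :: real
  assumes ab: "a < b" and \<alpha>: "0 < \<alpha>" and c0: "0 < c0" and U: "0 \<le> U" and L: "0 \<le> L"
    and m_bd: "x \<in> {a..b} \<Longrightarrow> c0 \<le> m x \<and> m x \<le> M"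
    and u_bd: "x \<in> {a..b} \<Longrightarrow> \<bar>u0 x\<bar> \<le> U \<and> \<bar>u1 x\<bar> \<le> U"
    and lip: "x \<in> {a..b} \<Longrightarrow> y \<in> {a..b} \<Longrightarrow> \<bar>m x - m y\<bar> \<le> L * \<bar>x - y\<bar> \<and> \<bar>u1 x - u1 y\<bar> \<le> L * \<bar>x - y\<bar>"
    and u0_deriv: "x \<in> {a..b} \<Longrightarrow> (u0 has_real_derivative u1 x) (at x within {a..b})"
    and u0_bc: "u0 a = 0" "u0 b = 0"
begin

text \<open>The quantity \<open>q = m / \<Phi>'\<close>, recovered from the momentum \<open>p\<close> of the Euler-Lagrange equation.\<close>

definition q_of :: "real \<Rightarrow> (real \<Rightarrow> real) \<Rightarrow> real \<Rightarrow> real" where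
  "q_of t p x = p x + m x * (1 - t * u1 x)"

text \<open>The Euler-Lagrange equation of the energy at time \<open>t\<close> as a first-order system. In terms of \<open>q = m / \<Phi>'\<close> it reads
\<open>\<alpha> (q - m (1 - t u1))' = - m (\<Phi> - x - t u0)\<close>.\<close>

definition euler_lagrange :: "real \<Rightarrow> (real \<Rightarrow> real) \<Rightarrow> (real \<Rightarrow> real) \<Rightarrow> bool" where
  "euler_lagrange t \<Phi> p \<longleftrightarrow> \<Phi> a = a \<and> \<Phi> b = b \<and> (\<forall>x\<in>{a..b}. 0 < q_of t p x \<and>
     (\<Phi> has_real_derivative m x / q_of t p x) (at x within {a..b}) \<and>
     (p has_real_derivative - (m x / \<alpha> * (\<Phi> x - x - t * u0 x))) (at x within {a..b}))"

lemma M: "0 < M" using m_bd[of a] c0 ab by auto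

lemma m_pos: "x \<in> {a..b} \<Longrightarrow> 0 < m x" using m_bd[of x] c0 by auto

lemma cont_m: "continuous_on {a..b} m" and cont_u1: "continuous_on {a..b} u1"
  using lip L by (auto intro!: lipschitz_on_continuous_on[of L] lipschitz_onI simp: dist_real_def)

lemma cont_u0: "continuous_on {a..b} u0"
  by (rule DERIV_continuous_on[OF u0_deriv])

text \<open>A bound of the Lipschitz constant of \<open>q\<close> that does not depend on the solution.\<close>

definition q_lip :: "real \<Rightarrow> real" where
  "q_lip T = M / \<alpha> * (b - a + T * U) + (L * (1 + T * U) + M * (T * L)) + 1"

lemma q_lip_pos: "0 \<le> T \<Longrightarrow> 0 < q_lip T"
  unfolding q_lip_def using M U L \<alpha> ab by (intro add_nonneg_pos add_nonneg_nonneg mult_nonneg_nonneg) auto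

text \<open>The upper end \<open>B\<close> of the range of \<open>\<Phi>\<close> is left open, because the solutions of the truncated initial
value problem may leave \<open>[a,b]\<close>, unlike those of the boundary value problem.\<close>

lemma shifted_bound:
  assumes t: "0 \<le> t" "t \<le> T" and x: "x \<in> {a..b}" "\<Phi> x \<in> {a..B}" and B: "b \<le> B"
  shows "\<bar>m x / \<alpha> * (\<Phi> x - x - t * u0 x)\<bar> \<le> M / \<alpha> * (B - a + T * U)"
proof -
  have "\<bar>t * u0 x\<bar> \<le> T * U" unfolding abs_mult using t u_bd[OF x(1)] by (intro mult_mono) auto
  then have "\<bar>\<Phi> x - x - t * u0 x\<bar> \<le> B - a + T * U"
    using x B by auto
  moreover have "\<bar>m x / \<alpha>\<bar> \<le> M / \<alpha>" using m_bd[OF x(1)] c0 \<alpha> by (simp add: divide_right_mono)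
  ultimately show ?thesis unfolding abs_mult
    using M \<alpha> by (intro mult_mono) auto
qed

lemma mu_bound:
  assumes t: "0 \<le> t" "t \<le> T" and x: "x \<in> {a..b}"
  shows "\<bar>m x * (1 - t * u1 x)\<bar> \<le> M * (1 + T * U)"
proof -
  have "\<bar>t * u1 x\<bar> \<le> T * U" unfolding abs_mult using t u_bd[OF x] by (intro mult_mono) auto
  then show ?thesis unfolding abs_mult[of "m x"] using m_bd[OF x] c0 M by (intro mult_mono) auto
qed

text \<open>This bound uses about \<open>\<Phi>\<close> only that it takes values in \<open>[a,b]\<close>, and therefore holds uniformly in the
truncation parameter.\<close>

lemma q_lipschitz:
  assumes t: "0 \<le> t" "t \<le> T"
    and p: "\<And>x. x \<in> {a..b} \<Longrightarrow> (p has_real_derivative - (m x / \<alpha> * (\<Phi> x - x - t * u0 x))) (at x within {a..b})"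
    and \<Phi>: "\<And>x. x \<in> {a..b} \<Longrightarrow> \<Phi> x \<in> {a..b}"
    and xy: "x \<in> {a..b}" "y \<in> {a..b}"
  shows "\<bar>q_of t p x - q_of t p y\<bar> \<le> q_lip T * \<bar>x - y\<bar>"
proof -
  have "\<bar>p x - p y\<bar> \<le> (M / \<alpha> * (b - a + T * U)) * \<bar>x - y\<bar>"
    by (rule lipschitz_of_deriv_bounded[OF p _ xy]) (use shifted_bound[OF t] \<Phi> in auto)
  moreover have "\<bar>m x * (1 - t * u1 x) - m y * (1 - t * u1 y)\<bar> \<le> (L * (1 + T * U) + M * (T * L)) * \<bar>x - y\<bar>"
  proof -
    have e: "m x * (1 - t * u1 x) - m y * (1 - t * u1 y) = (m x - m y) * (1 - t * u1 x) - m y * (t * (u1 x - u1 y))"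
      by (simp add: algebra_simps)
    have "\<bar>t * u1 x\<bar> \<le> T * U" unfolding abs_mult using t u_bd[OF xy(1)] by (intro mult_mono) auto
    then have "\<bar>(m x - m y) * (1 - t * u1 x)\<bar> \<le> (L * \<bar>x - y\<bar>) * (1 + T * U)"
      unfolding abs_mult[of "m x - m y"] using lip[OF xy] by (intro mult_mono) auto
    moreover have "\<bar>m y * (t * (u1 x - u1 y))\<bar> \<le> M * (T * (L * \<bar>x - y\<bar>))"
      unfolding abs_mult using lip[OF xy] m_bd[OF xy(2)] c0 t by (intro mult_mono) auto
    ultimately show ?thesis unfolding e by (simp add: algebra_simps)
  qed
  moreover have "q_of t p x - q_of t p y = (p x - p y) + (m x * (1 - t * u1 x) - m y * (1 - t * u1 y))"
    by (simp add: q_of_def)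
  ultimately have "\<bar>q_of t p x - q_of t p y\<bar> \<le> (M / \<alpha> * (b - a + T * U) + (L * (1 + T * U) + M * (T * L))) * \<bar>x - y\<bar>"
    by (simp only:) (rule abs_add_le, assumption+, simp only: distrib_right order_refl)
  also have "\<dots> \<le> q_lip T * \<bar>x - y\<bar>"
    unfolding q_lip_def by (intro mult_right_mono) auto
  finally show ?thesis .
qed

text \<open>With \<open>q\<close> replaced by \<open>max \<epsilon> q\<close> the right-hand side is globally Lipschitz, so for every initial momentum
\<open>s\<close> there is a global solution depending continuously on \<open>s\<close>. For very negative \<open>s\<close> the truncation is active
everywhere and \<open>\<Phi>' \<ge> m / \<epsilon> \<ge> 1\<close>; for very large \<open>s\<close> one has \<open>q \<ge> M\<close> and \<open>\<Phi>' \<le> 1\<close>. In between,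
\<open>\<Phi>(b) = b\<close> is attained.\<close>

lemma truncated_bvp_exists:
  assumes t: "0 \<le> t" "t \<le> T" and \<epsilon>: "0 < \<epsilon>" "\<epsilon> \<le> c0"
  shows "\<exists>\<Phi> p. \<Phi> a = a \<and> \<Phi> b = b \<and> (\<forall>x\<in>{a..b}.
     (\<Phi> has_real_derivative m x / max \<epsilon> (q_of t p x)) (at x within {a..b}) \<and>
     (p has_real_derivative - (m x / \<alpha> * (\<Phi> x - x - t * u0 x))) (at x within {a..b}))"
proof -
  define F where "F x z = (m x / max \<epsilon> (snd z + m x * (1 - t * u1 x)), - (m x / \<alpha> * (fst z - x - t * u0 x)))"
    for x and z :: "real \<times> real"
  have trunc: "\<bar>m x / max \<epsilon> r - m x / max \<epsilon> s\<bar> \<le> M / \<epsilon>\<^sup>2 * \<bar>r - s\<bar>" if x: "x \<in> {a..b}" for x r s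
  proof -
    have "m x / max \<epsilon> r - m x / max \<epsilon> s = m x / (max \<epsilon> r * max \<epsilon> s) * (max \<epsilon> s - max \<epsilon> r)"
      using \<epsilon> by (simp add: field_simps max_def)
    also have "\<bar>\<dots>\<bar> = m x / (max \<epsilon> r * max \<epsilon> s) * \<bar>max \<epsilon> s - max \<epsilon> r\<bar>"
      unfolding abs_mult using m_pos[OF x] \<epsilon> by (simp add: max_def)
    also have "\<dots> \<le> M / \<epsilon>\<^sup>2 * \<bar>r - s\<bar>"
    proof (rule mult_mono)
      show "m x / (max \<epsilon> r * max \<epsilon> s) \<le> M / \<epsilon>\<^sup>2"
        using m_bd[OF x] c0 \<epsilon> M unfolding power2_eq_square by (intro frac_le mult_mono) auto
    qed (use M in auto)
    finally show ?thesis .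
  qed
  have snd_lip: "\<bar>- (m x / \<alpha> * (r - x - t * u0 x)) - - (m x / \<alpha> * (s - x - t * u0 x))\<bar> \<le> M / \<alpha> * \<bar>r - s\<bar>"
    if x: "x \<in> {a..b}" for x r s
  proof -
    have "- (m x / \<alpha> * (r - x - t * u0 x)) - - (m x / \<alpha> * (s - x - t * u0 x)) = m x / \<alpha> * (s - r)"
      by (simp add: algebra_simps diff_divide_distrib)
    also have "\<bar>\<dots>\<bar> = m x / \<alpha> * \<bar>r - s\<bar>" unfolding abs_mult using m_pos[OF x] \<alpha> by simp
    also have "\<dots> \<le> M / \<alpha> * \<bar>r - s\<bar>" using m_bd[OF x] \<alpha> by (intro mult_right_mono divide_right_mono) auto
    finally show ?thesis .
  qed
  have "\<exists>z. z a = (a, s) \<and> (\<forall>x\<in>{a..b}. (z has_vector_derivative F x (z x)) (at x within {a..b}))" for s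
  proof (rule picard_lindelof[where L = "M / \<epsilon>\<^sup>2 + M / \<alpha>"])
    have c': "continuous_on ({a..b} \<times> UNIV) (\<lambda>z. f (fst z))" if "continuous_on {a..b} f" for f :: "real \<Rightarrow> real"
      by (rule continuous_on_compose2[OF that]) (auto intro!: continuous_intros)
    show "continuous_on ({a..b} \<times> UNIV) (\<lambda>(x, z). F x z)"
      unfolding F_def split_beta using \<alpha> \<epsilon>
      by (intro continuous_intros c' cont_m cont_u0 cont_u1) auto
    fix x and y z :: "real \<times> real" assume x: "x \<in> {a..b}"
    have "norm (F x y - F x z) \<le> M / \<epsilon>\<^sup>2 * \<bar>snd (y - z)\<bar> + M / \<alpha> * \<bar>fst (y - z)\<bar>"
      unfolding F_def diff_Pair
      using trunc[OF x, of "snd y + m x * (1 - t * u1 x)" "snd z + m x * (1 - t * u1 x)"]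
        snd_lip[OF x, of "fst y" "fst z"]
      by (intro order_trans[OF norm_Pair_le]) auto
    also have "\<dots> \<le> M / \<epsilon>\<^sup>2 * norm (y - z) + M / \<alpha> * norm (y - z)"
      using norm_snd_le[of "snd (y - z)" "fst (y - z)"] norm_fst_le[of "fst (y - z)" "snd (y - z)"] M \<alpha>
      unfolding prod.collapse by (intro add_mono mult_left_mono) auto
    finally show "norm (F x y - F x z) \<le> (M / \<epsilon>\<^sup>2 + M / \<alpha>) * norm (y - z)" by (simp add: algebra_simps)
  qed (use ab in simp)
  then obtain z where z: "\<And>s. z s a = (a, s)"
     "\<And>s x. x \<in> {a..b} \<Longrightarrow> (z s has_vector_derivative F x (z s x)) (at x within {a..b})" by metis
  define \<Phi> p where "\<Phi> s x = fst (z s x)" and "p s x = snd (z s x)" for s x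
  have d\<Phi>: "(\<Phi> s has_real_derivative m x / max \<epsilon> (q_of t (p s) x)) (at x within {a..b})" if "x \<in> {a..b}" for s x
    using bounded_linear.has_vector_derivative[OF bounded_linear_fst z(2)[OF that]]
    unfolding \<Phi>_def[abs_def] p_def[abs_def] q_of_def
    by (simp add: has_real_derivative_iff_has_vector_derivative F_def)
  have dp: "(p s has_real_derivative - (m x / \<alpha> * (\<Phi> s x - x - t * u0 x))) (at x within {a..b})" if "x \<in> {a..b}" for s x
    using bounded_linear.has_vector_derivative[OF bounded_linear_snd z(2)[OF that]]
    unfolding \<Phi>_def[abs_def] p_def[abs_def]
    by (simp add: has_real_derivative_iff_has_vector_derivative F_def)
  have ini: "\<Phi> s a = a" "p s a = s" for s by (simp_all add: \<Phi>_def p_def z)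
  let ?K = "M / \<epsilon>\<^sup>2 + M / \<alpha>"
  have K: "0 \<le> ?K" using M \<alpha> by (intro add_nonneg_nonneg) auto
  \<comment> \<open>Lipschitz dependence of the solution on the initial momentum.\<close>
  have cdep: "\<bar>\<Phi> s b - \<Phi> r b\<bar> \<le> sqrt (exp (?K * (b - a))) * \<bar>s - r\<bar>" for s r
  proof -
    define w where "w x = (\<Phi> s x - \<Phi> r x)\<^sup>2 + (p s x - p r x)\<^sup>2" for x
    have "w b + 0 \<le> (w a + 0) * exp (?K * \<bar>b - a\<bar>)"
    proof (rule gronwall[where a = a and b = b and z' = "\<lambda>x.
         2 * (\<Phi> s x - \<Phi> r x) * (m x / max \<epsilon> (q_of t (p s) x) - m x / max \<epsilon> (q_of t (p r) x)) +
         2 * (p s x - p r x) * (- (m x / \<alpha> * (\<Phi> s x - x - t * u0 x)) - - (m x / \<alpha> * (\<Phi> r x - x - t * u0 x)))"])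
      fix x assume x: "x \<in> {a..b}"
      show "(w has_real_derivative 2 * (\<Phi> s x - \<Phi> r x) * (m x / max \<epsilon> (q_of t (p s) x) - m x / max \<epsilon> (q_of t (p r) x)) +
         2 * (p s x - p r x) * (- (m x / \<alpha> * (\<Phi> s x - x - t * u0 x)) - - (m x / \<alpha> * (\<Phi> r x - x - t * u0 x))))
         (at x within {a..b})"
        unfolding w_def by (intro sum_of_squares_deriv DERIV_diff d\<Phi> dp x)
      let ?P = "\<bar>\<Phi> s x - \<Phi> r x\<bar>" and ?Q = "\<bar>p s x - p r x\<bar>"
      have "\<bar>2 * (\<Phi> s x - \<Phi> r x) * (m x / max \<epsilon> (q_of t (p s) x) - m x / max \<epsilon> (q_of t (p r) x))\<bar>
          \<le> 2 * ?P * (M / \<epsilon>\<^sup>2 * ?Q)"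
        using trunc[OF x, of "q_of t (p s) x" "q_of t (p r) x"]
        unfolding abs_mult by (intro mult_mono) (auto simp: q_of_def)
      moreover have "\<bar>2 * (p s x - p r x) * (- (m x / \<alpha> * (\<Phi> s x - x - t * u0 x)) - - (m x / \<alpha> * (\<Phi> r x - x - t * u0 x)))\<bar>
          \<le> 2 * ?Q * (M / \<alpha> * ?P)"
        using snd_lip[OF x, of "\<Phi> s x" "\<Phi> r x"]
        unfolding abs_mult by (intro mult_mono) auto
      moreover have "2 * ?P * (M / \<epsilon>\<^sup>2 * ?Q) + 2 * ?Q * (M / \<alpha> * ?P) \<le> ?K * (w x + 0)"
      proof -
        have "2 * ?P * (M / \<epsilon>\<^sup>2 * ?Q) + 2 * ?Q * (M / \<alpha> * ?P) = ?K * (2 * ?P * ?Q)"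
          by (simp add: algebra_simps)
        also have "\<dots> \<le> ?K * (w x + 0)"
          using sum_squares_bound[of ?P ?Q] by (intro mult_left_mono K) (simp add: w_def)
        finally show ?thesis .
      qed
      ultimately show "\<bar>2 * (\<Phi> s x - \<Phi> r x) * (m x / max \<epsilon> (q_of t (p s) x) - m x / max \<epsilon> (q_of t (p r) x)) +
         2 * (p s x - p r x) * (- (m x / \<alpha> * (\<Phi> s x - x - t * u0 x)) - - (m x / \<alpha> * (\<Phi> r x - x - t * u0 x)))\<bar>
         \<le> ?K * (w x + 0)" by (rule abs_add_le)
    qed (use ab in auto)
    then have "(\<Phi> s b - \<Phi> r b)\<^sup>2 + (p s b - p r b)\<^sup>2 \<le> (s - r)\<^sup>2 * exp (?K * (b - a))"
      using ab by (simp add: w_def ini)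
    moreover have "(s - r)\<^sup>2 * exp (?K * (b - a)) = (sqrt (exp (?K * (b - a))) * \<bar>s - r\<bar>)\<^sup>2"
      by (simp add: power_mult_distrib)
    ultimately have "(\<Phi> s b - \<Phi> r b)\<^sup>2 \<le> (sqrt (exp (?K * (b - a))) * \<bar>s - r\<bar>)\<^sup>2"
      using zero_le_power2[of "p s b - p r b"] by linarith
    then show ?thesis by (simp add: power2_le_iff_abs_le)
  qed
  have cont: "continuous_on S (\<lambda>s. \<Phi> s b)" for S
    by (rule lipschitz_on_continuous_on[of "sqrt (exp (?K * (b - a)))"])
       (auto intro!: lipschitz_onI simp: dist_real_def cdep)
  \<comment> \<open>An upper bound of \<open>\<Phi>\<close>, from \<open>\<Phi>' \<le> M / \<epsilon>\<close>.\<close>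
  define B where "B = a + M / \<epsilon> * (b - a)"
  have bB: "b \<le> B"
  proof -
    have "1 \<le> M / \<epsilon>" using m_bd[of a] \<epsilon> ab by auto
    then have "1 * (b - a) \<le> M / \<epsilon> * (b - a)" using ab by (intro mult_right_mono) auto
    then show ?thesis by (simp add: B_def)
  qed
  have \<Phi>r: "\<Phi> s x \<in> {a..B}" if x: "x \<in> {a..b}" for s x
  proof -
    have "\<Phi> s a \<le> \<Phi> s x"
    proof (rule nondecreasing_of_deriv_nonneg[OF d\<Phi>])
      show "0 \<le> m y / max \<epsilon> (q_of t (p s) y)" if "y \<in> {a..b}" for y
        using m_pos[OF that] \<epsilon> by (simp add: max_def)
    qed (use x in auto)
    moreover have "\<bar>\<Phi> s x - \<Phi> s a\<bar> \<le> M / \<epsilon> * \<bar>x - a\<bar>"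
    proof (rule lipschitz_of_deriv_bounded[OF d\<Phi>])
      show "\<bar>m y / max \<epsilon> (q_of t (p s) y)\<bar> \<le> M / \<epsilon>" if "y \<in> {a..b}" for y
        unfolding abs_divide using m_bd[OF that] c0 M \<epsilon> by (intro frac_le) auto
    qed (use x in auto)
    moreover have "M / \<epsilon> * \<bar>x - a\<bar> \<le> M / \<epsilon> * (b - a)" using M \<epsilon> x by (intro mult_left_mono) auto
    ultimately show ?thesis by (auto simp: ini B_def)
  qed
  define P where "P = M / \<alpha> * (B - a + T * U) * (b - a)"
  have ps: "\<bar>p s x - s\<bar> \<le> P" if x: "x \<in> {a..b}" for s x
  proof -
    have "\<bar>p s x - p s a\<bar> \<le> M / \<alpha> * (B - a + T * U) * \<bar>x - a\<bar>"
      by (rule lipschitz_of_deriv_bounded[OF dp]) (use x shifted_bound[where \<Phi> = "\<Phi> s" and B = B, OF t _ \<Phi>r bB] in auto)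
    also have "\<dots> \<le> P" unfolding P_def
      using x M \<alpha> U t ab bB by (intro mult_left_mono mult_nonneg_nonneg add_nonneg_nonneg) auto
    finally show ?thesis by (simp add: ini)
  qed
  \<comment> \<open>\<open>P\<close> bounds the variation of the momentum, and \<open>M (1 + T U)\<close> bounds \<open>q - p\<close>.\<close>
  define s1 s2 where "s1 = - P - M * (1 + T * U)" and "s2 = P + M * (1 + T * U) + M"
  have "b \<le> \<Phi> s1 b"
  proof -
    have "\<Phi> s1 a - a \<le> \<Phi> s1 b - b"
    proof (rule nondecreasing_of_deriv_nonneg[where a = a and b = b
          and f = "\<lambda>x. \<Phi> s1 x - x" and f' = "\<lambda>x. m x / max \<epsilon> (q_of t (p s1) x) - 1"])
      fix x assume x: "x \<in> {a..b}"
      show "((\<lambda>x. \<Phi> s1 x - x) has_real_derivative m x / max \<epsilon> (q_of t (p s1) x) - 1) (at x within {a..b})"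
        by (rule derivative_eq_intros d\<Phi>[OF x] refl | simp)+
      have "q_of t (p s1) x \<le> \<epsilon>"
        unfolding q_of_def using ps[OF x, of s1] mu_bound[OF t x] \<epsilon> unfolding s1_def by linarith
      then show "0 \<le> m x / max \<epsilon> (q_of t (p s1) x) - 1"
        using \<epsilon> m_bd[OF x] by (simp add: max_absorb1)
    qed (use ab in auto)
    then show ?thesis by (simp add: ini)
  qed
  moreover have "\<Phi> s2 b \<le> b"
  proof -
    have "a - \<Phi> s2 a \<le> b - \<Phi> s2 b"
    proof (rule nondecreasing_of_deriv_nonneg[where a = a and b = b
          and f = "\<lambda>x. x - \<Phi> s2 x" and f' = "\<lambda>x. 1 - m x / max \<epsilon> (q_of t (p s2) x)"])
      fix x assume x: "x \<in> {a..b}"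
      show "((\<lambda>x. x - \<Phi> s2 x) has_real_derivative 1 - m x / max \<epsilon> (q_of t (p s2) x)) (at x within {a..b})"
        by (rule derivative_eq_intros d\<Phi>[OF x] refl | simp)+
      have "M \<le> q_of t (p s2) x"
        unfolding q_of_def using ps[OF x, of s2] mu_bound[OF t x] unfolding s2_def by linarith
      then have "m x \<le> max \<epsilon> (q_of t (p s2) x)" using m_bd[OF x] by auto
      then show "0 \<le> 1 - m x / max \<epsilon> (q_of t (p s2) x)"
        using \<epsilon> by (simp add: divide_le_eq)
    qed (use ab in auto)
    then show ?thesis by (simp add: ini)
  qed
  moreover have "s1 \<le> s2"
    unfolding s1_def s2_def P_def using M \<alpha> U t ab bB by (auto intro!: add_nonneg_nonneg mult_nonneg_nonneg order_trans[of _ 0 _])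
  ultimately obtain s where "\<Phi> s b = b"
    using IVT2'[of "\<lambda>s. \<Phi> s b" s2 b s1] cont by auto
  then show ?thesis using d\<Phi> dp ini by blast
qed

lemma euler_lagrange_range:
  assumes "euler_lagrange t \<Phi> p" "x \<in> {a..b}"
  shows "\<Phi> x \<in> {a..b}"
proof -
  have "\<Phi> y \<le> \<Phi> z" if "a \<le> y" "y \<le> z" "z \<le> b" for y z
    by (rule nondecreasing_of_deriv_nonneg[where a = a and b = b and f' = "\<lambda>x. m x / q_of t p x"])
      (use assms m_pos that in \<open>auto simp: euler_lagrange_def less_imp_le\<close>)
  from this[of a x] this[of x b] show ?thesis using assms by (auto simp: euler_lagrange_def)
qed

lemma barrier_constant_exists:
  assumes T: "0 \<le> T"
  obtains \<epsilon> where "0 < \<epsilon>" "\<epsilon> \<le> c0"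
    "b - a < c0 / q_lip T * ln (1 + q_lip T * ((b - a) / 2) / \<epsilon>)"
  using small_barrier_exists[OF c0 q_lip_pos[OF T], of "b - a" c0] ab c0 by auto

text \<open>Bounds that are uniform over \<open>t \<in> [0,T]\<close> and over all solutions: the lower one by the barrier, the upper one
because \<open>q = m\<close> at some point.\<close>

lemma euler_lagrange_bounds:
  assumes T: "0 \<le> T"
  obtains \<epsilon> Q where "0 < \<epsilon>" "\<And>t \<Phi> p x. 0 \<le> t \<Longrightarrow> t \<le> T \<Longrightarrow> euler_lagrange t \<Phi> p \<Longrightarrow> x \<in> {a..b} \<Longrightarrow>
      \<epsilon> \<le> q_of t p x \<and> q_of t p x \<le> Q"
proof -
  obtain \<epsilon> where e: "0 < \<epsilon>" "\<epsilon> \<le> c0" "b - a < c0 / q_lip T * ln (1 + q_lip T * ((b - a) / 2) / \<epsilon>)"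
    by (rule barrier_constant_exists[OF T])
  have "\<epsilon> \<le> q_of t p x \<and> q_of t p x \<le> M + q_lip T * (b - a)"
    if t: "0 \<le> t" "t \<le> T" and el: "euler_lagrange t \<Phi> p" and x: "x \<in> {a..b}" for t \<Phi> p x
  proof
    have d: "(\<Phi> has_real_derivative m x / q_of t p x) (at x within {a..b})"
       "(p has_real_derivative - (m x / \<alpha> * (\<Phi> x - x - t * u0 x))) (at x within {a..b})"
       "0 < q_of t p x" if "x \<in> {a..b}" for x
      using el that by (auto simp: euler_lagrange_def)
    have lipq: "\<bar>q_of t p x - q_of t p y\<bar> \<le> q_lip T * \<bar>x - y\<bar>" if "x \<in> {a..b}" "y \<in> {a..b}" for x y
      by (rule q_lipschitz[OF t d(2) euler_lagrange_range[OF el] that])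
    show "\<epsilon> \<le> q_of t p x"
    proof (rule lower_barrier[OF ab c0 q_lip_pos[OF T] e(1) d(1) _ lipq _ e(3) x])
      show "c0 / max \<epsilon> (q_of t p x) \<le> m x / q_of t p x" if "x \<in> {a..b}" for x
        using m_bd[OF that] c0 d(3)[OF that] by (intro frac_le) auto
      show "\<Phi> b - \<Phi> a \<le> b - a" using el by (simp add: euler_lagrange_def)
    qed
    \<comment> \<open>By the mean value theorem \<open>m / q = 1\<close> somewhere.\<close>
    obtain z where "a < z" "z < b" "\<Phi> b - \<Phi> a = (\<lambda>h. m z / q_of t p z * h) (b - a)"
    proof (rule mvt[OF ab, of \<Phi> "\<lambda>z h. m z / q_of t p z * h"])
      show "continuous_on {a..b} \<Phi>" by (rule DERIV_continuous_on[OF d(1)])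
      fix z assume z: "a < z" "z < b"
      have "at z within {a..b} = at z" using z by (intro at_within_interior) auto
      then show "(\<Phi> has_derivative (\<lambda>h. m z / q_of t p z * h)) (at z)"
        using d(1)[of z] z by (simp add: has_field_derivative_def del: times_divide_eq_left)
    qed
    then have z: "z \<in> {a..b}" "\<Phi> b - \<Phi> a = (b - a) * (m z / q_of t p z)" by auto
    then have "(b - a) * (m z / q_of t p z) = (b - a) * 1" using el by (simp add: euler_lagrange_def)
    then have "m z / q_of t p z = 1" unfolding mult_cancel_left using ab by simp
    then have "q_of t p z = m z" using d(3)[OF z(1)] by (simp add: field_simps)
    then have "q_of t p x \<le> M + q_lip T * \<bar>x - z\<bar>" using lipq[OF x z(1)] m_bd[OF z(1)] by linarith
    also have "q_lip T * \<bar>x - z\<bar> \<le> q_lip T * (b - a)"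
      using q_lip_pos[OF T] x z by (intro mult_left_mono) auto
    finally show "q_of t p x \<le> M + q_lip T * (b - a)" by simp
  qed
  then show thesis using e(1) that by blast
qed

theorem euler_lagrange_exists:
  assumes t: "0 \<le> t"
  shows "\<exists>\<Phi> p. euler_lagrange t \<Phi> p"
proof -
  obtain \<epsilon> where e: "0 < \<epsilon>" "\<epsilon> \<le> c0" "b - a < c0 / q_lip t * ln (1 + q_lip t * ((b - a) / 2) / \<epsilon>)"
    by (rule barrier_constant_exists[OF t])
  obtain \<Phi> p where bc: "\<Phi> a = a" "\<Phi> b = b" and
     d: "\<And>x. x \<in> {a..b} \<Longrightarrow> (\<Phi> has_real_derivative m x / max \<epsilon> (q_of t p x)) (at x within {a..b})"
     "\<And>x. x \<in> {a..b} \<Longrightarrow> (p has_real_derivative - (m x / \<alpha> * (\<Phi> x - x - t * u0 x))) (at x within {a..b})"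
    using truncated_bvp_exists[OF t order_refl e(1,2)] by blast
  have "\<Phi> y \<le> \<Phi> z" if "a \<le> y" "y \<le> z" "z \<le> b" for y z
  proof (rule nondecreasing_of_deriv_nonneg[OF d(1)])
    show "0 \<le> m x / max \<epsilon> (q_of t p x)" if "x \<in> {a..b}" for x
      using m_pos[OF that] e by (simp add: max_def)
  qed (use that in auto)
  from this[of a] this[of _ b] have rng: "\<Phi> x \<in> {a..b}" if "x \<in> {a..b}" for x
    using that bc by fastforce
  have lipq: "\<bar>q_of t p x - q_of t p y\<bar> \<le> q_lip t * \<bar>x - y\<bar>" if "x \<in> {a..b}" "y \<in> {a..b}" for x y
    by (rule q_lipschitz[OF t order_refl d(2) rng that])
  have q: "\<epsilon> \<le> q_of t p x" if x: "x \<in> {a..b}" for x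
  proof (rule lower_barrier[OF ab c0 q_lip_pos[OF t] e(1) d(1) _ lipq _ e(3) x])
    show "c0 / max \<epsilon> (q_of t p x) \<le> m x / max \<epsilon> (q_of t p x)" if "x \<in> {a..b}" for x
      using m_bd[OF that] e by (intro divide_right_mono) auto
  qed (use bc in auto)
  have "max \<epsilon> (q_of t p x) = q_of t p x" "0 < q_of t p x" if "x \<in> {a..b}" for x
    using q[OF that] e(1) by auto
  then have "euler_lagrange t \<Phi> p"
    unfolding euler_lagrange_def using bc d by auto
  then show ?thesis by blast
qed

end

section \<open>Locally Lipschitz dependence on time\<close>

text \<open>Functions of time and space that are bounded, and Lipschitz in time uniformly in space, on every
bounded time interval. A function whose time derivative has this property has difference quotients that converge
at first order, which is all that is needed to pass to the limit under integrals.\<close>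

definition time_Lip :: "real \<Rightarrow> real \<Rightarrow> (real \<Rightarrow> real \<Rightarrow> real) \<Rightarrow> bool" where
  "time_Lip a b f \<longleftrightarrow> (\<forall>T\<ge>0. \<exists>K\<ge>0. \<forall>t\<in>{0..T}. \<forall>x\<in>{a..b}.
     \<bar>f t x\<bar> \<le> K \<and> (\<forall>s\<in>{0..T}. \<bar>f s x - f t x\<bar> \<le> K * \<bar>s - t\<bar>))"

lemma time_Lip_D:
  assumes "time_Lip a b f" "0 \<le> T"
  obtains K where "0 \<le> K" "\<And>t x. t \<in> {0..T} \<Longrightarrow> x \<in> {a..b} \<Longrightarrow> \<bar>f t x\<bar> \<le> K"
    "\<And>s t x. s \<in> {0..T} \<Longrightarrow> t \<in> {0..T} \<Longrightarrow> x \<in> {a..b} \<Longrightarrow> \<bar>f s x - f t x\<bar> \<le> K * \<bar>s - t\<bar>"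
  using assms unfolding time_Lip_def by metis

text \<open>A bound at time \<open>0\<close> spreads to bounded time intervals by the Lipschitz estimate.\<close>

lemma time_Lip_I:
  assumes "\<And>T. 0 \<le> T \<Longrightarrow> \<exists>K. \<forall>s\<in>{0..T}. \<forall>t\<in>{0..T}. \<forall>x\<in>{a..b}. \<bar>f s x - f t x\<bar> \<le> K * \<bar>s - t\<bar>"
    and bd: "\<And>x. x \<in> {a..b} \<Longrightarrow> \<bar>f 0 x\<bar> \<le> C"
  shows "time_Lip a b f"
  unfolding time_Lip_def
proof (intro allI impI)
  fix T :: real assume T: "0 \<le> T"
  obtain K where K: "\<And>s t x. s \<in> {0..T} \<Longrightarrow> t \<in> {0..T} \<Longrightarrow> x \<in> {a..b} \<Longrightarrow> \<bar>f s x - f t x\<bar> \<le> K * \<bar>s - t\<bar>"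
    using assms(1)[OF T] by blast
  have 1: "\<bar>f t x\<bar> \<le> \<bar>C\<bar> + \<bar>K\<bar> * T + \<bar>K\<bar>" if "t \<in> {0..T}" "x \<in> {a..b}" for t x
  proof -
    have "K * t \<le> \<bar>K\<bar> * T" using that T by (intro mult_mono) auto
    then show ?thesis using K[of t 0 x] bd[of x] that T by auto
  qed
  have 2: "\<bar>f s x - f t x\<bar> \<le> (\<bar>C\<bar> + \<bar>K\<bar> * T + \<bar>K\<bar>) * \<bar>s - t\<bar>" if "s \<in> {0..T}" "t \<in> {0..T}" "x \<in> {a..b}" for s t x
  proof -
    have "K \<le> \<bar>C\<bar> + \<bar>K\<bar> * T + \<bar>K\<bar>" using T by (auto intro: add_increasing)
    then show ?thesis using K[OF that] by (meson abs_ge_zero mult_right_mono order_trans)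
  qed
  show "\<exists>K\<ge>0. \<forall>t\<in>{0..T}. \<forall>x\<in>{a..b}. \<bar>f t x\<bar> \<le> K \<and> (\<forall>s\<in>{0..T}. \<bar>f s x - f t x\<bar> \<le> K * \<bar>s - t\<bar>)"
    using 1 2 T by (intro exI[of _ "\<bar>C\<bar> + \<bar>K\<bar> * T + \<bar>K\<bar>"]) auto
qed

lemma time_Lip_cong:
  assumes "\<And>t x. 0 \<le> t \<Longrightarrow> x \<in> {a..b} \<Longrightarrow> f t x = g t x"
  shows "time_Lip a b f \<longleftrightarrow> time_Lip a b g"
  unfolding time_Lip_def using assms by simp

lemma time_Lip_const: "(\<And>x. x \<in> {a..b} \<Longrightarrow> \<bar>f x\<bar> \<le> C) \<Longrightarrow> time_Lip a b (\<lambda>t. f)"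
  by (rule time_Lip_I[where C = C]) (auto intro!: exI[of _ 0])

lemma time_Lip_time: "time_Lip a b (\<lambda>t x. t)"
  by (rule time_Lip_I[where C = 0]) (auto intro!: exI[of _ 1])

lemma time_Lip_add:
  assumes "time_Lip a b f" "time_Lip a b g"
  shows "time_Lip a b (\<lambda>t x. f t x + g t x)"
  unfolding time_Lip_def
proof (intro allI impI)
  fix T :: real assume T: "0 \<le> T"
  obtain K where K: "0 \<le> K" "\<And>t x. t \<in> {0..T} \<Longrightarrow> x \<in> {a..b} \<Longrightarrow> \<bar>f t x\<bar> \<le> K"
    "\<And>s t x. s \<in> {0..T} \<Longrightarrow> t \<in> {0..T} \<Longrightarrow> x \<in> {a..b} \<Longrightarrow> \<bar>f s x - f t x\<bar> \<le> K * \<bar>s - t\<bar>"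
    using time_Lip_D[OF assms(1) T] by blast
  obtain J where J: "0 \<le> J" "\<And>t x. t \<in> {0..T} \<Longrightarrow> x \<in> {a..b} \<Longrightarrow> \<bar>g t x\<bar> \<le> J"
    "\<And>s t x. s \<in> {0..T} \<Longrightarrow> t \<in> {0..T} \<Longrightarrow> x \<in> {a..b} \<Longrightarrow> \<bar>g s x - g t x\<bar> \<le> J * \<bar>s - t\<bar>"
    using time_Lip_D[OF assms(2) T] by blast
  have "\<bar>f t x + g t x\<bar> \<le> K + J \<and> (\<forall>s\<in>{0..T}. \<bar>f s x + g s x - (f t x + g t x)\<bar> \<le> (K + J) * \<bar>s - t\<bar>)"
    if t: "t \<in> {0..T}" and x: "x \<in> {a..b}" for t x
  proof (intro conjI ballI)
    show "\<bar>f t x + g t x\<bar> \<le> K + J" using K(2)[OF t x] J(2)[OF t x] by linarith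
    fix s assume s: "s \<in> {0..T}"
    have "f s x + g s x - (f t x + g t x) = (f s x - f t x) + (g s x - g t x)" by simp
    then show "\<bar>f s x + g s x - (f t x + g t x)\<bar> \<le> (K + J) * \<bar>s - t\<bar>"
      using K(3)[OF s t x] J(3)[OF s t x] unfolding distrib_right by linarith
  qed
  then show "\<exists>K\<ge>0. \<forall>t\<in>{0..T}. \<forall>x\<in>{a..b}. \<bar>f t x + g t x\<bar> \<le> K \<and> (\<forall>s\<in>{0..T}. \<bar>f s x + g s x - (f t x + g t x)\<bar> \<le> K * \<bar>s - t\<bar>)"
    using K(1) J(1) by (intro exI[of _ "K + J"]) auto
qed

lemma time_Lip_mult:
  assumes "time_Lip a b f" "time_Lip a b g"
  shows "time_Lip a b (\<lambda>t x. f t x * g t x)"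
  unfolding time_Lip_def
proof (intro allI impI)
  fix T :: real assume T: "0 \<le> T"
  obtain K where K: "0 \<le> K" "\<And>t x. t \<in> {0..T} \<Longrightarrow> x \<in> {a..b} \<Longrightarrow> \<bar>f t x\<bar> \<le> K"
    "\<And>s t x. s \<in> {0..T} \<Longrightarrow> t \<in> {0..T} \<Longrightarrow> x \<in> {a..b} \<Longrightarrow> \<bar>f s x - f t x\<bar> \<le> K * \<bar>s - t\<bar>"
    using time_Lip_D[OF assms(1) T] by blast
  obtain J where J: "0 \<le> J" "\<And>t x. t \<in> {0..T} \<Longrightarrow> x \<in> {a..b} \<Longrightarrow> \<bar>g t x\<bar> \<le> J"
    "\<And>s t x. s \<in> {0..T} \<Longrightarrow> t \<in> {0..T} \<Longrightarrow> x \<in> {a..b} \<Longrightarrow> \<bar>g s x - g t x\<bar> \<le> J * \<bar>s - t\<bar>"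
    using time_Lip_D[OF assms(2) T] by blast
  have KJ: "0 \<le> K * J" using K(1) J(1) by simp
  have "\<bar>f t x * g t x\<bar> \<le> 2 * (K * J) \<and> (\<forall>s\<in>{0..T}. \<bar>f s x * g s x - f t x * g t x\<bar> \<le> 2 * (K * J) * \<bar>s - t\<bar>)"
    if t: "t \<in> {0..T}" and x: "x \<in> {a..b}" for t x
  proof (intro conjI ballI)
    have "\<bar>f t x * g t x\<bar> \<le> K * J" unfolding abs_mult using K(2)[OF t x] J(2)[OF t x] K J by (intro mult_mono) auto
    then show "\<bar>f t x * g t x\<bar> \<le> 2 * (K * J)" using KJ by linarith
    fix s assume s: "s \<in> {0..T}"
    have "f s x * g s x - f t x * g t x = (f s x - f t x) * g s x + f t x * (g s x - g t x)" by (simp add: algebra_simps)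
    moreover have "\<bar>(f s x - f t x) * g s x\<bar> \<le> (K * \<bar>s - t\<bar>) * J"
      unfolding abs_mult using K(1) K(3)[OF s t x] J(2)[OF s x] by (intro mult_mono) auto
    moreover have "\<bar>f t x * (g s x - g t x)\<bar> \<le> K * (J * \<bar>s - t\<bar>)"
      unfolding abs_mult using K(1) K(2)[OF t x] J(3)[OF s t x] by (intro mult_mono) auto
    ultimately show "\<bar>f s x * g s x - f t x * g t x\<bar> \<le> 2 * (K * J) * \<bar>s - t\<bar>" by (simp add: algebra_simps)
  qed
  then show "\<exists>K\<ge>0. \<forall>t\<in>{0..T}. \<forall>x\<in>{a..b}. \<bar>f t x * g t x\<bar> \<le> K \<and> (\<forall>s\<in>{0..T}. \<bar>f s x * g s x - f t x * g t x\<bar> \<le> K * \<bar>s - t\<bar>)"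
    using KJ by (intro exI[of _ "2 * (K * J)"]) auto
qed

lemma time_Lip_inverse:
  assumes "time_Lip a b f" and low: "\<And>T. 0 \<le> T \<Longrightarrow> \<exists>c>0. \<forall>t\<in>{0..T}. \<forall>x\<in>{a..b}. c \<le> f t x"
  shows "time_Lip a b (\<lambda>t x. 1 / f t x)"
  unfolding time_Lip_def
proof (intro allI impI)
  fix T :: real assume T: "0 \<le> T"
  obtain K where K: "0 \<le> K" "\<And>t x. t \<in> {0..T} \<Longrightarrow> x \<in> {a..b} \<Longrightarrow> \<bar>f t x\<bar> \<le> K"
    "\<And>s t x. s \<in> {0..T} \<Longrightarrow> t \<in> {0..T} \<Longrightarrow> x \<in> {a..b} \<Longrightarrow> \<bar>f s x - f t x\<bar> \<le> K * \<bar>s - t\<bar>"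
    using time_Lip_D[OF assms(1) T] by blast
  obtain c where c: "0 < c" "\<And>t x. t \<in> {0..T} \<Longrightarrow> x \<in> {a..b} \<Longrightarrow> c \<le> f t x" using low[OF T] by blast
  have cp: "0 < f t x" if "t \<in> {0..T}" "x \<in> {a..b}" for t x using c(1) c(2)[OF that] by linarith
  have "\<bar>1 / f t x\<bar> \<le> 1 / c + K / c\<^sup>2 \<and> (\<forall>s\<in>{0..T}. \<bar>1 / f s x - 1 / f t x\<bar> \<le> (1 / c + K / c\<^sup>2) * \<bar>s - t\<bar>)"
    if t: "t \<in> {0..T}" and x: "x \<in> {a..b}" for t x
  proof (intro conjI ballI)
    have "1 / f t x \<le> 1 / c" using c(1) c(2)[OF t x] by (intro frac_le) auto
    then show "\<bar>1 / f t x\<bar> \<le> 1 / c + K / c\<^sup>2" using cp[OF t x] K(1) by (simp add: add_increasing2)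
    fix s assume s: "s \<in> {0..T}"
    have "1 / f s x - 1 / f t x = (f t x - f s x) / (f s x * f t x)" using cp[OF s x] cp[OF t x] by (simp add: field_simps)
    also have "\<bar>\<dots>\<bar> \<le> (K * \<bar>s - t\<bar>) / (c * c)"
      unfolding abs_divide using cp[OF s x] cp[OF t x] c(1) c(2)[OF t x] c(2)[OF s x] K(1) K(3)[OF s t x]
      by (intro frac_le) (auto simp: abs_mult abs_minus_commute intro!: mult_mono)
    also have "\<dots> \<le> (1 / c + K / c\<^sup>2) * \<bar>s - t\<bar>" using c(1) by (simp add: power2_eq_square algebra_simps)
    finally show "\<bar>1 / f s x - 1 / f t x\<bar> \<le> (1 / c + K / c\<^sup>2) * \<bar>s - t\<bar>" .
  qed
  then show "\<exists>K\<ge>0. \<forall>t\<in>{0..T}. \<forall>x\<in>{a..b}. \<bar>1 / f t x\<bar> \<le> K \<and> (\<forall>s\<in>{0..T}. \<bar>1 / f s x - 1 / f t x\<bar> \<le> K * \<bar>s - t\<bar>)"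
    using c(1) K(1) by (intro exI[of _ "1 / c + K / c\<^sup>2"]) auto
qed

text \<open>Differentiation in time, with the derivative again Lipschitz, gives a quantitative difference quotient.\<close>

lemma time_Lip_difference_quotient:
  assumes time_Lip: "time_Lip a b v" and T: "0 \<le> T"
    and d: "\<And>t x. 0 \<le> t \<Longrightarrow> x \<in> {a..b} \<Longrightarrow> ((\<lambda>s. u s x) has_real_derivative v t x) (at t within {0..})"
  shows "\<exists>K. \<forall>s\<in>{0..T}. \<forall>t\<in>{0..T}. \<forall>x\<in>{a..b}. s \<noteq> t \<longrightarrow> \<bar>(u s x - u t x) / (s - t) - v t x\<bar> \<le> K * \<bar>s - t\<bar>"
proof -
  obtain K where K: "0 \<le> K" "\<And>s t x. s \<in> {0..T} \<Longrightarrow> t \<in> {0..T} \<Longrightarrow> x \<in> {a..b} \<Longrightarrow> \<bar>v s x - v t x\<bar> \<le> K * \<bar>s - t\<bar>"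
    using time_Lip_D[OF time_Lip T] by metis
  have *: "\<exists>r. s < r \<and> r < t \<and> (u t x - u s x) / (t - s) = v r x"
    if st: "0 \<le> s" "s < t" and x: "x \<in> {a..b}" for s t x
  proof -
    obtain r where "s < r" "r < t" "u t x - u s x = (\<lambda>h. v r x * h) (t - s)"
    proof (rule mvt[OF st(2), of "\<lambda>s. u s x" "\<lambda>r h. v r x * h"])
      show "continuous_on {s..t} (\<lambda>s. u s x)"
        by (rule DERIV_continuous_on[OF DERIV_subset[OF d[OF _ x]]]) (use st in auto)
      fix r assume r: "s < r" "r < t"
      have "at r within {0..} = at r" using r st by (intro at_within_interior) auto
      then show "((\<lambda>s. u s x) has_derivative (\<lambda>h. v r x * h)) (at r)"
        using d[of r x] r st x by (simp add: has_field_derivative_def)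
    qed
    then show ?thesis using st by (intro exI[of _ r]) (auto simp: field_simps)
  qed
  have "\<bar>(u s x - u t x) / (s - t) - v t x\<bar> \<le> K * \<bar>s - t\<bar>"
    if s: "s \<in> {0..T}" and t: "t \<in> {0..T}" and x: "x \<in> {a..b}" and ne: "s \<noteq> t" for s t x
  proof -
    have "\<exists>r\<in>{0..T}. \<bar>r - t\<bar> \<le> \<bar>s - t\<bar> \<and> (u s x - u t x) / (s - t) = v r x"
    proof (cases "s < t")
      case True
      then obtain r where "s < r" "r < t" "(u t x - u s x) / (t - s) = v r x" using *[of s t x] s x by auto
      moreover have "(u s x - u t x) / (s - t) = (u t x - u s x) / (t - s)"
        using minus_divide_divide[of "u t x - u s x" "t - s"] by simp
      ultimately show ?thesis using s t by (intro bexI[of _ r]) auto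
    next
      case False
      then obtain r where "t < r" "r < s" "(u s x - u t x) / (s - t) = v r x" using *[of t s x] t x ne by auto
      then show ?thesis using s t by (intro bexI[of _ r]) auto
    qed
    then obtain r where r: "r \<in> {0..T}" "\<bar>r - t\<bar> \<le> \<bar>s - t\<bar>" "(u s x - u t x) / (s - t) = v r x" by blast
    have "K * \<bar>r - t\<bar> \<le> K * \<bar>s - t\<bar>" using r(2) K(1) by (rule mult_left_mono)
    then show ?thesis using K(2)[OF r(1) t x] r(3) by linarith
  qed
  then show ?thesis by blast
qed

text \<open>Converse of \<open>time_Lip_difference_quotient\<close>, used to identify solutions of the differentiated problems as
time derivatives.\<close>

lemma time_derivative_of_quotient_bound:
  fixes u :: "real \<Rightarrow> real"
  assumes t: "0 \<le> t"
    and q: "\<And>T. t \<le> T \<Longrightarrow> \<exists>K. \<forall>s\<in>{0..T}. s \<noteq> t \<longrightarrow> \<bar>(u s - u t) / (s - t) - v\<bar> \<le> K * \<bar>s - t\<bar>"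
  shows "(u has_real_derivative v) (at t within {0..})"
proof -
  obtain K where K: "\<And>s. s \<in> {0..t+1} \<Longrightarrow> s \<noteq> t \<Longrightarrow> \<bar>(u s - u t) / (s - t) - v\<bar> \<le> K * \<bar>s - t\<bar>"
    using q[OF less_imp_le[OF less_add_one]] by blast
  have "((\<lambda>s. (u s - u t) / (s - t) - v) \<longlongrightarrow> 0) (at t within {0..})"
  proof (rule Lim_null_comparison)
    show "\<forall>\<^sub>F s in at t within {0..}. norm ((u s - u t) / (s - t) - v) \<le> K * \<bar>s - t\<bar>"
      unfolding eventually_at using K by (intro exI[of _ 1]) (auto simp: dist_real_def)
    have "((\<lambda>s. K * \<bar>s - t\<bar>) \<longlongrightarrow> K * \<bar>t - t\<bar>) (at t within {0..})" by (intro tendsto_intros)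
    then show "((\<lambda>s. K * \<bar>s - t\<bar>) \<longlongrightarrow> 0) (at t within {0..})" by simp
  qed
  then show ?thesis unfolding has_field_derivative_iff by (rule LIM_zero_cancel)
qed

section \<open>Lipschitz dependence of the solution on time\<close>

lemma compact_bound:
  fixes f :: "real \<Rightarrow> real"
  assumes "continuous_on {a..b} f"
  obtains C where "\<And>x. x \<in> {a..b} \<Longrightarrow> \<bar>f x\<bar> \<le> C"
  using compact_imp_bounded[OF compact_continuous_image[OF assms compact_Icc]]
  unfolding bounded_iff by (metis image_eqI real_norm_def)

text \<open>A choice of solutions of the Euler-Lagrange equation for all times, with no regularity in
time assumed.\<close>

locale igr_flow = igr_data +
  fixes \<Phi> p :: "real \<Rightarrow> real \<Rightarrow> real"
  assumes el: "0 \<le> t \<Longrightarrow> euler_lagrange t (\<Phi> t) (p t)"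
begin

definition q :: "real \<Rightarrow> real \<Rightarrow> real" where "q t x = q_of t (p t) x"

lemma q_eq: "q t x = p t x + m x * (1 - t * u1 x)" by (simp add: q_def q_of_def)

lemma flow:
  assumes "0 \<le> t"
  shows "\<Phi> t a = a" "\<Phi> t b = b" "x \<in> {a..b} \<Longrightarrow> 0 < q t x"
    "x \<in> {a..b} \<Longrightarrow> (\<Phi> t has_real_derivative m x / q t x) (at x within {a..b})"
    "x \<in> {a..b} \<Longrightarrow> (p t has_real_derivative - (m x / \<alpha> * (\<Phi> t x - x - t * u0 x))) (at x within {a..b})"
  using el[OF assms] unfolding euler_lagrange_def q_def by auto

lemma q_bounds:
  assumes T: "0 \<le> T"
  obtains \<epsilon> Q where "0 < \<epsilon>" "\<And>t x. t \<in> {0..T} \<Longrightarrow> x \<in> {a..b} \<Longrightarrow> \<epsilon> \<le> q t x \<and> q t x \<le> Q"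
  using euler_lagrange_bounds[OF T] el unfolding q_def by (metis atLeastAtMost_iff)

lemma cont_q: "0 \<le> t \<Longrightarrow> continuous_on {a..b} (q t)"
  unfolding q_eq[abs_def]
  by (intro continuous_intros cont_m cont_u1 DERIV_continuous_on[OF flow(5)])

text \<open>The stability estimate for the linearized problem with coefficient \<open>m / (q\<^sub>s q\<^sub>t)\<close>, uniform over times in
\<open>[0,T]\<close>. Two different times are allowed since \<open>m / q\<^sub>s - m / q\<^sub>t = - m (q\<^sub>s - q\<^sub>t) / (q\<^sub>s q\<^sub>t)\<close> makes the
equations for difference quotients exactly linear.\<close>

definition stability_bound :: "real \<Rightarrow> real \<Rightarrow> bool" where
  "stability_bound T S \<longleftrightarrow> (\<forall>s\<in>{0..T}. \<forall>t\<in>{0..T}. \<forall>y P g N. y a = 0 \<longrightarrow> y b = 0 \<longrightarrow>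
      (\<forall>x\<in>{a..b}. (y has_real_derivative g x - m x / (q s x * q t x) * P x) (at x within {a..b})) \<longrightarrow>
      (\<forall>x\<in>{a..b}. (P has_real_derivative - (m x / \<alpha>) * y x) (at x within {a..b})) \<longrightarrow>
      (\<forall>x\<in>{a..b}. \<bar>g x\<bar> \<le> N) \<longrightarrow> (\<forall>x\<in>{a..b}. \<bar>y x\<bar> \<le> S * N \<and> \<bar>P x\<bar> \<le> S * N))"

lemma stability_boundD:
  assumes "stability_bound T S" "s \<in> {0..T}" "t \<in> {0..T}" "y a = 0" "y b = 0"
    "\<And>x. x \<in> {a..b} \<Longrightarrow> (y has_real_derivative g x - m x / (q s x * q t x) * P x) (at x within {a..b})"
    "\<And>x. x \<in> {a..b} \<Longrightarrow> (P has_real_derivative - (m x / \<alpha>) * y x) (at x within {a..b})"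
    "\<And>x. x \<in> {a..b} \<Longrightarrow> \<bar>g x\<bar> \<le> N" "x \<in> {a..b}"
  shows "\<bar>y x\<bar> \<le> S * N" "\<bar>P x\<bar> \<le> S * N"
  using assms unfolding stability_bound_def by blast+

lemma stability_bound_exists:
  assumes T: "0 \<le> T"
  shows "\<exists>S. stability_bound T S"
proof -
  obtain \<epsilon> Q where e: "0 < \<epsilon>" and Q: "\<And>t x. t \<in> {0..T} \<Longrightarrow> x \<in> {a..b} \<Longrightarrow> \<epsilon> \<le> q t x \<and> q t x \<le> Q"
    using q_bounds[OF T] by blast
  have Qp: "0 < Q" using Q[of 0 a] e T ab by auto
  \<comment> \<open>Common bounds for both coefficients \<open>m / (q\<^sub>s q\<^sub>t)\<close> and \<open>m / \<alpha>\<close>.\<close>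
  define \<kappa> C where "\<kappa> = min (c0 / (Q * Q)) (c0 / \<alpha>)" and "C = max (M / (\<epsilon> * \<epsilon>)) (M / \<alpha>)"
  have \<kappa>: "0 < \<kappa>" using c0 Qp \<alpha> by (simp add: \<kappa>_def)
  show ?thesis
  proof (rule exI[of _ "stability_constant \<kappa> C (b - a)"], unfold stability_bound_def, intro ballI allI impI)
    fix s t y P g N x
    assume st: "s \<in> {0..T}" "t \<in> {0..T}" and bc: "y a = 0" "y b = 0"
      and d: "\<forall>x\<in>{a..b}. (y has_real_derivative g x - m x / (q s x * q t x) * P x) (at x within {a..b})"
        "\<forall>x\<in>{a..b}. (P has_real_derivative - (m x / \<alpha>) * y x) (at x within {a..b})"
      and g: "\<forall>x\<in>{a..b}. \<bar>g x\<bar> \<le> N" and x: "x \<in> {a..b}"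
    show "\<bar>y x\<bar> \<le> stability_constant \<kappa> C (b - a) * N \<and> \<bar>P x\<bar> \<le> stability_constant \<kappa> C (b - a) * N"
    proof (rule linear_stability[OF ab bspec[OF d(1)] bspec[OF d(2)] bc _ _ bspec[OF g] \<kappa> x])
      fix x assume x: "x \<in> {a..b}"
      have "c0 / (Q * Q) \<le> m x / (q s x * q t x)" "m x / (q s x * q t x) \<le> M / (\<epsilon> * \<epsilon>)"
        using m_bd[OF x] Q[OF st(1) x] Q[OF st(2) x] e c0 by (auto intro!: frac_le mult_mono mult_pos_pos)
      then show "\<kappa> \<le> m x / (q s x * q t x) \<and> m x / (q s x * q t x) \<le> C"
        unfolding \<kappa>_def C_def by (auto simp: min_le_iff_disj le_max_iff_disj)
      have "c0 / \<alpha> \<le> m x / \<alpha>" "m x / \<alpha> \<le> M / \<alpha>"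
        using m_bd[OF x] \<alpha> by (auto intro: divide_right_mono)
      then show "\<kappa> \<le> m x / \<alpha> \<and> m x / \<alpha> \<le> C"
        unfolding \<kappa>_def C_def by (auto simp: min_le_iff_disj le_max_iff_disj)
    qed
  qed
qed

text \<open>Subtracting \<open>u0\<close> from the difference quotient of \<open>\<Phi>\<close> absorbs the explicit dependence of \<open>p'\<close> on \<open>t\<close> and
retains zero boundary values.\<close>

lemma difference_quotient_ode:
  assumes st: "0 \<le> s" "0 \<le> t" "s \<noteq> t" and x: "x \<in> {a..b}"
  shows "((\<lambda>x. (\<Phi> s x - \<Phi> t x) / (s - t) - u0 x) has_real_derivative
       (m x / (q s x * q t x) * (m x * u1 x) - u1 x) - m x / (q s x * q t x) * ((p s x - p t x) / (s - t))) (at x within {a..b})"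
    and "((\<lambda>x. (p s x - p t x) / (s - t)) has_real_derivative
       - (m x / \<alpha>) * ((\<Phi> s x - \<Phi> t x) / (s - t) - u0 x)) (at x within {a..b})"
proof -
  have qp: "0 < q s x" "0 < q t x" using flow(3) st x by auto
  have qd: "(q s x - q t x) / (s - t) = (p s x - p t x) / (s - t) - m x * u1 x"
    using st by (simp add: q_eq field_simps)
  have "(m x / q s x - m x / q t x) / (s - t) = - (m x / (q s x * q t x)) * ((q s x - q t x) / (s - t))"
    using qp st by (simp add: divide_simps) (simp add: algebra_simps)
  then have "(m x / q s x - m x / q t x) / (s - t) - u1 x = (m x / (q s x * q t x) * (m x * u1 x) - u1 x) - m x / (q s x * q t x) * ((p s x - p t x) / (s - t))"
    unfolding qd by (simp add: algebra_simps)
  moreover have "((\<lambda>x. (\<Phi> s x - \<Phi> t x) / (s - t) - u0 x) has_real_derivative (m x / q s x - m x / q t x) / (s - t) - u1 x) (at x within {a..b})"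
    by (intro DERIV_diff DERIV_cdivide flow u0_deriv st x)
  ultimately show "((\<lambda>x. (\<Phi> s x - \<Phi> t x) / (s - t) - u0 x) has_real_derivative
       (m x / (q s x * q t x) * (m x * u1 x) - u1 x) - m x / (q s x * q t x) * ((p s x - p t x) / (s - t))) (at x within {a..b})"
    by (simp only:)
  have "((\<lambda>x. (p s x - p t x) / (s - t)) has_real_derivative (- (m x / \<alpha> * (\<Phi> s x - x - s * u0 x)) - - (m x / \<alpha> * (\<Phi> t x - x - t * u0 x))) / (s - t)) (at x within {a..b})"
    by (intro DERIV_diff DERIV_cdivide flow st x)
  moreover have "(- (m x / \<alpha> * (\<Phi> s x - x - s * u0 x)) - - (m x / \<alpha> * (\<Phi> t x - x - t * u0 x))) / (s - t)
     = - (m x / \<alpha>) * ((\<Phi> s x - \<Phi> t x) / (s - t) - u0 x)"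
    using st \<alpha> by (simp add: divide_simps) (simp add: algebra_simps)
  ultimately show "((\<lambda>x. (p s x - p t x) / (s - t)) has_real_derivative
       - (m x / \<alpha>) * ((\<Phi> s x - \<Phi> t x) / (s - t) - u0 x)) (at x within {a..b})"
    by simp
qed

text \<open>The term bounded here is the inhomogeneity in \<open>difference_quotient_ode\<close>.\<close>

lemma forcing_bound:
  assumes T: "0 \<le> T"
  obtains N where "0 \<le> N" "\<And>s t x. s \<in> {0..T} \<Longrightarrow> t \<in> {0..T} \<Longrightarrow> x \<in> {a..b} \<Longrightarrow>
    \<bar>m x / (q s x * q t x) * (m x * u1 x) - u1 x\<bar> \<le> N"
proof -
  obtain \<epsilon> Q where e: "0 < \<epsilon>" and Q: "\<And>t x. t \<in> {0..T} \<Longrightarrow> x \<in> {a..b} \<Longrightarrow> \<epsilon> \<le> q t x \<and> q t x \<le> Q"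
    using q_bounds[OF T] by blast
  show thesis
  proof (rule that[of "M / (\<epsilon> * \<epsilon>) * (M * U) + U"])
    show "0 \<le> M / (\<epsilon> * \<epsilon>) * (M * U) + U" using M U e by (auto intro!: add_nonneg_nonneg mult_nonneg_nonneg)
    fix s t x assume st: "s \<in> {0..T}" "t \<in> {0..T}" and x: "x \<in> {a..b}"
    have "\<bar>m x / (q s x * q t x)\<bar> \<le> M / (\<epsilon> * \<epsilon>)"
      unfolding abs_divide using m_bd[OF x] Q[OF st(1) x] Q[OF st(2) x] e c0
      by (intro frac_le) (auto simp: abs_mult intro!: mult_mono)
    moreover have "\<bar>m x * u1 x\<bar> \<le> M * U" unfolding abs_mult
      using m_bd[OF x] u_bd[OF x] c0 M by (intro mult_mono) auto
    ultimately have "\<bar>m x / (q s x * q t x) * (m x * u1 x)\<bar> \<le> M / (\<epsilon> * \<epsilon>) * (M * U)"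
      unfolding abs_mult[of "m x / (q s x * q t x)"] using M e by (intro mult_mono) auto
    then show "\<bar>m x / (q s x * q t x) * (m x * u1 x) - u1 x\<bar> \<le> M / (\<epsilon> * \<epsilon>) * (M * U) + U"
      using u_bd[OF x] by linarith
  qed
qed

text \<open>The stability estimate applied to difference quotients.\<close>

lemma time_Lip_flow: "time_Lip a b \<Phi>" "time_Lip a b p"
proof -
  have "\<exists>K. \<forall>s\<in>{0..T}. \<forall>t\<in>{0..T}. \<forall>x\<in>{a..b}. \<bar>\<Phi> s x - \<Phi> t x\<bar> \<le> K * \<bar>s - t\<bar> \<and> \<bar>p s x - p t x\<bar> \<le> K * \<bar>s - t\<bar>"
    if T: "0 \<le> T" for T
  proof -
    obtain S where S: "stability_bound T S" using stability_bound_exists[OF T] by blast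
    obtain N where N: "0 \<le> N" "\<And>s t x. s \<in> {0..T} \<Longrightarrow> t \<in> {0..T} \<Longrightarrow> x \<in> {a..b} \<Longrightarrow>
      \<bar>m x / (q s x * q t x) * (m x * u1 x) - u1 x\<bar> \<le> N" using forcing_bound[OF T] by blast
    have "\<bar>\<Phi> s x - \<Phi> t x\<bar> \<le> (S * N + U) * \<bar>s - t\<bar> \<and> \<bar>p s x - p t x\<bar> \<le> (S * N + U) * \<bar>s - t\<bar>"
      if s: "s \<in> {0..T}" and t: "t \<in> {0..T}" and x: "x \<in> {a..b}" for s t x
    proof (cases "s = t")
      case False
      have st: "0 \<le> s" "0 \<le> t" using s t by auto
      have bc: "(\<Phi> s a - \<Phi> t a) / (s - t) - u0 a = 0" "(\<Phi> s b - \<Phi> t b) / (s - t) - u0 b = 0"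
        using flow(1,2) st u0_bc by auto
      have "\<bar>(\<Phi> s x - \<Phi> t x) / (s - t) - u0 x\<bar> \<le> S * N" "\<bar>(p s x - p t x) / (s - t)\<bar> \<le> S * N"
        using stability_boundD[OF S s t bc difference_quotient_ode[OF st False] N(2)[OF s t] x] by auto
      then have "\<bar>(\<Phi> s x - \<Phi> t x) / (s - t)\<bar> \<le> S * N + U" "\<bar>(p s x - p t x) / (s - t)\<bar> \<le> S * N + U"
        using u_bd[OF x] U by linarith+
      then show ?thesis using False by (simp add: abs_divide divide_le_eq)
    qed simp
    then show ?thesis by blast
  qed
  note * = this
  obtain C where C: "\<And>x. x \<in> {a..b} \<Longrightarrow> \<bar>\<Phi> 0 x\<bar> \<le> C"
    using compact_bound[OF DERIV_continuous_on[OF flow(4)[OF order_refl]]] by blast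
  obtain D where D: "\<And>x. x \<in> {a..b} \<Longrightarrow> \<bar>p 0 x\<bar> \<le> D"
    using compact_bound[OF DERIV_continuous_on[OF flow(5)[OF order_refl]]] by blast
  show "time_Lip a b \<Phi>" by (rule time_Lip_I[where f = \<Phi> and C = C]) (use * C in blast)+
  show "time_Lip a b p" by (rule time_Lip_I[where f = p and C = D]) (use * D in blast)+
qed

lemma time_Lip_static: "continuous_on {a..b} f \<Longrightarrow> time_Lip a b (\<lambda>t. f)"
  by (metis time_Lip_const compact_bound)

lemma time_Lip_q: "time_Lip a b q"
proof -
  have "time_Lip a b (\<lambda>t x. p t x + (m x + t * (- (m x * u1 x))))"
    by (intro time_Lip_add time_Lip_mult time_Lip_flow time_Lip_time time_Lip_static continuous_intros cont_m cont_u1)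
  then show ?thesis by (rule time_Lip_cong[THEN iffD1, rotated]) (simp add: q_eq algebra_simps)
qed

lemma time_Lip_inverse_q: "time_Lip a b (\<lambda>t x. 1 / q t x)"
proof (rule time_Lip_inverse[OF time_Lip_q])
  fix T :: real assume "0 \<le> T"
  then obtain \<epsilon> Q where "0 < \<epsilon>" "\<And>t x. t \<in> {0..T} \<Longrightarrow> x \<in> {a..b} \<Longrightarrow> \<epsilon> \<le> q t x \<and> q t x \<le> Q"
    using q_bounds by blast
  then show "\<exists>c>0. \<forall>t\<in>{0..T}. \<forall>x\<in>{a..b}. c \<le> q t x" by blast
qed

end

section \<open>Velocity and acceleration\<close>

lemma time_Lip_uminus: "time_Lip a b f \<Longrightarrow> time_Lip a b (\<lambda>t x. - f t x)"
  using time_Lip_mult[OF time_Lip_const[of a b "\<lambda>_. -1" 1], of f] by simp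

lemma time_Lip_diff: "time_Lip a b f \<Longrightarrow> time_Lip a b g \<Longrightarrow> time_Lip a b (\<lambda>t x. f t x - g t x)"
  using time_Lip_add[OF _ time_Lip_uminus, of a b f g] by simp

text \<open>Algebraic rearrangements that bring the right-hand sides of the differentiated equations into the form
\<open>g - c P\<close> of the linear problem. They are stated with opaque variables to keep the products intact.\<close>

lemma igr_rearrange:
  fixes k l r r' w v P z X Y b d e :: real
  shows "- k * (r - w) - v = (k * w - v) - k * r"
    "- k * (r - w) = (k * w - v) - k * r + v"
    "k * w - v - k * P - (- l * (r - w) - v) = (l * (r - w) - k * (r - w)) - k * (P - r)"
    "- k * (r - w) - - l * (r' - w) = (l - k) * (r' - w) - k * (r - r')"
    "- k * X - Y * z - (- d * z - l * b) = (- (k - l) * b - (Y - d) * z) - k * (X - b)"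
  by (simp_all add: algebra_simps)

text \<open>\<open>V\<close> and \<open>R\<close> solve the problem obtained by formal differentiation of the Euler-Lagrange system for \<open>\<Phi>\<close> and \<open>p\<close>
with respect to \<open>t\<close>. That they are the time derivatives is proved in \<open>flow_time_deriv\<close>.\<close>

locale igr_velocity = igr_flow +
  fixes V R :: "real \<Rightarrow> real \<Rightarrow> real"
  assumes V_bc: "0 \<le> t \<Longrightarrow> V t a = 0 \<and> V t b = 0"
    and V_deriv: "0 \<le> t \<Longrightarrow> x \<in> {a..b} \<Longrightarrow>
      (V t has_real_derivative - (m x / (q t x * q t x)) * (R t x - m x * u1 x)) (at x within {a..b})"
    and R_deriv: "0 \<le> t \<Longrightarrow> x \<in> {a..b} \<Longrightarrow>
      (R t has_real_derivative - (m x / \<alpha>) * (V t x - u0 x)) (at x within {a..b})"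
begin

text \<open>The time derivative of \<open>q\<close>.\<close>

definition Z :: "real \<Rightarrow> real \<Rightarrow> real" where "Z t x = R t x - m x * u1 x"

definition c :: "real \<Rightarrow> real \<Rightarrow> real" where "c t x = m x * ((1 / q t x) * (1 / q t x))"

lemma c_eq: "c t x = m x / (q t x * q t x)" by (simp add: c_def)

lemma time_Lip_c: "time_Lip a b c"
  unfolding c_def[abs_def] by (intro time_Lip_mult time_Lip_inverse_q time_Lip_static cont_m)

lemma Z_bounded:
  assumes T: "0 \<le> T"
  shows "\<exists>K. \<forall>t\<in>{0..T}. \<forall>x\<in>{a..b}. \<bar>Z t x\<bar> \<le> K"
proof -
  obtain S where S: "stability_bound T S" using stability_bound_exists[OF T] by blast
  obtain N where N: "0 \<le> N" "\<And>s t x. s \<in> {0..T} \<Longrightarrow> t \<in> {0..T} \<Longrightarrow> x \<in> {a..b} \<Longrightarrow>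
    \<bar>m x / (q s x * q t x) * (m x * u1 x) - u1 x\<bar> \<le> N" using forcing_bound[OF T] by blast
  have "\<bar>Z t x\<bar> \<le> S * N + M * U" if t: "t \<in> {0..T}" and x: "x \<in> {a..b}" for t x
  proof -
    have t0: "0 \<le> t" using t by simp
    have "\<bar>R t x\<bar> \<le> S * N"
    proof (rule stability_boundD(2)[OF S t t _ _ _ _ N(2)[OF t t] x, where y = "\<lambda>x. V t x - u0 x"])
      fix x assume x: "x \<in> {a..b}"
      show "((\<lambda>x. V t x - u0 x) has_real_derivative (m x / (q t x * q t x) * (m x * u1 x) - u1 x) - m x / (q t x * q t x) * R t x) (at x within {a..b})"
        by (rule DERIV_cong[OF DERIV_diff[OF V_deriv[OF t0 x] u0_deriv[OF x]]]) (rule igr_rearrange)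
      show "(R t has_real_derivative - (m x / \<alpha>) * (V t x - u0 x)) (at x within {a..b})" by (rule R_deriv[OF t0 x])
    qed (use V_bc[OF t0] u0_bc in auto)
    moreover have "\<bar>m x * u1 x\<bar> \<le> M * U" unfolding abs_mult
      using m_bd[OF x] u_bd[OF x] c0 M by (intro mult_mono) auto
    ultimately show ?thesis unfolding Z_def by linarith
  qed
  then show ?thesis by blast
qed

text \<open>The difference between the quotient at \<open>s, t\<close> and \<open>(V, R)\<close> solves the linear problem with an inhomogeneity
proportional to \<open>1 / q\<^sub>t - 1 / q\<^sub>s\<close>, which is of order \<open>\<bar>s - t\<bar>\<close>.\<close>

lemma flow_quotient:
  assumes T: "0 \<le> T"
  shows "\<exists>K. \<forall>s\<in>{0..T}. \<forall>t\<in>{0..T}. \<forall>x\<in>{a..b}. s \<noteq> t \<longrightarrow>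
    \<bar>(\<Phi> s x - \<Phi> t x) / (s - t) - V t x\<bar> \<le> K * \<bar>s - t\<bar> \<and> \<bar>(p s x - p t x) / (s - t) - R t x\<bar> \<le> K * \<bar>s - t\<bar>"
proof -
  obtain S where S: "stability_bound T S" using stability_bound_exists[OF T] by blast
  obtain KZ where KZ: "\<And>t x. t \<in> {0..T} \<Longrightarrow> x \<in> {a..b} \<Longrightarrow> \<bar>Z t x\<bar> \<le> KZ"
    using Z_bounded[OF T] by blast
  have KZ0: "0 \<le> KZ" using KZ[of 0 a] T ab by auto
  obtain K where K: "0 \<le> K" "\<And>t x. t \<in> {0..T} \<Longrightarrow> x \<in> {a..b} \<Longrightarrow> \<bar>1 / q t x\<bar> \<le> K"
    "\<And>s t x. s \<in> {0..T} \<Longrightarrow> t \<in> {0..T} \<Longrightarrow> x \<in> {a..b} \<Longrightarrow> \<bar>1 / q s x - 1 / q t x\<bar> \<le> K * \<bar>s - t\<bar>"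
    using time_Lip_D[OF time_Lip_inverse_q T] by metis
  have "\<bar>(\<Phi> s x - \<Phi> t x) / (s - t) - V t x\<bar> \<le> S * (M * K * K * KZ) * \<bar>s - t\<bar> \<and>
      \<bar>(p s x - p t x) / (s - t) - R t x\<bar> \<le> S * (M * K * K * KZ) * \<bar>s - t\<bar>"
    if s: "s \<in> {0..T}" and t: "t \<in> {0..T}" and x: "x \<in> {a..b}" and ne: "s \<noteq> t" for s t x
  proof -
    have st: "0 \<le> s" "0 \<le> t" using s t by auto
    let ?y = "\<lambda>x. ((\<Phi> s x - \<Phi> t x) / (s - t) - u0 x) - (V t x - u0 x)"
    let ?P = "\<lambda>x. (p s x - p t x) / (s - t) - R t x"
    let ?g = "\<lambda>x. m x * (1 / q t x) * (1 / q t x - 1 / q s x) * Z t x"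
    have bc: "?y a = 0" "?y b = 0" using flow(1,2) st u0_bc V_bc by auto
    have d1: "(?y has_real_derivative ?g x - m x / (q s x * q t x) * ?P x) (at x within {a..b})" if x: "x \<in> {a..b}" for x
    proof (rule DERIV_cong[OF DERIV_diff[OF difference_quotient_ode(1)[OF st ne x] DERIV_diff[OF V_deriv[OF st(2) x] u0_deriv[OF x]]]])
      have "?g x = m x / (q t x * q t x) * Z t x - m x / (q s x * q t x) * Z t x" by (simp add: algebra_simps)
      then show "m x / (q s x * q t x) * (m x * u1 x) - u1 x - m x / (q s x * q t x) * ((p s x - p t x) / (s - t)) -
         (- (m x / (q t x * q t x)) * (R t x - m x * u1 x) - u1 x) = ?g x - m x / (q s x * q t x) * ?P x"
        unfolding Z_def by (simp only:) (rule igr_rearrange)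
    qed
    have d2: "(?P has_real_derivative - (m x / \<alpha>) * ?y x) (at x within {a..b})" if x: "x \<in> {a..b}" for x
      by (rule DERIV_cong[OF DERIV_diff[OF difference_quotient_ode(2)[OF st ne x] R_deriv[OF st(2) x]]])
         (simp add: algebra_simps)
    have g: "\<bar>?g x\<bar> \<le> M * K * K * KZ * \<bar>s - t\<bar>" if x: "x \<in> {a..b}" for x
    proof -
      have "\<bar>?g x\<bar> \<le> M * K * (K * \<bar>s - t\<bar>) * KZ"
        unfolding abs_mult using m_bd[OF x] c0 M K(1) K(2)[OF t x] K(3)[OF t s x] KZ[OF t x]
        by (intro mult_mono mult_nonneg_nonneg) (auto simp: abs_minus_commute)
      then show ?thesis by (simp add: mult_ac)
    qed
    show ?thesis
      using stability_boundD[OF S s t bc d1 d2 g x] by (simp add: mult.assoc)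
  qed
  then show ?thesis by blast
qed

lemma flow_time_deriv:
  assumes t: "0 \<le> t" and x: "x \<in> {a..b}"
  shows "((\<lambda>s. \<Phi> s x) has_real_derivative V t x) (at t within {0..})"
    "((\<lambda>s. p s x) has_real_derivative R t x) (at t within {0..})"
    "((\<lambda>s. q s x) has_real_derivative Z t x) (at t within {0..})"
proof -
  have *: "\<exists>K. \<forall>s\<in>{0..T}. s \<noteq> t \<longrightarrow> \<bar>(\<Phi> s x - \<Phi> t x) / (s - t) - V t x\<bar> \<le> K * \<bar>s - t\<bar>"
     "\<exists>K. \<forall>s\<in>{0..T}. s \<noteq> t \<longrightarrow> \<bar>(p s x - p t x) / (s - t) - R t x\<bar> \<le> K * \<bar>s - t\<bar>" if "t \<le> T" for T
    using flow_quotient[of T] that t x by (meson atLeastAtMost_iff order_trans)+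
  show "((\<lambda>s. \<Phi> s x) has_real_derivative V t x) (at t within {0..})"
    by (rule time_derivative_of_quotient_bound[OF t *(1)])
  show p: "((\<lambda>s. p s x) has_real_derivative R t x) (at t within {0..})"
    by (rule time_derivative_of_quotient_bound[OF t *(2)])
  show "((\<lambda>s. q s x) has_real_derivative Z t x) (at t within {0..})"
    unfolding q_eq Z_def by (rule derivative_eq_intros p refl | simp)+
qed

text \<open>The increments of \<open>V\<close> and \<open>R\<close> solve the linear problem with inhomogeneity \<open>(c\<^sub>t - c\<^sub>s) Z\<^sub>t\<close>.\<close>

lemma time_Lip_velocity: "time_Lip a b V" "time_Lip a b R"
proof -
  have "\<exists>K. \<forall>s\<in>{0..T}. \<forall>t\<in>{0..T}. \<forall>x\<in>{a..b}. \<bar>V s x - V t x\<bar> \<le> K * \<bar>s - t\<bar> \<and> \<bar>R s x - R t x\<bar> \<le> K * \<bar>s - t\<bar>"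
    if T: "0 \<le> T" for T
  proof -
    obtain S where S: "stability_bound T S" using stability_bound_exists[OF T] by blast
    obtain KZ where KZ: "\<And>t x. t \<in> {0..T} \<Longrightarrow> x \<in> {a..b} \<Longrightarrow> \<bar>Z t x\<bar> \<le> KZ"
      using Z_bounded[OF T] by blast
    have KZ0: "0 \<le> KZ" using KZ[of 0 a] T ab by auto
    obtain K where K: "0 \<le> K" "\<And>t x. t \<in> {0..T} \<Longrightarrow> x \<in> {a..b} \<Longrightarrow> \<bar>c t x\<bar> \<le> K"
      "\<And>s t x. s \<in> {0..T} \<Longrightarrow> t \<in> {0..T} \<Longrightarrow> x \<in> {a..b} \<Longrightarrow> \<bar>c s x - c t x\<bar> \<le> K * \<bar>s - t\<bar>"
      using time_Lip_D[OF time_Lip_c T] by metis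
    have "\<bar>V s x - V t x\<bar> \<le> S * (K * KZ) * \<bar>s - t\<bar> \<and> \<bar>R s x - R t x\<bar> \<le> S * (K * KZ) * \<bar>s - t\<bar>"
      if s: "s \<in> {0..T}" and t: "t \<in> {0..T}" and x: "x \<in> {a..b}" for s t x
    proof -
      have st: "0 \<le> s" "0 \<le> t" using s t by auto
      let ?y = "\<lambda>x. V s x - V t x" and ?P = "\<lambda>x. R s x - R t x" and ?g = "\<lambda>x. (c t x - c s x) * Z t x"
      have bc: "?y a = 0" "?y b = 0" using st V_bc by auto
      have d1: "(?y has_real_derivative ?g x - m x / (q s x * q s x) * ?P x) (at x within {a..b})" if x: "x \<in> {a..b}" for x
        by (rule DERIV_cong[OF DERIV_diff[OF V_deriv[OF st(1) x] V_deriv[OF st(2) x]]])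
           (unfold c_eq Z_def, rule igr_rearrange)
      have d2: "(?P has_real_derivative - (m x / \<alpha>) * ?y x) (at x within {a..b})" if x: "x \<in> {a..b}" for x
        by (rule DERIV_cong[OF DERIV_diff[OF R_deriv[OF st(1) x] R_deriv[OF st(2) x]]])
           (simp add: algebra_simps diff_divide_distrib)
      have g: "\<bar>?g x\<bar> \<le> K * KZ * \<bar>s - t\<bar>" if x: "x \<in> {a..b}" for x
      proof -
        have "\<bar>?g x\<bar> \<le> (K * \<bar>s - t\<bar>) * KZ"
          unfolding abs_mult using K(1) K(3)[OF t s x] KZ[OF t x]
          by (intro mult_mono) (auto simp: abs_minus_commute)
        then show ?thesis by (simp add: mult_ac)
      qed
      show ?thesis
        using stability_boundD[OF S s s bc d1 d2 g x] by (simp add: mult.assoc)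
    qed
    then show ?thesis by blast
  qed
  note * = this
  obtain C where C: "\<And>x. x \<in> {a..b} \<Longrightarrow> \<bar>V 0 x\<bar> \<le> C"
    using compact_bound[OF DERIV_continuous_on[OF V_deriv[OF order_refl]]] by blast
  obtain D where D: "\<And>x. x \<in> {a..b} \<Longrightarrow> \<bar>R 0 x\<bar> \<le> D"
    using compact_bound[OF DERIV_continuous_on[OF R_deriv[OF order_refl]]] by blast
  show "time_Lip a b V" by (rule time_Lip_I[where f = V and C = C]) (use * C in blast)+
  show "time_Lip a b R" by (rule time_Lip_I[where f = R and C = D]) (use * D in blast)+
qed

lemma time_Lip_Z: "time_Lip a b Z"
  unfolding Z_def[abs_def] by (intro time_Lip_diff time_Lip_velocity time_Lip_static continuous_intros cont_m cont_u1)

definition c_dot :: "real \<Rightarrow> real \<Rightarrow> real" where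
  "c_dot t x = - (2 * m x * Z t x / (q t x * q t x * q t x))"

lemma time_Lip_c_dot: "time_Lip a b c_dot"
proof -
  have "time_Lip a b (\<lambda>t x. - ((2 * m x) * (Z t x * ((1 / q t x) * (1 / q t x) * (1 / q t x)))))"
    by (intro time_Lip_uminus time_Lip_mult time_Lip_inverse_q time_Lip_Z time_Lip_static continuous_intros cont_m)
  then show ?thesis by (simp add: c_dot_def[abs_def] mult.assoc)
qed

lemma c_time_deriv:
  assumes t: "0 \<le> t" and x: "x \<in> {a..b}"
  shows "((\<lambda>s. c s x) has_real_derivative c_dot t x) (at t within {0..})"
proof -
  have qn: "q t x \<noteq> 0" using flow(3)[OF t x] by simp
  have d: "((\<lambda>s. 1 / q s x) has_real_derivative - (Z t x / (q t x * q t x))) (at t within {0..})"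
    using DERIV_inverse'[OF flow_time_deriv(3)[OF t x] qn] by (simp add: inverse_eq_divide)
  show ?thesis unfolding c_def c_dot_def
    using DERIV_cmult[OF DERIV_mult[OF d d], of "m x"] by (simp add: mult_ac)
qed

end

text \<open>\<open>A\<close> and \<open>B\<close> solve the problem obtained by formal differentiation of the velocity problem; that they are the time derivatives of
\<open>V\<close> and \<open>R\<close> is proved in \<open>velocity_time_deriv\<close>.\<close>

locale igr_acceleration = igr_velocity +
  fixes A B :: "real \<Rightarrow> real \<Rightarrow> real"
  assumes A_bc: "0 \<le> t \<Longrightarrow> A t a = 0 \<and> A t b = 0"
    and A_deriv: "0 \<le> t \<Longrightarrow> x \<in> {a..b} \<Longrightarrow>
      (A t has_real_derivative - c_dot t x * Z t x - c t x * B t x) (at x within {a..b})"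
    and B_deriv: "0 \<le> t \<Longrightarrow> x \<in> {a..b} \<Longrightarrow>
      (B t has_real_derivative - (m x / \<alpha>) * A t x) (at x within {a..b})"
begin

lemma B_bounded:
  assumes T: "0 \<le> T"
  shows "\<exists>K. \<forall>t\<in>{0..T}. \<forall>x\<in>{a..b}. \<bar>B t x\<bar> \<le> K"
proof -
  obtain S where S: "stability_bound T S" using stability_bound_exists[OF T] by blast
  have LCg: "time_Lip a b (\<lambda>t x. - c_dot t x * Z t x)" by (intro time_Lip_mult time_Lip_uminus time_Lip_c_dot time_Lip_Z)
  obtain K where K: "\<And>t x. t \<in> {0..T} \<Longrightarrow> x \<in> {a..b} \<Longrightarrow> \<bar>- c_dot t x * Z t x\<bar> \<le> K"
    using time_Lip_D[OF LCg T] by metis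
  have "\<bar>B t x\<bar> \<le> S * K" if t: "t \<in> {0..T}" and x: "x \<in> {a..b}" for t x
  proof -
    have t0: "0 \<le> t" using t by simp
    show ?thesis
      by (rule stability_boundD(2)[OF S t t _ _ _ B_deriv[OF t0] K[OF t] x])
         (use A_bc[OF t0] A_deriv[OF t0] in \<open>auto simp: c_eq\<close>)
  qed
  then show ?thesis by blast
qed

text \<open>As in \<open>flow_quotient\<close>; the inhomogeneity now consists of an increment of \<open>c\<close> and of the error of its
difference quotient, both of order \<open>\<bar>s - t\<bar>\<close>.\<close>

lemma velocity_quotient:
  assumes T: "0 \<le> T"
  shows "\<exists>K. \<forall>s\<in>{0..T}. \<forall>t\<in>{0..T}. \<forall>x\<in>{a..b}. s \<noteq> t \<longrightarrow>
    \<bar>(V s x - V t x) / (s - t) - A t x\<bar> \<le> K * \<bar>s - t\<bar> \<and> \<bar>(R s x - R t x) / (s - t) - B t x\<bar> \<le> K * \<bar>s - t\<bar>"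
proof -
  obtain S where S: "stability_bound T S" using stability_bound_exists[OF T] by blast
  obtain KB where KB: "\<And>t x. t \<in> {0..T} \<Longrightarrow> x \<in> {a..b} \<Longrightarrow> \<bar>B t x\<bar> \<le> KB"
    using B_bounded[OF T] by blast
  have KB0: "0 \<le> KB" using KB[of 0 a] T ab by auto
  obtain K where K: "0 \<le> K" "\<And>t x. t \<in> {0..T} \<Longrightarrow> x \<in> {a..b} \<Longrightarrow> \<bar>c t x\<bar> \<le> K"
    "\<And>s t x. s \<in> {0..T} \<Longrightarrow> t \<in> {0..T} \<Longrightarrow> x \<in> {a..b} \<Longrightarrow> \<bar>c s x - c t x\<bar> \<le> K * \<bar>s - t\<bar>"
    using time_Lip_D[OF time_Lip_c T] by metis
  obtain J where J: "0 \<le> J" "\<And>t x. t \<in> {0..T} \<Longrightarrow> x \<in> {a..b} \<Longrightarrow> \<bar>Z t x\<bar> \<le> J"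
    using time_Lip_D[OF time_Lip_Z T] by metis
  obtain H where H: "\<And>s t x. s \<in> {0..T} \<Longrightarrow> t \<in> {0..T} \<Longrightarrow> x \<in> {a..b} \<Longrightarrow> s \<noteq> t \<Longrightarrow>
      \<bar>(c s x - c t x) / (s - t) - c_dot t x\<bar> \<le> H * \<bar>s - t\<bar>"
    using time_Lip_difference_quotient[OF time_Lip_c_dot T c_time_deriv] by blast
  have "\<bar>(V s x - V t x) / (s - t) - A t x\<bar> \<le> S * (K * KB + H * J) * \<bar>s - t\<bar> \<and>
      \<bar>(R s x - R t x) / (s - t) - B t x\<bar> \<le> S * (K * KB + H * J) * \<bar>s - t\<bar>"
    if s: "s \<in> {0..T}" and t: "t \<in> {0..T}" and x: "x \<in> {a..b}" and ne: "s \<noteq> t" for s t x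
  proof -
    have st: "0 \<le> s" "0 \<le> t" using s t by auto
    let ?y = "\<lambda>x. (V s x - V t x) / (s - t) - A t x" and ?P = "\<lambda>x. (R s x - R t x) / (s - t) - B t x"
    let ?g = "\<lambda>x. - (c s x - c t x) * B t x - ((c s x - c t x) / (s - t) - c_dot t x) * Z t x"
    have bc: "?y a = 0" "?y b = 0" using st A_bc V_bc by auto
    have d1: "(?y has_real_derivative ?g x - m x / (q s x * q s x) * ?P x) (at x within {a..b})" if x: "x \<in> {a..b}" for x
    proof (rule DERIV_cong[OF DERIV_diff[OF DERIV_cdivide[OF DERIV_diff[OF V_deriv[OF st(1) x] V_deriv[OF st(2) x]]] A_deriv[OF st(2) x]]])
      have ZR: "Z s x - Z t x = R s x - R t x" by (simp add: Z_def)
      have "(- (m x / (q s x * q s x)) * (R s x - m x * u1 x) - - (m x / (q t x * q t x)) * (R t x - m x * u1 x)) / (s - t)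
        = (- c s x * Z s x + c t x * Z t x) / (s - t)" by (simp add: c_eq Z_def)
      also have "- c s x * Z s x + c t x * Z t x = - (c s x) * (R s x - R t x) - (c s x - c t x) * Z t x"
        unfolding ZR[symmetric] by (simp add: algebra_simps)
      also have "\<dots> / (s - t) = - (c s x) * ((R s x - R t x) / (s - t)) - ((c s x - c t x) / (s - t)) * Z t x"
        by (simp add: divide_inverse algebra_simps)
      finally have E: "(- (m x / (q s x * q s x)) * (R s x - m x * u1 x) - - (m x / (q t x * q t x)) * (R t x - m x * u1 x)) / (s - t)
        = - (c s x) * ((R s x - R t x) / (s - t)) - ((c s x - c t x) / (s - t)) * Z t x" .
      show "(- (m x / (q s x * q s x)) * (R s x - m x * u1 x) - - (m x / (q t x * q t x)) * (R t x - m x * u1 x)) / (s - t)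
         - (- c_dot t x * Z t x - c t x * B t x) = ?g x - m x / (q s x * q s x) * ?P x"
        by (simp only: E) (unfold c_eq[of s, symmetric], rule igr_rearrange)
    qed
    have d2: "(?P has_real_derivative - (m x / \<alpha>) * ?y x) (at x within {a..b})" if x: "x \<in> {a..b}" for x
    proof (rule DERIV_cong[OF DERIV_diff[OF DERIV_cdivide[OF DERIV_diff[OF R_deriv[OF st(1) x] R_deriv[OF st(2) x]]] B_deriv[OF st(2) x]]])
      have "(- (m x / \<alpha>) * (V s x - u0 x) - - (m x / \<alpha>) * (V t x - u0 x)) = - (m x / \<alpha>) * (V s x - V t x)"
        by (simp add: algebra_simps diff_divide_distrib)
      then show "(- (m x / \<alpha>) * (V s x - u0 x) - - (m x / \<alpha>) * (V t x - u0 x)) / (s - t) - - (m x / \<alpha>) * A t x = - (m x / \<alpha>) * ?y x"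
        by (simp only: right_diff_distrib times_divide_eq_right)
    qed
    have g: "\<bar>?g x\<bar> \<le> (K * KB + H * J) * \<bar>s - t\<bar>" if x: "x \<in> {a..b}" for x
    proof -
      have "\<bar>(c s x - c t x) * B t x\<bar> \<le> (K * \<bar>s - t\<bar>) * KB"
        unfolding abs_mult using K(1) K(3)[OF s t x] KB[OF t x] by (intro mult_mono) auto
      moreover have "\<bar>((c s x - c t x) / (s - t) - c_dot t x) * Z t x\<bar> \<le> (H * \<bar>s - t\<bar>) * J"
        unfolding abs_mult using H[OF s t x ne] J(1) J(2)[OF t x]
        by (intro mult_mono) (auto intro: order_trans[OF abs_ge_zero])
      ultimately show ?thesis by (simp add: algebra_simps)
    qed
    show ?thesis
      using stability_boundD[OF S s s bc d1 d2 g x] by (simp add: mult.assoc)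
  qed
  then show ?thesis by blast
qed

lemma velocity_time_deriv:
  assumes t: "0 \<le> t" and x: "x \<in> {a..b}"
  shows "((\<lambda>s. V s x) has_real_derivative A t x) (at t within {0..})"
    "((\<lambda>s. R s x) has_real_derivative B t x) (at t within {0..})"
proof -
  have *: "\<exists>K. \<forall>s\<in>{0..T}. s \<noteq> t \<longrightarrow> \<bar>(V s x - V t x) / (s - t) - A t x\<bar> \<le> K * \<bar>s - t\<bar>"
     "\<exists>K. \<forall>s\<in>{0..T}. s \<noteq> t \<longrightarrow> \<bar>(R s x - R t x) / (s - t) - B t x\<bar> \<le> K * \<bar>s - t\<bar>" if "t \<le> T" for T
    using velocity_quotient[of T] that t x by (meson atLeastAtMost_iff order_trans)+
  show "((\<lambda>s. V s x) has_real_derivative A t x) (at t within {0..})"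
    by (rule time_derivative_of_quotient_bound[OF t *(1)])
  show "((\<lambda>s. R s x) has_real_derivative B t x) (at t within {0..})"
    by (rule time_derivative_of_quotient_bound[OF t *(2)])
qed

lemma time_Lip_acceleration: "time_Lip a b A" "time_Lip a b B"
proof -
  have "\<exists>K. \<forall>s\<in>{0..T}. \<forall>t\<in>{0..T}. \<forall>x\<in>{a..b}. \<bar>A s x - A t x\<bar> \<le> K * \<bar>s - t\<bar> \<and> \<bar>B s x - B t x\<bar> \<le> K * \<bar>s - t\<bar>"
    if T: "0 \<le> T" for T
  proof -
    obtain S where S: "stability_bound T S" using stability_bound_exists[OF T] by blast
    obtain KB where KB: "\<And>t x. t \<in> {0..T} \<Longrightarrow> x \<in> {a..b} \<Longrightarrow> \<bar>B t x\<bar> \<le> KB"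
      using B_bounded[OF T] by blast
    obtain K where K: "0 \<le> K" "\<And>t x. t \<in> {0..T} \<Longrightarrow> x \<in> {a..b} \<Longrightarrow> \<bar>c t x\<bar> \<le> K"
      "\<And>s t x. s \<in> {0..T} \<Longrightarrow> t \<in> {0..T} \<Longrightarrow> x \<in> {a..b} \<Longrightarrow> \<bar>c s x - c t x\<bar> \<le> K * \<bar>s - t\<bar>"
      using time_Lip_D[OF time_Lip_c T] by metis
    have LCg: "time_Lip a b (\<lambda>t x. - c_dot t x * Z t x)" by (intro time_Lip_mult time_Lip_uminus time_Lip_c_dot time_Lip_Z)
    obtain H where H: "\<And>s t x. s \<in> {0..T} \<Longrightarrow> t \<in> {0..T} \<Longrightarrow> x \<in> {a..b} \<Longrightarrow>
        \<bar>- c_dot s x * Z s x - - c_dot t x * Z t x\<bar> \<le> H * \<bar>s - t\<bar>"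
      using time_Lip_D[OF LCg T] by metis
    have "\<bar>A s x - A t x\<bar> \<le> S * (K * KB + H) * \<bar>s - t\<bar> \<and> \<bar>B s x - B t x\<bar> \<le> S * (K * KB + H) * \<bar>s - t\<bar>"
      if s: "s \<in> {0..T}" and t: "t \<in> {0..T}" and x: "x \<in> {a..b}" for s t x
    proof -
      have st: "0 \<le> s" "0 \<le> t" using s t by auto
      let ?y = "\<lambda>x. A s x - A t x" and ?P = "\<lambda>x. B s x - B t x"
      let ?g = "\<lambda>x. (- c_dot s x * Z s x - - c_dot t x * Z t x) - (c s x - c t x) * B t x"
      have bc: "?y a = 0" "?y b = 0" using st A_bc by auto
      have d1: "(?y has_real_derivative ?g x - m x / (q s x * q s x) * ?P x) (at x within {a..b})" if x: "x \<in> {a..b}" for x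
        by (rule DERIV_cong[OF DERIV_diff[OF A_deriv[OF st(1) x] A_deriv[OF st(2) x]]])
           (unfold c_eq[of s, symmetric], simp add: algebra_simps)
      have d2: "(?P has_real_derivative - (m x / \<alpha>) * ?y x) (at x within {a..b})" if x: "x \<in> {a..b}" for x
        by (rule DERIV_cong[OF DERIV_diff[OF B_deriv[OF st(1) x] B_deriv[OF st(2) x]]])
           (simp add: algebra_simps)
      have g: "\<bar>?g x\<bar> \<le> (K * KB + H) * \<bar>s - t\<bar>" if x: "x \<in> {a..b}" for x
      proof -
        have "\<bar>(c s x - c t x) * B t x\<bar> \<le> (K * \<bar>s - t\<bar>) * KB"
          unfolding abs_mult using K(1) K(3)[OF s t x] KB[OF t x] by (intro mult_mono) auto
        then have "\<bar>?g x\<bar> \<le> H * \<bar>s - t\<bar> + (K * \<bar>s - t\<bar>) * KB"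
          using H[OF s t x] by linarith
        then show ?thesis by (simp add: algebra_simps)
      qed
      show ?thesis
        using stability_boundD[OF S s s bc d1 d2 g x] by (simp add: mult.assoc)
    qed
    then show ?thesis by blast
  qed
  note * = this
  obtain C where C: "\<And>x. x \<in> {a..b} \<Longrightarrow> \<bar>A 0 x\<bar> \<le> C"
    using compact_bound[OF DERIV_continuous_on[OF A_deriv[OF order_refl]]] by blast
  obtain D where D: "\<And>x. x \<in> {a..b} \<Longrightarrow> \<bar>B 0 x\<bar> \<le> D"
    using compact_bound[OF DERIV_continuous_on[OF B_deriv[OF order_refl]]] by blast
  show "time_Lip a b A" by (rule time_Lip_I[where f = A and C = C]) (use * C in blast)+
  show "time_Lip a b B" by (rule time_Lip_I[where f = B and C = D]) (use * D in blast)+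
qed

end

context igr_flow
begin

text \<open>The linear problem is solved for \<open>V - u0\<close>, which has zero boundary values.\<close>

lemma velocity_exists: "\<exists>V R. igr_velocity a b \<alpha> m u0 u1 c0 M U L \<Phi> p V R"
proof -
  have "\<exists>V R. V a = 0 \<and> V b = 0 \<and> (\<forall>x\<in>{a..b}. (V has_real_derivative - (m x / (q t x * q t x)) * (R x - m x * u1 x)) (at x within {a..b}) \<and>
      (R has_real_derivative - (m x / \<alpha>) * (V x - u0 x)) (at x within {a..b}))" if t: "0 \<le> t" for t
  proof -
    have qn: "q t x \<noteq> 0" if "x \<in> {a..b}" for x using flow(3)[OF t that] by simp
    have "\<exists>y P. y a = 0 \<and> y b = 0 \<and> (\<forall>x\<in>{a..b}. (y has_real_derivative
        (m x / (q t x * q t x) * (m x * u1 x) - u1 x) - m x / (q t x * q t x) * P x) (at x within {a..b}) \<and>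
        (P has_real_derivative - (m x / \<alpha>) * y x) (at x within {a..b}))"
      by (rule linear_bvp[OF ab])
         (use m_pos flow(3)[OF t] \<alpha> qn in \<open>auto intro!: continuous_intros cont_q[OF t] cont_m cont_u1\<close>)
    then obtain y P where y: "y a = 0" "y b = 0"
      "\<And>x. x \<in> {a..b} \<Longrightarrow> (y has_real_derivative (m x / (q t x * q t x) * (m x * u1 x) - u1 x) - m x / (q t x * q t x) * P x) (at x within {a..b})"
      "\<And>x. x \<in> {a..b} \<Longrightarrow> (P has_real_derivative - (m x / \<alpha>) * y x) (at x within {a..b})" by blast
    show ?thesis
    proof (intro exI conjI ballI)
      fix x assume x: "x \<in> {a..b}"
      show "((\<lambda>x. y x + u0 x) has_real_derivative - (m x / (q t x * q t x)) * (P x - m x * u1 x)) (at x within {a..b})"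
        by (rule DERIV_cong[OF DERIV_add[OF y(3)[OF x] u0_deriv[OF x]]]) (rule igr_rearrange(2)[symmetric])
      show "(P has_real_derivative - (m x / \<alpha>) * (y x + u0 x - u0 x)) (at x within {a..b})" using y(4)[OF x] by simp
    qed (use y u0_bc in auto)
  qed
  then obtain V R where "\<And>t. 0 \<le> t \<Longrightarrow> V t a = 0 \<and> V t b = 0 \<and> (\<forall>x\<in>{a..b}. (V t has_real_derivative - (m x / (q t x * q t x)) * (R t x - m x * u1 x)) (at x within {a..b}) \<and>
      (R t has_real_derivative - (m x / \<alpha>) * (V t x - u0 x)) (at x within {a..b}))" by metis
  then have "igr_velocity a b \<alpha> m u0 u1 c0 M U L \<Phi> p V R" by unfold_locales auto
  then show ?thesis by blast
qed

end

context igr_velocity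
begin

lemma cont_R: "0 \<le> t \<Longrightarrow> continuous_on {a..b} (R t)"
  by (rule DERIV_continuous_on[OF R_deriv])

lemma acceleration_exists: "\<exists>A B. igr_acceleration a b \<alpha> m u0 u1 c0 M U L \<Phi> p V R A B"
proof -
  have "\<exists>A B. A a = 0 \<and> A b = 0 \<and> (\<forall>x\<in>{a..b}. (A has_real_derivative - c_dot t x * Z t x - c t x * B x) (at x within {a..b}) \<and>
      (B has_real_derivative - (m x / \<alpha>) * A x) (at x within {a..b}))" if t: "0 \<le> t" for t
  proof -
    have qn: "q t x \<noteq> 0" if "x \<in> {a..b}" for x using flow(3)[OF t that] by simp
    have qp: "0 < c t x" if "x \<in> {a..b}" for x unfolding c_eq using flow(3)[OF t that] m_pos[OF that] by simp
    have "continuous_on {a..b} (\<lambda>x. - c_dot t x * Z t x)" "continuous_on {a..b} (c t)"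
      unfolding c_dot_def Z_def c_def[abs_def] using qn
      by (auto intro!: continuous_intros cont_q[OF t] cont_m cont_u1 cont_R[OF t])
    then show ?thesis
      by (intro linear_bvp[OF ab]) (use m_pos qp \<alpha> in \<open>auto intro!: continuous_intros cont_m\<close>)
  qed
  then obtain A B where "\<And>t. 0 \<le> t \<Longrightarrow> A t a = 0 \<and> A t b = 0 \<and> (\<forall>x\<in>{a..b}. (A t has_real_derivative - c_dot t x * Z t x - c t x * B t x) (at x within {a..b}) \<and>
      (B t has_real_derivative - (m x / \<alpha>) * A t x) (at x within {a..b}))" by metis
  then have "igr_acceleration a b \<alpha> m u0 u1 c0 M U L \<Phi> p V R A B" by unfold_locales auto
  then show ?thesis by blast
qed

end

section \<open>Test functions\<close>

text \<open>Smoothness graded by a recursion on the function rather than on iterated derivatives, so that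
closure properties follow by induction.\<close>

primrec times_differentiable :: "nat \<Rightarrow> (real \<Rightarrow> real) \<Rightarrow> bool" where
  "times_differentiable 0 f = True"
| "times_differentiable (Suc n) f = ((\<forall>x. f field_differentiable (at x)) \<and> times_differentiable n (deriv f))"

definition smooth :: "(real \<Rightarrow> real) \<Rightarrow> bool" where
  "smooth f \<longleftrightarrow> (\<forall>n x. (deriv ^^ n) f field_differentiable (at x))"

lemma smooth_iff: "smooth f \<longleftrightarrow> (\<forall>n. times_differentiable n f)"
proof -
  have "times_differentiable n f \<longleftrightarrow> (\<forall>k<n. \<forall>x. (deriv ^^ k) f field_differentiable (at x))" for n
  proof (induction n arbitrary: f)
    case (Suc n)
    have "(\<forall>k<Suc n. \<forall>x. (deriv ^^ k) f field_differentiable (at x)) \<longleftrightarrow>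
      (\<forall>x. f field_differentiable (at x)) \<and> (\<forall>k<n. \<forall>x. (deriv ^^ k) (deriv f) field_differentiable (at x))"
      unfolding All_less_Suc2 by (simp add: funpow_swap1)
    then show ?case by (simp add: Suc.IH)
  qed simp
  then show ?thesis unfolding smooth_def by (meson lessI)
qed

lemma times_differentiable_mono: "times_differentiable (Suc n) f \<Longrightarrow> times_differentiable n f"
  by (induction n arbitrary: f) auto

lemma times_differentiable_add:
  "times_differentiable n f \<Longrightarrow> times_differentiable n g \<Longrightarrow> times_differentiable n (\<lambda>x. f x + g x)"
proof (induction n arbitrary: f g)
  case (Suc n)
  then have "deriv (\<lambda>x. f x + g x) = (\<lambda>x. deriv f x + deriv g x)" by (auto intro!: ext deriv_add)
  then show ?case using Suc by (auto intro: field_differentiable_add)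
qed simp

lemma times_differentiable_mult:
  "times_differentiable n f \<Longrightarrow> times_differentiable n g \<Longrightarrow> times_differentiable n (\<lambda>x. f x * g x)"
proof (induction n arbitrary: f g)
  case (Suc n)
  then have "deriv (\<lambda>x. f x * g x) = (\<lambda>x. f x * deriv g x + deriv f x * g x)" by (auto intro!: ext deriv_mult)
  moreover have "times_differentiable n f" "times_differentiable n g"
    using Suc.prems times_differentiable_mono by blast+
  ultimately show ?case using Suc
    by (auto intro!: field_differentiable_mult times_differentiable_add Suc.IH)
qed simp

lemma smooth_const: "smooth (\<lambda>x. c)"
proof -
  have "(deriv ^^ n) (\<lambda>x. c) = (\<lambda>x. if n = 0 then c else 0)" for n :: nat by (induction n) auto
  then show ?thesis unfolding smooth_def by simp
qed

lemma smooth_add: "smooth f \<Longrightarrow> smooth g \<Longrightarrow> smooth (\<lambda>x. f x + g x)"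
  by (simp add: smooth_iff times_differentiable_add)

lemma smooth_mult: "smooth f \<Longrightarrow> smooth g \<Longrightarrow> smooth (\<lambda>x. f x * g x)"
  by (simp add: smooth_iff times_differentiable_mult)

lemma smooth_diff: "smooth f \<Longrightarrow> smooth g \<Longrightarrow> smooth (\<lambda>x. f x - g x)"
  using smooth_add[OF _ smooth_mult[OF smooth_const[of "-1"]], of f g] by simp

lemma smooth_power: "smooth f \<Longrightarrow> smooth (\<lambda>x. f x ^ n)"
  by (induction n) (auto intro: smooth_const smooth_mult)

lemma smooth_affine:
  assumes "smooth f"
  shows "smooth (\<lambda>x. f (k * x + c))"
proof -
  have "times_differentiable n f \<Longrightarrow> times_differentiable n (\<lambda>x. f (k * x + c))" for n
  proof (induction n arbitrary: f)
    case (Suc n)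
    have d: "((\<lambda>x. f (k * x + c)) has_real_derivative deriv f (k * x + c) * k) (at x)" for x
      using Suc.prems by (intro DERIV_chain2[where g = "\<lambda>x. k * x + c"])
        (auto intro!: derivative_eq_intros simp: field_differentiable_derivI)
    then have "deriv (\<lambda>x. f (k * x + c)) = (\<lambda>x. deriv f (k * x + c) * k)" by (auto intro!: ext DERIV_imp_deriv)
    moreover have "times_differentiable n (\<lambda>x. deriv f (k * x + c) * k)"
      using Suc smooth_const[of k] by (intro times_differentiable_mult) (auto simp: smooth_iff)
    ultimately show ?case using d by (auto simp: field_differentiable_def)
  qed simp
  then show ?thesis using assms by (simp add: smooth_iff)
qed

text \<open>The factor \<open>y ^ k\<close> makes the induction on the polynomial work.\<close>

lemma poly_div_exp_at_top:
  fixes P :: "real poly"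
  shows "((\<lambda>y. y ^ k * poly P y / exp y) \<longlongrightarrow> 0) at_top"
proof (induction P arbitrary: k)
  case (pCons a P)
  have "((\<lambda>y. a * (y ^ k / exp y) + y ^ Suc k * poly P y / exp y) \<longlongrightarrow> a * 0 + 0) at_top"
    by (intro tendsto_intros tendsto_power_div_exp_0 pCons.IH)
  then show ?case by (simp add: algebra_simps add_divide_distrib)
qed simp

text \<open>The functions \<open>P(1/x) exp(-1/x)\<close>, continued by \<open>0\<close>: a family closed under differentiation that
contains the standard flat function.\<close>

definition flat_exp :: "real poly \<Rightarrow> real \<Rightarrow> real" where
  "flat_exp P x = (if 0 < x then poly P (1 / x) * exp (- (1 / x)) else 0)"

lemma flat_exp_deriv:
  "(flat_exp P has_real_derivative flat_exp ([:0, 0, 1:] * (P - pderiv P)) x) (at x)"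
proof -
  consider "x < 0" | "0 < x" | "x = 0" by linarith
  then show ?thesis
  proof cases
    case 1
    have "((\<lambda>_. 0) has_real_derivative 0) (at x)" by simp
    then have "(flat_exp P has_real_derivative 0) (at x)"
      by (rule has_field_derivative_transform_within_open[of _ _ _ "{..<0}"])
         (use 1 in \<open>auto simp: flat_exp_def\<close>)
    then show ?thesis using 1 by (simp add: flat_exp_def)
  next
    case 2
    have "((\<lambda>x. poly P (1 / x)) has_real_derivative poly (pderiv P) (1 / x) * (- (1 / x^2))) (at x)"
      by (rule DERIV_chain2[OF poly_DERIV])
         (use 2 in \<open>auto intro!: derivative_eq_intros simp: power2_eq_square\<close>)
    moreover have "((\<lambda>x. exp (- (1 / x))) has_real_derivative exp (- (1 / x)) * (1 / x^2)) (at x)"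
      by (rule derivative_eq_intros refl | use 2 in \<open>simp add: power2_eq_square\<close>)+
    ultimately have "((\<lambda>x. poly P (1 / x) * exp (- (1 / x))) has_real_derivative
        (poly (pderiv P) (1 / x) * (- (1 / x^2))) * exp (- (1 / x)) + exp (- (1 / x)) * (1 / x^2) * poly P (1 / x)) (at x)"
      by (rule DERIV_mult)
    then have "(flat_exp P has_real_derivative
        (poly (pderiv P) (1 / x) * (- (1 / x^2))) * exp (- (1 / x)) + exp (- (1 / x)) * (1 / x^2) * poly P (1 / x)) (at x)"
      by (rule has_field_derivative_transform_within_open[of _ _ _ "{0<..}"])
         (use 2 in \<open>auto simp: flat_exp_def\<close>)
    then show ?thesis
      by (rule DERIV_cong) (use 2 in \<open>simp add: flat_exp_def power2_eq_square algebra_simps\<close>)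
  next
    case 3
    have "((\<lambda>h. flat_exp P h / h) \<longlongrightarrow> 0) (at_right 0)"
    proof -
      have "((\<lambda>h. (1/h) ^ 1 * poly P (1/h) / exp (1/h)) \<longlongrightarrow> 0) (at_right 0)"
        using filterlim_compose[OF poly_div_exp_at_top[of 1 P] filterlim_inverse_at_top_right]
        by (simp add: inverse_eq_divide)
      moreover have "\<forall>\<^sub>F h in at_right 0. (1/h) ^ 1 * poly P (1/h) / exp (1/h) = flat_exp P h / h"
        unfolding eventually_at_right_field
        by (intro exI[of _ 1]) (auto simp: flat_exp_def exp_minus divide_inverse)
      ultimately show ?thesis by (rule Lim_transform_eventually)
    qed
    moreover have "((\<lambda>h. flat_exp P h / h) \<longlongrightarrow> 0) (at_left 0)"
    proof (rule Lim_transform_eventually[OF tendsto_const])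
      show "\<forall>\<^sub>F h in at_left 0. 0 = flat_exp P h / h"
        unfolding eventually_at_left_field by (intro exI[of _ "-1"]) (auto simp: flat_exp_def)
    qed
    ultimately have "((\<lambda>h. flat_exp P h / h) \<longlongrightarrow> 0) (at 0)" by (simp add: filterlim_split_at)
    then show ?thesis using 3 by (simp add: has_field_derivative_iff flat_exp_def)
  qed
qed

lemma smooth_flat_exp: "smooth (flat_exp P)"
proof -
  have d: "deriv (flat_exp P) = flat_exp ([:0, 0, 1:] * (P - pderiv P))" for P
    by (intro ext DERIV_imp_deriv flat_exp_deriv)
  have "times_differentiable n (flat_exp P)" for n
    by (induction n arbitrary: P) (auto simp only: times_differentiable.simps d field_differentiable_def intro: flat_exp_deriv)
  then show ?thesis by (simp add: smooth_iff)
qed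

definition bump :: "real \<Rightarrow> real \<Rightarrow> real \<Rightarrow> real" where
  "bump c d x = flat_exp 1 (1 * x + - c) * flat_exp 1 (- 1 * x + d)"

lemma smooth_bump: "smooth (bump c d)"
  unfolding bump_def[abs_def] by (intro smooth_mult smooth_affine smooth_flat_exp)

lemma bump_pos: "c < x \<Longrightarrow> x < d \<Longrightarrow> 0 < bump c d x \<and> bump c d x < 1"
proof -
  assume x: "c < x" "x < d"
  have "exp (- (1 / (x - c))) * exp (- (1 / (d - x))) < 1 * 1"
    using x by (intro mult_strict_mono) auto
  then show ?thesis using x by (simp add: bump_def flat_exp_def)
qed

lemma bump_zero: "x \<notin> {c<..<d} \<Longrightarrow> bump c d x = 0"
  by (auto simp: bump_def flat_exp_def)

text \<open>The functions \<open>1 - (1 - B)\<^sup>n\<close> converge to the indicator of the set where \<open>B > 0\<close>,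
  which gives smooth approximations of an interval without any smooth step function.\<close>

definition plateau :: "real \<Rightarrow> real \<Rightarrow> nat \<Rightarrow> real \<Rightarrow> real" where
  "plateau c d n x = 1 - (1 - bump c d x) ^ n"

lemma smooth_plateau: "smooth (plateau c d n)"
  unfolding plateau_def[abs_def] by (intro smooth_diff smooth_power smooth_const smooth_bump)

lemma plateau_bounds: "0 \<le> plateau c d n x" "plateau c d n x \<le> indicator {c<..<d} x"
proof -
  have "0 \<le> (1 - bump c d x) ^ n \<and> (1 - bump c d x) ^ n \<le> 1"
    using bump_pos[of c x d] bump_zero[of x c d] by (cases "x \<in> {c<..<d}") (auto intro: power_le_one)
  then show "0 \<le> plateau c d n x" "plateau c d n x \<le> indicator {c<..<d} x"
    using bump_zero[of x c d] by (auto simp: plateau_def indicator_def)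
qed

lemma plateau_tendsto: "(\<lambda>n. plateau c d n x) \<longlonglongrightarrow> indicator {c<..<d} x"
proof (cases "x \<in> {c<..<d}")
  case True
  then have "(\<lambda>n. 1 - (1 - bump c d x) ^ n) \<longlonglongrightarrow> 1 - 0"
    using bump_pos[of c x d] by (intro tendsto_diff tendsto_const LIMSEQ_realpow_zero) auto
  then show ?thesis using True by (simp add: plateau_def)
qed (simp add: plateau_def bump_zero)

lemma test_function_iff:
  "test_function a b \<phi> \<longleftrightarrow> smooth \<phi> \<and> (\<exists>c d. a < c \<and> d < b \<and> (\<forall>x. x \<notin> {c..d} \<longrightarrow> \<phi> x = 0))"
  by (simp add: test_function_def smooth_def)

lemma test_function_plateau: "a < c \<Longrightarrow> d < b \<Longrightarrow> test_function a b (plateau c d n)"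
  unfolding test_function_iff using smooth_plateau
  by (intro conjI exI[of _ c] exI[of _ d]) (auto simp: plateau_def bump_zero)

lemma test_function_add: 
  assumes "test_function a b f" "test_function a b g"
  shows "test_function a b (\<lambda>x. f x + g x)"
proof -
  obtain c d c' d' where "a < c" "d < b" "\<forall>x. x \<notin> {c..d} \<longrightarrow> f x = 0" "a < c'" "d' < b" "\<forall>x. x \<notin> {c'..d'} \<longrightarrow> g x = 0"
    using assms unfolding test_function_iff by metis
  then have "\<exists>c d. a < c \<and> d < b \<and> (\<forall>x. x \<notin> {c..d} \<longrightarrow> f x + g x = 0)"
    by (intro exI[of _ "min c c'"] exI[of _ "max d d'"] conjI allI impI) (auto simp: min_def max_def split: if_splits)
  then show ?thesis using assms by (auto simp: test_function_iff intro: smooth_add)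
qed

lemma test_function_cmult: "test_function a b f \<Longrightarrow> test_function a b (\<lambda>x. k * f x)"
  unfolding test_function_iff by (auto intro!: smooth_mult smooth_const)

lemma smooth_has_deriv: "smooth f \<Longrightarrow> (f has_real_derivative deriv f x) (at x)"
  unfolding smooth_def by (metis field_differentiable_derivI funpow_0)

lemma smooth_deriv: "smooth f \<Longrightarrow> smooth (deriv f)"
  unfolding smooth_def by (metis funpow_swap1 funpow.simps(2) comp_apply)

lemma smooth_continuous: "smooth f \<Longrightarrow> continuous_on S f"
  by (meson smooth_has_deriv DERIV_isCont continuous_at_imp_continuous_on)

lemma test_function_deriv:
  assumes "test_function a b f"
  shows "test_function a b (deriv f)"
proof -
  obtain c d where cd: "a < c" "d < b" "\<And>x. x \<notin> {c..d} \<Longrightarrow> f x = 0" and s: "smooth f"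
    using assms unfolding test_function_iff by blast
  have "deriv f x = 0" if "x \<notin> {c..d}" for x
  proof (rule DERIV_imp_deriv)
    have "((\<lambda>_. 0) has_real_derivative 0) (at x)" by simp
    then show "(f has_real_derivative 0) (at x)"
      by (rule has_field_derivative_transform_within_open[of _ _ _ "- {c..d}"])
         (use that cd in \<open>auto\<close>)
  qed
  then show ?thesis using cd smooth_deriv[OF s] by (auto simp: test_function_iff)
qed

lemma test_function_deriv_n: "test_function a b f \<Longrightarrow> test_function a b ((deriv ^^ n) f)"
  by (induction n) (auto intro: test_function_deriv)

lemma test_function_of_deriv:
  assumes d: "\<And>x. (\<phi> has_real_derivative \<psi> x) (at x)" and s: "smooth \<psi>"
    and supp: "a < c" "d < b" "\<And>x. x \<notin> {c..d} \<Longrightarrow> \<phi> x = 0"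
  shows "test_function a b \<phi>"
proof -
  have "deriv \<phi> = \<psi>" by (intro ext DERIV_imp_deriv d)
  then have "times_differentiable n \<phi>" for n
    using s d by (cases n) (auto simp: smooth_iff field_differentiable_def)
  then show ?thesis using supp by (auto simp: test_function_iff smooth_iff)
qed

section \<open>The fundamental lemma of the calculus of variations\<close>

lemma emeasure_density_tail:
  fixes g :: "real \<Rightarrow> real"
  assumes g: "integrable lborel g"
  shows "emeasure (density lborel (\<lambda>y. ennreal (g y))) {x<..} = ennreal (\<integral>y. max 0 (indicator {x<..} y * g y) \<partial>lborel)"
proof -
    have [measurable]: "g \<in> borel_measurable borel" using g by (simp add: borel_measurable_integrable)
    have i: "integrable lborel (\<lambda>y. indicator {x<..} y * g y)"
      using integrable_mult_indicator[of "{x<..}" lborel g] g by simp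
    have "emeasure (density lborel (\<lambda>y. ennreal (g y))) {x<..} = (\<integral>\<^sup>+y. ennreal (g y) * indicator {x<..} y \<partial>lborel)"
      by (intro emeasure_density) auto
    also have "\<dots> = (\<integral>\<^sup>+y. ennreal (max 0 (indicator {x<..} y * g y)) \<partial>lborel)"
      by (intro nn_integral_cong) (auto simp: indicator_def max_def ennreal_neg)
    also have "\<dots> = ennreal (\<integral>y. max 0 (indicator {x<..} y * g y) \<partial>lborel)"
      by (intro nn_integral_eq_integral integrable_max i) auto
    finally show ?thesis .
  qed

text \<open>The densities \<open>max 0 f\<close> and \<open>max 0 (- f)\<close> define measures that agree on all half-lines.\<close>

lemma integrable_zero_tails_imp_AE_zero:
  fixes f :: "real \<Rightarrow> real"
  assumes f: "integrable lborel f" and z: "\<And>x. (LINT y:{x<..}|lborel. f y) = 0"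
  shows "AE x in lborel. f x = 0"
proof -
  have [measurable]: "f \<in> borel_measurable borel" using f by (simp add: borel_measurable_integrable)
  note val = emeasure_density_tail
  have "density lborel (\<lambda>y. ennreal (f y)) = density lborel (\<lambda>y. ennreal (- f y))"
  proof (rule measure_eqI_lessThan)
    fix x
    show "emeasure (density lborel (\<lambda>y. ennreal (f y))) {x<..} < \<infinity>" by (simp add: val f)
    have i: "integrable lborel (\<lambda>y. indicator {x<..} y * f y)"
      using integrable_mult_indicator[of "{x<..}" lborel f] f by simp
    have "(\<integral>y. max 0 (indicator {x<..} y * f y) \<partial>lborel) - (\<integral>y. max 0 (- (indicator {x<..} y * f y)) \<partial>lborel)
       = (\<integral>y. max 0 (indicator {x<..} y * f y) - max 0 (- (indicator {x<..} y * f y)) \<partial>lborel)"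
      by (intro Bochner_Integration.integral_diff[symmetric] integrable_max i integrable_minus) auto
    also have "\<dots> = (\<integral>y. indicator {x<..} y * f y \<partial>lborel)"
      by (intro Bochner_Integration.integral_cong) auto
    also have "\<dots> = 0" using z[of x] by (simp add: set_lebesgue_integral_def)
    finally show "emeasure (density lborel (\<lambda>y. ennreal (f y))) {x<..} = emeasure (density lborel (\<lambda>y. ennreal (- f y))) {x<..}"
      using f by (simp add: val)
  qed simp_all
  then have "AE x in lborel. ennreal (f x) = ennreal (- f x)"
    by (subst (asm) sigma_finite_measure.density_unique_iff[OF sigma_finite_lborel]) auto
  then show ?thesis
  proof eventually_elim
    case (elim x)
    then show ?case by (cases "0 \<le> f x") (auto simp: ennreal_neg ennreal_eq_0_iff dest: sym)
  qed
qed

lemma locally_integrableD: "locally_integrable a b f \<Longrightarrow> a < c \<Longrightarrow> d < b \<Longrightarrow> set_integrable lborel {c..d} f"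
  by (simp add: locally_integrable_def)

lemma locally_integrable_mult_test:
  assumes f: "locally_integrable a b f" and \<phi>: "test_function a b \<phi>"
  shows "set_integrable lborel {a<..<b} (\<lambda>x. f x * \<phi> x)"
proof -
  obtain c d where cd: "a < c" "d < b" "\<And>x. x \<notin> {c..d} \<Longrightarrow> \<phi> x = 0" and s: "smooth \<phi>"
    using \<phi> unfolding test_function_iff by blast
  have c: "continuous_on UNIV \<phi>" by (rule smooth_continuous[OF s])
  obtain K where K: "\<And>x. x \<in> {c..d} \<Longrightarrow> \<bar>\<phi> x\<bar> \<le> K"
    using compact_imp_bounded[OF compact_continuous_image[OF continuous_on_subset[OF c] compact_Icc], of c d]
    unfolding bounded_iff by (metis image_eqI real_norm_def subset_UNIV)
  have [measurable]: "\<phi> \<in> borel_measurable borel" by (rule borel_measurable_continuous_onI[OF c])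
  have i: "integrable lborel (\<lambda>x. indicator {c..d} x * f x)"
    using locally_integrableD[OF f cd(1,2)] by (simp add: set_integrable_def)
  have m: "(\<lambda>x. indicator {c..d} x * f x) \<in> borel_measurable borel"
    using borel_measurable_integrable[OF i] by simp
  have "integrable lborel (\<lambda>x. (indicator {c..d} x * f x) * \<phi> x)"
  proof (rule Bochner_Integration.integrable_bound[of _ "\<lambda>x. \<bar>K\<bar> * (indicator {c..d} x * f x)"])
    show "integrable lborel (\<lambda>x. \<bar>K\<bar> * (indicator {c..d} x * f x))" using i by simp
    show "(\<lambda>x. (indicator {c..d} x * f x) * \<phi> x) \<in> borel_measurable lborel" using m by measurable
    show "AE x in lborel. norm ((indicator {c..d} x * f x) * \<phi> x) \<le> norm (\<bar>K\<bar> * (indicator {c..d} x * f x))"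
    proof (rule AE_I2)
      fix x
      show "norm ((indicator {c..d} x * f x) * \<phi> x) \<le> norm (\<bar>K\<bar> * (indicator {c..d} x * f x))"
        using K[of x] by (auto simp: indicator_def abs_mult mult.commute[of "\<bar>f x\<bar>"] intro!: mult_right_mono)
    qed
  qed
  moreover have "(\<lambda>x. (indicator {c..d} x * f x) * \<phi> x) = (\<lambda>x. indicator {a<..<b} x *\<^sub>R (f x * \<phi> x))"
    using cd by (auto simp: indicator_def fun_eq_iff)
  ultimately show ?thesis by (simp add: set_integrable_def)
qed

text \<open>Testing with \<open>plateau\<close> and dominated convergence give vanishing integrals over all subintervals,
hence equality of the measures with densities \<open>k\<^sup>+\<close> and \<open>k\<^sup>-\<close>.\<close>

lemma fundamental_lemma:
  assumes k: "locally_integrable a b k"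
    and z: "\<And>\<psi>. test_function a b \<psi> \<Longrightarrow> (LINT x:{a<..<b}|lborel. k x * \<psi> x) = 0"
  shows "AE x in lborel. x \<in> {a<..<b} \<longrightarrow> k x = 0"
proof (cases "a < b")
  case ab: True
  have int: "(LINT x:{c<..<d}|lborel. k x) = 0" if cd: "a < c" "d < b" for c d
  proof -
    have i: "integrable lborel (\<lambda>x. indicator {c..d} x * k x)"
      using locally_integrableD[OF k cd] by (simp add: set_integrable_def)
    have m: "(\<lambda>x. indicator {c..d} x * k x) \<in> borel_measurable borel"
      using borel_measurable_integrable[OF i] by simp
    have pm: "plateau c d n \<in> borel_measurable borel" for n
      by (rule borel_measurable_continuous_onI[OF smooth_continuous[OF smooth_plateau]])
    have "(\<lambda>n. \<integral>x. (indicator {c..d} x * k x) * plateau c d n x \<partial>lborel) \<longlonglongrightarrow>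
       (\<integral>x. (indicator {c..d} x * k x) * indicator {c<..<d} x \<partial>lborel)"
    proof (rule integral_dominated_convergence[where w = "\<lambda>x. \<bar>indicator {c..d} x * k x\<bar>"])
      show "AE x in lborel. (\<lambda>n. indicator {c..d} x * k x * plateau c d n x) \<longlonglongrightarrow> indicator {c..d} x * k x * indicator {c<..<d} x"
        by (intro AE_I2 tendsto_mult tendsto_const plateau_tendsto)
      show "AE x in lborel. norm (indicator {c..d} x * k x * plateau c d n x) \<le> \<bar>indicator {c..d} x * k x\<bar>" for n
      proof (rule AE_I2)
        fix x
        have "\<bar>plateau c d n x\<bar> \<le> 1"
          using plateau_bounds(1)[of c d n x] order_trans[OF plateau_bounds(2)[of c d n x] indicator_le_1] by simp
        then show "norm (indicator {c..d} x * k x * plateau c d n x) \<le> \<bar>indicator {c..d} x * k x\<bar>"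
          unfolding real_norm_def abs_mult by (metis abs_ge_zero mult_left_le mult_nonneg_nonneg)
      qed
    qed (use i m pm in auto)
    moreover have "(\<integral>x. (indicator {c..d} x * k x) * plateau c d n x \<partial>lborel) = 0" for n
    proof -
      have p0: "plateau c d n x = 0" if "x \<notin> {c<..<d}" for x
        using plateau_bounds[of c d n x] that by simp
      have "(\<integral>x. (indicator {c..d} x * k x) * plateau c d n x \<partial>lborel) = (LINT x:{a<..<b}|lborel. k x * plateau c d n x)"
        unfolding set_lebesgue_integral_def
      proof (intro Bochner_Integration.integral_cong refl)
        fix x
        show "(indicator {c..d} x * k x) * plateau c d n x = indicator {a<..<b} x *\<^sub>R (k x * plateau c d n x)"
          using p0[of x] cd by (cases "x \<in> {c<..<d}") auto
      qed
      then show ?thesis using z[OF test_function_plateau[OF cd]] by simp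
    qed
    ultimately have "(\<integral>x. (indicator {c..d} x * k x) * indicator {c<..<d} x \<partial>lborel) = 0"
      by (simp add: LIMSEQ_const_iff)
    moreover have "(\<integral>x. (indicator {c..d} x * k x) * indicator {c<..<d} x \<partial>lborel) = (LINT x:{c<..<d}|lborel. k x)"
      unfolding set_lebesgue_integral_def by (intro Bochner_Integration.integral_cong) (auto simp: indicator_def)
    ultimately show ?thesis by simp
  qed
  have loc: "AE x in lborel. x \<in> {c..d} \<longrightarrow> k x = 0" if cd: "a < c" "d < b" for c d
  proof -
    have "AE x in lborel. indicator {c..d} x * k x = 0"
    proof (rule integrable_zero_tails_imp_AE_zero)
      show "integrable lborel (\<lambda>x. indicator {c..d} x * k x)"
        using locally_integrableD[OF k cd] by (simp add: set_integrable_def)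
      fix x
      have "(LINT y:{x<..}|lborel. indicator {c..d} y * k y) = (LINT y:{max c x<..<d}|lborel. k y)"
        unfolding set_lebesgue_integral_def
      proof (rule integral_cong_AE)
        show "AE y in lborel. indicator {x<..} y *\<^sub>R (indicator {c..d} y * k y) = indicator {max c x<..<d} y *\<^sub>R k y"
          using AE_lborel_singleton[of c] AE_lborel_singleton[of d]
          by eventually_elim (auto simp: indicator_def)
        have m: "(\<lambda>x. indicator {c..d} x * k x) \<in> borel_measurable borel"
          using borel_measurable_integrable[OF locally_integrableD[OF k cd, unfolded set_integrable_def]] by simp
        then show "(\<lambda>y. indicator {x<..} y *\<^sub>R (indicator {c..d} y * k y)) \<in> borel_measurable lborel" by simp
        have "(\<lambda>y. indicator {max c x<..<d} y *\<^sub>R k y) = (\<lambda>y. indicator {max c x<..<d} y * (indicator {c..d} y * k y))"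
          by (auto simp: indicator_def fun_eq_iff)
        then show "(\<lambda>y. indicator {max c x<..<d} y *\<^sub>R k y) \<in> borel_measurable lborel" using m by simp
      qed
      also have "\<dots> = 0" by (rule int) (use cd in auto)
      finally show "(LINT y:{x<..}|lborel. indicator {c..d} y * k y) = 0" .
    qed
    then show ?thesis by eventually_elim auto
  qed
  define \<delta> where "\<delta> n = (b - a) / (real n + 3)" for n
  have "AE x in lborel. \<forall>n. x \<in> {a + \<delta> n..b - \<delta> n} \<longrightarrow> k x = 0"
    unfolding AE_all_countable by (intro allI loc) (use ab in \<open>auto simp: \<delta>_def\<close>)
  then show ?thesis
  proof eventually_elim
    case (elim x)
    show ?case
    proof
      assume x: "x \<in> {a<..<b}"
      have "\<delta> \<longlonglongrightarrow> 0" unfolding \<delta>_def by real_asymp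
      then have "\<forall>\<^sub>F n in sequentially. \<delta> n < min (x - a) (b - x)"
        using x by (intro order_tendstoD(2)) auto
      then obtain n where "\<delta> n < min (x - a) (b - x)" by (auto simp: eventually_sequentially)
      then show "k x = 0" using elim[rule_format, of n] by auto
    qed
  qed
qed auto

lemma integral_Ioo_Icc:
  fixes f :: "real \<Rightarrow> real"
  assumes "set_borel_measurable lborel {a..b} f"
  shows "(LINT x:{a<..<b}|lborel. f x) = (LINT x:{a..b}|lborel. f x)"
  unfolding set_lebesgue_integral_def
proof (rule integral_cong_AE)
  have ivl_sub: "{a<..<b} \<subseteq> {a..b}" by auto
  show "(\<lambda>x. indicator {a<..<b} x *\<^sub>R f x) \<in> borel_measurable lborel"
    using set_borel_measurable_subset[OF assms , of "{a<..<b}"] ivl_sub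
    by (simp add: set_borel_measurable_def)
  show "AE x in lborel. indicator {a<..<b} x *\<^sub>R f x = indicator {a..b} x *\<^sub>R f x"
    using AE_lborel_singleton[of a] AE_lborel_singleton[of b]
    by eventually_elim (auto simp: indicator_def)
qed (use assms in \<open>auto simp: set_borel_measurable_def\<close>)

section \<open>Primitives of integrable functions\<close>

text \<open>\<open>f\<close> is a primitive of the integrable function \<open>g\<close> on \<open>[a,b]\<close>, hence absolutely continuous. Lebesgue
integrability is combined with the gauge integral, whose rules for intervals are more convenient.\<close>

definition primitive :: "real \<Rightarrow> real \<Rightarrow> (real \<Rightarrow> real) \<Rightarrow> (real \<Rightarrow> real) \<Rightarrow> bool" where
  "primitive a b f g \<longleftrightarrow> set_integrable lborel {a..b} g \<and> (\<forall>x\<in>{a..b}. f x = f a + integral {a..x} g)"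

lemma primitiveD: "primitive a b f g \<Longrightarrow> x \<in> {a..b} \<Longrightarrow> f x = f a + integral {a..x} g"
  and primitive_set_integrable: "primitive a b f g \<Longrightarrow> set_integrable lborel {a..b} g"
  unfolding primitive_def by blast+

lemma primitiveI: "set_integrable lborel {a..b} g \<Longrightarrow> (\<And>x. x \<in> {a..b} \<Longrightarrow> f x = f a + integral {a..x} g) \<Longrightarrow> primitive a b f g"
  unfolding primitive_def by blast

lemma set_integrable_Icc_sub:
  "set_integrable lborel {a..b} g \<Longrightarrow> a \<le> x \<Longrightarrow> y \<le> b \<Longrightarrow> set_integrable lborel {x..y} (g :: real \<Rightarrow> real)"
  by (rule set_integrable_subset) auto

lemma set_integrable_continuous_mult:
  fixes u g :: "real \<Rightarrow> real"
  assumes g: "set_integrable lborel {a..b} g" and u: "continuous_on {a..b} u"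
  shows "set_integrable lborel {a..b} (\<lambda>x. g x * u x)"
proof -
  obtain K where K: "\<And>x. x \<in> {a..b} \<Longrightarrow> \<bar>u x\<bar> \<le> K"
    using compact_imp_bounded[OF compact_continuous_image[OF u compact_Icc]]
    unfolding bounded_iff by (metis image_eqI real_norm_def)
  have i: "integrable lborel (\<lambda>x. indicator {a..b} x * g x)" using g by (simp add: set_integrable_def)
  have m: "(\<lambda>x. indicator {a..b} x * u x) \<in> borel_measurable borel"
    using borel_measurable_continuous_on_indicator[OF _ u] by simp
  have "integrable lborel (\<lambda>x. (indicator {a..b} x * g x) * (indicator {a..b} x * u x))"
  proof (rule Bochner_Integration.integrable_bound[of _ "\<lambda>x. \<bar>K\<bar> * (indicator {a..b} x * g x)"])
    show "integrable lborel (\<lambda>x. \<bar>K\<bar> * (indicator {a..b} x * g x))" using i by simp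
    show "AE x in lborel. norm (indicator {a..b} x * g x * (indicator {a..b} x * u x)) \<le> norm (\<bar>K\<bar> * (indicator {a..b} x * g x))"
    proof (rule AE_I2)
      fix x
      show "norm (indicator {a..b} x * g x * (indicator {a..b} x * u x)) \<le> norm (\<bar>K\<bar> * (indicator {a..b} x * g x))"
        using K[of x] by (auto simp: indicator_def abs_mult mult.commute[of "\<bar>g x\<bar>"] intro!: mult_right_mono)
    qed
  qed (use borel_measurable_integrable[OF i] m in auto)
  moreover have "(\<lambda>x. (indicator {a..b} x * g x) * (indicator {a..b} x * u x)) = (\<lambda>x. indicator {a..b} x *\<^sub>R (g x * u x))"
    by (auto simp: indicator_def fun_eq_iff)
  ultimately show ?thesis by (simp add: set_integrable_def)
qed

lemma primitive_integrable:
  assumes "primitive a b f g" "a \<le> x" "y \<le> b"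
  shows "g integrable_on {x..y}" "(\<lambda>s. \<bar>g s\<bar>) integrable_on {x..y}"
  using set_borel_integral_eq_integral(1)[OF set_integrable_Icc_sub[of a b g x y]]
    set_borel_integral_eq_integral(1)[OF set_integrable_Icc_sub[OF set_integrable_abs, of a b g x y]] primitive_set_integrable[OF assms(1)] assms(2,3)
  by auto

lemma primitive_increment:
  assumes "primitive a b f g" "a \<le> x" "x \<le> y" "y \<le> b"
  shows "f y - f x = integral {x..y} g"
proof -
  have "integral {a..x} g + integral {x..y} g = integral {a..y} g"
    using assms by (intro Henstock_Kurzweil_Integration.integral_combine primitive_integrable[OF assms(1)]) auto
  moreover have "f y = f a + integral {a..y} g" "f x = f a + integral {a..x} g"
    using assms(2-4) by (intro primitiveD[OF assms(1)]; simp)+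
  ultimately show ?thesis by linarith
qed

lemma primitive_continuous: "primitive a b f g \<Longrightarrow> continuous_on {a..b} f"
proof -
  assume p: "primitive a b f g"
  have "continuous_on {a..b} (\<lambda>x. f a + integral {a..x} g)"
    by (intro continuous_intros indefinite_integral_continuous_1 primitive_integrable[OF p]) auto
  then show ?thesis by (rule continuous_on_cong[THEN iffD1, rotated 2]) (use primitiveD[OF p] in metis)+
qed

lemma primitive_abs_diff:
  assumes "primitive a b f g" "a \<le> x" "x \<le> y" "y \<le> b"
  shows "\<bar>f y - f x\<bar> \<le> integral {x..y} (\<lambda>s. \<bar>g s\<bar>)"
  unfolding primitive_increment[OF assms]
  using Henstock_Kurzweil_Integration.integral_norm_bound_integral[OF primitive_integrable(1)[OF assms(1,2,4)] primitive_integrable(2)[OF assms(1,2,4)]]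
  by simp

lemma primitive_lipschitz:
  assumes "primitive a b f g" "\<And>x. x \<in> {a..b} \<Longrightarrow> \<bar>g x\<bar> \<le> K" "a \<le> x" "x \<le> y" "y \<le> b"
  shows "\<bar>f y - f x\<bar> \<le> K * (y - x)"
proof -
  have "norm (integral {x..y} g) \<le> integral {x..y} (\<lambda>s. K)"
    by (intro Henstock_Kurzweil_Integration.integral_norm_bound_integral primitive_integrable(1)[OF assms(1)]) (use assms in auto)
  then show ?thesis using assms unfolding primitive_increment[OF assms(1,3-5)] by (simp add: mult.commute)
qed

lemma primitive_cong:
  assumes "primitive a b f g" "\<And>x. x \<in> {a..b} \<Longrightarrow> f x = f' x" "\<And>x. x \<in> {a..b} \<Longrightarrow> g x = g' x" 
  shows "primitive a b f' g'"
  unfolding primitive_def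
proof
  show "set_integrable lborel {a..b} g'"
    using assms(1,3) set_integrable_cong[of lborel lborel "{a..b}" "{a..b}" g g'] primitive_set_integrable by blast
  show "\<forall>x\<in>{a..b}. f' x = f' a + integral {a..x} g'"
  proof
    fix x assume x: "x \<in> {a..b}"
    have "integral {a..x} g' = integral {a..x} g"
      by (rule Henstock_Kurzweil_Integration.integral_cong) (use assms(3) x in auto)
    then show "f' x = f' a + integral {a..x} g'" using primitiveD[OF assms(1) x] x assms(2)[OF x] assms(2)[of a] by simp
  qed
qed

lemma primitive_of_deriv:
  assumes d: "\<And>x. x \<in> {a..b} \<Longrightarrow> (f has_real_derivative g x) (at x within {a..b})"
    and c: "continuous_on {a..b} g"
  shows "primitive a b f g"
  unfolding primitive_def
proof
  show "set_integrable lborel {a..b} g"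
    by (rule borel_integrable_compact[OF compact_Icc c, folded set_integrable_def])
  show "\<forall>x\<in>{a..b}. f x = f a + integral {a..x} g"
  proof
    fix x assume x: "x \<in> {a..b}"
    have "(g has_integral (f x - f a)) {a..x}"
    proof (rule fundamental_theorem_of_calculus)
      fix y assume y: "y \<in> {a..x}"
      have "(f has_real_derivative g y) (at y within {a..x})" by (rule DERIV_subset[OF d]) (use x y in auto)
      then show "(f has_vector_derivative g y) (at y within {a..x})" by (simp add: has_real_derivative_iff_has_vector_derivative)
    qed (use x in simp)
    then show "f x = f a + integral {a..x} g" by (simp add: integral_unique)
  qed
qed

lemma primitive_imp_deriv:
  assumes p: "primitive a b f g" and c: "continuous_on {a..b} g" and x: "x \<in> {a..b}"
  shows "(f has_real_derivative g x) (at x within {a..b})"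
proof -
  have "((\<lambda>u. f a + integral {a..u} g) has_real_derivative g x) (at x within {a..b})"
    using integral_has_vector_derivative[OF c x]
    by (auto simp: has_real_derivative_iff_has_vector_derivative intro!: derivative_eq_intros)
  then show ?thesis
    by (rule has_field_derivative_transform_within[where d = 1]) (use primitiveD[OF p, symmetric] x in auto)
qed

lemma primitive_add:
  assumes "primitive a b f g" "primitive a b u v"
  shows "primitive a b (\<lambda>x. f x + u x) (\<lambda>x. g x + v x)"
  unfolding primitive_def
proof
  show "set_integrable lborel {a..b} (\<lambda>x. g x + v x)"
    using assms by (intro set_integral_add primitive_set_integrable)
  show "\<forall>x\<in>{a..b}. f x + u x = f a + u a + integral {a..x} (\<lambda>x. g x + v x)"
  proof
    fix x assume x: "x \<in> {a..b}"
    have "integral {a..x} (\<lambda>x. g x + v x) = integral {a..x} g + integral {a..x} v"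
      by (intro Henstock_Kurzweil_Integration.integral_add primitive_integrable(1)[OF assms(1)] primitive_integrable(1)[OF assms(2)]) (use x in auto)
    then show "f x + u x = f a + u a + integral {a..x} (\<lambda>x. g x + v x)"
      using primitiveD[OF assms(1) x] primitiveD[OF assms(2) x] by linarith
  qed
qed

text \<open>An increment of superlinear order on every subinterval forces constancy. This replaces
  differentiation almost everywhere in the proofs of the product and quotient rules.\<close>

lemma constant_of_superlinear_increments:
  fixes h G :: "real \<Rightarrow> real"
  assumes inc: "\<And>x y. a \<le> x \<Longrightarrow> x \<le> y \<Longrightarrow> y \<le> b \<Longrightarrow> \<bar>h y - h x\<bar> \<le> (y - x) * \<bar>G y - G x\<bar>"
    and G: "continuous_on {a..b} G" and x: "x \<in> {a..b}"
  shows "h x = h a"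
proof -
  have "(h has_real_derivative 0) (at x within {a..b})" if x: "x \<in> {a..b}" for x
  proof -
    have "((\<lambda>y. (h y - h x) / (y - x)) \<longlongrightarrow> 0) (at x within {a..b})"
    proof (rule Lim_null_comparison)
      have "norm ((h y - h x) / (y - x)) \<le> \<bar>G y - G x\<bar>" if "y \<in> {a..b}" "y \<noteq> x" for y
      proof -
        have "\<bar>h y - h x\<bar> \<le> \<bar>y - x\<bar> * \<bar>G y - G x\<bar>"
          using inc[of x y] inc[of y x] that x by (cases "x \<le> y") (auto simp: abs_minus_commute)
        then show ?thesis using that by (simp add: abs_divide divide_le_eq mult.commute)
      qed
      then show "\<forall>\<^sub>F y in at x within {a..b}. norm ((h y - h x) / (y - x)) \<le> \<bar>G y - G x\<bar>"
        by (auto simp: eventually_at intro!: exI[of _ 1])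
      have "((\<lambda>y. \<bar>G y - G x\<bar>) \<longlongrightarrow> \<bar>G x - G x\<bar>) (at x within {a..b})"
        by (intro tendsto_intros) (use G x in \<open>auto simp: continuous_on_def\<close>)
      then show "((\<lambda>y. \<bar>G y - G x\<bar>) \<longlongrightarrow> 0) (at x within {a..b})" by simp
    qed
    then show ?thesis by (simp add: has_field_derivative_iff)
  qed
  then obtain c where "\<And>x. x \<in> {a..b} \<Longrightarrow> h x = c"
    using has_field_derivative_zero_constant[of "{a..b}" h] by (metis convex_closed_interval(1) convex_real_interval(5))
  then show ?thesis using x by auto
qed

text \<open>The increment over \<open>[x,y]\<close> of \<open>f u\<close> minus the integral of the expected derivative is the integral
of \<open>g (u(y) - u) + v (f(x) - f)\<close>. With \<open>v\<close> bounded, this is at most a constant times \<open>(y - x) \<integral> \<bar>g\<bar>\<close>, hence superlinear.\<close>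

lemma primitive_mult:
  assumes p: "primitive a b f g" "primitive a b u v" and v: "\<And>x. x \<in> {a..b} \<Longrightarrow> \<bar>v x\<bar> \<le> K"
  shows "primitive a b (\<lambda>x. f x * u x) (\<lambda>x. g x * u x + v x * f x)"
proof -
  have si: "set_integrable lborel {a..b} (\<lambda>x. g x * u x + v x * f x)"
    using p by (intro set_integral_add set_integrable_continuous_mult primitive_continuous) (auto dest: primitive_set_integrable)
  define I where "I x = integral {a..x} (\<lambda>x. g x * u x + v x * f x)" for x
  define h where "h x = f x * u x - I x" for x
  \<comment> \<open>The modulus in \<open>constant_of_superlinear_increments\<close>.\<close>
  define G where "G x = 2 * K * integral {a..x} (\<lambda>s. \<bar>g s\<bar>)" for x
  have gi: "(\<lambda>x. g x * u x + v x * f x) integrable_on {x..y}" if "a \<le> x" "y \<le> b" for x y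
    by (rule set_borel_integral_eq_integral(1)[OF set_integrable_Icc_sub[OF si that]])
  have "h x = h a" if "x \<in> {a..b}" for x
  proof (rule constant_of_superlinear_increments[OF _ _ that])
    show "continuous_on {a..b} G" unfolding G_def
      by (intro continuous_intros indefinite_integral_continuous_1 primitive_integrable(2)[OF p(1)]) auto
    fix x y assume xy: "a \<le> x" "x \<le> y" "y \<le> b"
    have K: "0 \<le> K" using v[of x] xy by (auto intro: order_trans[OF abs_ge_zero])
    let ?D = "integral {x..y} (\<lambda>s. \<bar>g s\<bar>)"
    have D0: "0 \<le> ?D" by (rule Henstock_Kurzweil_Integration.integral_nonneg[OF primitive_integrable(2)[OF p(1) xy(1,3)]]) auto
    have "integral {a..x} (\<lambda>s. \<bar>g s\<bar>) + ?D = integral {a..y} (\<lambda>s. \<bar>g s\<bar>)"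
      using xy by (intro Henstock_Kurzweil_Integration.integral_combine primitive_integrable(2)[OF p(1)]) auto
    then have GD: "\<bar>G y - G x\<bar> = 2 * K * ?D" using K D0 by (simp add: G_def flip: right_diff_distrib)
    have "I y - I x = integral {x..y} (\<lambda>x. g x * u x + v x * f x)"
      using Henstock_Kurzweil_Integration.integral_combine[OF xy(1,2) gi[of a y]] xy by (simp add: I_def)
    moreover have "f y * u y - f x * u x = integral {x..y} (\<lambda>s. g s * u y + v s * f x)"
    proof -
      have "f y * u y - f x * u x = (f y - f x) * u y + (u y - u x) * f x" by (simp add: algebra_simps)
      also have "\<dots> = integral {x..y} g * u y + integral {x..y} v * f x"
        unfolding primitive_increment[OF p(1) xy] primitive_increment[OF p(2) xy] by simp
      also have "\<dots> = integral {x..y} (\<lambda>s. g s * u y) + integral {x..y} (\<lambda>s. v s * f x)" by simp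
      also have "\<dots> = integral {x..y} (\<lambda>s. g s * u y + v s * f x)"
        by (intro Henstock_Kurzweil_Integration.integral_add[symmetric] integrable_on_mult_left
            primitive_integrable(1)[OF p(1) xy(1,3)] primitive_integrable(1)[OF p(2) xy(1,3)])
      finally show ?thesis .
    qed
    ultimately have "h y - h x = integral {x..y} (\<lambda>s. g s * u y + v s * f x) - integral {x..y} (\<lambda>x. g x * u x + v x * f x)"
      by (simp add: h_def)
    also have "\<dots> = integral {x..y} (\<lambda>s. (g s * u y + v s * f x) - (g s * u s + v s * f s))"
      by (intro Henstock_Kurzweil_Integration.integral_diff[symmetric] Henstock_Kurzweil_Integration.integrable_add
          integrable_on_mult_left gi primitive_integrable(1)[OF p(1) xy(1,3)] primitive_integrable(1)[OF p(2) xy(1,3)] xy)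
    finally have eq: "h y - h x = integral {x..y} (\<lambda>s. (g s * u y + v s * f x) - (g s * u s + v s * f s))" .
    have "norm (integral {x..y} (\<lambda>s. (g s * u y + v s * f x) - (g s * u s + v s * f s)))
      \<le> integral {x..y} (\<lambda>s. \<bar>g s\<bar> * (K * (y - x)) + K * ?D)"
    proof (rule Henstock_Kurzweil_Integration.integral_norm_bound_integral)
      show "(\<lambda>s. (g s * u y + v s * f x) - (g s * u s + v s * f s)) integrable_on {x..y}"
        by (intro Henstock_Kurzweil_Integration.integrable_diff Henstock_Kurzweil_Integration.integrable_add
          integrable_on_mult_left gi primitive_integrable(1)[OF p(1) xy(1,3)] primitive_integrable(1)[OF p(2) xy(1,3)] xy)
      show "(\<lambda>s. \<bar>g s\<bar> * (K * (y - x)) + K * ?D) integrable_on {x..y}"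
        by (intro Henstock_Kurzweil_Integration.integrable_add integrable_on_mult_left primitive_integrable(2)[OF p(1) xy(1,3)]) auto
      fix s assume s: "s \<in> {x..y}"
      have 1: "\<bar>u y - u s\<bar> \<le> K * (y - x)"
      proof -
        have "\<bar>u y - u s\<bar> \<le> K * (y - s)" by (rule primitive_lipschitz[OF p(2) v]) (use s xy in auto)
        also have "\<dots> \<le> K * (y - x)" using s K by (intro mult_left_mono) auto
        finally show ?thesis .
      qed
      have 2: "\<bar>f s - f x\<bar> \<le> ?D"
      proof -
        have "\<bar>f s - f x\<bar> \<le> integral {x..s} (\<lambda>s. \<bar>g s\<bar>)" by (rule primitive_abs_diff[OF p(1)]) (use s xy in auto)
        also have "\<dots> \<le> ?D"
          by (rule integral_subset_le) (use s xy in \<open>auto intro!: primitive_integrable(2)[OF p(1)]\<close>)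
        finally show ?thesis .
      qed
      have "(g s * u y + v s * f x) - (g s * u s + v s * f s) = g s * (u y - u s) + - (v s * (f s - f x))"
        by (simp add: algebra_simps)
      moreover have "\<bar>g s * (u y - u s)\<bar> \<le> \<bar>g s\<bar> * (K * (y - x))" unfolding abs_mult using 1 by (intro mult_left_mono) auto
      moreover have "\<bar>v s * (f s - f x)\<bar> \<le> K * ?D" unfolding abs_mult
        using 2 v[of s] s xy K by (intro mult_mono) auto
      ultimately show "norm ((g s * u y + v s * f x) - (g s * u s + v s * f s)) \<le> \<bar>g s\<bar> * (K * (y - x)) + K * ?D"
        by simp
    qed
    also have "\<dots> = ?D * (K * (y - x)) + K * ?D * (y - x)"
      using xy by (subst Henstock_Kurzweil_Integration.integral_add) (auto intro!: integrable_on_mult_left primitive_integrable(2)[OF p(1)])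
    also have "\<dots> = (y - x) * \<bar>G y - G x\<bar>" unfolding GD by simp
    finally show "\<bar>h y - h x\<bar> \<le> (y - x) * \<bar>G y - G x\<bar>" unfolding eq by simp
  qed
  then have "f x * u x = f a * u a + I x" if "x \<in> {a..b}" for x
    using that[THEN \<open>\<And>x. x \<in> {a..b} \<Longrightarrow> h x = h a\<close>] by (simp add: h_def I_def)
  then show ?thesis using si unfolding I_def by (intro primitiveI)
qed

text \<open>As for the product rule: \<open>1/f(y) - 1/f(x)\<close> is the integral of \<open>- g / (f(x) f(y))\<close>, and replacing
\<open>f(x) f(y)\<close> by \<open>f\<^sup>2\<close> costs \<open>O((y - x)\<^sup>2)\<close>.\<close>

lemma primitive_inverse:
  assumes p: "primitive a b f g" and g: "\<And>x. x \<in> {a..b} \<Longrightarrow> \<bar>g x\<bar> \<le> K"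
    and c: "0 < c" "\<And>x. x \<in> {a..b} \<Longrightarrow> c \<le> f x"
  shows "primitive a b (\<lambda>x. 1 / f x) (\<lambda>x. - (g x * (1 / f x * (1 / f x))))"
proof -
  have fpos: "0 < f x" if "x \<in> {a..b}" for x using c(2)[OF that] c(1) by linarith
  have fcont: "continuous_on {a..b} (\<lambda>x. 1 / f x * (1 / f x))"
    using fpos by (intro continuous_intros primitive_continuous[OF p]) force+
  have si': "set_integrable lborel {a..b} (\<lambda>x. g x * (1 / f x * (1 / f x)))"
    using p by (intro set_integrable_continuous_mult fcont primitive_set_integrable)
  have si: "set_integrable lborel {a..b} (\<lambda>x. - (g x * (1 / f x * (1 / f x))))"
    using set_integrable_mult_right[of "-1", OF si'] by simp
  obtain C where C: "\<And>x. x \<in> {a..b} \<Longrightarrow> \<bar>f x\<bar> \<le> C"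
    using compact_imp_bounded[OF compact_continuous_image[OF primitive_continuous[OF p] compact_Icc]]
    unfolding bounded_iff by (metis image_eqI real_norm_def)
  define I where "I x = integral {a..x} (\<lambda>x. - (g x * (1 / f x * (1 / f x))))" for x
  define h where "h x = 1 / f x - I x" for x
  have gi: "(\<lambda>x. - (g x * (1 / f x * (1 / f x)))) integrable_on {x..y}" if "a \<le> x" "y \<le> b" for x y
    by (rule set_borel_integral_eq_integral(1)[OF set_integrable_Icc_sub[OF si that]])
  define H where "H = K * (2 * K * C / (c * c * (c * c)))"
  have "h x = h a" if "x \<in> {a..b}" for x
  proof (rule constant_of_superlinear_increments[OF _ _ that, of _ "\<lambda>x. H * x"])
    show "continuous_on {a..b} (\<lambda>x. H * x)" by (intro continuous_intros)
    fix x y assume xy: "a \<le> x" "x \<le> y" "y \<le> b"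
    have K: "0 \<le> K" using g[of x] xy by (auto intro: order_trans[OF abs_ge_zero])
    have C0: "0 \<le> C" using C[of x] xy by (auto intro: order_trans[OF abs_ge_zero])
    have "I y - I x = integral {x..y} (\<lambda>x. - (g x * (1 / f x * (1 / f x))))"
      using Henstock_Kurzweil_Integration.integral_combine[OF xy(1,2) gi[of a y]] xy by (simp add: I_def)
    moreover have "1 / f y - 1 / f x = integral {x..y} (\<lambda>s. g s * (- (1 / f x * (1 / f y))))"
    proof -
      have "1 / f y - 1 / f x = (f y - f x) * (- (1 / f x * (1 / f y)))"
        using fpos[of x] fpos[of y] xy by (simp add: field_simps)
      also have "\<dots> = integral {x..y} (\<lambda>s. g s * (- (1 / f x * (1 / f y))))"
        unfolding primitive_increment[OF p xy] by (simp only: integral_mult_left)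
      finally show ?thesis .
    qed
    ultimately have "h y - h x = integral {x..y} (\<lambda>s. g s * (- (1 / f x * (1 / f y)))) - integral {x..y} (\<lambda>x. - (g x * (1 / f x * (1 / f x))))"
      by (simp add: h_def)
    also have "\<dots> = integral {x..y} (\<lambda>s. g s * (- (1 / f x * (1 / f y))) - - (g s * (1 / f s * (1 / f s))))"
      by (intro Henstock_Kurzweil_Integration.integral_diff[symmetric] integrable_on_mult_left gi primitive_integrable(1)[OF p xy(1,3)] xy)
    finally have eq: "h y - h x = integral {x..y} (\<lambda>s. g s * (- (1 / f x * (1 / f y))) - - (g s * (1 / f s * (1 / f s))))" .
    have "norm (integral {x..y} (\<lambda>s. g s * (- (1 / f x * (1 / f y))) - - (g s * (1 / f s * (1 / f s)))))
      \<le> integral {x..y} (\<lambda>s. H * (y - x))"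
    proof (rule Henstock_Kurzweil_Integration.integral_norm_bound_integral)
      show "(\<lambda>s. g s * (- (1 / f x * (1 / f y))) - - (g s * (1 / f s * (1 / f s)))) integrable_on {x..y}"
        by (intro Henstock_Kurzweil_Integration.integrable_diff integrable_on_mult_left gi primitive_integrable(1)[OF p xy(1,3)] xy)
      fix s assume s: "s \<in> {x..y}"
      have sx: "s \<in> {a..b}" "x \<in> {a..b}" "y \<in> {a..b}" using s xy by auto
      have l: "\<bar>f s - f x\<bar> \<le> K * (y - x)" "\<bar>f y - f s\<bar> \<le> K * (y - x)"
      proof -
        have "\<bar>f s - f x\<bar> \<le> K * (s - x)" "\<bar>f y - f s\<bar> \<le> K * (y - s)"
          by (rule primitive_lipschitz[OF p g]; use s xy in auto)+
        moreover have "K * (s - x) \<le> K * (y - x)" "K * (y - s) \<le> K * (y - x)"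
          using s K by (auto intro: mult_left_mono)
        ultimately show "\<bar>f s - f x\<bar> \<le> K * (y - x)" "\<bar>f y - f s\<bar> \<le> K * (y - x)" by linarith+
      qed
      have pos: "f s \<noteq> 0" "f x \<noteq> 0" "f y \<noteq> 0" using fpos sx by force+
      have "1 / f s * (1 / f s) - 1 / f x * (1 / f y) = (f x * f y - f s * f s) / ((f s * f s) * (f x * f y))"
        using pos by (simp add: divide_simps)
      also have "f x * f y - f s * f s = f s * (f y - f s) - (f s - f x) * f y" by (simp add: algebra_simps)
      finally have e: "1 / f s * (1 / f s) - 1 / f x * (1 / f y) = (f s * (f y - f s) - (f s - f x) * f y) / ((f s * f s) * (f x * f y))" .
      have n: "\<bar>f s * (f y - f s) - (f s - f x) * f y\<bar> \<le> C * (K * (y - x)) + (K * (y - x)) * C"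
      proof -
        have "\<bar>f s * (f y - f s)\<bar> \<le> C * (K * (y - x))" unfolding abs_mult using C[OF sx(1)] l C0 by (intro mult_mono) auto
        moreover have "\<bar>(f s - f x) * f y\<bar> \<le> (K * (y - x)) * C" unfolding abs_mult
          using C[OF sx(3)] l C0 K xy by (intro mult_mono) auto
        ultimately show ?thesis by linarith
      qed
      have "\<bar>1 / f s * (1 / f s) - 1 / f x * (1 / f y)\<bar> \<le> (C * (K * (y - x)) + (K * (y - x)) * C) / (c * c * (c * c))"
        unfolding e abs_divide
      proof (rule frac_le[OF _ n])
        have "c * c * (c * c) \<le> (f s * f s) * (f x * f y)"
          using c(1) c(2)[OF sx(1)] c(2)[OF sx(2)] c(2)[OF sx(3)] by (intro mult_mono mult_nonneg_nonneg) auto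
        then show "c * c * (c * c) \<le> \<bar>(f s * f s) * (f x * f y)\<bar>" by linarith
      qed (use c C0 K xy in auto)
      then have "\<bar>g s\<bar> * \<bar>1 / f s * (1 / f s) - 1 / f x * (1 / f y)\<bar> \<le> K * ((C * (K * (y - x)) + (K * (y - x)) * C) / (c * c * (c * c)))"
        using g[OF sx(1)] K by (intro mult_mono) auto
      also have "\<dots> = H * (y - x)" by (simp add: H_def algebra_simps)
      also have "\<bar>g s\<bar> * \<bar>1 / f s * (1 / f s) - 1 / f x * (1 / f y)\<bar> = norm (g s * (- (1 / f x * (1 / f y))) - - (g s * (1 / f s * (1 / f s))))"
        unfolding abs_mult[symmetric] real_norm_def by (simp add: algebra_simps)
      finally show "norm (g s * (- (1 / f x * (1 / f y))) - - (g s * (1 / f s * (1 / f s)))) \<le> H * (y - x)" .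
    qed auto
    also have "\<dots> = (y - x) * (H * y - H * x)" using xy by (simp add: algebra_simps)
    also have "\<dots> \<le> (y - x) * \<bar>H * y - H * x\<bar>" using xy by (intro mult_left_mono) auto
    finally show "\<bar>h y - h x\<bar> \<le> (y - x) * \<bar>H * y - H * x\<bar>" unfolding eq by simp
  qed
  then have "1 / f x = 1 / f a + I x" if "x \<in> {a..b}" for x
    using that[THEN \<open>\<And>x. x \<in> {a..b} \<Longrightarrow> h x = h a\<close>] by (simp add: h_def I_def)
  then show ?thesis using si unfolding primitive_def I_def by blast
qed

section \<open>Weak derivatives and primitives\<close>

lemma set_integrable_measurable:
  fixes f :: "real \<Rightarrow> real"
  shows "set_integrable lborel S f \<Longrightarrow> set_borel_measurable lborel S f"
  unfolding set_integrable_def set_borel_measurable_def by (rule borel_measurable_integrable)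

lemma LINT_Ioo_eq_integral:
  fixes f :: "real \<Rightarrow> real"
  assumes "set_integrable lborel {a..b} f"
  shows "(LINT x:{a<..<b}|lborel. f x) = integral {a..b} f"
  using integral_Ioo_Icc[OF set_integrable_measurable[OF assms]] set_borel_integral_eq_integral(2)[OF assms] by simp

lemma locally_integrable_of_set_integrable: "set_integrable lborel {a..b} f \<Longrightarrow> locally_integrable a b f"
  unfolding locally_integrable_def by (auto intro: set_integrable_Icc_sub)

lemma locally_integrable_diff:
  "locally_integrable a b f \<Longrightarrow> locally_integrable a b g \<Longrightarrow> locally_integrable a b (\<lambda>x. f x - g x)"
  unfolding locally_integrable_def by (auto intro: set_integral_diff(1))

lemma set_integrable_continuous: "continuous_on {a..b} f \<Longrightarrow> set_integrable lborel {a..b} (f :: real \<Rightarrow> real)"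
  by (rule borel_integrable_compact[OF compact_Icc, folded set_integrable_def])

text \<open>Integration by parts, from the product rule for primitives.\<close>

lemma weak_deriv_primitive:
  assumes p: "primitive a b f g"
  shows "is_weak_deriv a b 1 f g"
  unfolding is_weak_deriv_def
proof (intro conjI allI impI)
  show "locally_integrable a b f" "locally_integrable a b g"
    by (intro locally_integrable_of_set_integrable set_integrable_continuous primitive_continuous[OF p]
        primitive_set_integrable[OF p])+
  fix \<phi> assume t: "test_function a b \<phi>"
  then obtain c d where cd: "a < c" "d < b" "\<And>x. x \<notin> {c..d} \<Longrightarrow> \<phi> x = 0" and s: "smooth \<phi>"
    unfolding test_function_iff by blast
  have c': "continuous_on S (deriv \<phi>)" for S by (rule smooth_continuous[OF smooth_deriv[OF s]])
  have p\<phi>: "primitive a b \<phi> (deriv \<phi>)"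
    by (rule primitive_of_deriv[OF _ c']) (rule DERIV_subset[OF smooth_has_deriv[OF s]], simp)
  obtain K where K: "\<And>x. x \<in> {a..b} \<Longrightarrow> \<bar>deriv \<phi> x\<bar> \<le> K"
    using compact_imp_bounded[OF compact_continuous_image[OF c' compact_Icc], of a b]
    unfolding bounded_iff by (metis image_eqI real_norm_def)
  have pm: "primitive a b (\<lambda>x. f x * \<phi> x) (\<lambda>x. g x * \<phi> x + deriv \<phi> x * f x)"
    by (rule primitive_mult[OF p p\<phi> K])
  have i1: "set_integrable lborel {a..b} (\<lambda>x. g x * \<phi> x)"
    by (intro set_integrable_continuous_mult primitive_set_integrable[OF p] primitive_continuous[OF p\<phi>])
  have i2: "set_integrable lborel {a..b} (\<lambda>x. f x * deriv \<phi> x)"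
    by (intro set_integrable_continuous continuous_intros primitive_continuous[OF p] c')
  have "integral {a..b} (\<lambda>x. g x * \<phi> x + deriv \<phi> x * f x) = 0"
  proof (cases "a \<le> b")
    case True
    have "\<phi> a = 0" "\<phi> b = 0" using cd by auto
    then show ?thesis using primitive_increment[OF pm order_refl True order_refl] by simp
  qed auto
  moreover have "integral {a..b} (\<lambda>x. g x * \<phi> x + deriv \<phi> x * f x) = integral {a..b} (\<lambda>x. g x * \<phi> x) + integral {a..b} (\<lambda>x. f x * deriv \<phi> x)"
    using set_borel_integral_eq_integral(1)[OF i1] set_borel_integral_eq_integral(1)[OF i2]
    by (subst Henstock_Kurzweil_Integration.integral_add[symmetric]) (auto simp: mult.commute)
  ultimately show "(LINT x:{a<..<b}|lborel. f x * (deriv ^^ 1) \<phi> x) = (-1) ^ 1 * (LINT x:{a<..<b}|lborel. g x * \<phi> x)"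
    by (simp add: LINT_Ioo_eq_integral[OF i1] LINT_Ioo_eq_integral[OF i2])
qed

lemma weak_deriv_integrals:
  "is_weak_deriv a b n f g \<Longrightarrow> test_function a b \<phi> \<Longrightarrow>
    (LINT x:{a<..<b}|lborel. f x * (deriv ^^ n) \<phi> x) = (-1) ^ n * (LINT x:{a<..<b}|lborel. g x * \<phi> x)"
  by (simp add: is_weak_deriv_def)

lemma weak_deriv_Suc:
  assumes "is_weak_deriv a b 1 f g" "is_weak_deriv a b n g h"
  shows "is_weak_deriv a b (Suc n) f h"
  unfolding is_weak_deriv_def
proof (intro conjI allI impI)
  fix \<phi> assume t: "test_function a b \<phi>"
  show "(LINT x:{a<..<b}|lborel. f x * (deriv ^^ Suc n) \<phi> x) = (-1) ^ Suc n * (LINT x:{a<..<b}|lborel. h x * \<phi> x)"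
    using weak_deriv_integrals[OF assms(1) test_function_deriv_n[OF t, of n]] weak_deriv_integrals[OF assms(2) t] by simp
qed (use assms in \<open>auto simp: is_weak_deriv_def\<close>)

lemma weak_deriv_0: "locally_integrable a b f \<Longrightarrow> is_weak_deriv a b 0 f f"
  by (simp add: is_weak_deriv_def)

lemma weak_deriv_unique:
  assumes "is_weak_deriv a b n f g" "is_weak_deriv a b n f h"
  shows "AE x in lborel. x \<in> {a<..<b} \<longrightarrow> g x = h x"
proof -
  have "AE x in lborel. x \<in> {a<..<b} \<longrightarrow> g x - h x = 0"
  proof (rule fundamental_lemma)
    show "locally_integrable a b (\<lambda>x. g x - h x)"
      using assms by (intro locally_integrable_diff) (auto simp: is_weak_deriv_def)
    fix \<psi> assume t: "test_function a b \<psi>"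
    have i: "set_integrable lborel {a<..<b} (\<lambda>x. g x * \<psi> x)" "set_integrable lborel {a<..<b} (\<lambda>x. h x * \<psi> x)"
      using assms t by (auto simp: is_weak_deriv_def intro: locally_integrable_mult_test)
    have "(-1) ^ n * (LINT x:{a<..<b}|lborel. g x * \<psi> x) = (-1) ^ n * (LINT x:{a<..<b}|lborel. h x * \<psi> x)"
      using weak_deriv_integrals[OF assms(1) t] weak_deriv_integrals[OF assms(2) t] by simp
    then have "(LINT x:{a<..<b}|lborel. g x * \<psi> x) = (LINT x:{a<..<b}|lborel. h x * \<psi> x)"
      by (metis mult_left_cancel power_not_zero zero_neq_neg_one)
    then show "(LINT x:{a<..<b}|lborel. (g x - h x) * \<psi> x) = 0"
      unfolding left_diff_distrib by (subst set_integral_diff(2)[OF i]) simp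
  qed
  then show ?thesis by eventually_elim auto
qed

lemma weak_deriv_cong_AE:
  assumes w: "is_weak_deriv a b n f g"
    and f: "locally_integrable a b f'" "AE x in lborel. x \<in> {a<..<b} \<longrightarrow> f x = f' x"
    and g: "locally_integrable a b g'" "AE x in lborel. x \<in> {a<..<b} \<longrightarrow> g x = g' x"
  shows "is_weak_deriv a b n f' g'"
proof -
  have *: "(LINT x:{a<..<b}|lborel. h x * \<psi> x) = (LINT x:{a<..<b}|lborel. h' x * \<psi> x)"
    if h: "locally_integrable a b h" "locally_integrable a b h'" "AE x in lborel. x \<in> {a<..<b} \<longrightarrow> h x = h' x"
      and t: "test_function a b \<psi>" for h h' \<psi>
    unfolding set_lebesgue_integral_def
  proof (rule integral_cong_AE)
    show "AE x in lborel. indicator {a<..<b} x *\<^sub>R (h x * \<psi> x) = indicator {a<..<b} x *\<^sub>R (h' x * \<psi> x)"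
      using h(3) by eventually_elim (auto simp: indicator_def)
  qed (use locally_integrable_mult_test[OF h(1) t] locally_integrable_mult_test[OF h(2) t] in
      \<open>auto simp: set_integrable_def dest: borel_measurable_integrable\<close>)
  show ?thesis unfolding is_weak_deriv_def
  proof (intro conjI allI impI f g)
    fix \<phi> assume t: "test_function a b \<phi>"
    show "(LINT x:{a<..<b}|lborel. f' x * (deriv ^^ n) \<phi> x) = (-1) ^ n * (LINT x:{a<..<b}|lborel. g' x * \<phi> x)"
      using weak_deriv_integrals[OF w t] *[OF _ f test_function_deriv_n[OF t, of n]] *[OF _ g t] w
      by (simp add: is_weak_deriv_def)
  qed
qed

text \<open>A function with vanishing weak derivative is constant: subtracting from a test function the
  right multiple of a fixed one makes its integral vanish, and then it has a test function as primitive.\<close>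

lemma weak_deriv_zero_imp_constant:
  assumes ab: "a < b" and h: "locally_integrable a b h"
    and z: "\<And>\<phi>. test_function a b \<phi> \<Longrightarrow> (LINT x:{a<..<b}|lborel. h x * deriv \<phi> x) = 0"
  shows "\<exists>C. AE x in lborel. x \<in> {a<..<b} \<longrightarrow> h x = C"
proof -
  define c0 d0 where "c0 = a + (b - a) / 3" and "d0 = b - (b - a) / 3"
  have c0: "a < c0" "c0 < d0" "d0 < b" using ab by (auto simp: c0_def d0_def field_simps)
  \<comment> \<open>The fixed test function, with nonzero integral.\<close>
  define \<psi>0 where "\<psi>0 = plateau c0 d0 1"
  have t0: "test_function a b \<psi>0" unfolding \<psi>0_def by (rule test_function_plateau[OF c0(1,3)])
  have sc: "continuous_on S \<psi>" if "test_function a b \<psi>" for \<psi> S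
    using that smooth_continuous by (auto simp: test_function_iff)
  define I where "I \<psi> = integral {a..b} \<psi>" for \<psi> :: "real \<Rightarrow> real"
  have I0: "0 < I \<psi>0"
  proof -
    have ii: "\<psi>0 integrable_on {a..b}" by (intro integrable_continuous_real sc[OF t0])
    have "I \<psi>0 \<noteq> 0"
    proof
      assume "I \<psi>0 = 0"
      then have "\<forall>x\<in>{a..b}. \<psi>0 x = 0"
        using integral_eq_0_iff[of a b \<psi>0] sc[OF t0] ab plateau_bounds(1) by (auto simp: I_def \<psi>0_def)
      moreover have "0 < \<psi>0 ((c0 + d0) / 2)" using bump_pos[of c0 "(c0 + d0) / 2" d0] c0 by (simp add: \<psi>0_def plateau_def)
      ultimately show False using c0 by (auto dest: bspec[of _ _ "(c0 + d0) / 2"])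
    qed
    moreover have "0 \<le> I \<psi>0" unfolding I_def
      by (rule Henstock_Kurzweil_Integration.integral_nonneg[OF ii]) (simp add: \<psi>0_def plateau_bounds)
    ultimately show ?thesis by simp
  qed
  define C where "C = (LINT x:{a<..<b}|lborel. h x * \<psi>0 x) / I \<psi>0"
  have main: "(LINT x:{a<..<b}|lborel. h x * \<psi> x) = C * I \<psi>" if t: "test_function a b \<psi>" for \<psi>
  proof -
    \<comment> \<open>A test function of integral \<open>0\<close>.\<close>
    define \<eta> where "\<eta> x = \<psi> x + (- (I \<psi> / I \<psi>0)) * \<psi>0 x" for x
    have t\<eta>: "test_function a b \<eta>" unfolding \<eta>_def by (intro test_function_add test_function_cmult t t0)
    have c\<eta>: "continuous_on S \<eta>" for S by (rule sc[OF t\<eta>])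
    have I\<eta>: "I \<eta> = 0"
    proof -
      have "I \<eta> = integral {a..b} \<psi> + integral {a..b} (\<lambda>x. (- (I \<psi> / I \<psi>0)) * \<psi>0 x)"
        unfolding I_def[of \<eta>] \<eta>_def
        by (intro Henstock_Kurzweil_Integration.integral_add integrable_continuous_real continuous_intros sc[OF t] sc[OF t0])
      also have "\<dots> = I \<psi> + (- (I \<psi> / I \<psi>0)) * I \<psi>0"
        unfolding I_def by (simp only: integral_mult_right)
      finally have "I \<eta> = I \<psi> + (- (I \<psi> / I \<psi>0)) * I \<psi>0" .
      then show ?thesis using I0 by simp
    qed
    obtain c d where cd: "a < c" "d < b" "\<And>x. x \<notin> {c..d} \<Longrightarrow> \<eta> x = 0" and s: "smooth \<eta>"
      using t\<eta> unfolding test_function_iff by blast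
    \<comment> \<open>A nonempty interval containing the support.\<close>
    define cc dd where "cc = min c ((a + b) / 2)" and "dd = max d ((a + b) / 2)"
    have cc: "a < cc" "dd < b" "cc \<le> dd" "\<And>x. x \<notin> {cc..dd} \<Longrightarrow> \<eta> x = 0"
      using cd ab by (auto simp: cc_def dd_def min_def max_def split: if_splits)
    define \<phi> where "\<phi> x = (if a \<le> x \<and> x \<le> b then integral {a..x} \<eta> else 0)" for x
    have int0: "integral {u..v} \<eta> = 0" if "\<And>x. x \<in> {u..v} \<Longrightarrow> \<eta> x = 0" for u v
      by (rule integral_unique[OF has_integral_is_0]) (use that in auto)
    have \<phi>0: "\<phi> x = 0" if "x \<notin> {cc..dd}" for x
    proof (cases "a \<le> x \<and> x \<le> b")
      case True
      show ?thesis
      proof (cases "x < cc")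
        case True
        then show ?thesis unfolding \<phi>_def by (auto intro!: int0 cc(4))
      next
        case False
        then have x: "dd < x" using that by auto
        have "integral {a..x} \<eta> + integral {x..b} \<eta> = I \<eta>" unfolding I_def
          using True by (intro Henstock_Kurzweil_Integration.integral_combine integrable_continuous_real c\<eta>) auto
        moreover have "integral {x..b} \<eta> = 0" by (rule int0) (use x cc in auto)
        ultimately show ?thesis using I\<eta> True by (simp add: \<phi>_def)
      qed
    qed (auto simp: \<phi>_def)
    have d\<phi>: "(\<phi> has_real_derivative \<eta> x) (at x)" for x
    proof (cases "x \<in> {a<..<b}")
      case True
      have "((\<lambda>u. integral {a..u} \<eta>) has_real_derivative \<eta> x) (at x within {a..b})"
        using integral_has_vector_derivative[OF c\<eta>, of x a b] True by (simp add: has_real_derivative_iff_has_vector_derivative)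
      moreover have "at x within {a..b} = at x" using True by (intro at_within_interior) auto
      ultimately have "((\<lambda>u. integral {a..u} \<eta>) has_real_derivative \<eta> x) (at x)" by simp
      then show ?thesis
        by (rule has_field_derivative_transform_within_open[of _ _ _ "{a<..<b}"]) (use True in \<open>auto simp: \<phi>_def\<close>)
    next
      case False
      then have x: "x \<notin> {cc..dd}" using cc by auto
      have "((\<lambda>_. 0) has_real_derivative 0) (at x)" by simp
      then have "(\<phi> has_real_derivative 0) (at x)"
        by (rule has_field_derivative_transform_within_open[of _ _ _ "- {cc..dd}"]) (use x \<phi>0 in auto)
      then show ?thesis using cc(4)[OF x] by simp
    qed
    have t\<phi>: "test_function a b \<phi>"
      by (rule test_function_of_deriv[OF d\<phi> s cc(1,2) \<phi>0])
    have "deriv \<phi> = \<eta>" by (intro ext DERIV_imp_deriv d\<phi>)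
    then have "0 = (LINT x:{a<..<b}|lborel. h x * \<eta> x)" using z[OF t\<phi>] by simp
    also have "\<dots> = (LINT x:{a<..<b}|lborel. h x * \<psi> x + (- (I \<psi> / I \<psi>0)) * (h x * \<psi>0 x))"
      by (simp add: \<eta>_def algebra_simps)
    also have "\<dots> = (LINT x:{a<..<b}|lborel. h x * \<psi> x) + (- (I \<psi> / I \<psi>0)) * (LINT x:{a<..<b}|lborel. h x * \<psi>0 x)"
      by (subst set_integral_add(2)[OF locally_integrable_mult_test[OF h t] set_integrable_mult_right])
         (use locally_integrable_mult_test[OF h t0] in \<open>simp_all only: set_integral_mult_right\<close>)
    finally show ?thesis using I0 by (simp add: C_def field_simps)
  qed
  have "AE x in lborel. x \<in> {a<..<b} \<longrightarrow> h x - C = 0"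
  proof (rule fundamental_lemma)
    have lc: "locally_integrable a b (\<lambda>x. C)"
      by (intro locally_integrable_of_set_integrable set_integrable_continuous continuous_intros)
    show "locally_integrable a b (\<lambda>x. h x - C)" by (intro locally_integrable_diff h lc)
    fix \<psi> assume t: "test_function a b \<psi>"
    have i: "set_integrable lborel {a..b} (\<lambda>x. C * \<psi> x)"
      by (intro set_integrable_continuous continuous_intros sc[OF t])
    have "(LINT x:{a<..<b}|lborel. (h x - C) * \<psi> x) = (LINT x:{a<..<b}|lborel. h x * \<psi> x) - (LINT x:{a<..<b}|lborel. C * \<psi> x)"
      unfolding left_diff_distrib
      by (rule set_integral_diff(2)[OF locally_integrable_mult_test[OF h t] locally_integrable_mult_test[OF lc t]])
    also have "\<dots> = C * I \<psi> - C * I \<psi>"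
      unfolding main[OF t] LINT_Ioo_eq_integral[OF i] I_def by (simp only: integral_mult_right)
    also have "\<dots> = 0" by simp
    finally show "(LINT x:{a<..<b}|lborel. (h x - C) * \<psi> x) = 0" .
  qed
  then show ?thesis by (intro exI[of _ C]) (auto elim: eventually_mono)
qed

text \<open>Together with \<open>weak_deriv_primitive\<close> this is the du Bois-Reymond characterization of weak differentiability.\<close>

lemma weak_deriv_imp_primitive:
  assumes ab: "a < b" and w: "is_weak_deriv a b 1 f g" and g: "set_integrable lborel {a..b} g"
  shows "\<exists>F. primitive a b F g \<and> (AE x in lborel. x \<in> {a<..<b} \<longrightarrow> f x = F x)"
proof -
  define G where "G x = integral {a..x} g" for x
  have pG: "primitive a b G g" using g by (intro primitiveI) (auto simp: G_def)
  have lf: "locally_integrable a b f" using w by (simp add: is_weak_deriv_def)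
  have lG: "locally_integrable a b G" using weak_deriv_primitive[OF pG] by (simp add: is_weak_deriv_def)
  have "\<exists>C. AE x in lborel. x \<in> {a<..<b} \<longrightarrow> f x - G x = C"
  proof (rule weak_deriv_zero_imp_constant[OF ab locally_integrable_diff[OF lf lG]])
    fix \<phi> assume t: "test_function a b \<phi>"
    show "(LINT x:{a<..<b}|lborel. (f x - G x) * deriv \<phi> x) = 0"
      unfolding left_diff_distrib
      using weak_deriv_integrals[OF w t] weak_deriv_integrals[OF weak_deriv_primitive[OF pG] t]
      by (subst set_integral_diff(2)) (auto intro: locally_integrable_mult_test[OF _ test_function_deriv[OF t]] lf lG)
  qed
  then obtain C where C: "AE x in lborel. x \<in> {a<..<b} \<longrightarrow> f x - G x = C" by blast
  have "primitive a b (\<lambda>x. C + G x) g" using g by (intro primitiveI) (auto simp: G_def)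
  moreover have "AE x in lborel. x \<in> {a<..<b} \<longrightarrow> f x = C + G x" using C by eventually_elim auto
  ultimately show ?thesis by blast
qed

text \<open>A set of full measure is dense.\<close>

lemma continuous_AE_eq:
  fixes f g :: "real \<Rightarrow> real"
  assumes ab: "a < b" and f: "continuous_on {a..b} f" and g: "continuous_on {a..b} g"
    and ae: "AE x in lborel. x \<in> {a<..<b} \<longrightarrow> f x = g x" and x: "x \<in> {a..b}"
  shows "f x = g x"
proof -
  have cl: "closure {y\<in>{a<..<b}. f y = g y} = {a..b}"
  proof
    show "closure {y\<in>{a<..<b}. f y = g y} \<subseteq> {a..b}" by (intro closure_minimal) auto
    show "{a..b} \<subseteq> closure {y\<in>{a<..<b}. f y = g y}"
    proof
      fix x assume x: "x \<in> {a..b}"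
      show "x \<in> closure {y\<in>{a<..<b}. f y = g y}"
        unfolding closure_approachable
      proof (intro allI impI)
        fix e :: real assume e: "0 < e"
        define u v where "u = max a (x - e)" and "v = min b (x + e)"
        have uv: "u < v" using x e ab by (auto simp: u_def v_def)
        have "\<exists>y\<in>{u<..<v}. f y = g y"
        proof (rule ccontr)
          assume "\<not> ?thesis"
          then have "AE y in lborel. y \<notin> {u<..<v}"
            using ae by (auto elim!: eventually_mono simp: u_def v_def)
          then have "emeasure lborel {u<..<v} = 0"
            by (subst (asm) AE_iff_measurable[where N = "{u<..<v}"]) auto
          then show False using uv by simp
        qed
        then obtain y where "y \<in> {u<..<v}" "f y = g y" by blast
        then show "\<exists>y\<in>{y\<in>{a<..<b}. f y = g y}. dist y x < e"
          by (intro bexI[of _ y]) (auto simp: u_def v_def dist_real_def)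
      qed
    qed
  qed
  have "continuous_on (closure {y\<in>{a<..<b}. f y = g y}) (\<lambda>x. f x - g x)"
    unfolding cl by (intro continuous_intros f g)
  then have "f x - g x = 0"
    by (rule continuous_constant_on_closure[where f = "\<lambda>x. f x - g x"]) (use x cl in auto)
  then show ?thesis by simp
qed

section \<open>Calculus of twice differentiable curves of functions\<close>

lemma primitive_cmult: "primitive a b f g \<Longrightarrow> primitive a b (\<lambda>x. k * f x) (\<lambda>x. k * g x)"
proof (rule primitiveI)
  assume p: "primitive a b f g"
  show "set_integrable lborel {a..b} (\<lambda>x. k * g x)" using primitive_set_integrable[OF p] by simp
  show "k * f x = k * f a + integral {a..x} (\<lambda>x. k * g x)" if "x \<in> {a..b}" for x
    unfolding primitiveD[OF p that] by (simp only: integral_mult_right distrib_left)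
qed

lemma primitive_const: "primitive a b (\<lambda>x. k) (\<lambda>x. 0)"
  by (rule primitiveI) (auto simp: set_integrable_def)

text \<open>The least regular functions admitted, the class of the highest spatial derivatives. Bounded measurable
and continuous functions are the instances of interest; the calculus is carried out once for both.\<close>

locale base_class =
  fixes a b :: real and B :: "(real \<Rightarrow> real) \<Rightarrow> bool"
  assumes ab: "a < b"
    and B_cont: "continuous_on {a..b} f \<Longrightarrow> B f"
    and B_add: "B f \<Longrightarrow> B g \<Longrightarrow> B (\<lambda>x. f x + g x)"
    and B_mult: "B f \<Longrightarrow> B g \<Longrightarrow> B (\<lambda>x. f x * g x)"
    and B_inverse: "B f \<Longrightarrow> 0 < c \<Longrightarrow> (\<And>x. x \<in> {a..b} \<Longrightarrow> c \<le> f x) \<Longrightarrow> B (\<lambda>x. 1 / f x)"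
    and B_bounded: "B f \<Longrightarrow> \<exists>K. \<forall>x\<in>{a..b}. \<bar>f x\<bar> \<le> K"
    and B_integrable: "B f \<Longrightarrow> set_integrable lborel {a..b} f"
begin

text \<open>\<open>j\<close>-fold primitives of base functions: for the two instances this is \<open>W\<close> of order \<open>j\<close> and
exponent infinity, for \<open>j \<ge> 1\<close>, and \<open>C\<^sup>j\<close>.\<close>

primrec regular :: "nat \<Rightarrow> (real \<Rightarrow> real) \<Rightarrow> bool" where
  "regular 0 f = B f"
| "regular (Suc j) f = (\<exists>g. primitive a b f g \<and> regular j g)"

text \<open>All derivatives up to order \<open>j\<close> are bounded by \<open>r\<close> on \<open>[a,b]\<close>. Derivatives are determined
only almost everywhere, and a bound of this form replaces a norm.\<close>

primrec small :: "real \<Rightarrow> nat \<Rightarrow> (real \<Rightarrow> real) \<Rightarrow> bool" where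
  "small r 0 f = (B f \<and> (\<forall>x\<in>{a..b}. \<bar>f x\<bar> \<le> r))"
| "small r (Suc j) f = ((\<forall>x\<in>{a..b}. \<bar>f x\<bar> \<le> r) \<and> (\<exists>g. primitive a b f g \<and> small r j g))"

lemma B_const: "B (\<lambda>x. k)" by (rule B_cont) simp

lemma regular_B: "regular j f \<Longrightarrow> B f"
  by (cases j) (auto intro: B_cont primitive_continuous)

lemma regular_const: "regular j (\<lambda>x. k)"
proof (induction j arbitrary: k)
  case (Suc j)
  have "regular j (\<lambda>x. 0)" by (rule Suc)
  then show ?case using primitive_const by auto
qed (simp add: B_const)

lemma small_mono: "small r j f \<Longrightarrow> r \<le> r' \<Longrightarrow> small r' j f"
  by (induction j arbitrary: f) (auto intro: order_trans)

text \<open>Curves with Lipschitz second time derivative \<open>w\<close>, where time derivatives are taken pointwise in space.\<close>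

definition base_curve :: "(real \<Rightarrow> real \<Rightarrow> real) \<Rightarrow> (real \<Rightarrow> real \<Rightarrow> real) \<Rightarrow> (real \<Rightarrow> real \<Rightarrow> real) \<Rightarrow> bool" where
  "base_curve u v w \<longleftrightarrow> time_Lip a b u \<and> time_Lip a b v \<and> time_Lip a b w \<and>
     (\<forall>t\<ge>0. B (u t) \<and> B (v t) \<and> B (w t) \<and> (\<forall>x\<in>{a..b}.
        ((\<lambda>s. u s x) has_real_derivative v t x) (at t within {0..}) \<and>
        ((\<lambda>s. v s x) has_real_derivative w t x) (at t within {0..})))"

lemma base_curveD:
  assumes "base_curve u v w"
  shows "time_Lip a b u" "time_Lip a b v" "time_Lip a b w"
    "0 \<le> t \<Longrightarrow> B (u t)" "0 \<le> t \<Longrightarrow> B (v t)" "0 \<le> t \<Longrightarrow> B (w t)"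
    "0 \<le> t \<Longrightarrow> x \<in> {a..b} \<Longrightarrow> ((\<lambda>s. u s x) has_real_derivative v t x) (at t within {0..})"
    "0 \<le> t \<Longrightarrow> x \<in> {a..b} \<Longrightarrow> ((\<lambda>s. v s x) has_real_derivative w t x) (at t within {0..})"
  using assms unfolding base_curve_def by blast+

text \<open>Curves whose spatial derivatives up to order \<open>j\<close> are again such curves. The time derivatives are
explicit arguments, since the primitives must be those of \<open>v\<close> and \<open>w\<close> as well.\<close>

primrec curve_derivs :: "nat \<Rightarrow> (real \<Rightarrow> real \<Rightarrow> real) \<Rightarrow> (real \<Rightarrow> real \<Rightarrow> real) \<Rightarrow> (real \<Rightarrow> real \<Rightarrow> real) \<Rightarrow> bool" where
  "curve_derivs 0 u v w = base_curve u v w"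
| "curve_derivs (Suc j) u v w = (base_curve u v w \<and> (\<exists>d e f. curve_derivs j d e f \<and>
     (\<forall>t\<ge>0. primitive a b (u t) (d t) \<and> primitive a b (v t) (e t) \<and> primitive a b (w t) (f t))))"

lemma curve_derivs_base: "curve_derivs j u v w \<Longrightarrow> base_curve u v w"
  by (cases j) auto

lemma curve_derivs_Suc_imp: "curve_derivs (Suc j) u v w \<Longrightarrow> curve_derivs j u v w"
proof (induction j arbitrary: u v w)
  case (Suc j)
  from Suc.prems obtain d e f where "base_curve u v w" "curve_derivs (Suc j) d e f"
    "\<forall>t\<ge>0. primitive a b (u t) (d t) \<and> primitive a b (v t) (e t) \<and> primitive a b (w t) (f t)"
    unfolding curve_derivs.simps(2)[of "Suc j"] by blast
  then show ?case using Suc.IH unfolding curve_derivs.simps(2)[of j] by blast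
qed auto

text \<open>Time derivatives and spatial primitives commute: the difference quotients of \<open>d\<close> converge uniformly, so
the limit may be taken under the integral.\<close>

lemma primitive_time_deriv:
  assumes p: "\<And>t. 0 \<le> t \<Longrightarrow> primitive a b (u t) (d t)"
    and u: "\<And>t x. 0 \<le> t \<Longrightarrow> x \<in> {a..b} \<Longrightarrow> ((\<lambda>s. u s x) has_real_derivative v t x) (at t within {0..})"
    and d: "\<And>t x. 0 \<le> t \<Longrightarrow> x \<in> {a..b} \<Longrightarrow> ((\<lambda>s. d s x) has_real_derivative e t x) (at t within {0..})"
    and e: "time_Lip a b e" "B (e t)" and t: "0 \<le> t"
  shows "primitive a b (v t) (e t)"
proof (rule primitiveI)
  show ie: "set_integrable lborel {a..b} (e t)" by (rule B_integrable[OF e(2)])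
  fix x assume x: "x \<in> {a..b}"
  let ?F = "at t within {0..}"
  let ?Q = "\<lambda>s y. (u s y - u t y) / (s - t)"
  have qu: "((\<lambda>s. ?Q s y) \<longlongrightarrow> v t y) ?F" if "y \<in> {a..b}" for y
    using u[OF t that] by (simp add: has_field_derivative_iff)
  have nb: "?F \<noteq> bot"
  proof -
    have "{t<..} \<subseteq> {0..}" using t by auto
    then show ?thesis using at_le[of "{t<..}" "{0..}" t] trivial_limit_at_right_real[of t] by (auto simp: bot_unique)
  qed
  have "\<exists>K. \<forall>s\<in>{0..t+1}. \<forall>r\<in>{0..t+1}. \<forall>y\<in>{a..b}. s \<noteq> r \<longrightarrow> \<bar>(d s y - d r y) / (s - r) - e r y\<bar> \<le> K * \<bar>s - r\<bar>"
    by (rule time_Lip_difference_quotient[OF e(1) _ d]) (use t in auto)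
  then obtain K where K: "\<And>s r y. s \<in> {0..t+1} \<Longrightarrow> r \<in> {0..t+1} \<Longrightarrow> y \<in> {a..b} \<Longrightarrow> s \<noteq> r \<Longrightarrow>
      \<bar>(d s y - d r y) / (s - r) - e r y\<bar> \<le> K * \<bar>s - r\<bar>"
    by blast
  have ieh: "e t integrable_on {a..x}"
    using set_borel_integral_eq_integral(1)[OF set_integrable_Icc_sub[OF ie order_refl]] x by auto
  have "((\<lambda>s. ?Q s x - ?Q s a - integral {a..x} (e t)) \<longlongrightarrow> 0) ?F"
  proof (rule Lim_null_comparison)
    have "norm (?Q s x - ?Q s a - integral {a..x} (e t)) \<le> K * \<bar>s - t\<bar> * (x - a)"
      if s: "s \<in> {0..t+1}" "s \<noteq> t" for s
    proof -
      have ps: "primitive a b (u s) (d s)" using p s by simp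
      have id: "d s integrable_on {a..x}" "d t integrable_on {a..x}"
        using primitive_integrable(1)[OF ps, of a x] primitive_integrable(1)[OF p[OF t], of a x] x by auto
      have "?Q s x - ?Q s a = ((u s x - u s a) - (u t x - u t a)) / (s - t)"
        by (simp add: diff_divide_distrib)
      also have "\<dots> = (integral {a..x} (d s) - integral {a..x} (d t)) / (s - t)"
        using primitive_increment[OF ps, of a x] primitive_increment[OF p[OF t], of a x] x by simp
      also have "\<dots> = integral {a..x} (\<lambda>y. (d s y - d t y) / (s - t))"
        using id by (simp add: Henstock_Kurzweil_Integration.integral_diff)
      finally have E: "?Q s x - ?Q s a = integral {a..x} (\<lambda>y. (d s y - d t y) / (s - t))" .
      have "?Q s x - ?Q s a - integral {a..x} (e t) = integral {a..x} (\<lambda>y. (d s y - d t y) / (s - t) - e t y)"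
        unfolding E by (intro Henstock_Kurzweil_Integration.integral_diff[symmetric] integrable_on_divide integrable_diff id ieh)
      also have "norm \<dots> \<le> integral {a..x} (\<lambda>y. K * \<bar>s - t\<bar>)"
        using id ieh x s t by (intro Henstock_Kurzweil_Integration.integral_norm_bound_integral integrable_diff
            integrable_on_divide) (auto intro!: K)
      finally show ?thesis using x by (simp add: mult_ac)
    qed
    then show "\<forall>\<^sub>F s in ?F. norm (?Q s x - ?Q s a - integral {a..x} (e t)) \<le> K * \<bar>s - t\<bar> * (x - a)"
      unfolding eventually_at by (intro exI[of _ 1]) (auto simp: dist_real_def)
    have "((\<lambda>s. K * \<bar>s - t\<bar> * (x - a)) \<longlongrightarrow> K * \<bar>t - t\<bar> * (x - a)) ?F" by (intro tendsto_intros)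
    then show "((\<lambda>s. K * \<bar>s - t\<bar> * (x - a)) \<longlongrightarrow> 0) ?F" by simp
  qed
  moreover have "((\<lambda>s. ?Q s x - ?Q s a - integral {a..x} (e t)) \<longlongrightarrow> v t x - v t a - integral {a..x} (e t)) ?F"
    using x ab by (intro tendsto_intros qu) auto
  ultimately have "v t x - v t a - integral {a..x} (e t) = 0"
    using tendsto_unique[OF nb] by blast
  then show "v t x = v t a + integral {a..x} (e t)" by simp
qed

text \<open>It suffices to find a spatial derivative of \<open>u\<close> among the curves; that its time derivatives are spatial
derivatives of \<open>v\<close> and \<open>w\<close> is automatic.\<close>

lemma curve_derivs_SucI:
  assumes b: "base_curve u v w" and p: "\<And>t. 0 \<le> t \<Longrightarrow> primitive a b (u t) (d t)" and c: "curve_derivs j d e f"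
  shows "curve_derivs (Suc j) u v w"
proof -
  note d = curve_derivs_base[OF c]
  have e: "primitive a b (v t) (e t)" if "0 \<le> t" for t
    by (rule primitive_time_deriv[OF p base_curveD(7)[OF b] base_curveD(7)[OF d] base_curveD(2)[OF d] base_curveD(5)[OF d that] that])
  have "primitive a b (w t) (f t)" if "0 \<le> t" for t
    by (rule primitive_time_deriv[OF e base_curveD(8)[OF b] base_curveD(8)[OF d] base_curveD(3)[OF d] base_curveD(6)[OF d that] that])
  then show ?thesis unfolding curve_derivs.simps(2) using b c p e by (intro conjI exI[of _ d] exI[of _ e] exI[of _ f]) auto
qed

lemma base_curve_add:
  assumes "base_curve u v w" "base_curve u' v' w'"
  shows "base_curve (\<lambda>t x. u t x + u' t x) (\<lambda>t x. v t x + v' t x) (\<lambda>t x. w t x + w' t x)"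
  unfolding base_curve_def
  by (intro conjI allI impI ballI time_Lip_add B_add DERIV_add base_curveD[OF assms(1)] base_curveD[OF assms(2)])

lemma base_curve_mult:
  assumes "base_curve u v w" "base_curve u' v' w'"
  shows "base_curve (\<lambda>t x. u t x * u' t x) (\<lambda>t x. v t x * u' t x + u t x * v' t x)
    (\<lambda>t x. w t x * u' t x + 2 * (v t x * v' t x) + u t x * w' t x)"
  unfolding base_curve_def
proof (intro conjI allI impI ballI)
  note D = base_curveD[OF assms(1)] base_curveD[OF assms(2)]
  have two: "time_Lip a b (\<lambda>t x. 2)" by (rule time_Lip_const[of _ _ _ 2]) simp
  show "time_Lip a b (\<lambda>t x. u t x * u' t x)" "time_Lip a b (\<lambda>t x. v t x * u' t x + u t x * v' t x)"
    "time_Lip a b (\<lambda>t x. w t x * u' t x + 2 * (v t x * v' t x) + u t x * w' t x)"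
    by (intro time_Lip_add time_Lip_mult D two)+
  fix t :: real assume t: "0 \<le> t"
  show "B (\<lambda>x. u t x * u' t x)" "B (\<lambda>x. v t x * u' t x + u t x * v' t x)"
    "B (\<lambda>x. w t x * u' t x + 2 * (v t x * v' t x) + u t x * w' t x)"
    by (intro B_add B_mult D t B_const)+
  fix x assume x: "x \<in> {a..b}"
  show "((\<lambda>s. u s x * u' s x) has_real_derivative v t x * u' t x + u t x * v' t x) (at t within {0..})"
    by (rule DERIV_cong[OF DERIV_mult[OF D(7)[OF t x] D(15)[OF t x]]]) simp
  show "((\<lambda>s. v s x * u' s x + u s x * v' s x) has_real_derivative
     w t x * u' t x + 2 * (v t x * v' t x) + u t x * w' t x) (at t within {0..})"
    by (rule DERIV_cong[OF DERIV_add[OF DERIV_mult[OF D(8)[OF t x] D(15)[OF t x]] DERIV_mult[OF D(7)[OF t x] D(16)[OF t x]]]])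
       (simp add: algebra_simps)
qed

definition bounded_below :: "(real \<Rightarrow> real \<Rightarrow> real) \<Rightarrow> bool" where
  "bounded_below u \<longleftrightarrow> (\<forall>T\<ge>0. \<exists>c>0. \<forall>t\<in>{0..T}. \<forall>x\<in>{a..b}. c \<le> u t x)"

lemma base_curve_inverse:
  assumes "base_curve u v w" and low: "bounded_below u"
  shows "base_curve (\<lambda>t x. 1 / u t x) (\<lambda>t x. - 1 * (v t x * (1 / u t x * (1 / u t x))))
    (\<lambda>t x. 2 * (v t x * (v t x * (1 / u t x * (1 / u t x * (1 / u t x))))) + - 1 * (w t x * (1 / u t x * (1 / u t x))))"
  unfolding base_curve_def
proof (intro conjI allI impI ballI)
  note D = base_curveD[OF assms(1)]
  have k: "time_Lip a b (\<lambda>t x. k)" for k by (rule time_Lip_const[of _ _ _ "\<bar>k\<bar>"]) simp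
  have i: "time_Lip a b (\<lambda>t x. 1 / u t x)" using low by (intro time_Lip_inverse D) (auto simp: bounded_below_def)
  show "time_Lip a b (\<lambda>t x. 1 / u t x)" "time_Lip a b (\<lambda>t x. - 1 * (v t x * (1 / u t x * (1 / u t x))))"
   "time_Lip a b (\<lambda>t x. 2 * (v t x * (v t x * (1 / u t x * (1 / u t x * (1 / u t x))))) + - 1 * (w t x * (1 / u t x * (1 / u t x))))"
    by (intro time_Lip_add time_Lip_mult D k i)+
  fix t :: real assume t: "0 \<le> t"
  obtain c where c: "0 < c" "\<And>x. x \<in> {a..b} \<Longrightarrow> c \<le> u t x" using low t unfolding bounded_below_def
    by (metis atLeastAtMost_iff order_refl)
  have Bi: "B (\<lambda>x. 1 / u t x)" by (rule B_inverse[OF D(4)[OF t] c])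
  show "B (\<lambda>x. 1 / u t x)" "B (\<lambda>x. - 1 * (v t x * (1 / u t x * (1 / u t x))))"
   "B (\<lambda>x. 2 * (v t x * (v t x * (1 / u t x * (1 / u t x * (1 / u t x))))) + - 1 * (w t x * (1 / u t x * (1 / u t x))))"
    by (intro B_add B_mult D t B_const Bi)+
  fix x assume x: "x \<in> {a..b}"
  have un: "u t x \<noteq> 0" using c(1) c(2)[OF x] by linarith
  have iu: "((\<lambda>s. 1 / u s x) has_real_derivative - 1 * (v t x * (1 / u t x * (1 / u t x)))) (at t within {0..})"
    using DERIV_inverse'[OF D(7)[OF t x] un] by (simp add: inverse_eq_divide)
  show "((\<lambda>s. 1 / u s x) has_real_derivative - 1 * (v t x * (1 / u t x * (1 / u t x)))) (at t within {0..})" by (rule iu)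
  show "((\<lambda>s. - 1 * (v s x * (1 / u s x * (1 / u s x)))) has_real_derivative
    2 * (v t x * (v t x * (1 / u t x * (1 / u t x * (1 / u t x))))) + - 1 * (w t x * (1 / u t x * (1 / u t x)))) (at t within {0..})"
    by (rule DERIV_cong[OF DERIV_cmult[OF DERIV_mult[OF D(8)[OF t x] DERIV_mult[OF iu iu]]]])
       (simp add: divide_inverse algebra_simps)
qed

lemma curve_derivs_add:
  "curve_derivs j u v w \<Longrightarrow> curve_derivs j u' v' w' \<Longrightarrow> curve_derivs j (\<lambda>t x. u t x + u' t x) (\<lambda>t x. v t x + v' t x) (\<lambda>t x. w t x + w' t x)"
proof (induction j arbitrary: u v w u' v' w')
  case (Suc j)
  obtain d e f where d: "curve_derivs j d e f" "\<And>t. 0 \<le> t \<Longrightarrow> primitive a b (u t) (d t)" using Suc.prems(1) by auto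
  obtain d' e' f' where d': "curve_derivs j d' e' f'" "\<And>t. 0 \<le> t \<Longrightarrow> primitive a b (u' t) (d' t)" using Suc.prems(2) by auto
  show ?case
    by (rule curve_derivs_SucI[OF base_curve_add[OF curve_derivs_base[OF Suc.prems(1)] curve_derivs_base[OF Suc.prems(2)]] primitive_add[OF d(2) d'(2)] Suc.IH[OF d(1) d'(1)]])
qed (simp add: base_curve_add)

text \<open>Only the spatial product rule for \<open>u u'\<close> enters, by \<open>curve_derivs_SucI\<close>.\<close>

lemma curve_derivs_mult:
  "curve_derivs j u v w \<Longrightarrow> curve_derivs j u' v' w' \<Longrightarrow> curve_derivs j (\<lambda>t x. u t x * u' t x) (\<lambda>t x. v t x * u' t x + u t x * v' t x)
    (\<lambda>t x. w t x * u' t x + 2 * (v t x * v' t x) + u t x * w' t x)"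
proof (induction j arbitrary: u v w u' v' w')
  case (Suc j)
  obtain d e f where d: "curve_derivs j d e f" "\<And>t. 0 \<le> t \<Longrightarrow> primitive a b (u t) (d t)" using Suc.prems(1) by auto
  obtain d' e' f' where d': "curve_derivs j d' e' f'" "\<And>t. 0 \<le> t \<Longrightarrow> primitive a b (u' t) (d' t)" using Suc.prems(2) by auto
  have p: "primitive a b (\<lambda>x. u t x * u' t x) (\<lambda>x. d t x * u' t x + d' t x * u t x)" if t: "0 \<le> t" for t
  proof -
    obtain K where "\<forall>x\<in>{a..b}. \<bar>d' t x\<bar> \<le> K"
      using B_bounded[OF base_curveD(4)[OF curve_derivs_base[OF d'(1)] t]] by blast
    then show ?thesis by (intro primitive_mult[OF d(2)[OF t] d'(2)[OF t]]) blast
  qed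
  show ?case
    by (rule curve_derivs_SucI[OF base_curve_mult[OF curve_derivs_base[OF Suc.prems(1)] curve_derivs_base[OF Suc.prems(2)]] p
       curve_derivs_add[OF Suc.IH[OF d(1) curve_derivs_Suc_imp[OF Suc.prems(2)]] Suc.IH[OF d'(1) curve_derivs_Suc_imp[OF Suc.prems(1)]]]])
qed (simp add: base_curve_mult)

lemma base_curve_static: "B f \<Longrightarrow> base_curve (\<lambda>t. f) (\<lambda>t x. 0) (\<lambda>t x. 0)"
proof -
  assume f: "B f"
  obtain K where "\<And>x. x \<in> {a..b} \<Longrightarrow> \<bar>f x\<bar> \<le> K" using B_bounded[OF f] by blast
  then have "time_Lip a b (\<lambda>t. f)" by (rule time_Lip_const)
  moreover have "time_Lip a b (\<lambda>t x. 0)" by (rule time_Lip_const[of _ _ _ 0]) simp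
  ultimately show ?thesis unfolding base_curve_def using f by (auto intro: B_const)
qed

lemma curve_derivs_static: "regular j f \<Longrightarrow> curve_derivs j (\<lambda>t. f) (\<lambda>t x. 0) (\<lambda>t x. 0)"
proof (induction j arbitrary: f)
  case (Suc j)
  obtain g where g: "primitive a b f g" "regular j g" using Suc.prems by auto
  show ?case by (rule curve_derivs_SucI[OF base_curve_static[OF regular_B[OF Suc.prems]] g(1) Suc.IH[OF g(2)]])
qed (simp add: base_curve_static)

lemma curve_derivs_time: "curve_derivs j (\<lambda>t x. t) (\<lambda>t x. 1) (\<lambda>t x. 0)"
proof -
  have b: "base_curve (\<lambda>t x. t) (\<lambda>t x. 1) (\<lambda>t x. 0)"
    unfolding base_curve_def
    by (auto intro!: time_Lip_time time_Lip_const[of a b "\<lambda>_. 1" 1] time_Lip_const[of a b "\<lambda>_. 0" 0] B_const derivative_eq_intros)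
  show ?thesis
  proof (cases j)
    case (Suc i)
    show ?thesis unfolding Suc by (rule curve_derivs_SucI[OF b primitive_const curve_derivs_static[OF regular_const]])
  qed (simp add: b)
qed

lemma curve_derivs_inverse:
  "curve_derivs j u v w \<Longrightarrow> bounded_below u \<Longrightarrow> curve_derivs j (\<lambda>t x. 1 / u t x) (\<lambda>t x. - 1 * (v t x * (1 / u t x * (1 / u t x))))
    (\<lambda>t x. 2 * (v t x * (v t x * (1 / u t x * (1 / u t x * (1 / u t x))))) + - 1 * (w t x * (1 / u t x * (1 / u t x))))"
proof (induction j arbitrary: u v w)
  case (Suc j)
  obtain d e f where d: "curve_derivs j d e f" "\<And>t. 0 \<le> t \<Longrightarrow> primitive a b (u t) (d t)" using Suc.prems(1) by auto
  have p: "primitive a b (\<lambda>x. 1 / u t x) (\<lambda>x. - 1 * (d t x * (1 / u t x * (1 / u t x))))" if t: "0 \<le> t" for t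
  proof -
    obtain K where K: "\<And>x. x \<in> {a..b} \<Longrightarrow> \<bar>d t x\<bar> \<le> K"
      using B_bounded[OF base_curveD(4)[OF curve_derivs_base[OF d(1)] t]] by blast
    obtain c where c: "0 < c" "\<And>x. x \<in> {a..b} \<Longrightarrow> c \<le> u t x" using Suc.prems(2) t unfolding bounded_below_def
      by (metis atLeastAtMost_iff order_refl)
    show ?thesis using primitive_inverse[OF d(2)[OF t] K c] by simp
  qed
  note IH = Suc.IH[OF curve_derivs_Suc_imp[OF Suc.prems(1)] Suc.prems(2)]
  show ?case
    by (rule curve_derivs_SucI[OF base_curve_inverse[OF curve_derivs_base[OF Suc.prems(1)] Suc.prems(2)] p
       curve_derivs_mult[OF curve_derivs_static[OF regular_const] curve_derivs_mult[OF d(1) curve_derivs_mult[OF IH IH]]]])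
qed (simp only: curve_derivs.simps base_curve_inverse)

lemma curve_derivs_regular: "curve_derivs j u v w \<Longrightarrow> 0 \<le> t \<Longrightarrow> regular j (u t) \<and> regular j (v t) \<and> regular j (w t)"
proof (induction j arbitrary: u v w)
  case 0
  then show ?case using base_curveD[of u v w] by simp
next
  case (Suc j)
  then obtain d e f where "curve_derivs j d e f" "primitive a b (u t) (d t) \<and> primitive a b (v t) (e t) \<and> primitive a b (w t) (f t)"
    by auto
  then show ?case using Suc.IH[of d e f] Suc.prems by auto
qed

lemma base_quotient:
  assumes b: "base_curve u v w" and T: "0 \<le> T"
  shows "\<exists>K\<ge>0. \<forall>s\<in>{0..T}. \<forall>t\<in>{0..T}. s \<noteq> t \<longrightarrow> (\<forall>x\<in>{a..b}.
     \<bar>(u s x - u t x) / (s - t) - v t x\<bar> \<le> K * \<bar>s - t\<bar> \<and>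
     \<bar>(v s x - v t x) / (s - t) - w t x\<bar> \<le> K * \<bar>s - t\<bar> \<and>
     \<bar>w s x - w t x\<bar> \<le> K * \<bar>s - t\<bar>)"
proof -
  note D = base_curveD[OF b]
  obtain K1 where K1: "\<forall>s\<in>{0..T}. \<forall>t\<in>{0..T}. \<forall>x\<in>{a..b}. s \<noteq> t \<longrightarrow> \<bar>(u s x - u t x) / (s - t) - v t x\<bar> \<le> K1 * \<bar>s - t\<bar>"
    using time_Lip_difference_quotient[OF D(2) T D(7)] by blast
  obtain K2 where K2: "\<forall>s\<in>{0..T}. \<forall>t\<in>{0..T}. \<forall>x\<in>{a..b}. s \<noteq> t \<longrightarrow> \<bar>(v s x - v t x) / (s - t) - w t x\<bar> \<le> K2 * \<bar>s - t\<bar>"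
    using time_Lip_difference_quotient[OF D(3) T D(8)] by blast
  obtain K3 where K3: "0 \<le> K3" "\<And>t x. t \<in> {0..T} \<Longrightarrow> x \<in> {a..b} \<Longrightarrow> \<bar>w t x\<bar> \<le> K3"
     "\<And>s t x. s \<in> {0..T} \<Longrightarrow> t \<in> {0..T} \<Longrightarrow> x \<in> {a..b} \<Longrightarrow> \<bar>w s x - w t x\<bar> \<le> K3 * \<bar>s - t\<bar>"
    using time_Lip_D[OF D(3) T] by metis
  let ?K = "\<bar>K1\<bar> + \<bar>K2\<bar> + K3"
  have le: "K1 * r \<le> ?K * r" "K2 * r \<le> ?K * r" "K3 * r \<le> ?K * r" if "0 \<le> r" for r
    using K3(1) that by (auto intro!: mult_right_mono)
  show ?thesis
  proof (intro exI[of _ ?K] conjI ballI impI)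
    fix s t x assume *: "s \<in> {0..T}" "t \<in> {0..T}" "s \<noteq> t" "x \<in> {a..b}"
    show "\<bar>(u s x - u t x) / (s - t) - v t x\<bar> \<le> ?K * \<bar>s - t\<bar>" 
      using K1[rule_format, OF *(1,2,4,3)] le(1)[of "\<bar>s - t\<bar>"] by linarith
    show "\<bar>(v s x - v t x) / (s - t) - w t x\<bar> \<le> ?K * \<bar>s - t\<bar>" 
      using K2[rule_format, OF *(1,2,4,3)] le(2)[of "\<bar>s - t\<bar>"] by linarith
    show "\<bar>w s x - w t x\<bar> \<le> ?K * \<bar>s - t\<bar>" using K3(3)[OF *(1,2,4)] le(3)[of "\<bar>s - t\<bar>"] by linarith
  qed (use K3(1) in simp)
qed

lemma quotient_eq: "(\<lambda>x. (f x - g x) / k - h x) = (\<lambda>x. (1 / k) * (f x + -1 * g x) + -1 * h x)" for f g h :: "real \<Rightarrow> real"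
  by (auto simp: fun_eq_iff)

lemma B_diff: "B f \<Longrightarrow> B g \<Longrightarrow> B (\<lambda>x. f x - g x)"
  using B_add[OF _ B_mult[OF B_const[of "-1"]], of f g] by simp

lemma B_quotient: "B f \<Longrightarrow> B g \<Longrightarrow> B h \<Longrightarrow> B (\<lambda>x. (f x - g x) / k - h x)"
  unfolding quotient_eq by (intro B_add B_mult B_const)

lemma primitive_quotient:
  "primitive a b f f' \<Longrightarrow> primitive a b g g' \<Longrightarrow> primitive a b h h' \<Longrightarrow> primitive a b (\<lambda>x. (f x - g x) / k - h x) (\<lambda>x. (f' x - g' x) / k - h' x)"
  unfolding quotient_eq by (intro primitive_add primitive_cmult)

lemma primitive_diff: "primitive a b f f' \<Longrightarrow> primitive a b g g' \<Longrightarrow> primitive a b (\<lambda>x. f x - g x) (\<lambda>x. f' x - g' x)"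
  using primitive_add[OF _ primitive_cmult[of a b g g' "-1"], of f f'] by simp

text \<open>Difference quotients converge at first order in all spatial derivatives at once.\<close>

lemma small_quotient:
  assumes T: "0 \<le> T"
  shows "curve_derivs j u v w \<Longrightarrow> \<exists>K\<ge>0. \<forall>s\<in>{0..T}. \<forall>t\<in>{0..T}. s \<noteq> t \<longrightarrow>
     small (K * \<bar>s - t\<bar>) j (\<lambda>x. (u s x - u t x) / (s - t) - v t x) \<and>
     small (K * \<bar>s - t\<bar>) j (\<lambda>x. (v s x - v t x) / (s - t) - w t x) \<and>
     small (K * \<bar>s - t\<bar>) j (\<lambda>x. w s x - w t x)"
proof (induction j arbitrary: u v w)
  case 0
  then have b: "base_curve u v w" by simp
  obtain K where "0 \<le> K" and K: "\<forall>s\<in>{0..T}. \<forall>t\<in>{0..T}. s \<noteq> t \<longrightarrow> (\<forall>x\<in>{a..b}.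
     \<bar>(u s x - u t x) / (s - t) - v t x\<bar> \<le> K * \<bar>s - t\<bar> \<and>
     \<bar>(v s x - v t x) / (s - t) - w t x\<bar> \<le> K * \<bar>s - t\<bar> \<and>
     \<bar>w s x - w t x\<bar> \<le> K * \<bar>s - t\<bar>)"
    using base_quotient[OF b T] by blast
  note D = base_curveD(4-6)[OF b]
  show ?case
  proof (intro exI[of _ K] conjI ballI impI)
    fix s t assume *: "s \<in> {0..T}" "t \<in> {0..T}" "s \<noteq> t"
    then have st: "0 \<le> s" "0 \<le> t" by auto
    note K' = K[rule_format, OF *]
    show "small (K * \<bar>s - t\<bar>) 0 (\<lambda>x. (u s x - u t x) / (s - t) - v t x)"
      "small (K * \<bar>s - t\<bar>) 0 (\<lambda>x. (v s x - v t x) / (s - t) - w t x)"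
      "small (K * \<bar>s - t\<bar>) 0 (\<lambda>x. w s x - w t x)"
      unfolding small.simps by (intro conjI ballI B_quotient B_diff D st; use K' in blast)+
  qed fact
next
  case (Suc j)
  obtain d e f where d: "curve_derivs j d e f" and p: "\<And>t. 0 \<le> t \<Longrightarrow> primitive a b (u t) (d t) \<and> primitive a b (v t) (e t) \<and> primitive a b (w t) (f t)"
    using Suc.prems by auto
  obtain J where J0: "0 \<le> J" and J: "\<forall>s\<in>{0..T}. \<forall>t\<in>{0..T}. s \<noteq> t \<longrightarrow>
     small (J * \<bar>s - t\<bar>) j (\<lambda>x. (d s x - d t x) / (s - t) - e t x) \<and>
     small (J * \<bar>s - t\<bar>) j (\<lambda>x. (e s x - e t x) / (s - t) - f t x) \<and>
     small (J * \<bar>s - t\<bar>) j (\<lambda>x. f s x - f t x)" using Suc.IH[OF d] by blast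
  obtain K where K0: "0 \<le> K" and K: "\<forall>s\<in>{0..T}. \<forall>t\<in>{0..T}. s \<noteq> t \<longrightarrow> (\<forall>x\<in>{a..b}.
     \<bar>(u s x - u t x) / (s - t) - v t x\<bar> \<le> K * \<bar>s - t\<bar> \<and>
     \<bar>(v s x - v t x) / (s - t) - w t x\<bar> \<le> K * \<bar>s - t\<bar> \<and>
     \<bar>w s x - w t x\<bar> \<le> K * \<bar>s - t\<bar>)"
    using base_quotient[OF curve_derivs_base[OF Suc.prems] T] by blast
  show ?case
  proof (intro exI[of _ "K + J"] conjI ballI impI)
    fix s t assume *: "s \<in> {0..T}" "t \<in> {0..T}" "s \<noteq> t"
    then have ps: "primitive a b (u s) (d s)" "primitive a b (v s) (e s)" "primitive a b (w s) (f s)"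
      and pt: "primitive a b (u t) (d t)" "primitive a b (v t) (e t)" "primitive a b (w t) (f t)" using p by auto
    have le: "K * \<bar>s - t\<bar> \<le> (K + J) * \<bar>s - t\<bar>" "J * \<bar>s - t\<bar> \<le> (K + J) * \<bar>s - t\<bar>"
      using J0 K0 by (auto intro!: mult_right_mono)
    note K' = K[rule_format, OF *] and J' = J[rule_format, OF *]
    show "small ((K + J) * \<bar>s - t\<bar>) (Suc j) (\<lambda>x. (u s x - u t x) / (s - t) - v t x)"
      unfolding small.simps(2)
      by (intro conjI ballI exI[of _ "\<lambda>x. (d s x - d t x) / (s - t) - e t x"] primitive_quotient ps pt small_mono[OF _ le(2)] order_trans[OF _ le(1)])
         (use K' J' in blast)+
    show "small ((K + J) * \<bar>s - t\<bar>) (Suc j) (\<lambda>x. (v s x - v t x) / (s - t) - w t x)"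
      unfolding small.simps(2)
      by (intro conjI ballI exI[of _ "\<lambda>x. (e s x - e t x) / (s - t) - f t x"] primitive_quotient ps pt small_mono[OF _ le(2)] order_trans[OF _ le(1)])
         (use K' J' in blast)+
    show "small ((K + J) * \<bar>s - t\<bar>) (Suc j) (\<lambda>x. w s x - w t x)"
      unfolding small.simps(2)
      by (intro conjI ballI exI[of _ "\<lambda>x. f s x - f t x"] primitive_diff ps pt small_mono[OF _ le(2)] order_trans[OF _ le(1)])
         (use K' J' in blast)+
  qed (use K0 J0 in simp)
qed

end

section \<open>Sobolev and classical spaces as iterated primitives\<close>

text \<open>Bounded everywhere on \<open>[a,b]\<close>, not just almost everywhere: a choice of representative which makes the
class closed under pointwise operations with explicit bounds.\<close>

definition bounded_measurable :: "real \<Rightarrow> real \<Rightarrow> (real \<Rightarrow> real) \<Rightarrow> bool" where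
  "bounded_measurable a b f \<longleftrightarrow> set_borel_measurable lborel {a..b} f \<and> (\<exists>K. \<forall>x\<in>{a..b}. \<bar>f x\<bar> \<le> K)"

lemma bounded_measurableI: "set_borel_measurable lborel {a..b} f \<Longrightarrow> (\<And>x. x \<in> {a..b} \<Longrightarrow> \<bar>f x\<bar> \<le> K) \<Longrightarrow> bounded_measurable a b f"
  unfolding bounded_measurable_def by blast

lemma bounded_measurable_bound: "bounded_measurable a b f \<Longrightarrow> \<exists>K. \<forall>x\<in>{a..b}. \<bar>f x\<bar> \<le> K"
  unfolding bounded_measurable_def by blast

lemma bounded_measurable_integrable:
  assumes "bounded_measurable a b f"
  shows "set_integrable lborel {a..b} f"
proof -
  obtain K where K: "\<And>x. x \<in> {a..b} \<Longrightarrow> \<bar>f x\<bar> \<le> K" using bounded_measurable_bound[OF assms] by blast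
  have m: "(\<lambda>x. indicator {a..b} x *\<^sub>R f x) \<in> borel_measurable lborel"
    using assms by (simp add: bounded_measurable_def set_borel_measurable_def)
  have "integrable lborel (\<lambda>x. indicator {a..b} x * K)"
    using set_integrable_continuous[of a b "\<lambda>_. K"] by (simp add: set_integrable_def)
  then show ?thesis unfolding set_integrable_def
  proof (rule Bochner_Integration.integrable_bound[OF _ m])
    show "AE x in lborel. norm (indicator {a..b} x *\<^sub>R f x) \<le> norm (indicator {a..b} x * K)"
      using K by (intro AE_I2) (force simp: indicator_def)
  qed
qed

locale interval =
  fixes a b :: real
  assumes a_less_b: "a < b"

sublocale interval \<subseteq> W: base_class a b "bounded_measurable a b"
proof unfold_locales
  show "a < b" by (rule a_less_b)
  fix f g :: "real \<Rightarrow> real"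
  show "bounded_measurable a b f" if f: "continuous_on {a..b} f"
  proof -
    obtain K where "\<And>x. x \<in> {a..b} \<Longrightarrow> \<bar>f x\<bar> \<le> K" using compact_bound[OF f] by blast
    then show ?thesis by (intro bounded_measurableI[OF set_integrable_measurable[OF set_integrable_continuous[OF f]]])
  qed
  show "set_integrable lborel {a..b} f" if f: "bounded_measurable a b f" by (rule bounded_measurable_integrable[OF f])
  show "\<exists>K. \<forall>x\<in>{a..b}. \<bar>f x\<bar> \<le> K" if "bounded_measurable a b f" using that by (simp add: bounded_measurable_def)
  show "bounded_measurable a b (\<lambda>x. f x + g x)" if f: "bounded_measurable a b f" and g: "bounded_measurable a b g"
  proof -
    obtain K J where K: "\<forall>x\<in>{a..b}. \<bar>f x\<bar> \<le> K" and J: "\<forall>x\<in>{a..b}. \<bar>g x\<bar> \<le> J" using f g by (auto simp: bounded_measurable_def)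
    show ?thesis
    proof (rule bounded_measurableI)
      show "set_borel_measurable lborel {a..b} (\<lambda>x. f x + g x)"
        using f g by (auto simp: bounded_measurable_def set_borel_measurable_def distrib_left)
      show "\<bar>f x + g x\<bar> \<le> K + J" if "x \<in> {a..b}" for x using K[rule_format, OF that] J[rule_format, OF that] by linarith
    qed
  qed
  show "bounded_measurable a b (\<lambda>x. f x * g x)" if f: "bounded_measurable a b f" and g: "bounded_measurable a b g"
  proof -
    obtain K J where K: "\<forall>x\<in>{a..b}. \<bar>f x\<bar> \<le> K" and J: "\<forall>x\<in>{a..b}. \<bar>g x\<bar> \<le> J" using f g by (auto simp: bounded_measurable_def)
    show ?thesis
    proof (rule bounded_measurableI)
      have "(\<lambda>x. indicator {a..b} x *\<^sub>R (f x * g x)) = (\<lambda>x. (indicator {a..b} x *\<^sub>R f x) * (indicator {a..b} x *\<^sub>R g x))"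
        by (auto simp: indicator_def fun_eq_iff)
      then show "set_borel_measurable lborel {a..b} (\<lambda>x. f x * g x)"
        using f g unfolding bounded_measurable_def set_borel_measurable_def by (simp only: borel_measurable_times)
      show "\<bar>f x * g x\<bar> \<le> K * J" if "x \<in> {a..b}" for x
        unfolding abs_mult using K[rule_format, OF that] J[rule_format, OF that] by (intro mult_mono) auto
    qed
  qed
  show "bounded_measurable a b (\<lambda>x. 1 / f x)" if f: "bounded_measurable a b f" and c: "0 < c" "\<And>x. x \<in> {a..b} \<Longrightarrow> c \<le> f x" for c
  proof (rule bounded_measurableI)
    have "(\<lambda>x. indicator {a..b} x *\<^sub>R (1 / f x)) = (\<lambda>x. 1 / (indicator {a..b} x *\<^sub>R f x))"
      by (auto simp: indicator_def fun_eq_iff)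
    then show "set_borel_measurable lborel {a..b} (\<lambda>x. 1 / f x)"
      using f by (auto simp: bounded_measurable_def set_borel_measurable_def simp del: real_scaleR_def)
    show "\<bar>1 / f x\<bar> \<le> 1 / c" if "x \<in> {a..b}" for x
      unfolding abs_divide using c(2)[OF that] c(1) by (intro frac_le) auto
  qed
qed

sublocale interval \<subseteq> C: base_class a b "continuous_on {a..b}"
proof unfold_locales
  fix f g :: "real \<Rightarrow> real" and c :: real
  show "set_integrable lborel {a..b} f" if "continuous_on {a..b} f" by (rule set_integrable_continuous[OF that])
  show "\<exists>K. \<forall>x\<in>{a..b}. \<bar>f x\<bar> \<le> K" if "continuous_on {a..b} f" using compact_bound[OF that] by metis
  show "continuous_on {a..b} (\<lambda>x. 1 / f x)" if "continuous_on {a..b} f" "0 < c" "\<And>x. x \<in> {a..b} \<Longrightarrow> c \<le> f x"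
    using that by (intro continuous_intros) force+
qed (auto intro: continuous_intros a_less_b)

lemma is_weak_deriv_locally_integrable:
  "is_weak_deriv a b n f g \<Longrightarrow> locally_integrable a b f" "is_weak_deriv a b n f g \<Longrightarrow> locally_integrable a b g"
  by (simp_all add: is_weak_deriv_def)

text \<open>What the choice in the definition of the weak derivative guarantees.\<close>

lemma wderiv_props:
  assumes "is_weak_deriv a b n f g"
  shows "is_weak_deriv a b n f (wderiv a b n f)"
    and "is_weak_deriv a b n f h \<Longrightarrow> continuous_on {a..b} h \<Longrightarrow> continuous_on {a..b} (wderiv a b n f)"
proof -
  let ?P = "\<lambda>g. is_weak_deriv a b n f g \<and> ((\<exists>h. is_weak_deriv a b n f h \<and> continuous_on {a..b} h) \<longrightarrow> continuous_on {a..b} g)"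
  have "\<exists>g. ?P g" using assms by blast
  then have *: "?P (wderiv a b n f)" unfolding wderiv_def by (rule someI_ex)
  then show "is_weak_deriv a b n f (wderiv a b n f)" by blast
  show "continuous_on {a..b} (wderiv a b n f)" if "is_weak_deriv a b n f h" "continuous_on {a..b} h" using * that by blast
qed

text \<open>Local integrability controls the function only on compact subintervals; the endpoints are two points,
at which any values are measurable.\<close>

lemma locally_integrable_measurable:
  assumes ab: "a < b" and f: "locally_integrable a b f"
  shows "set_borel_measurable lborel {a..b} f"
proof -
  define \<delta> where "\<delta> n = (b - a) / (real n + 3)" for n
  have d0: "\<delta> \<longlonglongrightarrow> 0" unfolding \<delta>_def by real_asymp
  have m: "(\<lambda>x. indicator {a + \<delta> n..b - \<delta> n} x * f x) \<in> borel_measurable borel" for n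
  proof -
    have "set_integrable lborel {a + \<delta> n..b - \<delta> n} f"
      by (rule locally_integrableD[OF f]) (use ab in \<open>auto simp: \<delta>_def\<close>)
    from set_integrable_measurable[OF this] show ?thesis by (simp add: set_borel_measurable_def)
  qed
  have "(\<lambda>x. indicator {a<..<b} x * f x) \<in> borel_measurable borel"
  proof (rule borel_measurable_LIMSEQ_real[OF _ m])
    fix x
    show "(\<lambda>n. indicator {a + \<delta> n..b - \<delta> n} x * f x) \<longlonglongrightarrow> indicator {a<..<b} x * f x"
    proof (cases "x \<in> {a<..<b}")
      case True
      have "\<forall>\<^sub>F n in sequentially. \<delta> n < min (x - a) (b - x)"
        using True d0 by (intro order_tendstoD(2)) auto
      then have "\<forall>\<^sub>F n in sequentially. indicator {a + \<delta> n..b - \<delta> n} x * f x = indicator {a<..<b} x * f x"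
        by eventually_elim (use True in \<open>auto simp: indicator_def\<close>)
      then show ?thesis by (rule tendsto_eventually)
    next
      case False
      have "x \<notin> {a + \<delta> n..b - \<delta> n}" for n
      proof -
        have "0 < \<delta> n" using ab by (simp add: \<delta>_def)
        then show ?thesis using False by auto
      qed
      then have "indicator {a + \<delta> n..b - \<delta> n} x * f x = 0" for n by (metis indicator_simps(2) mult_zero_left)
      moreover have "indicator {a<..<b} x * f x = 0" using False by (metis indicator_simps(2) mult_zero_left)
      ultimately show ?thesis by (simp only: tendsto_const)
    qed
  qed
  then have "(\<lambda>x. indicator {a<..<b} x * f x + indicator {a} x * f a + indicator {b} x * f b) \<in> borel_measurable borel"
    by measurable
  moreover have "(\<lambda>x. indicator {a<..<b} x * f x + indicator {a} x * f a + indicator {b} x * f b) = (\<lambda>x. indicator {a..b} x * f x)"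
    using ab by (auto simp: indicator_def fun_eq_iff)
  ultimately show ?thesis by (simp add: set_borel_measurable_def)
qed

lemma measurable_leb_iff: "f \<in> borel_measurable (leb a b) \<longleftrightarrow> set_borel_measurable lborel {a..b} (f :: real \<Rightarrow> real)"
  by (subst borel_measurable_restrict_space_iff) (auto simp: set_borel_measurable_def)

lemma AE_leb_iff: "(AE x in leb a b. P x) \<longleftrightarrow> (AE x in lborel. x \<in> {a..b} \<longrightarrow> P x)"
  by (rule AE_restrict_space_iff) simp

lemma AE_Ioo_Icc: "(AE x in lborel. x \<in> {a<..<b} \<longrightarrow> P x) \<longleftrightarrow> (AE x in lborel. x \<in> {a..b::real} \<longrightarrow> P x)"
proof
  assume "AE x in lborel. x \<in> {a<..<b} \<longrightarrow> P x"
  then show "AE x in lborel. x \<in> {a..b} \<longrightarrow> P x"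
    using AE_lborel_singleton[of a] AE_lborel_singleton[of b] by eventually_elim auto
qed (auto elim: eventually_mono)

lemma Linf_norm_le:
  assumes m: "f \<in> borel_measurable (leb a b)" and ae: "AE x in lborel. x \<in> {a<..<b} \<longrightarrow> f x = g x"
    and g: "\<And>x. x \<in> {a..b} \<Longrightarrow> \<bar>g x\<bar> \<le> r"
  shows "Linf_norm a b f \<le> ennreal r"
  unfolding Linf_norm_def
proof (rule esssup_I)
  show "(\<lambda>x. ennreal \<bar>f x\<bar>) \<in> borel_measurable (leb a b)" using m by measurable
  have "AE x in lborel. x \<in> {a..b} \<longrightarrow> f x = g x" using ae unfolding AE_Ioo_Icc .
  then show "AE x in leb a b. ennreal \<bar>f x\<bar> \<le> ennreal r"
    unfolding AE_leb_iff by eventually_elim (use g in \<open>auto intro!: ennreal_leI\<close>)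
qed

lemma bounded_measurable_Linf: "bounded_measurable a b g \<Longrightarrow> g \<in> Linf a b"
proof -
  assume g: "bounded_measurable a b g"
  have m: "g \<in> borel_measurable (leb a b)" using g by (simp add: measurable_leb_iff bounded_measurable_def)
  obtain K where "\<And>x. x \<in> {a..b} \<Longrightarrow> \<bar>g x\<bar> \<le> K" using bounded_measurable_bound[OF g] by blast
  then have "Linf_norm a b g \<le> ennreal K" by (intro Linf_norm_le[OF m]) auto
  then show ?thesis using m by (auto simp: Linf_def intro: le_less_trans)
qed

text \<open>The values where the essential bound is violated are replaced by \<open>0\<close>.\<close>

lemma Linf_bounded_representative:
  assumes "g \<in> Linf a b"
  obtains h where "bounded_measurable a b h" "AE x in lborel. x \<in> {a<..<b} \<longrightarrow> g x = h x"
proof -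
  have m: "g \<in> borel_measurable (leb a b)" and fin: "Linf_norm a b g < \<infinity>" using assms by (auto simp: Linf_def)
  obtain K where K: "Linf_norm a b g = ennreal K" "0 \<le> K" using fin by (cases "Linf_norm a b g") auto
  have "AE x in leb a b. ennreal \<bar>g x\<bar> \<le> ennreal K"
    using esssup_AE[of "\<lambda>x. ennreal \<bar>g x\<bar>" "leb a b"] K(1) by (simp add: Linf_norm_def)
  then have ae: "AE x in lborel. x \<in> {a..b} \<longrightarrow> \<bar>g x\<bar> \<le> K"
    unfolding AE_leb_iff using K(2) by (simp add: ennreal_le_iff)
  define h where "h x = (if \<bar>g x\<bar> \<le> K then g x else 0)" for x
  show thesis
  proof (rule that)
    show "bounded_measurable a b h"
    proof (rule bounded_measurableI)
      have "h \<in> borel_measurable (leb a b)" unfolding h_def using m by measurable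
      then show "set_borel_measurable lborel {a..b} h" by (simp add: measurable_leb_iff)
      show "\<bar>h x\<bar> \<le> K" for x using K(2) by (simp add: h_def)
    qed
    show "AE x in lborel. x \<in> {a<..<b} \<longrightarrow> g x = h x" using ae by eventually_elim (auto simp: h_def)
  qed
qed

context interval
begin

lemma small_weak_deriv:
  "W.small r j f \<Longrightarrow> n \<le> j \<Longrightarrow> \<exists>g. is_weak_deriv a b n f g \<and> bounded_measurable a b g \<and> (\<forall>x\<in>{a..b}. \<bar>g x\<bar> \<le> r)"
proof (induction j arbitrary: f n)
  case 0
  then have "bounded_measurable a b f \<and> (\<forall>x\<in>{a..b}. \<bar>f x\<bar> \<le> r)" "n = 0" by auto
  then show ?case using weak_deriv_0[OF locally_integrable_of_set_integrable[OF bounded_measurable_integrable]] by blast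
next
  case (Suc j)
  then obtain g where g: "primitive a b f g" "W.small r j g" and f: "\<forall>x\<in>{a..b}. \<bar>f x\<bar> \<le> r" by auto
  show ?case
  proof (cases n)
    case 0
    have "bounded_measurable a b f" by (rule W.B_cont[OF primitive_continuous[OF g(1)]])
    then show ?thesis using f 0 weak_deriv_0[OF locally_integrable_of_set_integrable[OF bounded_measurable_integrable]] by blast
  next
    case (Suc k)
    then obtain h where "is_weak_deriv a b k g h" "bounded_measurable a b h" "\<forall>x\<in>{a..b}. \<bar>h x\<bar> \<le> r"
      using Suc.IH[OF g(2), of k] Suc.prems by auto
    then show ?thesis using weak_deriv_Suc[OF weak_deriv_primitive[OF g(1)]] Suc by blast
  qed
qed

lemma small_sobolev_norm:
  assumes "W.small r j f"
  shows "sobolev_inf_norm a b j f \<le> ennreal (real (j + 1) * r)"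
proof -
  have r: "0 \<le> r" using assms a_less_b by (cases j) (auto dest!: bspec[of _ _ a])
  have "Linf_norm a b (wderiv a b n f) \<le> ennreal r" if n: "n \<le> j" for n
  proof -
    obtain g where g: "is_weak_deriv a b n f g" "\<forall>x\<in>{a..b}. \<bar>g x\<bar> \<le> r" using small_weak_deriv[OF assms n] by blast
    note w = wderiv_props(1)[OF g(1)]
    show ?thesis
    proof (rule Linf_norm_le[OF _ weak_deriv_unique[OF w g(1)]])
      show "wderiv a b n f \<in> borel_measurable (leb a b)"
        unfolding measurable_leb_iff
        by (rule locally_integrable_measurable[OF a_less_b is_weak_deriv_locally_integrable(2)[OF w]])
    qed (use g(2) in auto)
  qed
  then have "sobolev_inf_norm a b j f \<le> (\<Sum>n\<le>j. ennreal r)" unfolding sobolev_inf_norm_def by (intro sum_mono) auto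
  also have "\<dots> = ennreal (real (j + 1) * r)" using r by (simp add: ennreal_of_nat_eq_real_of_nat ennreal_mult' add_ac flip: ennreal_plus)
  finally show ?thesis .
qed

lemma regular_imp_small: "W.regular j f \<Longrightarrow> \<exists>r. W.small r j f"
proof (induction j arbitrary: f)
  case 0
  then show ?case using W.B_bounded by auto
next
  case (Suc j)
  then obtain g where "primitive a b f g" "W.regular j g" by auto
  then obtain r where g: "primitive a b f g" "W.small r j g" using Suc.IH[of g] by blast
  obtain K where K: "\<And>x. x \<in> {a..b} \<Longrightarrow> \<bar>f x\<bar> \<le> K" using compact_bound[OF primitive_continuous[OF g(1)]] by blast
  have "W.small (max r K) (Suc j) f" using g K W.small_mono[OF g(2), of "max r K"] by (auto intro: le_max_iff_disj[THEN iffD2])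
  then show ?case by blast
qed

lemma regular_sobolev:
  assumes "W.regular (Suc j) f"
  shows "f \<in> sobolev_inf a b (Suc j)"
proof -
  obtain r where r: "W.small r (Suc j) f" using regular_imp_small[OF assms] by blast
  have "continuous_on {a..b} f" using assms primitive_continuous by auto
  then show ?thesis unfolding sobolev_inf_def using small_weak_deriv[OF r] bounded_measurable_Linf by blast
qed

lemma weak_deriv_shift:
  assumes "is_weak_deriv a b 1 f g" "is_weak_deriv a b (Suc n) f h"
  shows "is_weak_deriv a b n g h"
  unfolding is_weak_deriv_def
proof (intro conjI allI impI)
  fix \<phi> assume t: "test_function a b \<phi>"
  show "(LINT x:{a<..<b}|lborel. g x * (deriv ^^ n) \<phi> x) = (-1) ^ n * (LINT x:{a<..<b}|lborel. h x * \<phi> x)"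
    using weak_deriv_integrals[OF assms(1) test_function_deriv_n[OF t, of n]] weak_deriv_integrals[OF assms(2) t] by simp
qed (use assms in \<open>auto simp: is_weak_deriv_def\<close>)

text \<open>Successive weak derivatives are turned into primitives: each one but the last may be
replaced by a continuous representative, and then the next one is its density.\<close>

lemma sobolev_regular:
  assumes "continuous_on {a..b} f" "\<And>n. n \<le> Suc j \<Longrightarrow> \<exists>g. is_weak_deriv a b n f g \<and> g \<in> Linf a b"
  shows "W.regular (Suc j) f"
  using assms
proof (induction j arbitrary: f)
  case 0
  obtain g where g: "is_weak_deriv a b 1 f g" "g \<in> Linf a b" using 0(2)[of 1] by auto
  obtain h where h: "bounded_measurable a b h" "AE x in lborel. x \<in> {a<..<b} \<longrightarrow> g x = h x"
    by (rule Linf_bounded_representative[OF g(2)])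
  have "is_weak_deriv a b 1 f h"
    by (rule weak_deriv_cong_AE[OF g(1) is_weak_deriv_locally_integrable(1)[OF g(1)] _
          locally_integrable_of_set_integrable[OF bounded_measurable_integrable[OF h(1)]] h(2)]) simp
  then obtain F where F: "primitive a b F h" "AE x in lborel. x \<in> {a<..<b} \<longrightarrow> f x = F x"
    using weak_deriv_imp_primitive[OF a_less_b _ bounded_measurable_integrable[OF h(1)]] by blast
  have "F x = f x" if "x \<in> {a..b}" for x
    using continuous_AE_eq[OF a_less_b 0(1) primitive_continuous[OF F(1)] F(2) that] by simp
  then have "primitive a b f h" by (rule primitive_cong[OF F(1)]) auto
  then show ?case using h(1) by auto
next
  case (Suc j)
  obtain g where g: "is_weak_deriv a b 1 f g" using Suc.prems(2)[of 1] by auto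
  obtain g2 where g2: "is_weak_deriv a b (Suc 1) f g2" "g2 \<in> Linf a b" using Suc.prems(2)[of "Suc 1"] by auto
  obtain h2 where h2: "bounded_measurable a b h2" "AE x in lborel. x \<in> {a<..<b} \<longrightarrow> g2 x = h2 x"
    by (rule Linf_bounded_representative[OF g2(2)])
  have "is_weak_deriv a b 1 g h2"
    by (rule weak_deriv_cong_AE[OF weak_deriv_shift[OF g g2(1)] is_weak_deriv_locally_integrable(2)[OF g] _
          locally_integrable_of_set_integrable[OF bounded_measurable_integrable[OF h2(1)]] h2(2)]) simp
  then obtain G where G: "primitive a b G h2" "AE x in lborel. x \<in> {a<..<b} \<longrightarrow> g x = G x"
    using weak_deriv_imp_primitive[OF a_less_b _ bounded_measurable_integrable[OF h2(1)]] by blast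
  note cG = primitive_continuous[OF G(1)]
  have lG: "locally_integrable a b G" by (rule locally_integrable_of_set_integrable[OF set_integrable_continuous[OF cG]])
  have fG: "is_weak_deriv a b 1 f G"
    by (rule weak_deriv_cong_AE[OF g is_weak_deriv_locally_integrable(1)[OF g] _ lG G(2)]) simp
  then obtain F where F: "primitive a b F G" "AE x in lborel. x \<in> {a<..<b} \<longrightarrow> f x = F x"
    using weak_deriv_imp_primitive[OF a_less_b _ set_integrable_continuous[OF cG]] by blast
  have "F x = f x" if "x \<in> {a..b}" for x
    using continuous_AE_eq[OF a_less_b Suc.prems(1) primitive_continuous[OF F(1)] F(2) that] by simp
  then have pf: "primitive a b f G" by (rule primitive_cong[OF F(1)]) auto
  have "W.regular (Suc j) G"
  proof (rule Suc.IH[OF cG])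
    fix n assume "n \<le> Suc j"
    then obtain h where "is_weak_deriv a b (Suc n) f h" "h \<in> Linf a b" using Suc.prems(2)[of "Suc n"] by auto
    then show "\<exists>h. is_weak_deriv a b n G h \<and> h \<in> Linf a b" using weak_deriv_shift[OF fG] by blast
  qed
  then show ?case using pf by auto
qed

lemma sobolev_iff_regular: "f \<in> sobolev_inf a b (Suc j) \<longleftrightarrow> W.regular (Suc j) f"
  using regular_sobolev sobolev_regular by (auto simp: sobolev_inf_def)

text \<open>Almost everywhere in general, and at every point, endpoints included, if the derivative has a continuous
representative.\<close>

lemma wderiv_primitive:
  assumes p: "primitive a b f g"
  shows "AE x in lborel. x \<in> {a..b} \<longrightarrow> wderiv a b 1 f x = g x"
    and "continuous_on {a..b} g \<Longrightarrow> x \<in> {a..b} \<Longrightarrow> wderiv a b 1 f x = g x"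
proof -
  note w = wderiv_props(1)[OF weak_deriv_primitive[OF p]]
  note ae = weak_deriv_unique[OF w weak_deriv_primitive[OF p]]
  show "AE x in lborel. x \<in> {a..b} \<longrightarrow> wderiv a b 1 f x = g x" using ae unfolding AE_Ioo_Icc .
  show "wderiv a b 1 f x = g x" if c: "continuous_on {a..b} g" and x: "x \<in> {a..b}"
    by (rule continuous_AE_eq[OF a_less_b wderiv_props(2)[OF w weak_deriv_primitive[OF p] c] c ae x])
qed

lemma cderiv_primitive:
  assumes p: "primitive a b f g" and c: "continuous_on {a..b} g" and x: "x \<in> {a..b}"
  shows "cderiv a b f x = g x"
  unfolding cderiv_def
  by (rule vector_derivative_within_cbox[OF _ _ , folded interval_cbox])
     (use primitive_imp_deriv[OF p c x] a_less_b x in \<open>auto simp: has_real_derivative_iff_has_vector_derivative\<close>)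

lemma cderiv_cong:
  assumes "\<And>x. x \<in> {a..b} \<Longrightarrow> f x = g x" "x \<in> {a..b}"
  shows "(cderiv a b ^^ n) f x = (cderiv a b ^^ n) g x"
  using assms
proof (induction n arbitrary: x)
  case (Suc n)
  have "vector_derivative ((cderiv a b ^^ n) f) (at x within {a..b}) = vector_derivative ((cderiv a b ^^ n) g) (at x within {a..b})"
    by (rule vector_derivative_cong_eq)
       (use Suc in \<open>auto simp: eventually_at intro!: exI[of _ 1]\<close>)
  then show ?case by (simp add: cderiv_def[of a b "(cderiv a b ^^ n) f"] cderiv_def[of a b "(cderiv a b ^^ n) g"])
qed simp

lemma C_regular_continuous: "C.regular j f \<Longrightarrow> continuous_on {a..b} f"
  by (cases j) (auto intro: primitive_continuous)

lemma cderiv_n_primitive: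
  assumes "primitive a b f g" "continuous_on {a..b} g" "x \<in> {a..b}"
  shows "(cderiv a b ^^ Suc n) f x = (cderiv a b ^^ n) g x"
  using cderiv_cong[of "cderiv a b f" g x n] cderiv_primitive[OF assms(1,2)] assms(3)
  by (simp add: funpow_swap1)

lemma C_small_continuous: "C.small r j f \<Longrightarrow> continuous_on {a..b} f"
  by (cases j) (auto intro: primitive_continuous)

lemma C_small_bound: "C.small r j f \<Longrightarrow> n \<le> j \<Longrightarrow> x \<in> {a..b} \<Longrightarrow> \<bar>(cderiv a b ^^ n) f x\<bar> \<le> r"
proof (induction j arbitrary: f n)
  case (Suc j)
  then obtain g where g: "primitive a b f g" "C.small r j g" and f: "\<forall>x\<in>{a..b}. \<bar>f x\<bar> \<le> r" by auto
  show ?case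
  proof (cases n)
    case 0 then show ?thesis using f Suc.prems by simp
  next
    case (Suc k)
    show ?thesis unfolding Suc cderiv_n_primitive[OF g(1) C_small_continuous[OF g(2)] \<open>x \<in> {a..b}\<close>]
      using Suc.IH[OF g(2)] Suc.prems Suc by auto
  qed
qed simp

lemma C_small_norm:
  assumes "C.small r j f"
  shows "C_norm a b j f \<le> ennreal (real (j + 1) * r)"
proof -
  have r: "0 \<le> r" using assms a_less_b by (cases j) (auto dest!: bspec[of _ _ a])
  have "C_norm a b j f \<le> (\<Sum>n\<le>j. ennreal r)" unfolding C_norm_def
    by (intro sum_mono SUP_least ennreal_leI C_small_bound[OF assms]) auto
  also have "\<dots> = ennreal (real (j + 1) * r)" using r by (simp add: ennreal_of_nat_eq_real_of_nat ennreal_mult' add_ac flip: ennreal_plus)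
  finally show ?thesis .
qed

lemma C_regular_C_space: "C.regular j f \<Longrightarrow> f \<in> C_space a b j"
proof (induction j arbitrary: f)
  case (Suc j)
  then obtain g where g: "primitive a b f g" "C.regular j g" by auto
  note cg = C_regular_continuous[OF g(2)]
  have S: "g \<in> C_space a b j" by (rule Suc.IH[OF g(2)])
  have dd: "f differentiable (at x within {a..b})" if "x \<in> {a..b}" for x
    using primitive_imp_deriv[OF g(1) cg that] by (auto simp: real_differentiable_def)
  have eq: "(cderiv a b ^^ Suc n) f x = (cderiv a b ^^ n) g x" if "x \<in> {a..b}" for n x
    by (rule cderiv_n_primitive[OF g(1) cg that])
  have "(cderiv a b ^^ n) f differentiable (at x within {a..b})" if "n < Suc j" "x \<in> {a..b}" for n x
  proof (cases n)
    case 0 then show ?thesis using dd that by simp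
  next
    case (Suc i)
    have "(cderiv a b ^^ i) g differentiable (at x within {a..b})" using S that Suc by (auto simp: C_space_def)
    then show ?thesis unfolding Suc
      by (rule differentiable_transform_within[where d = 1]) (use that eq in auto)
  qed
  moreover have "continuous_on {a..b} ((cderiv a b ^^ Suc j) f)"
    by (rule continuous_on_cong[THEN iffD1, OF refl eq[symmetric]]) (use S in \<open>auto simp: C_space_def\<close>)
  ultimately show ?case by (auto simp: C_space_def)
qed (simp add: C_space_def)

lemma C_space_C_regular: "f \<in> C_space a b j \<Longrightarrow> C.regular j f"
proof (induction j arbitrary: f)
  case (Suc j)
  have S: "cderiv a b f \<in> C_space a b j"
    using Suc.prems unfolding C_space_def by (auto simp: funpow_swap1)
  have R: "C.regular j (cderiv a b f)" by (rule Suc.IH[OF S])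
  have "(f has_real_derivative cderiv a b f x) (at x within {a..b})" if x: "x \<in> {a..b}" for x
  proof -
    have "f differentiable (at x within {a..b})" using Suc.prems x unfolding C_space_def by force
    then show ?thesis unfolding cderiv_def has_real_derivative_iff_has_vector_derivative
      by (simp add: vector_derivative_works)
  qed
  then have "primitive a b f (cderiv a b f)" by (rule primitive_of_deriv[OF _ C_regular_continuous[OF R]])
  then show ?case using R by auto
qed (simp add: C_space_def)

end

section \<open>Regularity in space and the fluxes\<close>

context base_class
begin

lemma regular_Suc_imp: "regular (Suc j) f \<Longrightarrow> regular j f"
proof (induction j arbitrary: f)
  case 0 then show ?case by (auto intro: B_cont primitive_continuous)
next
  case (Suc j)
  then obtain g where "primitive a b f g" "regular (Suc j) g" unfolding regular.simps(2)[of "Suc j"] by blast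
  then show ?case using Suc.IH by auto
qed

lemma regular_le: "regular n f \<Longrightarrow> j \<le> n \<Longrightarrow> regular j f"
  by (induction n) (auto simp: le_Suc_eq simp del: regular.simps dest: regular_Suc_imp)

lemma curve_derivs_le: "curve_derivs n u v w \<Longrightarrow> j \<le> n \<Longrightarrow> curve_derivs j u v w"
  by (induction n) (auto simp: le_Suc_eq simp del: curve_derivs.simps dest: curve_derivs_Suc_imp)

text \<open>The form in which the calculus is applied: time derivatives are not spelled out.\<close>

definition curve :: "nat \<Rightarrow> (real \<Rightarrow> real \<Rightarrow> real) \<Rightarrow> bool" where
  "curve j u \<longleftrightarrow> (\<exists>v w. curve_derivs j u v w)"

lemma curveI: "curve_derivs j u v w \<Longrightarrow> curve j u"
  by (auto simp: curve_def)

lemma curve_add: "curve j u \<Longrightarrow> curve j v \<Longrightarrow> curve j (\<lambda>t x. u t x + v t x)"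
  and curve_mult: "curve j u \<Longrightarrow> curve j v \<Longrightarrow> curve j (\<lambda>t x. u t x * v t x)"
  and curve_inverse: "curve j u \<Longrightarrow> bounded_below u \<Longrightarrow> curve j (\<lambda>t x. 1 / u t x)"
  and curve_static: "regular j f \<Longrightarrow> curve j (\<lambda>t x. f x)"
  and curve_time: "curve j (\<lambda>t x. t)"
  unfolding curve_def by (blast intro: curve_derivs_add curve_derivs_mult curve_derivs_inverse curve_derivs_static curve_derivs_time)+

lemma curve_derivs_Suc_of_curve:
  assumes "base_curve u v w" "curve j d" "\<And>t. 0 \<le> t \<Longrightarrow> primitive a b (u t) (d t)"
  shows "curve_derivs (Suc j) u v w"
  using assms(2) curve_derivs_SucI[OF assms(1,3)] unfolding curve_def by blast

lemma regular_add: "regular j f \<Longrightarrow> regular j g \<Longrightarrow> regular j (\<lambda>x. f x + g x)"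
  using curve_derivs_regular[OF curve_derivs_add[OF curve_derivs_static curve_derivs_static], of j f g 0] by simp

lemma regular_mult: "regular j f \<Longrightarrow> regular j g \<Longrightarrow> regular j (\<lambda>x. f x * g x)"
  using curve_derivs_regular[OF curve_derivs_mult[OF curve_derivs_static curve_derivs_static], of j f g 0] by simp

lemma regular_inverse:
  assumes "regular j f" "0 < c" "\<And>x. x \<in> {a..b} \<Longrightarrow> c \<le> f x"
  shows "regular j (\<lambda>x. 1 / f x)"
proof -
  have "bounded_below (\<lambda>t. f)" using assms(2,3) by (auto simp: bounded_below_def)
  from curve_derivs_regular[OF curve_derivs_inverse[OF curve_derivs_static[OF assms(1)] this], of 0] show ?thesis by simp
qed

lemma regular_ident: "regular j (\<lambda>x. x)"
proof (cases j)
  case (Suc i)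
  have "primitive a b (\<lambda>x. x) (\<lambda>x. 1)"
    by (rule primitive_of_deriv) (auto intro!: derivative_eq_intros)
  then show ?thesis using Suc regular_const[of i 1] by auto
qed (simp add: B_cont)

end

context igr_acceleration
begin

lemma q_low:
  assumes "base_class a b P"
  shows "base_class.bounded_below a b q"
  unfolding base_class.bounded_below_def[OF assms] using q_bounds by (metis)

text \<open>If \<open>\<Phi>\<close> and \<open>p\<close> are curves of order \<open>j\<close>, the right-hand sides of their equations are, too, by the
calculus, and so both are of order \<open>j + 1\<close>, as long as \<open>m\<close> and \<open>u1\<close> permit. The final order of
\<open>\<Phi>\<close> is \<open>k + 2\<close> because \<open>m\<close>, \<open>u1\<close> and therefore \<open>\<Phi>' = m / q\<close> have order \<open>k + 1\<close>.\<close>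

lemma bootstrap:
  assumes cls: "base_class a b P" and m: "base_class.regular a b P (Suc k) m" and u1: "base_class.regular a b P (Suc k) u1"
  shows "base_class.curve_derivs a b P (Suc (Suc k)) \<Phi> V A \<and> base_class.curve_derivs a b P (Suc k) p R B"
proof -
  interpret K: base_class a b P by (rule cls)
  have "primitive a b u0 u1" by (rule primitive_of_deriv[OF u0_deriv cont_u1])
  then have u0: "K.regular (Suc (Suc k)) u0" using u1 unfolding K.regular.simps(2)[of "Suc k"] by blast
  have b\<Phi>: "K.base_curve \<Phi> V A" unfolding K.base_curve_def
    by (intro conjI allI impI ballI time_Lip_flow time_Lip_velocity time_Lip_acceleration flow_time_deriv velocity_time_deriv
        K.B_cont DERIV_continuous_on[OF flow(4)] DERIV_continuous_on[OF V_deriv] DERIV_continuous_on[OF A_deriv])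
  have bp: "K.base_curve p R B" unfolding K.base_curve_def
    by (intro conjI allI impI ballI time_Lip_flow time_Lip_velocity time_Lip_acceleration flow_time_deriv velocity_time_deriv
        K.B_cont DERIV_continuous_on[OF flow(5)] DERIV_continuous_on[OF R_deriv] DERIV_continuous_on[OF B_deriv])
  note D\<Phi> = DERIV_continuous_on[OF flow(4)]
  have pp: "primitive a b (p t) (\<lambda>x. (- 1 / \<alpha>) * (m x * (\<Phi> t x + (-1 * x + -1 * (t * u0 x)))))" if t: "0 \<le> t" for t
    by (rule primitive_of_deriv[OF DERIV_cong[OF flow(5)[OF t]]])
       (use \<alpha> in \<open>auto intro!: continuous_intros cont_m cont_u0 D\<Phi> t simp: field_simps\<close>)
  have p\<Phi>: "primitive a b (\<Phi> t) (\<lambda>x. m x * (1 / q t x))" if t: "0 \<le> t" for t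
  proof (rule primitive_of_deriv[OF DERIV_cong[OF flow(4)[OF t]]])
    have "q t x \<noteq> 0" if "x \<in> {a..b}" for x using flow(3)[OF t that] by simp
    then show "continuous_on {a..b} (\<lambda>x. m x * (1 / q t x))" by (intro continuous_intros cont_m cont_q t) auto
  qed auto
  have stepp: "K.curve j (\<lambda>t x. (- 1 / \<alpha>) * (m x * (\<Phi> t x + (-1 * x + -1 * (t * u0 x)))))"
    if j: "j \<le> Suc k" and c: "K.curve j \<Phi>" for j
    by (intro K.curve_mult K.curve_add K.curve_time c K.curve_static K.regular_const K.regular_ident
        K.regular_le[OF m] K.regular_le[OF u0] j le_SucI)
  have stepq: "K.curve j (\<lambda>t x. m x * (1 / q t x))" if j: "j \<le> Suc k" and c: "K.curve j p" for j
  proof -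
    have "K.curve j (\<lambda>t x. p t x + (m x + -1 * (t * (m x * u1 x))))"
      by (intro K.curve_mult K.curve_add K.curve_time c K.curve_static K.regular_const K.regular_le[OF m] K.regular_le[OF u1] j)
    moreover have "(\<lambda>t x. p t x + (m x + -1 * (t * (m x * u1 x)))) = q"
      by (auto simp: fun_eq_iff q_eq algebra_simps)
    ultimately have "K.curve j q" by simp
    then show ?thesis
      by (intro K.curve_mult K.curve_inverse q_low[OF cls] K.curve_static K.regular_le[OF m j])
  qed
  have "j \<le> Suc k \<Longrightarrow> K.curve_derivs j \<Phi> V A \<and> K.curve_derivs j p R B" for j
  proof (induction j)
    case (Suc j)
    then have j: "j \<le> Suc k" and c: "K.curve j \<Phi>" "K.curve j p" by (auto intro: K.curveI)
    show ?case
      by (intro conjI K.curve_derivs_Suc_of_curve[OF b\<Phi> stepq[OF j c(2)] p\<Phi>] K.curve_derivs_Suc_of_curve[OF bp stepp[OF j c(1)] pp])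
  qed (simp add: b\<Phi> bp)
  then have cp: "K.curve_derivs (Suc k) p R B" by blast
  then show ?thesis using K.curve_derivs_Suc_of_curve[OF b\<Phi> stepq[OF order_refl K.curveI[OF cp]] p\<Phi>] by blast
qed

text \<open>In terms of the momenta, the two fluxes of the equation are \<open>2 Z\<^sup>2 / q - B\<close> and \<open>Z\<^sup>2 / q\<close>.\<close>

lemma flux_regular:
  assumes cls: "base_class a b P" and m: "base_class.regular a b P (Suc k) m" and u1: "base_class.regular a b P (Suc k) u1"
    and t: "0 \<le> t"
  shows "base_class.regular a b P 1 (\<lambda>x. Z t x * Z t x * (1 / q t x))"
proof -
  interpret K: base_class a b P by (rule cls)
  have c: "K.curve_derivs 1 p R B" by (rule K.curve_derivs_le[OF conjunct2[OF bootstrap[OF cls m u1]]]) simp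
  have mu: "K.regular 1 m" "K.regular 1 u1" by (rule K.regular_le[OF m] K.regular_le[OF u1], simp)+
  have pR: "K.regular 1 (p t)" "K.regular 1 (R t)" using K.curve_derivs_regular[OF c t] by blast+
  have "K.regular 1 (\<lambda>x. R t x + -1 * (m x * u1 x))" "K.regular 1 (\<lambda>x. p t x + m x * (1 + (- t) * u1 x))"
    by (intro K.regular_add K.regular_mult K.regular_const mu pR)+
  then have r: "K.regular 1 (Z t)" "K.regular 1 (q t)" by (simp_all add: Z_def[abs_def] q_eq[abs_def])
  obtain \<epsilon> Q where "0 < \<epsilon>" "\<And>s x. s \<in> {0..t} \<Longrightarrow> x \<in> {a..b} \<Longrightarrow> \<epsilon> \<le> q s x \<and> q s x \<le> Q"
    using q_bounds[OF t] by blast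
  then have "K.regular 1 (\<lambda>x. 1 / q t x)" by (intro K.regular_inverse[OF r(2)]) (use t in auto)
  then show ?thesis by (intro K.regular_mult r)
qed

text \<open>The spatial derivative of \<open>B\<close> is known from its equation, which is how the term \<open>A m\<close> appears.\<close>

lemma primitive_flux:
  assumes t: "0 \<le> t" and g: "primitive a b (\<lambda>x. Z t x * Z t x * (1 / q t x)) g"
  shows "primitive a b (\<lambda>x. 2 * (Z t x * Z t x * (1 / q t x)) + - 1 * B t x) (\<lambda>x. 2 * g x + m x / \<alpha> * A t x)"
proof -
  have "primitive a b (B t) (\<lambda>x. - (m x / \<alpha>) * A t x)"
    by (rule primitive_of_deriv[OF B_deriv[OF t]])
       (use \<alpha> in \<open>auto intro!: continuous_intros cont_m DERIV_continuous_on[OF A_deriv] t\<close>)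
  then have "primitive a b (\<lambda>x. 2 * (Z t x * Z t x * (1 / q t x)) + - 1 * B t x) (\<lambda>x. 2 * g x + -1 * (- (m x / \<alpha>) * A t x))"
    by (intro primitive_add primitive_cmult g)
  then show ?thesis by simp
qed

lemma primitive_V: "0 \<le> t \<Longrightarrow> primitive a b (V t) (\<lambda>x. - c t x * Z t x)"
  and primitive_A: "0 \<le> t \<Longrightarrow> primitive a b (A t) (\<lambda>x. - c_dot t x * Z t x - c t x * B t x)"
  and primitive_\<Phi>: "0 \<le> t \<Longrightarrow> primitive a b (\<Phi> t) (\<lambda>x. m x / q t x)"
  and cont_V: "0 \<le> t \<Longrightarrow> continuous_on {a..b} (\<lambda>x. - c t x * Z t x)"
  and cont_A: "0 \<le> t \<Longrightarrow> continuous_on {a..b} (\<lambda>x. - c_dot t x * Z t x - c t x * B t x)"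
  and cont_\<Phi>: "0 \<le> t \<Longrightarrow> continuous_on {a..b} (\<lambda>x. m x / q t x)"
proof -
  assume t: "0 \<le> t"
  have qn: "q t x \<noteq> 0" if "x \<in> {a..b}" for x using flow(3)[OF t that] by simp
  have cZ: "continuous_on {a..b} (Z t)" unfolding Z_def[abs_def]
    by (intro continuous_intros cont_m cont_u1 cont_R t)
  have cc: "continuous_on {a..b} (c t)" "continuous_on {a..b} (c_dot t)"
    unfolding c_def[abs_def] c_dot_def[abs_def] using qn
    by (auto intro!: continuous_intros cont_q[OF t] cont_m cZ)
  show 1: "continuous_on {a..b} (\<lambda>x. - c t x * Z t x)" by (intro continuous_intros cc cZ)
  show 2: "continuous_on {a..b} (\<lambda>x. - c_dot t x * Z t x - c t x * B t x)"
    by (intro continuous_intros cc cZ DERIV_continuous_on[OF B_deriv] t)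
  show 3: "continuous_on {a..b} (\<lambda>x. m x / q t x)" using qn by (intro continuous_intros cont_m cont_q t) auto
  show "primitive a b (V t) (\<lambda>x. - c t x * Z t x)"
    by (rule primitive_of_deriv[OF DERIV_cong[OF V_deriv[OF t]] 1]) (auto simp: c_eq Z_def)
  show "primitive a b (A t) (\<lambda>x. - c_dot t x * Z t x - c t x * B t x)" by (rule primitive_of_deriv[OF A_deriv[OF t] 2])
  show "primitive a b (\<Phi> t) (\<lambda>x. m x / q t x)" by (rule primitive_of_deriv[OF flow(4)[OF t] 3])
qed

lemma flux_identities:
  assumes t: "0 \<le> t" and x: "x \<in> {a..b}"
  shows "inverse (m x / q t x) ^ 2 * (- c_dot t x * Z t x - c t x * B t x) * m x = 2 * (Z t x * Z t x * (1 / q t x)) + - 1 * B t x"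
    and "inverse (m x / q t x) ^ 3 * (- c t x * Z t x)\<^sup>2 * m x = Z t x * Z t x * (1 / q t x)"
proof -
  have n: "q t x \<noteq> 0" "m x \<noteq> 0" using flow(3)[OF t x] m_pos[OF x] by auto
  show "inverse (m x / q t x) ^ 2 * (- c_dot t x * Z t x - c t x * B t x) * m x = 2 * (Z t x * Z t x * (1 / q t x)) + - 1 * B t x"
    unfolding c_eq c_dot_def using n by (simp add: field_simps power2_eq_square)
  show "inverse (m x / q t x) ^ 3 * (- c t x * Z t x)\<^sup>2 * m x = Z t x * Z t x * (1 / q t x)"
    unfolding c_eq using n by (simp add: field_simps power2_eq_square power3_eq_cube)
qed

text \<open>At time \<open>0\<close> the identity solves the Euler-Lagrange equation, and then \<open>V = u0\<close> by the stability estimate.\<close>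

lemma initial_values:
  assumes x: "x \<in> {a..b}"
  shows "\<Phi> 0 x = x" "V 0 x = u0 x"
proof -
  obtain S where S: "stability_bound 0 S" using stability_bound_exists[of 0] by auto
  have z: "(0::real) \<in> {0..0}" by simp
  have q0: "0 < q 0 x" if "x \<in> {a..b}" for x by (rule flow(3)[OF order_refl that])
  have p0: "q 0 x = p 0 x + m x" for x by (simp add: q_eq)
  have st: "\<bar>\<Phi> 0 x - x\<bar> \<le> stability_constant \<kappa> C (b - a) * 0 \<and> \<bar>p 0 x\<bar> \<le> stability_constant \<kappa> C (b - a) * 0"
    if x: "x \<in> {a..b}" and \<kappa>: "0 < \<kappa>" and kb: "\<And>x. x \<in> {a..b} \<Longrightarrow> \<kappa> \<le> 1 / q 0 x \<and> 1 / q 0 x \<le> C"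
      "\<And>x. x \<in> {a..b} \<Longrightarrow> \<kappa> \<le> m x / \<alpha> \<and> m x / \<alpha> \<le> C" for x \<kappa> C
  proof (rule linear_stability[where y = "\<lambda>x. \<Phi> 0 x - x" and c = "\<lambda>x. 1 / q 0 x" and g = "\<lambda>x. 0" and h = "\<lambda>x. m x / \<alpha>", OF ab _ _ _ _ kb _ \<kappa> x])
    fix x assume x: "x \<in> {a..b}"
    have "m x / q 0 x - 1 = 0 - 1 / q 0 x * p 0 x" using q0[OF x] by (simp add: field_simps p0)
    then show "((\<lambda>x. \<Phi> 0 x - x) has_real_derivative 0 - 1 / q 0 x * p 0 x) (at x within {a..b})"
      by (intro DERIV_cong[OF DERIV_diff[OF flow(4)[OF order_refl x] DERIV_ident]])
    show "(p 0 has_real_derivative - (m x / \<alpha>) * (\<Phi> 0 x - x)) (at x within {a..b})"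
      using flow(5)[OF order_refl x] by simp
  qed (use flow(1,2) in auto)
  obtain \<epsilon> Q where eQ': "0 < \<epsilon>" "\<And>t x. t \<in> {0..0} \<Longrightarrow> x \<in> {a..b} \<Longrightarrow> \<epsilon> \<le> q t x \<and> q t x \<le> Q"
    using q_bounds[OF order_refl] by blast
  note eQ = eQ'(1) eQ'(2)[OF z]
  have Q0: "0 < Q" using eQ(1) eQ(2)[OF x] by linarith
  have "\<bar>\<Phi> 0 x - x\<bar> \<le> 0 \<and> \<bar>p 0 x\<bar> \<le> 0" if x: "x \<in> {a..b}" for x
  proof -
    have "\<bar>\<Phi> 0 x - x\<bar> \<le> stability_constant (min (1 / Q) (c0 / \<alpha>)) (max (1 / \<epsilon>) (M / \<alpha>)) (b - a) * 0 \<and>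
       \<bar>p 0 x\<bar> \<le> stability_constant (min (1 / Q) (c0 / \<alpha>)) (max (1 / \<epsilon>) (M / \<alpha>)) (b - a) * 0"
    proof (rule st[OF x])
      show "0 < min (1 / Q) (c0 / \<alpha>)" using Q0 c0 \<alpha> by simp
      fix x assume x: "x \<in> {a..b}"
      have "1 / Q \<le> 1 / q 0 x" "1 / q 0 x \<le> 1 / \<epsilon>" using eQ(1) eQ(2)[OF x] q0[OF x] by (auto intro!: frac_le)
      then show "min (1 / Q) (c0 / \<alpha>) \<le> 1 / q 0 x \<and> 1 / q 0 x \<le> max (1 / \<epsilon>) (M / \<alpha>)" by auto
      have "c0 / \<alpha> \<le> m x / \<alpha>" "m x / \<alpha> \<le> M / \<alpha>" using m_bd[OF x] \<alpha> by (auto intro: divide_right_mono)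
      then show "min (1 / Q) (c0 / \<alpha>) \<le> m x / \<alpha> \<and> m x / \<alpha> \<le> max (1 / \<epsilon>) (M / \<alpha>)" by auto
    qed
    then show ?thesis by simp
  qed
  then have \<Phi>p: "\<Phi> 0 x = x" "p 0 x = 0" if "x \<in> {a..b}" for x using that by force+
  show "\<Phi> 0 x = x" by (rule \<Phi>p(1)[OF x])
  have "\<bar>V 0 x - u0 x\<bar> \<le> S * 0"
  proof (rule stability_boundD(1)[OF S z z, where y = "\<lambda>x. V 0 x - u0 x" and g = "\<lambda>x. 0" and P = "R 0", OF _ _ _ _ _ x])
    fix x assume x: "x \<in> {a..b}"
    have qm: "q 0 x = m x" using \<Phi>p(2)[OF x] by (simp add: p0)
    have "- (m x / (q 0 x * q 0 x)) * (R 0 x - m x * u1 x) - u1 x = 0 - m x / (q 0 x * q 0 x) * R 0 x"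
      unfolding qm using m_pos[OF x] by (simp add: field_simps)
    then show "((\<lambda>x. V 0 x - u0 x) has_real_derivative 0 - m x / (q 0 x * q 0 x) * R 0 x) (at x within {a..b})"
      by (intro DERIV_cong[OF DERIV_diff[OF V_deriv[OF order_refl x] u0_deriv[OF x]]])
    show "(R 0 has_real_derivative - (m x / \<alpha>) * (V 0 x - u0 x)) (at x within {a..b})"
      by (rule R_deriv[OF order_refl x])
  qed (use V_bc[of 0] u0_bc in auto)
  then show "V 0 x = u0 x" by simp
qed

end

section \<open>Monotone functions with a weak derivative\<close>

definition sum_measure :: "'a measure \<Rightarrow> 'a measure \<Rightarrow> 'a measure" where
  "sum_measure M N = measure_of (space M) (sets M) (\<lambda>A. emeasure M A + emeasure N A)"

lemma sets_sum_measure [simp]: "sets (sum_measure M N) = sets M"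
  by (simp add: sum_measure_def sets.sigma_sets_eq)

lemma emeasure_sum_measure:
  assumes "sets N = sets M" "A \<in> sets M"
  shows "emeasure (sum_measure M N) A = emeasure M A + emeasure N A"
proof (rule emeasure_measure_of[OF sum_measure_def])
  show "countably_additive (sets (sum_measure M N)) (\<lambda>A. emeasure M A + emeasure N A)"
  proof (rule countably_additiveI)
    fix A :: "nat \<Rightarrow> 'a set"
    assume A: "range A \<subseteq> sets (sum_measure M N)" "disjoint_family A"
    then have "(\<Sum>i. emeasure M (A i)) = emeasure M (\<Union>i. A i)" "(\<Sum>i. emeasure N (A i)) = emeasure N (\<Union>i. A i)"
      using assms by (auto intro!: suminf_emeasure)
    then show "(\<Sum>i. emeasure M (A i) + emeasure N (A i)) = emeasure M (\<Union>i. A i) + emeasure N (\<Union>i. A i)"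
      by (subst suminf_add[symmetric]) auto
  qed
qed (use assms sets.space_closed in \<open>auto simp: positive_def\<close>)

text \<open>The positive part of the density of a monotone function dominates the negative one, because
  their difference is the Stieltjes measure.\<close>

lemma monotone_primitive_nonneg:
  assumes cd: "c \<le> d" and p: "primitive c d f g" and mono: "\<And>x y. c \<le> x \<Longrightarrow> x \<le> y \<Longrightarrow> y \<le> d \<Longrightarrow> f x \<le> f y"
  shows "AE x in lborel. x \<in> {c..d} \<longrightarrow> 0 \<le> g x"
proof -
  define h where "h x = indicator {c..d} x * g x" for x :: real
  have hi: "integrable lborel h" using primitive_set_integrable[OF p] by (simp add: h_def[abs_def] set_integrable_def)
  then have [measurable]: "h \<in> borel_measurable borel" by (simp add: borel_measurable_integrable)
  \<comment> \<open>\<open>f\<close> is continued by constants to a continuous monotone function on the line.\<close>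
  define cl where "cl x = max c (min d x)" for x
  have cl: "cl x \<in> {c..d}" for x using cd by (auto simp: cl_def)
  define G where "G x = f (cl x)" for x
  have Gm: "G x \<le> G y" if "x \<le> y" for x y unfolding G_def
    by (rule mono) (use that cd in \<open>auto simp: cl_def\<close>)
  have Gc: "continuous_on UNIV G" unfolding G_def
    by (rule continuous_on_compose2[OF primitive_continuous[OF p]]) (use cl in \<open>auto simp: cl_def intro!: continuous_intros\<close>)
  have Grc: "continuous (at_right x) G" for x
    using Gc by (simp add: continuous_on_eq_continuous_within continuous_at_imp_continuous_at_within)
  have tail: "emeasure (interval_measure G) {x<..} = ennreal (G d - G x)" for x
  proof -
    define A where "A n = {x<..max x d + real n}" for n
    have "(\<lambda>n. emeasure (interval_measure G) (A n)) \<longlonglongrightarrow> emeasure (interval_measure G) (\<Union>n. A n)"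
      by (rule Lim_emeasure_incseq) (auto simp: A_def incseq_def)
    moreover have "(\<Union>n. A n) = {x<..}"
    proof (intro equalityI subsetI)
      fix y assume "y \<in> {x<..}"
      moreover obtain n where "y - max x d \<le> real n" using real_arch_simple by blast
      ultimately show "y \<in> (\<Union>n. A n)" by (auto simp: A_def intro!: exI[of _ n])
    qed (auto simp: A_def)
    moreover have "emeasure (interval_measure G) (A n) = ennreal (G d - G x)" for n
    proof -
      have "emeasure (interval_measure G) (A n) = ennreal (G (max x d + real n) - G x)"
        unfolding A_def by (rule emeasure_interval_measure_Ioc) (auto intro: Gm Grc)
      also have "G (max x d + real n) = G d" unfolding G_def by (simp add: cl_def max_def min_def)
      finally show ?thesis .
    qed
    ultimately show ?thesis by (simp add: LIMSEQ_const_iff)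
  qed
  have hint: "(\<integral>y. indicator {x<..} y * h y \<partial>lborel) = G d - G x" for x
  proof -
    have "(\<integral>y. indicator {x<..} y * h y \<partial>lborel) = (LINT y:{cl x..d}|lborel. g y)"
      unfolding set_lebesgue_integral_def
    proof (rule integral_cong_AE)
      have "(\<lambda>y. indicator {cl x..d} y *\<^sub>R g y) = (\<lambda>y. indicator {cl x..d} y * h y)"
        using cl[of x] by (auto simp: h_def indicator_def fun_eq_iff)
      then show "(\<lambda>y. indicator {cl x..d} y *\<^sub>R g y) \<in> borel_measurable lborel" by simp
      show "AE y in lborel. indicator {x<..} y * h y = indicator {cl x..d} y *\<^sub>R g y"
        using AE_lborel_singleton[of x] AE_lborel_singleton[of c] AE_lborel_singleton[of d]
        by eventually_elim (auto simp: h_def cl_def indicator_def max_def min_def split: if_splits)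
    qed measurable
    also have "\<dots> = integral {cl x..d} g"
      by (rule set_borel_integral_eq_integral(2)[OF set_integrable_Icc_sub[OF primitive_set_integrable[OF p]]]) (use cl[of x] in auto)
    also have "\<dots> = f d - f (cl x)" using primitive_increment[OF p, of "cl x" d] cl[of x] by simp
    finally show ?thesis using cd by (simp add: G_def cl_def)
  qed
  let ?M = "density lborel (\<lambda>y. ennreal (h y))" and ?N = "density lborel (\<lambda>y. ennreal (- h y))"
  have val: "emeasure (density lborel (\<lambda>y. ennreal (k y))) {x<..} = ennreal (\<integral>y. max 0 (indicator {x<..} y * k y) \<partial>lborel)"
    if k: "integrable lborel k" for k :: "real \<Rightarrow> real" and x
    by (rule emeasure_density_tail[OF k])
  have eq: "?M = sum_measure ?N (interval_measure G)"
  proof (rule measure_eqI_lessThan)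
    fix x
    show "emeasure ?M {x<..} < \<infinity>" by (simp add: val hi)
    have i: "integrable lborel (\<lambda>y. indicator {x<..} y * h y)"
      using integrable_mult_indicator[of "{x<..}" lborel h] hi by simp
    have "(\<integral>y. max 0 (indicator {x<..} y * h y) \<partial>lborel) - (\<integral>y. max 0 (- (indicator {x<..} y * h y)) \<partial>lborel)
       = (\<integral>y. max 0 (indicator {x<..} y * h y) - max 0 (- (indicator {x<..} y * h y)) \<partial>lborel)"
      by (intro Bochner_Integration.integral_diff[symmetric] integrable_max i integrable_minus) auto
    also have "\<dots> = (\<integral>y. indicator {x<..} y * h y \<partial>lborel)"
      by (intro Bochner_Integration.integral_cong) auto
    finally have "(\<integral>y. max 0 (indicator {x<..} y * h y) \<partial>lborel) = (\<integral>y. max 0 (- (indicator {x<..} y * h y)) \<partial>lborel) + (G d - G x)"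
      unfolding hint by simp
    moreover have "0 \<le> G d - G x" using Gm[of "cl x" d] cd by (simp add: G_def cl_def)
    ultimately show "emeasure ?M {x<..} = emeasure (sum_measure ?N (interval_measure G)) {x<..}"
      by (subst emeasure_sum_measure) (auto simp: val hi tail ennreal_plus[symmetric] simp del: ennreal_plus)
  qed auto
  let ?S = "{x. h x < 0}"
  have "emeasure ?M ?S = 0"
    by (subst emeasure_density) (auto intro!: nn_integral_0_iff_AE[THEN iffD2] AE_I2 simp: indicator_def ennreal_neg)
  then have "emeasure ?N ?S = 0" unfolding eq by (subst (asm) emeasure_sum_measure) auto
  then have "(\<integral>\<^sup>+y. ennreal (- h y) * indicator ?S y \<partial>lborel) = 0"
    by (subst (asm) emeasure_density) auto
  then have "AE y in lborel. ennreal (- h y) * indicator ?S y = 0" by (subst (asm) nn_integral_0_iff_AE) auto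
  then show ?thesis
    by eventually_elim (auto simp: h_def indicator_def not_less ennreal_eq_0_iff split: if_splits)
qed

text \<open>Test functions on the smaller interval are test functions on the larger one.\<close>

lemma weak_deriv_restrict:
  assumes w: "is_weak_deriv a b 1 f g" and cd: "a < c" "d < b"
  shows "is_weak_deriv c d 1 f g"
  unfolding is_weak_deriv_def
proof (intro conjI allI impI)
  show "locally_integrable c d f" "locally_integrable c d g"
    using w cd unfolding is_weak_deriv_def locally_integrable_def by (meson less_trans)+
  fix \<phi> assume t: "test_function c d \<phi>"
  have z: "\<phi> x = 0" "deriv \<phi> x = 0" if "x \<notin> {c<..<d}" for x
    using t test_function_deriv[OF t] that unfolding test_function_iff by force+
  have tab: "test_function a b \<phi>"
    using t cd unfolding test_function_iff by (meson less_trans)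
  have e: "(LINT x:{a<..<b}|lborel. k x * \<psi> x) = (LINT x:{c<..<d}|lborel. k x * \<psi> x)"
    if "\<And>x. x \<notin> {c<..<d} \<Longrightarrow> \<psi> x = 0" for k \<psi> :: "real \<Rightarrow> real"
    unfolding set_lebesgue_integral_def
  proof (intro Bochner_Integration.integral_cong refl)
    fix x
    show "indicator {a<..<b} x *\<^sub>R (k x * \<psi> x) = indicator {c<..<d} x *\<^sub>R (k x * \<psi> x)"
      using that[of x] cd by (cases "x \<in> {c<..<d}") auto
  qed
  show "(LINT x:{c<..<d}|lborel. f x * (deriv ^^ 1) \<phi> x) = (-1) ^ 1 * (LINT x:{c<..<d}|lborel. g x * \<phi> x)"
    using weak_deriv_integrals[OF w tab] e[where k = g and \<psi> = \<phi>, OF z(1)] e[where k = f and \<psi> = "deriv \<phi>", OF z(2)] by simp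
qed

text \<open>A weak derivative is only locally integrable. For a monotone function it is nonnegative, and monotone convergence
along \<open>[a + \<delta>, b - \<delta>]\<close> gives integrability up to the boundary; continuity at \<open>a\<close> and \<open>b\<close> excludes jumps there.\<close>

lemma monotone_weak_deriv_primitive:
  assumes ab: "a < b" and w: "is_weak_deriv a b 1 f g" and cont: "continuous_on {a..b} f"
    and mono: "\<And>x y. a \<le> x \<Longrightarrow> x \<le> y \<Longrightarrow> y \<le> b \<Longrightarrow> f x \<le> f y"
  shows "primitive a b f g"
proof -
  have pcd: "primitive c d f g" if cd: "a < c" "c < d" "d < b" for c d
  proof -
    have "set_integrable lborel {c..d} g"
      using is_weak_deriv_locally_integrable(2)[OF w] cd by (auto intro: locally_integrableD)
    from weak_deriv_imp_primitive[OF cd(2) weak_deriv_restrict[OF w cd(1,3)] this]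
    obtain F where F: "primitive c d F g" "AE x in lborel. x \<in> {c<..<d} \<longrightarrow> f x = F x" by blast
    have "F x = f x" if "x \<in> {c..d}" for x
      using continuous_AE_eq[OF cd(2) continuous_on_subset[OF cont] primitive_continuous[OF F(1)] F(2) that] cd by simp
    then show ?thesis by (rule primitive_cong[OF F(1)]) auto
  qed
  define \<delta> where "\<delta> n = (b - a) / (real n + 3)" for n
  have d0: "\<delta> \<longlonglongrightarrow> 0" unfolding \<delta>_def by real_asymp
  have dpos: "0 < \<delta> n" "\<delta> n < (b - a) / 2" for n
  proof -
    show "0 < \<delta> n" using ab by (simp add: \<delta>_def)
    show "\<delta> n < (b - a) / 2" unfolding \<delta>_def using ab by (intro divide_strict_left_mono) auto
  qed
  have din: "b - \<delta> n \<in> {a..b}" "a + \<delta> n \<in> {a..b}" for n using dpos[of n] by (auto simp: field_simps)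
  have ddec: "\<delta> n \<le> \<delta> k" if "k \<le> n" for n k using ab that by (auto simp: \<delta>_def intro!: divide_left_mono)
  have pn: "primitive (a + \<delta> n) (b - \<delta> n) f g" for n
    using dpos[of n] by (intro pcd) (auto simp: field_simps)
  have "AE x in lborel. \<forall>n. x \<in> {a + \<delta> n..b - \<delta> n} \<longrightarrow> 0 \<le> g x"
    unfolding AE_all_countable
  proof
    fix n show "AE x in lborel. x \<in> {a + \<delta> n..b - \<delta> n} \<longrightarrow> 0 \<le> g x"
      by (rule monotone_primitive_nonneg[OF _ pn]) (use dpos[of n] mono in \<open>auto simp: field_simps\<close>)
  qed
  have ev: "\<forall>\<^sub>F n in sequentially. x \<in> {a + \<delta> n..b - \<delta> n}" if "x \<in> {a<..<b}" for x
  proof -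
    have "\<forall>\<^sub>F n in sequentially. \<delta> n < min (x - a) (b - x)" using that d0 by (intro order_tendstoD(2)) auto
    then show ?thesis by eventually_elim auto
  qed
  have nn: "AE x in lborel. x \<in> {a<..<b} \<longrightarrow> 0 \<le> g x"
    using \<open>AE x in lborel. \<forall>n. _ n x\<close>
  proof eventually_elim
    case (elim x)
    then show ?case using ev[of x] by (auto simp: eventually_sequentially)
  qed
  have "integrable lborel (\<lambda>x. indicator {a<..<b} x * g x)"
  proof (rule integrable_monotone_convergence)
    show "integrable lborel (\<lambda>x. indicator {a + \<delta> n..b - \<delta> n} x * g x)" for n
      using primitive_set_integrable[OF pn] by (simp add: set_integrable_def)
    show "AE x in lborel. mono (\<lambda>n. indicator {a + \<delta> n..b - \<delta> n} x * g x)"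
      using nn
    proof eventually_elim
      case (elim x)
      show ?case
      proof (rule monoI)
        fix k n :: nat assume "k \<le> n"
        then show "indicator {a + \<delta> k..b - \<delta> k} x * g x \<le> indicator {a + \<delta> n..b - \<delta> n} x * g x"
          using elim ddec[of k n] dpos[of k] dpos[of n] by (auto simp: indicator_def)
      qed
    qed
    show "AE x in lborel. (\<lambda>n. indicator {a + \<delta> n..b - \<delta> n} x * g x) \<longlonglongrightarrow> indicator {a<..<b} x * g x"
    proof (rule AE_I2)
      fix x
      show "(\<lambda>n. indicator {a + \<delta> n..b - \<delta> n} x * g x) \<longlonglongrightarrow> indicator {a<..<b} x * g x"
      proof (cases "x \<in> {a<..<b}")
        case True
        have "\<forall>\<^sub>F n in sequentially. indicator {a + \<delta> n..b - \<delta> n} x * g x = indicator {a<..<b} x * g x"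
          using ev[OF True] by eventually_elim (use True in simp)
        then show ?thesis by (rule tendsto_eventually)
      next
        case False
        have "x \<notin> {a + \<delta> n..b - \<delta> n}" for n using False dpos[of n] by auto
        then have "indicator {a + \<delta> n..b - \<delta> n} x * g x = 0" for n by (metis indicator_simps(2) mult_zero_left)
        moreover have "indicator {a<..<b} x * g x = 0" using False by (metis indicator_simps(2) mult_zero_left)
        ultimately show ?thesis by (simp only: tendsto_const)
      qed
    qed
    have "(\<integral>x. indicator {a + \<delta> n..b - \<delta> n} x * g x \<partial>lborel) = f (b - \<delta> n) - f (a + \<delta> n)" for n
    proof -
      have "(\<integral>x. indicator {a + \<delta> n..b - \<delta> n} x * g x \<partial>lborel) = integral {a + \<delta> n..b - \<delta> n} g"
        using set_borel_integral_eq_integral(2)[OF primitive_set_integrable[OF pn]] by (simp add: set_lebesgue_integral_def)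
      also have "\<dots> = f (b - \<delta> n) - f (a + \<delta> n)"
        using primitive_increment[OF pn[of n], of "a + \<delta> n" "b - \<delta> n"] dpos[of n] by (simp add: field_simps)
      finally show ?thesis .
    qed
    moreover have "(\<lambda>n. f (b - \<delta> n) - f (a + \<delta> n)) \<longlonglongrightarrow> f b - f a"
    proof (intro tendsto_diff)
      have ab_in: "a \<in> {a..b}" "b \<in> {a..b}" using ab by auto
      have "(\<lambda>n. b - \<delta> n) \<longlonglongrightarrow> b - 0" "(\<lambda>n. a + \<delta> n) \<longlonglongrightarrow> a + 0" by (intro tendsto_intros d0)+
      then show "(\<lambda>n. f (b - \<delta> n)) \<longlonglongrightarrow> f b" "(\<lambda>n. f (a + \<delta> n)) \<longlonglongrightarrow> f a"
        using less_imp_le[OF ab] ab_in din by (auto intro!: continuous_on_tendsto_compose[OF cont] always_eventually simp del: atLeastAtMost_iff)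
    qed
    ultimately show "(\<lambda>n. \<integral>x. indicator {a + \<delta> n..b - \<delta> n} x * g x \<partial>lborel) \<longlonglongrightarrow> f b - f a" by simp
    have "set_borel_measurable lborel {a<..<b} g"
      by (rule set_borel_measurable_subset[OF locally_integrable_measurable[OF ab is_weak_deriv_locally_integrable(2)[OF w]]]) auto
    then show "(\<lambda>x. indicator {a<..<b} x * g x) \<in> borel_measurable lborel" by (simp add: set_borel_measurable_def)
  qed
  then have "integrable lborel (\<lambda>x. indicator {a<..<b} x * g x + (indicator {a} x * g a + indicator {b} x * g b))"
    by (intro Bochner_Integration.integrable_add integrable_mult_left) (auto intro: integrable_real_indicator)
  moreover have "(\<lambda>x. indicator {a<..<b} x * g x + (indicator {a} x * g a + indicator {b} x * g b)) = (\<lambda>x. indicator {a..b} x *\<^sub>R g x)"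
    using ab by (auto simp: indicator_def fun_eq_iff)
  ultimately have gi: "set_integrable lborel {a..b} g" by (simp add: set_integrable_def)
  obtain F where F: "primitive a b F g" "AE x in lborel. x \<in> {a<..<b} \<longrightarrow> f x = F x"
    using weak_deriv_imp_primitive[OF ab w gi] by blast
  have "F x = f x" if "x \<in> {a..b}" for x
    using continuous_AE_eq[OF ab cont primitive_continuous[OF F(1)] F(2) that] by simp
  then show ?thesis by (rule primitive_cong[OF F(1)]) auto
qed

section \<open>The velocity functional on the Helly space\<close>

lemma space_leb [simp]: "space (leb a b) = {a..b}" by (simp add: space_restrict_space)

lemma integrable_leb_iff: "integrable (leb a b) f \<longleftrightarrow> set_integrable lborel {a..b} (f :: real \<Rightarrow> real)"
  by (simp add: integrable_restrict_space set_integrable_def)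

lemma integral_leb_eq: "(\<integral>x. f x \<partial>leb a b) = (LINT x:{a..b}|lborel. (f x :: real))"
  by (simp add: integral_restrict_space set_lebesgue_integral_def)

lemma integral_leb_eq_integral:
  fixes f :: "real \<Rightarrow> real"
  shows "set_integrable lborel {a..b} f \<Longrightarrow> (\<integral>x. f x \<partial>leb a b) = integral {a..b} f"
  using set_borel_integral_eq_integral(2)[of "{a..b}" f] by (simp add: integral_leb_eq)

lemma integrable_leb_bounded_measurable: "bounded_measurable a b f \<Longrightarrow> integrable (leb a b) f"
  unfolding integrable_leb_iff by (rule bounded_measurable_integrable)

lemma bounded_measurable_measurable: "bounded_measurable a b f \<Longrightarrow> f \<in> borel_measurable (leb a b)"
  unfolding measurable_leb_iff by (simp add: bounded_measurable_def)

lemma primitive_imp_bounded_measurable: "a < b \<Longrightarrow> primitive a b f g \<Longrightarrow> bounded_measurable a b f"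
proof -
  assume "a < b" and p: "primitive a b f g"
  then interpret interval a b by unfold_locales
  show ?thesis by (rule W.B_cont[OF primitive_continuous[OF p]])
qed

lemma hellyD:
  assumes "\<Psi> \<in> helly a b"
  shows "mono_on {a..b} \<Psi>" "\<Psi> a = a" "\<Psi> b = b" "x \<in> {a..b} \<Longrightarrow> \<Psi> x \<in> {a..b}"
    "\<Psi> \<in> extensional {a..b}"
  using assms by (auto simp: helly_def PiE_def)

lemma helly_bounded_measurable:
  assumes "\<Psi> \<in> helly a b"
  shows "bounded_measurable a b \<Psi>"
proof (rule bounded_measurableI)
  have "\<Psi> \<in> borel_measurable (restrict_space borel {a..b})"
    by (rule borel_measurable_mono_on_fnc[OF hellyD(1)[OF assms]])
  then have "(\<lambda>x. indicator {a..b} x *\<^sub>R \<Psi> x) \<in> borel_measurable borel"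
    by (subst (asm) borel_measurable_restrict_space_iff) auto
  then show "set_borel_measurable lborel {a..b} \<Psi>" by (simp add: set_borel_measurable_def)
  show "\<bar>\<Psi> x\<bar> \<le> max \<bar>a\<bar> \<bar>b\<bar>" if "x \<in> {a..b}" for x using hellyD(4)[OF assms that] by auto
qed

sublocale igr_data \<subseteq> interval a b by unfold_locales (rule ab)

text \<open>The data of the variational problem: \<open>m1\<close> and \<open>u2\<close> are bounded representatives of the derivatives of
\<open>m\<close> and \<open>u1\<close>.\<close>

locale igr_variational = igr_data +
  fixes m1 u2 :: "real \<Rightarrow> real" and \<mu> :: "real measure"
  assumes m_primitive: "primitive a b m m1" and m1: "bounded_measurable a b m1"
    and u1_primitive: "primitive a b u1 u2" and u2: "bounded_measurable a b u2"
    and \<mu>: "\<mu> = density (leb a b) (\<lambda>x. ennreal (m x))" and prob: "prob_space \<mu>"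
begin

lemma bm_m: "bounded_measurable a b m" by (rule W.B_cont[OF cont_m])

lemma m_nonneg_AE: "AE x in leb a b. 0 \<le> m x"
  using m_pos by (intro AE_I2) (auto intro: less_imp_le)

lemma integral_\<mu>: "bounded_measurable a b f \<Longrightarrow> (\<integral>x. f x \<partial>\<mu>) = (\<integral>x. m x * f x \<partial>leb a b)"
  unfolding \<mu> by (subst integral_density) (auto intro: bounded_measurable_measurable bm_m m_nonneg_AE)

lemma integral_\<mu>_measurable: "f \<in> borel_measurable (leb a b) \<Longrightarrow> (\<integral>x. f x \<partial>\<mu>) = (\<integral>x. m x * f x \<partial>leb a b)"
  unfolding \<mu> by (subst integral_density) (auto intro: bounded_measurable_measurable bm_m m_nonneg_AE)

lemma mass: "(\<integral>x. m x \<partial>leb a b) = 1"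
  using integral_\<mu>[OF W.B_const[of 1]] prob_space.prob_space[OF prob] by simp

text \<open>In the velocity functional the derivative of the argument is integrated against \<open>\<alpha> \<eta>\<close>. The momentum
form of the Euler-Lagrange equation has \<open>q = p - \<eta>\<close>.\<close>

definition \<eta> :: "real \<Rightarrow> real \<Rightarrow> real" where "\<eta> t x = m x * (t * u1 x + - 1)"

definition \<eta>1 :: "real \<Rightarrow> real \<Rightarrow> real" where "\<eta>1 t x = m1 x * (t * u1 x + - 1) + (t * u2 x + 0) * m x"

lemma primitive_\<eta>: "primitive a b (\<eta> t) (\<eta>1 t)"
proof -
  have p: "primitive a b (\<lambda>x. t * u1 x + - 1) (\<lambda>x. t * u2 x + 0)"
    by (intro primitive_add primitive_cmult u1_primitive primitive_const)
  obtain K where "\<forall>x\<in>{a..b}. \<bar>t * u2 x + 0\<bar> \<le> K"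
    using W.B_bounded[OF W.B_add[OF W.B_mult[OF W.B_const[of t] u2] W.B_const[of 0]]] by blast
  then show ?thesis unfolding \<eta>_def[abs_def] \<eta>1_def[abs_def] by (intro primitive_mult[OF m_primitive p]) blast
qed

lemma bm_\<eta>1: "bounded_measurable a b (\<eta>1 t)"
  unfolding \<eta>1_def[abs_def] by (intro W.B_add W.B_mult W.B_const m1 u2 bm_m W.B_cont cont_u1)

text \<open>Integration by parts turns the first case of the definition into the second, in which the argument
  is not differentiated.\<close>

lemma velocity_functional_eq:
  assumes \<Psi>: "\<Psi> \<in> helly a b"
  shows "velocity_functional a b \<alpha> \<mu> m (\<lambda>x. t * u0 x) \<Psi> =
    (\<integral>x. \<Psi> x * (t * u0 x * m x - \<alpha> * \<eta>1 t x) \<partial>leb a b) + \<alpha> * (\<eta> t b * b - \<eta> t a * a)"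
proof -
  let ?w = "\<lambda>x. t * u0 x"
  define d where "d = wderiv a b 1"
  note bm\<Psi> = helly_bounded_measurable[OF \<Psi>]
  have bmu0: "bounded_measurable a b u0" by (rule W.B_cont[OF cont_u0])
  have pu0: "primitive a b u0 u1" by (rule primitive_of_deriv[OF u0_deriv cont_u1])
  have pw: "primitive a b ?w (\<lambda>x. t * u1 x)" by (intro primitive_cmult pu0)
  have dw: "d ?w x = t * u1 x" if "x \<in> {a..b}" for x
    unfolding d_def by (rule wderiv_primitive(2)[OF pw _ that]) (intro continuous_intros cont_u1)
  have bdw: "bounded_measurable a b (d ?w)"
    by (rule W.B_cont, rule continuous_on_cong[THEN iffD2, OF refl dw]) (auto intro: continuous_intros cont_u1)
  show ?thesis
  proof (cases "continuous_on {a..b} \<Psi> \<and> (\<exists>g. is_weak_deriv a b 1 \<Psi> g)")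
    case True
    then obtain g where g: "is_weak_deriv a b 1 \<Psi> g" and c\<Psi>: "continuous_on {a..b} \<Psi>" by blast
    have p\<Psi>: "primitive a b \<Psi> (d \<Psi>)" unfolding d_def
      by (rule monotone_weak_deriv_primitive[OF ab wderiv_props(1)[OF g] c\<Psi>])
         (use hellyD(1)[OF \<Psi>] in \<open>auto simp: mono_on_def\<close>)
    have md: "d \<Psi> \<in> borel_measurable (leb a b)"
      using primitive_set_integrable[OF p\<Psi>] unfolding measurable_leb_iff by (rule set_integrable_measurable)
    obtain K where K: "\<And>x. x \<in> {a..b} \<Longrightarrow> \<bar>\<eta>1 t x\<bar> \<le> K" using W.B_bounded[OF bm_\<eta>1] by blast
    have pm: "primitive a b (\<lambda>x. \<Psi> x * \<eta> t x) (\<lambda>x. d \<Psi> x * \<eta> t x + \<eta>1 t x * \<Psi> x)"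
      by (rule primitive_mult[OF p\<Psi> primitive_\<eta> K])
    have i1: "integrable (leb a b) (\<lambda>x. d \<Psi> x * \<eta> t x)"
      unfolding integrable_leb_iff by (intro set_integrable_continuous_mult primitive_set_integrable[OF p\<Psi>] primitive_continuous[OF primitive_\<eta>])
    have i2: "integrable (leb a b) (\<lambda>x. \<eta>1 t x * \<Psi> x)"
      by (intro integrable_leb_bounded_measurable W.B_mult bm_\<eta>1 bm\<Psi>)
    have i3: "integrable (leb a b) (\<lambda>x. m x * (\<Psi> x * ?w x))"
      by (intro integrable_leb_bounded_measurable W.B_mult bm_m bm\<Psi> W.B_const bmu0)
    have i4: "integrable (leb a b) (\<lambda>x. d \<Psi> x * m x)" 
      unfolding integrable_leb_iff by (intro set_integrable_continuous_mult primitive_set_integrable[OF p\<Psi>] cont_m)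
    have i4': "integrable (leb a b) (\<lambda>x. m x * (\<alpha> * d \<Psi> x))"
      using integrable_mult_right[OF i4, of \<alpha>] by (simp add: mult_ac)
    have i5: "integrable (leb a b) (\<lambda>x. d \<Psi> x * (m x * d ?w x))"
    proof -
      have "continuous_on {a..b} (\<lambda>x. m x * d ?w x)"
        by (rule continuous_on_cong[THEN iffD2, OF refl, of _ _ "\<lambda>x. m x * (t * u1 x)"])
           (auto simp: dw intro!: continuous_intros cont_m cont_u1)
      then show ?thesis unfolding integrable_leb_iff
        by (intro set_integrable_continuous_mult primitive_set_integrable[OF p\<Psi>])
    qed
    have "(\<integral>x. d \<Psi> x * \<eta> t x \<partial>leb a b) + (\<integral>x. \<eta>1 t x * \<Psi> x \<partial>leb a b) = (\<integral>x. d \<Psi> x * \<eta> t x + \<eta>1 t x * \<Psi> x \<partial>leb a b)"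
      by (rule Bochner_Integration.integral_add[OF i1 i2, symmetric])
    also have "\<dots> = \<Psi> b * \<eta> t b - \<Psi> a * \<eta> t a"
      using integral_leb_eq_integral[OF primitive_set_integrable[OF pm]] primitive_increment[OF pm, of a b] ab by simp
    finally have ibp: "(\<integral>x. d \<Psi> x * \<eta> t x \<partial>leb a b) = b * \<eta> t b - a * \<eta> t a - (\<integral>x. \<eta>1 t x * \<Psi> x \<partial>leb a b)"
      using hellyD(2,3)[OF \<Psi>] by simp
    have m1': "(\<lambda>x. \<Psi> x * ?w x + \<alpha> * d \<Psi> x * d ?w x) \<in> borel_measurable (leb a b)"
      using md bounded_measurable_measurable[OF bm\<Psi>] bounded_measurable_measurable[OF bdw] bounded_measurable_measurable[OF bmu0] by measurable
    have "velocity_functional a b \<alpha> \<mu> m ?w \<Psi> = (\<integral>x. m x * (\<Psi> x * ?w x + \<alpha> * d \<Psi> x * d ?w x) \<partial>leb a b) - (\<integral>x. m x * (\<alpha> * d \<Psi> x) \<partial>leb a b)"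
      unfolding velocity_functional_def Let_def d_def[symmetric] if_P[OF True]
      using md by (simp add: integral_\<mu>_measurable[OF m1'] integral_\<mu>_measurable del: integral_mult_right_zero integral_mult_right)
    also have "(\<integral>x. m x * (\<Psi> x * ?w x + \<alpha> * d \<Psi> x * d ?w x) \<partial>leb a b)
        = (\<integral>x. m x * (\<Psi> x * ?w x) + \<alpha> * (d \<Psi> x * (m x * d ?w x)) \<partial>leb a b)"
      by (simp add: algebra_simps)
    also have "\<dots> = (\<integral>x. m x * (\<Psi> x * ?w x) \<partial>leb a b) + (\<integral>x. \<alpha> * (d \<Psi> x * (m x * d ?w x)) \<partial>leb a b)"
      by (intro Bochner_Integration.integral_add i3 integrable_mult_right i5)
    also have "\<dots> - (\<integral>x. m x * (\<alpha> * d \<Psi> x) \<partial>leb a b)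
        = (\<integral>x. m x * (\<Psi> x * ?w x) \<partial>leb a b) + ((\<integral>x. \<alpha> * (d \<Psi> x * (m x * d ?w x)) \<partial>leb a b) - (\<integral>x. m x * (\<alpha> * d \<Psi> x) \<partial>leb a b))"
      by simp
    also have "(\<integral>x. \<alpha> * (d \<Psi> x * (m x * d ?w x)) \<partial>leb a b) - (\<integral>x. m x * (\<alpha> * d \<Psi> x) \<partial>leb a b)
        = (\<integral>x. \<alpha> * (d \<Psi> x * (m x * d ?w x)) - m x * (\<alpha> * d \<Psi> x) \<partial>leb a b)"
      by (intro Bochner_Integration.integral_diff[symmetric] integrable_mult_right i5 i4')
    also have "\<dots> = (\<integral>x. \<alpha> * (d \<Psi> x * \<eta> t x) \<partial>leb a b)"
    proof (rule Bochner_Integration.integral_cong[OF refl])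
      fix x assume "x \<in> space (leb a b)"
      then show "\<alpha> * (d \<Psi> x * (m x * d ?w x)) - m x * (\<alpha> * d \<Psi> x) = \<alpha> * (d \<Psi> x * \<eta> t x)"
        by (simp add: dw \<eta>_def algebra_simps)
    qed
    also have "\<dots> = \<alpha> * (b * \<eta> t b - a * \<eta> t a - (\<integral>x. \<eta>1 t x * \<Psi> x \<partial>leb a b))" using ibp by simp
    finally have E: "velocity_functional a b \<alpha> \<mu> m ?w \<Psi> = (\<integral>x. m x * (\<Psi> x * ?w x) \<partial>leb a b) + \<alpha> * (b * \<eta> t b - a * \<eta> t a - (\<integral>x. \<eta>1 t x * \<Psi> x \<partial>leb a b))" .
    have "(\<integral>x. \<Psi> x * (t * u0 x * m x - \<alpha> * \<eta>1 t x) \<partial>leb a b) = (\<integral>x. m x * (\<Psi> x * ?w x) - \<alpha> * (\<eta>1 t x * \<Psi> x) \<partial>leb a b)"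
      by (simp add: algebra_simps)
    also have "\<dots> = (\<integral>x. m x * (\<Psi> x * ?w x) \<partial>leb a b) - (\<integral>x. \<alpha> * (\<eta>1 t x * \<Psi> x) \<partial>leb a b)"
      by (intro Bochner_Integration.integral_diff i3 integrable_mult_right i2)
    finally show ?thesis unfolding E by (simp add: algebra_simps)
  next
    case False
    have p1: "primitive a b (\<lambda>x. m x * (t * u1 x)) (\<lambda>x. m1 x * (t * u1 x) + (t * u2 x) * m x)"
    proof -
      obtain K where "\<forall>x\<in>{a..b}. \<bar>t * u2 x\<bar> \<le> K" using W.B_bounded[OF W.B_mult[OF W.B_const[of t] u2]] by blast
      then show ?thesis by (intro primitive_mult[OF m_primitive primitive_cmult[OF u1_primitive]]) blast
    qed
    have p2: "primitive a b (\<lambda>y. m y * d ?w y) (\<lambda>x. m1 x * (t * u1 x) + (t * u2 x) * m x)"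
      by (rule primitive_cong[OF p1]) (auto simp: dw)
    have ae: "AE x in leb a b. \<Psi> x * (?w x * m x - \<alpha> * d (\<lambda>y. m y * d ?w y) x + \<alpha> * d m x) = \<Psi> x * (?w x * m x - \<alpha> * \<eta>1 t x)"
      using wderiv_primitive(1)[OF p2] wderiv_primitive(1)[OF m_primitive] unfolding AE_leb_iff d_def[symmetric]
      by eventually_elim (auto simp: \<eta>1_def algebra_simps)
    have mm: "d f \<in> borel_measurable (leb a b)" if "primitive a b f g" for f g
      unfolding measurable_leb_iff d_def
      by (rule locally_integrable_measurable[OF ab is_weak_deriv_locally_integrable(2)[OF wderiv_props(1)[OF weak_deriv_primitive[OF that]]]])
    have I: "(\<integral>x. \<Psi> x * (?w x * m x - \<alpha> * d (\<lambda>y. m y * d ?w y) x + \<alpha> * d m x) \<partial>leb a b) = (\<integral>x. \<Psi> x * (?w x * m x - \<alpha> * \<eta>1 t x) \<partial>leb a b)"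
    proof (rule integral_cong_AE[OF _ _ ae])
      note [measurable] = bounded_measurable_measurable[OF bm\<Psi>] bounded_measurable_measurable[OF bmu0] bounded_measurable_measurable[OF bm_m] mm[OF p2] mm[OF m_primitive] bounded_measurable_measurable[OF bm_\<eta>1]
      show "(\<lambda>x. \<Psi> x * (?w x * m x - \<alpha> * d (\<lambda>y. m y * d ?w y) x + \<alpha> * d m x)) \<in> borel_measurable (leb a b)" by measurable
      show "(\<lambda>x. \<Psi> x * (?w x * m x - \<alpha> * \<eta>1 t x)) \<in> borel_measurable (leb a b)" by measurable
    qed
    have e: "d ?w a = t * u1 a" "d ?w b = t * u1 b" using dw ab by auto
    show ?thesis
      unfolding velocity_functional_def Let_def d_def[symmetric] if_not_P[OF False] I e hellyD(2,3)[OF \<Psi>]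
      by (simp add: \<eta>_def algebra_simps)
  qed
qed

end

section \<open>A dual lower bound for the entropy\<close>

text \<open>The right-continuous generalized inverse of a monotone function. Jumps of \<open>\<Psi>\<close> become flat parts and
conversely.\<close>

definition gen_inverse :: "real \<Rightarrow> real \<Rightarrow> (real \<Rightarrow> real) \<Rightarrow> real \<Rightarrow> real" where
  "gen_inverse a b \<Psi> y = Sup {x \<in> {a..b}. \<Psi> x \<le> y}"

context
  fixes a b :: real and \<Psi> :: "real \<Rightarrow> real"
  assumes ab: "a < b" and \<Psi>: "\<Psi> \<in> helly a b"
begin

lemma gen_inverse_upper: "x \<in> {a..b} \<Longrightarrow> \<Psi> x \<le> y \<Longrightarrow> x \<le> gen_inverse a b \<Psi> y"
  unfolding gen_inverse_def by (intro cSup_upper) (auto intro: bdd_aboveI[of _ b])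

lemma gen_inverse_least: "y \<in> {a..b} \<Longrightarrow> (\<And>x. x \<in> {a..b} \<Longrightarrow> \<Psi> x \<le> y \<Longrightarrow> x \<le> z) \<Longrightarrow> gen_inverse a b \<Psi> y \<le> z"
  unfolding gen_inverse_def
proof (rule cSup_least)
  assume "y \<in> {a..b}"
  then have "a \<in> {x \<in> {a..b}. \<Psi> x \<le> y}" using ab hellyD(2)[OF \<Psi>] by auto
  then show "{x \<in> {a..b}. \<Psi> x \<le> y} \<noteq> {}" by blast
qed auto

lemma gen_inverse_range:
  assumes y: "y \<in> {a..b}"
  shows "gen_inverse a b \<Psi> y \<in> {a..b}"
proof -
  have "a \<le> gen_inverse a b \<Psi> y" by (rule gen_inverse_upper) (use y ab hellyD(2)[OF \<Psi>] in auto)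
  moreover have "gen_inverse a b \<Psi> y \<le> b" by (rule gen_inverse_least[OF y]) auto
  ultimately show ?thesis by simp
qed

lemma gen_inverse_mono: "mono_on {a..b} (gen_inverse a b \<Psi>)"
proof (rule mono_onI)
  fix r s assume rs: "r \<in> {a..b}" "s \<in> {a..b}" "r \<le> s"
  show "gen_inverse a b \<Psi> r \<le> gen_inverse a b \<Psi> s"
    by (rule gen_inverse_least[OF rs(1)]) (use rs in \<open>auto intro: gen_inverse_upper\<close>)
qed

lemma gen_inverse_measurable: "gen_inverse a b \<Psi> \<in> measurable (leb a b) (leb a b)"
proof -
  have "gen_inverse a b \<Psi> \<in> borel_measurable (restrict_space borel {a..b})"
    by (rule borel_measurable_mono_on_fnc[OF gen_inverse_mono])
  then have "gen_inverse a b \<Psi> \<in> borel_measurable (leb a b)"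
    by (simp add: measurable_def space_restrict_space sets_restrict_space)
  then have "gen_inverse a b \<Psi> \<in> measurable (leb a b) lborel" by (simp add: measurable_lborel1)
  then show ?thesis by (rule measurable_restrict_space2[rotated]) (use gen_inverse_range in auto)
qed

lemma helly_measurable: "\<Psi> \<in> measurable (leb a b) (leb a b)"
proof -
  have "\<Psi> \<in> measurable (leb a b) lborel"
    using bounded_measurable_measurable[OF helly_bounded_measurable[OF \<Psi>]] by (simp add: measurable_lborel1)
  then show ?thesis by (rule measurable_restrict_space2[rotated]) (use hellyD(4)[OF \<Psi>] in auto)
qed

lemma gen_inverse_of_strict:
  assumes "strict_mono_on {a..b} \<Psi>" "x \<in> {a..b}"
  shows "gen_inverse a b \<Psi> (\<Psi> x) = x"
proof (rule antisym)
  show "gen_inverse a b \<Psi> (\<Psi> x) \<le> x"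
  proof (rule gen_inverse_least[OF hellyD(4)[OF \<Psi> assms(2)]])
    fix z assume z: "z \<in> {a..b}" "\<Psi> z \<le> \<Psi> x"
    show "z \<le> x" using strict_mono_onD[OF assms(1), of x z] assms(2) z by fastforce
  qed
qed (rule gen_inverse_upper[OF assms(2) order_refl])

text \<open>Integration by parts for the Stieltjes measure of a monotone function, with the Stieltjes integral
  of \<open>q\<close> written as the Lebesgue integral of \<open>q\<close> along the generalized inverse.\<close>

lemma integral_gen_inverse:
  assumes p: "primitive a b q q'" and bq: "bounded_measurable a b q'"
  shows "(\<integral>y. q (gen_inverse a b \<Psi> y) \<partial>leb a b) = b * q b - a * q a - (\<integral>x. q' x * \<Psi> x \<partial>leb a b)"
proof -
  interpret interval a b by unfold_locales (rule ab)
  let ?L = "leb a b" and ?X = "gen_inverse a b \<Psi>"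
  interpret L: finite_measure ?L by (rule finite_measureI) (use ab in \<open>simp add: emeasure_restrict_space\<close>)
  interpret LL: pair_sigma_finite ?L ?L ..
  have [measurable]: "\<Psi> \<in> borel_measurable ?L" "q' \<in> borel_measurable ?L"
    by (rule bounded_measurable_measurable[OF helly_bounded_measurable[OF \<Psi>]] bounded_measurable_measurable[OF bq])+
  have idm[measurable]: "(\<lambda>y. y) \<in> borel_measurable ?L" by (rule bounded_measurable_measurable[OF W.B_cont]) (intro continuous_intros)
  obtain K where K: "\<And>x. x \<in> {a..b} \<Longrightarrow> \<bar>q' x\<bar> \<le> K" using W.B_bounded[OF bq] by blast
  \<comment> \<open>The increment \<open>q(b) - q(X(y))\<close> is the integral of \<open>q'\<close> over the \<open>x\<close> with \<open>\<Psi>(x) > y\<close>; then Fubini is applied.\<close>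
  define D where "D y x = (if y < \<Psi> x then q' x else 0)" for y x
  have Dm: "case_prod D \<in> borel_measurable (?L \<Otimes>\<^sub>M ?L)"
    unfolding D_def split_beta by measurable
  have Di: "integrable (?L \<Otimes>\<^sub>M ?L) (case_prod D)"
  proof (rule integrableI_bounded_set[where A = "space (?L \<Otimes>\<^sub>M ?L)" and B = "\<bar>K\<bar>"])
    interpret P: finite_measure "?L \<Otimes>\<^sub>M ?L" by (rule finite_measure_pair_measure[OF L.finite_measure_axioms L.finite_measure_axioms])
    show "emeasure (?L \<Otimes>\<^sub>M ?L) (space (?L \<Otimes>\<^sub>M ?L)) < \<infinity>" by (metis P.emeasure_finite infinity_ennreal_def less_top)
    show "AE z in ?L \<Otimes>\<^sub>M ?L. z \<in> space (?L \<Otimes>\<^sub>M ?L) \<longrightarrow> norm (case z of (y, x) \<Rightarrow> D y x) \<le> \<bar>K\<bar>"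
      using K by (intro AE_I2) (force simp: D_def space_pair_measure)
  qed (use Dm in auto)
  have in1: "(\<integral>x. D y x \<partial>?L) = q b - q (?X y)" if y: "y \<in> {a..b}" for y
  proof -
    have Xy: "?X y \<in> {a..b}" by (rule gen_inverse_range[OF y])
    have si: "set_integrable lborel {?X y..b} q'"
      using primitive_set_integrable[OF p] Xy by (auto intro: set_integrable_Icc_sub)
    have "(\<integral>x. D y x \<partial>?L) = (LINT x:{a..b}|lborel. D y x)" by (rule integral_leb_eq)
    also have "\<dots> = (LINT x:{?X y..b}|lborel. q' x)"
      unfolding set_lebesgue_integral_def
    proof (rule integral_cong_AE)
      have "(\<lambda>x. D y x) \<in> borel_measurable ?L" unfolding D_def by measurable
      then show "(\<lambda>x. indicator {a..b} x *\<^sub>R D y x) \<in> borel_measurable lborel"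
        unfolding measurable_leb_iff set_borel_measurable_def .
      show "(\<lambda>x. indicator {?X y..b} x *\<^sub>R q' x) \<in> borel_measurable lborel"
        using set_integrable_measurable[OF si] by (simp add: set_borel_measurable_def)
      show "AE x in lborel. indicator {a..b} x *\<^sub>R D y x = indicator {?X y..b} x *\<^sub>R q' x"
        using AE_lborel_singleton[of "?X y"]
      proof eventually_elim
        case (elim x)
        have 1: "y < \<Psi> x" if "x \<in> {a..b}" "?X y < x" using gen_inverse_upper[of x y] that by fastforce
        have 2: "\<Psi> x \<le> y" if x: "x \<in> {a..b}" "x < ?X y"
        proof (rule ccontr)
          assume n: "\<not> \<Psi> x \<le> y"
          have "?X y \<le> x"
          proof (rule gen_inverse_least[OF y])
            fix z assume z: "z \<in> {a..b}" "\<Psi> z \<le> y"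
            show "z \<le> x" using hellyD(1)[OF \<Psi>] z x n by (auto simp: mono_on_def not_le) (meson less_le_not_le linear order_trans)
          qed
          then show False using x by simp
        qed
        show ?case
          using elim 1 2 Xy by (cases "x \<in> {a..b}"; cases "x < ?X y") (auto simp: D_def indicator_def not_less)
      qed
    qed
    also have "\<dots> = integral {?X y..b} q'" by (rule set_borel_integral_eq_integral(2)[OF si])
    also have "\<dots> = q b - q (?X y)" using primitive_increment[OF p, of "?X y" b] Xy by simp
    finally show ?thesis .
  qed
  have in2: "(\<integral>y. D y x \<partial>?L) = q' x * (\<Psi> x - a)" if x: "x \<in> {a..b}" for x
  proof -
    have P: "\<Psi> x \<in> {a..b}" by (rule hellyD(4)[OF \<Psi> x])
    have "(\<integral>y. D y x \<partial>?L) = (\<integral>y. q' x * indicator {a..<\<Psi> x} y \<partial>?L)"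
      by (rule Bochner_Integration.integral_cong) (auto simp: D_def indicator_def)
    also have "\<dots> = q' x * (\<integral>y. indicator {a..<\<Psi> x} y \<partial>?L)" by simp
    also have "(\<integral>y. indicator {a..<\<Psi> x} y \<partial>?L) = measure ?L {a..<\<Psi> x}"
    proof -
      have "{a..<\<Psi> x} \<inter> {a..b} = {a..<\<Psi> x}" using P by auto
      then show ?thesis by simp
    qed
    also have "measure ?L {a..<\<Psi> x} = measure lborel {a..<\<Psi> x}"
      by (rule measure_restrict_space) (use P in auto)
    also have "\<dots> = \<Psi> x - a" using P by simp
    finally show ?thesis .
  qed
  have iX: "integrable ?L (\<lambda>y. q (?X y))"
  proof -
    obtain J where J: "\<And>x. x \<in> {a..b} \<Longrightarrow> \<bar>q x\<bar> \<le> J" using compact_bound[OF primitive_continuous[OF p]] by blast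
    have "q \<in> borel_measurable ?L" by (rule bounded_measurable_measurable[OF primitive_imp_bounded_measurable[OF ab p]])
    from measurable_compose[OF gen_inverse_measurable this]
    have "bounded_measurable a b (\<lambda>y. q (?X y))"
      unfolding measurable_leb_iff by (rule bounded_measurableI) (use J gen_inverse_range in blast)
    then show ?thesis by (rule integrable_leb_bounded_measurable)
  qed
  have vol: "measure ?L {a..b} = b - a" using ab by (subst measure_restrict_space) auto
  have "(\<integral>y. (\<integral>x. D y x \<partial>?L) \<partial>?L) = (\<integral>x. (\<integral>y. D y x \<partial>?L) \<partial>?L)"
    by (rule LL.Fubini_integral[OF Di, symmetric, unfolded split_beta fst_conv snd_conv])
  moreover have "(\<integral>y. (\<integral>x. D y x \<partial>?L) \<partial>?L) = (b - a) * q b - (\<integral>y. q (?X y) \<partial>?L)"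
  proof -
    have "(\<integral>y. (\<integral>x. D y x \<partial>?L) \<partial>?L) = (\<integral>y. q b - q (?X y) \<partial>?L)"
      by (rule Bochner_Integration.integral_cong) (auto simp: in1)
    also have "\<dots> = (b - a) * q b - (\<integral>y. q (?X y) \<partial>?L)"
      using iX vol by (subst Bochner_Integration.integral_diff) (auto)
    finally show ?thesis .
  qed
  moreover have "(\<integral>x. (\<integral>y. D y x \<partial>?L) \<partial>?L) = (\<integral>x. q' x * \<Psi> x \<partial>?L) - a * (q b - q a)"
  proof -
    have "(\<integral>x. (\<integral>y. D y x \<partial>?L) \<partial>?L) = (\<integral>x. q' x * \<Psi> x - a * q' x \<partial>?L)"
      by (rule Bochner_Integration.integral_cong) (auto simp: in2 algebra_simps)
    also have "\<dots> = (\<integral>x. q' x * \<Psi> x \<partial>?L) - (\<integral>x. a * q' x \<partial>?L)"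
      by (intro Bochner_Integration.integral_diff integrable_leb_bounded_measurable W.B_mult W.B_const bq helly_bounded_measurable[OF \<Psi>])
    also have "(\<integral>x. a * q' x \<partial>?L) = a * (q b - q a)"
      using integral_leb_eq_integral[OF primitive_set_integrable[OF p]] primitive_increment[OF p, of a b] ab by simp
    finally show ?thesis .
  qed
  ultimately show ?thesis by (simp add: algebra_simps)
qed

end

text \<open>The Fenchel-Young inequality for \<open>r ln r\<close>, with the convention \<open>0 ln 0 = 0\<close> that the logarithm satisfies.\<close>

lemma entropy_young:
  fixes r \<rho> :: real
  assumes "0 \<le> r" "0 < \<rho>"
  shows "r * ln \<rho> + r - \<rho> \<le> r * ln r"
proof (cases "r = 0")
  case False
  then have r: "0 < r" using assms by simp
  have "ln (\<rho> / r) \<le> \<rho> / r - 1" using ln_le_minus_one[of "\<rho> / r"] r assms by simp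
  then have "r * (ln \<rho> - ln r) \<le> r * (\<rho> / r - 1)" using r assms by (intro mult_left_mono) (auto simp: ln_div)
  then show ?thesis using r by (simp add: algebra_simps)
qed (use assms in simp)

lemma integral_pos_neg_parts:
  assumes "integrable M (f :: 'a \<Rightarrow> real)"
  shows "enn2ereal (\<integral>\<^sup>+ x. ennreal (f x) \<partial>M) - enn2ereal (\<integral>\<^sup>+ x. ennreal (- f x) \<partial>M) = ereal (\<integral>x. f x \<partial>M)"
proof -
  have fin: "(\<integral>\<^sup>+ x. ennreal (f x) \<partial>M) < \<infinity>" "(\<integral>\<^sup>+ x. ennreal (- f x) \<partial>M) < \<infinity>"
    using assms by (auto simp: real_integrable_def less_top)
  obtain r s where rs: "(\<integral>\<^sup>+ x. ennreal (f x) \<partial>M) = ennreal r" "0 \<le> r" "(\<integral>\<^sup>+ x. ennreal (- f x) \<partial>M) = ennreal s" "0 \<le> s"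
    using fin by (metis ennreal_cases less_top infinity_ennreal_def not_less_iff_gr_or_eq)
  then show ?thesis using real_lebesgue_integral_def[OF assms] by (simp add: enn2ereal_ennreal)
qed

lemma finite_measure_leb: "finite_measure (leb a b)"
proof (rule finite_measureI)
  have e: "emeasure (leb a b) (space (leb a b)) = emeasure lborel {a..b}"
    unfolding space_leb by (rule emeasure_restrict_space) auto
  have "emeasure lborel {a..b} < \<infinity>" by (rule emeasure_bounded_finite) (rule bounded_closed_interval)
  then show "emeasure (leb a b) (space (leb a b)) \<noteq> \<infinity>" unfolding e by (rule less_imp_neq)
qed

context igr_variational
begin

lemma bm_ln:
  assumes f: "continuous_on {a..b} f" and pos: "\<And>x. x \<in> {a..b} \<Longrightarrow> 0 < f x"
  shows "bounded_measurable a b (\<lambda>x. ln (f x))"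
  by (intro W.B_cont continuous_on_ln f) (use pos in force)

lemma \<mu>_sets: "sets \<mu> = sets (leb a b)" "space \<mu> = {a..b}" by (simp_all add: \<mu>)

lemma \<mu>_measurable: "measurable \<mu> N = measurable (leb a b) N"
  by (rule measurable_cong_sets[OF \<mu>_sets(1) refl])

text \<open>An absolutely continuous pushforward has no atoms, so the map has no flat parts.\<close>

lemma strict_mono_of_absolutely_continuous:
  assumes \<Psi>: "\<Psi> \<in> helly a b" and ac: "absolutely_continuous (leb a b) (distr \<mu> (leb a b) \<Psi>)"
  shows "strict_mono_on {a..b} \<Psi>"
proof (rule strict_mono_onI)
  fix c d assume cd: "c \<in> {a..b}" "d \<in> {a..b}" "c < d"
  have mono: "\<Psi> x \<le> \<Psi> y" if "x \<in> {a..b}" "y \<in> {a..b}" "x \<le> y" for x y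
    using hellyD(1)[OF \<Psi>] that by (auto simp: mono_on_def)
  show "\<Psi> c < \<Psi> d"
  proof (rule ccontr)
    assume "\<not> \<Psi> c < \<Psi> d"
    then have eq: "\<Psi> x = \<Psi> c" if "x \<in> {c..d}" for x
      using mono[of c x] mono[of x d] that cd by auto
    define y where "y = \<Psi> c"
    have y: "y \<in> {a..b}" unfolding y_def by (rule hellyD(4)[OF \<Psi> cd(1)])
    have sy: "{y} \<in> sets (leb a b)" using y by (simp add: sets_restrict_space_iff)
    have "emeasure (leb a b) {y} = emeasure lborel {y}" by (rule emeasure_restrict_space) (use y in auto)
    then have "{y} \<in> null_sets (leb a b)" using sy by (intro null_setsI) auto
    then have "{y} \<in> null_sets (distr \<mu> (leb a b) \<Psi>)" using ac by (auto simp: absolutely_continuous_def)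
    then have z: "emeasure \<mu> (\<Psi> -` {y} \<inter> space \<mu>) = 0"
      using helly_measurable[OF ab \<Psi>] sy by (auto simp: null_sets_def emeasure_distr \<mu>_measurable)
    have sm: "\<Psi> -` {y} \<inter> space \<mu> \<in> sets \<mu>"
      using measurable_sets[OF helly_measurable[OF ab \<Psi>] sy] by (simp add: \<mu>_sets)
    have "emeasure \<mu> {c..d} \<le> emeasure \<mu> (\<Psi> -` {y} \<inter> space \<mu>)"
    proof (rule emeasure_mono[OF _ sm], rule subsetI)
      fix x assume x: "x \<in> {c..d}"
      have "\<Psi> x = y" unfolding y_def by (rule eq[OF x])
      moreover have "x \<in> {a..b}" using x cd by auto
      ultimately show "x \<in> \<Psi> -` {y} \<inter> space \<mu>" by (simp add: \<mu>_sets)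
    qed
    then have z2: "emeasure \<mu> {c..d} = 0" using z by simp
    have scd: "{c..d} \<in> sets (leb a b)" using cd by (subst sets_restrict_space_iff) auto
    have "ennreal c0 * emeasure (leb a b) {c..d} = (\<integral>\<^sup>+ x. ennreal c0 * indicator {c..d} x \<partial>leb a b)"
      using scd by (simp add: nn_integral_cmult_indicator)
    also have "\<dots> \<le> (\<integral>\<^sup>+ x. ennreal (m x) * indicator {c..d} x \<partial>leb a b)"
      using m_bd by (intro nn_integral_mono mult_right_mono ennreal_leI) auto
    also have "\<dots> = emeasure \<mu> {c..d}"
      unfolding \<mu> using scd bounded_measurable_measurable[OF bm_m] by (subst emeasure_density) auto
    finally have "ennreal c0 * emeasure (leb a b) {c..d} = 0" using z2 by simp
    moreover have "emeasure (leb a b) {c..d} = ennreal (d - c)"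
      using cd by (subst emeasure_restrict_space) auto
    ultimately show False using c0 cd by (simp add: ennreal_mult[symmetric] ennreal_eq_0_iff mult_le_0_iff)
  qed
qed

text \<open>The duality bound for the entropy: Young's inequality against the density \<open>q\<close> transported by \<open>\<Psi>\<close>.\<close>

lemma entropy_lower_bound:
  assumes \<Psi>: "\<Psi> \<in> helly a b" and p: "primitive a b q q'" and bq: "bounded_measurable a b q'" and pos: "\<And>x. x \<in> {a..b} \<Longrightarrow> 0 < q x"
  shows "ereal ((\<integral>x. m x * ln (q x) \<partial>leb a b) + 1 - (b * q b - a * q a - (\<integral>x. q' x * \<Psi> x \<partial>leb a b)))
     \<le> Ent (leb a b) (distr \<mu> (leb a b) \<Psi>)"
proof (cases "absolutely_continuous (leb a b) (distr \<mu> (leb a b) \<Psi>)")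
  case False
  then show ?thesis by (simp add: Ent_def)
next
  case ac: True
  let ?L = "leb a b" and ?X = "gen_inverse a b \<Psi>"
  define \<nu> where "\<nu> = distr \<mu> ?L \<Psi>"
  interpret L: finite_measure ?L by (rule finite_measure_leb)
  interpret \<mu>: prob_space \<mu> by (rule prob)
  interpret \<nu>: prob_space \<nu> unfolding \<nu>_def
    by (rule \<mu>.prob_space_distr) (simp add: \<mu>_measurable helly_measurable[OF ab \<Psi>])
  have sm: "strict_mono_on {a..b} \<Psi>" by (rule strict_mono_of_absolutely_continuous[OF \<Psi> ac])
  have X\<Psi>: "?X (\<Psi> x) = x" if "x \<in> {a..b}" for x by (rule gen_inverse_of_strict[OF ab \<Psi> sm that])
  define R where "R = RN_deriv ?L \<nu>"
  define r where "r x = enn2real (R x)" for x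
  have Rm[measurable]: "R \<in> borel_measurable ?L" unfolding R_def by simp
  have rm[measurable]: "r \<in> borel_measurable ?L" unfolding r_def by measurable
  have dR: "density ?L R = \<nu>"
    unfolding R_def by (rule L.density_RN_deriv) (use ac in \<open>auto simp: \<nu>_def\<close>)
  have Rfin: "AE x in ?L. R x \<noteq> \<infinity>"
    unfolding R_def by (rule L.RN_deriv_finite) (use ac \<nu>.sigma_finite_measure_axioms in \<open>auto simp: \<nu>_def\<close>)
  have Rr: "AE x in ?L. R x = ennreal (r x)" using Rfin by eventually_elim (simp add: r_def less_top)
  have d\<nu>: "\<nu> = density ?L (\<lambda>x. ennreal (r x))"
    unfolding dR[symmetric] by (rule density_cong) (use Rr in auto)
  have r0: "0 \<le> r x" for x by (simp add: r_def)
  have intr: "integrable ?L r" "(\<integral>x. r x \<partial>?L) = 1"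
  proof -
    have "emeasure \<nu> (space ?L) = 1" using \<nu>.emeasure_space_1 by (simp add: \<nu>_def)
    moreover have "emeasure \<nu> (space ?L) = (\<integral>\<^sup>+ x. ennreal (r x) * indicator (space ?L) x \<partial>?L)"
      unfolding d\<nu> by (rule emeasure_density) (use sets.top[of ?L] in auto)
    moreover have "\<dots> = (\<integral>\<^sup>+ x. ennreal (r x) \<partial>?L)" by (rule nn_integral_cong) simp
    ultimately have "(\<integral>\<^sup>+ x. ennreal (r x) \<partial>?L) = 1" by simp
    then show "integrable ?L r" "(\<integral>x. r x \<partial>?L) = 1"
      using r0 by (auto intro!: integrableI_nonneg simp: integral_eq_nn_integral)
  qed
  define h where "h x = r x * ln (r x)" for x
  have Ent: "Ent ?L \<nu> = enn2ereal (\<integral>\<^sup>+ x. ennreal (h x) \<partial>?L) - enn2ereal (\<integral>\<^sup>+ x. ennreal (- h x) \<partial>?L)"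
    using ac by (simp add: Ent_def \<nu>_def h_def r_def R_def Let_def)
  have hm[measurable]: "h \<in> borel_measurable ?L" unfolding h_def by measurable
  have negfin: "(\<integral>\<^sup>+ x. ennreal (- h x) \<partial>?L) < \<infinity>"
  proof -
    have "- h x \<le> 1" for x using entropy_young[OF r0, of 1 x] r0[of x] by (simp add: h_def)
    then have "(\<integral>\<^sup>+ x. ennreal (- h x) \<partial>?L) \<le> (\<integral>\<^sup>+ x. 1 \<partial>?L)"
      by (intro nn_integral_mono) (metis ennreal_1 ennreal_leI)
    also have "\<dots> = emeasure ?L (space ?L)" by simp
    also have "\<dots> < \<infinity>" using L.emeasure_finite[of "space ?L"] by (metis infinity_ennreal_def less_top)
    finally show ?thesis .
  qed
  show ?thesis
  proof (cases "(\<integral>\<^sup>+ x. ennreal (h x) \<partial>?L) = \<infinity>")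
    case True
    obtain s where "(\<integral>\<^sup>+ x. ennreal (- h x) \<partial>?L) = ennreal s" "0 \<le> s"
      using negfin by (metis ennreal_cases infinity_ennreal_def less_irrefl)
    then have "Ent ?L \<nu> = \<infinity>" unfolding Ent True by (simp add: enn2ereal_ennreal)
    then show ?thesis by (simp add: \<nu>_def)
  next
    case False
    then have ih: "integrable ?L h" using negfin by (simp add: real_integrable_def)
    \<comment> \<open>The competitor density in Young's inequality.\<close>
    define \<rho> where "\<rho> y = q (?X y)" for y
    have Xr: "?X y \<in> {a..b}" if "y \<in> {a..b}" for y by (rule gen_inverse_range[OF ab \<Psi> that])
    note cq = primitive_continuous[OF p]
    have bml: "bounded_measurable a b (\<lambda>x. ln (q x))" by (rule bm_ln[OF cq pos])
    have comp: "bounded_measurable a b (\<lambda>y. f (?X y))" if f: "bounded_measurable a b f" for f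
    proof -
      obtain K where "\<And>x. x \<in> {a..b} \<Longrightarrow> \<bar>f x\<bar> \<le> K" using bounded_measurable_bound[OF f] by blast
      then show ?thesis using measurable_compose[OF gen_inverse_measurable[OF ab \<Psi>] bounded_measurable_measurable[OF f]]
        unfolding measurable_leb_iff by (rule_tac bounded_measurableI) (use Xr in blast)+
    qed
    have b\<rho>: "bounded_measurable a b \<rho>" "bounded_measurable a b (\<lambda>y. ln (\<rho> y))"
      unfolding \<rho>_def using comp[OF W.B_cont[OF cq]] comp[OF bml] by auto
    obtain K where K: "\<And>x. x \<in> {a..b} \<Longrightarrow> \<bar>ln (\<rho> x)\<bar> \<le> K" using bounded_measurable_bound[OF b\<rho>(2)] by blast
    have irl: "integrable ?L (\<lambda>y. r y * ln (\<rho> y))"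
    proof (rule Bochner_Integration.integrable_bound[of _ "\<lambda>y. K * r y"])
      show "integrable ?L (\<lambda>y. K * r y)" using intr by simp
      show "(\<lambda>y. r y * ln (\<rho> y)) \<in> borel_measurable ?L" using bounded_measurable_measurable[OF b\<rho>(2)] by measurable
      show "AE y in ?L. norm (r y * ln (\<rho> y)) \<le> norm (K * r y)"
      proof (rule AE_I2)
        fix y assume "y \<in> space ?L"
        then have "\<bar>ln (\<rho> y)\<bar> \<le> \<bar>K\<bar>" using K[of y] by simp
        then show "norm (r y * ln (\<rho> y)) \<le> norm (K * r y)"
          unfolding real_norm_def abs_mult by (subst mult.commute) (intro mult_right_mono, auto)
      qed
    qed
    have "(\<integral>y. r y * ln (\<rho> y) \<partial>?L) = (\<integral>y. ln (\<rho> y) \<partial>\<nu>)"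
      unfolding d\<nu> using r0 bounded_measurable_measurable[OF b\<rho>(2)] by (subst integral_density) auto
    also have "\<dots> = (\<integral>x. ln (\<rho> (\<Psi> x)) \<partial>\<mu>)"
      unfolding \<nu>_def using bounded_measurable_measurable[OF b\<rho>(2)]
      by (intro integral_distr) (auto simp: \<mu>_measurable helly_measurable[OF ab \<Psi>])
    also have "\<dots> = (\<integral>x. ln (q x) \<partial>\<mu>)"
      by (rule Bochner_Integration.integral_cong) (auto simp: \<mu>_sets \<rho>_def X\<Psi>)
    also have "\<dots> = (\<integral>x. m x * ln (q x) \<partial>?L)" by (rule integral_\<mu>[OF bml])
    finally have e1: "(\<integral>y. r y * ln (\<rho> y) \<partial>?L) = (\<integral>x. m x * ln (q x) \<partial>?L)" .
    have e2: "(\<integral>y. \<rho> y \<partial>?L) = b * q b - a * q a - (\<integral>x. q' x * \<Psi> x \<partial>?L)"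
      unfolding \<rho>_def by (rule integral_gen_inverse[OF ab \<Psi> p bq])
    note i\<rho> = integrable_leb_bounded_measurable[OF b\<rho>(1)]
    have "(\<integral>x. m x * ln (q x) \<partial>?L) + 1 - (b * q b - a * q a - (\<integral>x. q' x * \<Psi> x \<partial>?L))
       = (\<integral>y. r y * ln (\<rho> y) + r y - \<rho> y \<partial>?L)"
      unfolding e1[symmetric] e2[symmetric] intr(2)[symmetric]
      by (simp add: Bochner_Integration.integral_diff Bochner_Integration.integral_add irl intr i\<rho>)
    also have "\<dots> \<le> (\<integral>y. h y \<partial>?L)"
    proof (rule integral_mono[OF _ ih])
      show "integrable ?L (\<lambda>y. r y * ln (\<rho> y) + r y - \<rho> y)"
        by (intro Bochner_Integration.integrable_diff Bochner_Integration.integrable_add irl intr i\<rho>)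
      fix y assume "y \<in> space ?L"
      then have "0 < \<rho> y" using pos[OF Xr] by (simp add: \<rho>_def)
      then show "r y * ln (\<rho> y) + r y - \<rho> y \<le> h y" unfolding h_def by (rule entropy_young[OF r0])
    qed
    finally show ?thesis unfolding \<nu>_def[symmetric] Ent integral_pos_neg_parts[OF ih] by simp
  qed
qed

end

section \<open>Solutions of the Euler-Lagrange equation are the minimizers\<close>

text \<open>The substitution rule for the Lebesgue integral asks for a two-sided derivative at the endpoints, so the
function is continued affinely.\<close>

lemma derivative_extension:
  fixes f f' :: "real \<Rightarrow> real"
  assumes ab: "a < b" and d: "\<And>x. x \<in> {a..b} \<Longrightarrow> (f has_real_derivative f' x) (at x within {a..b})"
  shows "\<exists>F. (\<forall>x\<in>{a..b}. F x = f x) \<and> (\<forall>x\<in>{a..b}. (F has_real_derivative f' x) (at x))"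
proof -
  define F where "F x = (if x < a then f a + f' a * (x - a) else if b < x then f b + f' b * (x - b) else f x)" for x
  have F: "F x = f x" if "x \<in> {a..b}" for x using that by (simp add: F_def)
  have "(F has_real_derivative f' x) (at x)" if x: "x \<in> {a..b}" for x
  proof -
    have w: "(F has_real_derivative f' x) (at x within {a..b})"
      by (rule has_field_derivative_transform_within[OF d[OF x] zero_less_one x]) (simp add: F)
    consider "a < x \<and> x < b" | "x = a" | "x = b" using x by fastforce
    then show ?thesis
    proof cases
      case 1
      then have "at x within {a..b} = at x" by (intro at_within_interior) auto
      then show ?thesis using w by simp
    next
      case 2
      have "((\<lambda>y. f a + f' a * (y - a)) has_real_derivative f' a) (at a within {..a})"
        by (auto intro!: derivative_eq_intros)
      then have "(F has_real_derivative f' a) (at a within {..a})"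
        by (rule has_field_derivative_transform_within[of _ _ _ _ 1]) (use ab in \<open>auto simp: F_def\<close>)
      then have "((\<lambda>y. (F y - F a) / (y - a)) \<longlongrightarrow> f' a) (at a within {..a} \<union> {a..b})"
        unfolding at_within_union using w 2 by (intro filterlim_sup) (simp_all add: has_field_derivative_iff)
      then have "(F has_real_derivative f' a) (at a within {..a} \<union> {a..b})" by (simp add: has_field_derivative_iff)
      moreover have "at a within {..a} \<union> {a..b} = at a"
      proof (rule at_within_nhd[of _ "{..<b}"])
        show "({..a} \<union> {a..b}) \<inter> {..<b} - {a} = UNIV \<inter> {..<b} - {a}" by auto
      qed (use ab in auto)
      ultimately show ?thesis using 2 by simp
    next
      case 3
      have "((\<lambda>y. f b + f' b * (y - b)) has_real_derivative f' b) (at b within {b..})"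
        by (auto intro!: derivative_eq_intros)
      then have "(F has_real_derivative f' b) (at b within {b..})"
        by (rule has_field_derivative_transform_within[of _ _ _ _ 1]) (use ab in \<open>auto simp: F_def\<close>)
      then have "((\<lambda>y. (F y - F b) / (y - b)) \<longlongrightarrow> f' b) (at b within {b..} \<union> {a..b})"
        unfolding at_within_union using w 3 by (intro filterlim_sup) (simp_all add: has_field_derivative_iff)
      then have "(F has_real_derivative f' b) (at b within {b..} \<union> {a..b})" by (simp add: has_field_derivative_iff)
      moreover have "at b within {b..} \<union> {a..b} = at b"
      proof (rule at_within_nhd[of _ "{a<..}"])
        show "({b..} \<union> {a..b}) \<inter> {a<..} - {b} = UNIV \<inter> {a<..} - {b}" by auto
      qed (use ab in auto)
      ultimately show ?thesis using 3 by simp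
    qed
  qed
  then show ?thesis using F by blast
qed

context igr_variational
begin

context
  fixes t :: real and \<Phi> p :: "real \<Rightarrow> real"
  assumes t: "0 \<le> t" and EL: "euler_lagrange t \<Phi> p"
begin

lemma el: "\<Phi> a = a" "\<Phi> b = b" "x \<in> {a..b} \<Longrightarrow> 0 < q_of t p x"
  "x \<in> {a..b} \<Longrightarrow> (\<Phi> has_real_derivative m x / q_of t p x) (at x within {a..b})"
  "x \<in> {a..b} \<Longrightarrow> (p has_real_derivative - (m x / \<alpha> * (\<Phi> x - x - t * u0 x))) (at x within {a..b})"
  using EL unfolding euler_lagrange_def by auto

text \<open>The derivative of \<open>q\<close>, from the equation for \<open>p\<close>.\<close>

definition q1 :: "real \<Rightarrow> real" where
  "q1 x = - (m x / \<alpha> * (\<Phi> x - x - t * u0 x)) + - 1 * \<eta>1 t x"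

lemma cont_q_of: "continuous_on {a..b} (q_of t p)"
  unfolding q_of_def[abs_def]
  by (intro continuous_intros cont_m cont_u1 DERIV_continuous_on[OF el(5)])

lemma cont_\<Phi>: "continuous_on {a..b} \<Phi>" by (rule DERIV_continuous_on[OF el(4)])

lemma cont_p1: "continuous_on {a..b} (\<lambda>x. - (m x / \<alpha> * (\<Phi> x - x - t * u0 x)))"
  using \<alpha> by (intro continuous_intros cont_m cont_u0 cont_\<Phi>) auto

lemma primitive_q: "primitive a b (q_of t p) q1"
proof -
  have "primitive a b p (\<lambda>x. - (m x / \<alpha> * (\<Phi> x - x - t * u0 x)))" by (rule primitive_of_deriv[OF el(5) cont_p1])
  then have "primitive a b (\<lambda>x. p x + - 1 * \<eta> t x) (\<lambda>x. - (m x / \<alpha> * (\<Phi> x - x - t * u0 x)) + - 1 * \<eta>1 t x)"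
    by (intro primitive_add primitive_cmult primitive_\<eta>)
  then show ?thesis unfolding q1_def[abs_def] by (rule primitive_cong) (auto simp: q_of_def \<eta>_def algebra_simps)
qed

lemma bm_q1: "bounded_measurable a b q1"
  unfolding q1_def[abs_def] by (intro W.B_add W.B_mult W.B_const bm_\<eta>1 W.B_cont[OF cont_p1])

text \<open>The candidate for the minimizer: the solution \<open>\<Phi>\<close>, made extensional to lie in the Helly space.\<close>

definition minimizer :: "real \<Rightarrow> real" where "minimizer = restrict \<Phi> {a..b}"

lemma el_strict: "strict_mono_on {a..b} \<Phi>"
proof (rule strict_mono_onI)
  fix x y assume xy: "x \<in> {a..b}" "y \<in> {a..b}" "x < y"
  show "\<Phi> x < \<Phi> y"
  proof (rule DERIV_pos_imp_increasing_open[OF xy(3)])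
    show "continuous_on {x..y} \<Phi>" by (rule continuous_on_subset[OF cont_\<Phi>]) (use xy in auto)
    fix z assume z: "x < z" "z < y"
    have "at z within {a..b} = at z" using z xy by (intro at_within_interior) auto
    then show "\<exists>w. (\<Phi> has_real_derivative w) (at z) \<and> 0 < w"
      using el(3,4)[of z] m_pos[of z] z xy by auto
  qed
qed

lemma minimizer_helly: "minimizer \<in> helly a b"
proof -
  have "\<Phi> x \<in> {a..b}" if "x \<in> {a..b}" for x by (rule euler_lagrange_range[OF EL that])
  moreover have "mono_on {a..b} minimizer"
    using strict_mono_on_imp_mono_on[OF el_strict] by (auto simp: minimizer_def mono_on_def)
  ultimately show ?thesis unfolding helly_def using el(1,2) ab by (auto simp: minimizer_def)
qed

lemma minimizer_strict: "strict_mono_on {a..b} minimizer"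
  using el_strict by (auto simp: minimizer_def strict_mono_on_def)

lemma minimizer_eq: "x \<in> {a..b} \<Longrightarrow> minimizer x = \<Phi> x" by (simp add: minimizer_def)

lemma X_minimizer: "x \<in> {a..b} \<Longrightarrow> gen_inverse a b minimizer (\<Phi> x) = x"
  using gen_inverse_of_strict[OF ab minimizer_helly minimizer_strict] by (simp add: minimizer_eq)

text \<open>Change of variables \<open>y = \<Phi>(x)\<close> with \<open>m dx = q dy\<close>.\<close>

lemma pushforward_density:
  "distr \<mu> (leb a b) minimizer = density (leb a b) (\<lambda>y. ennreal (q_of t p (gen_inverse a b minimizer y)))"
proof (rule measure_eqI)
  let ?L = "leb a b" and ?X = "gen_inverse a b minimizer"
  have mopt: "minimizer \<in> measurable \<mu> ?L" unfolding \<mu>_measurable by (rule helly_measurable[OF ab minimizer_helly])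
  have mq: "(\<lambda>y. q_of t p (?X y)) \<in> borel_measurable ?L"
    by (rule measurable_compose[OF gen_inverse_measurable[OF ab minimizer_helly] bounded_measurable_measurable[OF W.B_cont[OF cont_q_of]]])
  show "sets (distr \<mu> ?L minimizer) = sets (density ?L (\<lambda>y. ennreal (q_of t p (?X y))))" by simp
  fix A assume "A \<in> sets (distr \<mu> ?L minimizer)"
  then have A: "A \<in> sets ?L" by simp
  then have AB: "A \<in> sets borel" "A \<subseteq> {a..b}"
    by (auto simp: sets_restrict_space_iff dest: sets.sets_into_space)
  obtain F where F: "\<And>x. x \<in> {a..b} \<Longrightarrow> F x = \<Phi> x" "\<And>x. x \<in> {a..b} \<Longrightarrow> (F has_real_derivative m x / q_of t p x) (at x)"
    using derivative_extension[OF ab el(4)] by blast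
  \<comment> \<open>The substitution rule is applied to \<open>g\<close> along the extension \<open>F\<close> of \<open>\<Phi>\<close>.\<close>
  define g where "g y = q_of t p (?X y) * indicator A y" for y
  have cont': "continuous_on {a..b} (\<lambda>x. m x / q_of t p x)"
    using el(3) by (intro continuous_intros cont_m cont_q_of) force
  have Fab: "F a = a" "F b = b" using F(1) el(1,2) ab by auto
  have gm: "set_borel_measurable borel {F a..F b} g"
  proof -
    have "(\<lambda>y. indicator {a..b} y *\<^sub>R q_of t p (?X y)) \<in> borel_measurable borel"
      using mq unfolding measurable_leb_iff set_borel_measurable_def by simp
    then have "(\<lambda>y. (indicator {a..b} y *\<^sub>R q_of t p (?X y)) * indicator A y) \<in> borel_measurable borel"
      using AB by measurable
    then show ?thesis by (simp add: g_def[abs_def] set_borel_measurable_def Fab mult.assoc)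
  qed
  have pre: "minimizer -` A \<inter> space \<mu> \<in> sets \<mu>" using measurable_sets[OF mopt A] .
  have preL: "minimizer -` A \<inter> {a..b} \<in> sets ?L" using pre by (simp add: \<mu>_sets)
  have "emeasure (distr \<mu> ?L minimizer) A = emeasure \<mu> (minimizer -` A \<inter> {a..b})"
    using emeasure_distr[OF mopt A] by (simp add: \<mu>_sets)
  also have "\<dots> = (\<integral>\<^sup>+x. ennreal (m x) * indicator (minimizer -` A \<inter> {a..b}) x \<partial>?L)"
    unfolding \<mu> using preL bounded_measurable_measurable[OF bm_m] by (subst emeasure_density) auto
  also have "\<dots> = (\<integral>\<^sup>+x. ennreal (m x) * indicator (minimizer -` A \<inter> {a..b}) x * indicator {a..b} x \<partial>lborel)"
    by (subst nn_integral_restrict_space) auto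
  also have "\<dots> = (\<integral>\<^sup>+x. ennreal (g (F x) * (m x / q_of t p x) * indicator {a..b} x) \<partial>lborel)"
  proof (rule nn_integral_cong)
    fix x
    show "ennreal (m x) * indicator (minimizer -` A \<inter> {a..b}) x * indicator {a..b} x
        = ennreal (g (F x) * (m x / q_of t p x) * indicator {a..b} x)"
    proof (cases "x \<in> {a..b}")
      case True
      have "q_of t p x * (m x / q_of t p x) = m x" using el(3)[OF True] by simp
      then show ?thesis
        using True X_minimizer[OF True] F(1)[OF True] el(3)[OF True] m_pos[OF True] minimizer_eq[OF True]
        by (auto simp: g_def indicator_def)
    qed simp
  qed
  also have "\<dots> = (\<integral>\<^sup>+y. ennreal (g y * indicator {F a..F b} y) \<partial>lborel)"
    by (rule nn_integral_substitution[OF gm F(2) cont' _ less_imp_le[OF ab], symmetric])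
       (use el(3) m_pos in \<open>auto simp: less_imp_le\<close>)
  also have "\<dots> = (\<integral>\<^sup>+y. ennreal (g y) \<partial>?L)"
    unfolding Fab by (subst nn_integral_restrict_space) (auto intro!: nn_integral_cong simp: indicator_def)
  also have "\<dots> = (\<integral>\<^sup>+y. ennreal (q_of t p (?X y)) * indicator A y \<partial>?L)"
    by (rule nn_integral_cong) (auto simp: g_def indicator_def)
  also have "\<dots> = emeasure (density ?L (\<lambda>y. ennreal (q_of t p (?X y)))) A"
    using A mq by (subst emeasure_density) auto
  finally show "emeasure (distr \<mu> ?L minimizer) A = emeasure (density ?L (\<lambda>y. ennreal (q_of t p (?X y)))) A" .
qed

lemma entropy_minimizer: "Ent (leb a b) (distr \<mu> (leb a b) minimizer) = ereal (\<integral>x. m x * ln (q_of t p x) \<partial>leb a b)"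
proof -
  let ?L = "leb a b" and ?X = "gen_inverse a b minimizer"
  interpret L: finite_measure ?L by (rule finite_measure_leb)
  define \<nu> where "\<nu> = distr \<mu> ?L minimizer"
  define \<rho> where "\<rho> y = q_of t p (?X y)" for y
  have Xr: "?X y \<in> {a..b}" if "y \<in> {a..b}" for y by (rule gen_inverse_range[OF ab minimizer_helly that])
  have comp: "bounded_measurable a b (\<lambda>y. f (?X y))" if f: "bounded_measurable a b f" for f
  proof -
    obtain K where "\<And>x. x \<in> {a..b} \<Longrightarrow> \<bar>f x\<bar> \<le> K" using bounded_measurable_bound[OF f] by blast
    then show ?thesis using measurable_compose[OF gen_inverse_measurable[OF ab minimizer_helly] bounded_measurable_measurable[OF f]]
      unfolding measurable_leb_iff by (rule_tac bounded_measurableI) (use Xr in blast)+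
  qed
  have bml: "bounded_measurable a b (\<lambda>x. ln (q_of t p x))" by (rule bm_ln[OF cont_q_of el(3)])
  have b\<rho>: "bounded_measurable a b \<rho>" "bounded_measurable a b (\<lambda>y. ln (\<rho> y))"
    unfolding \<rho>_def using comp[OF W.B_cont[OF cont_q_of]] comp[OF bml] by auto
  have \<rho>0: "0 < \<rho> y" if "y \<in> {a..b}" for y using el(3)[OF Xr[OF that]] by (simp add: \<rho>_def)
  have d\<nu>: "\<nu> = density ?L (\<lambda>y. ennreal (\<rho> y))" unfolding \<nu>_def \<rho>_def by (rule pushforward_density)
  have \<rho>m[measurable]: "\<rho> \<in> borel_measurable ?L" by (rule bounded_measurable_measurable[OF b\<rho>(1)])
  have ac: "absolutely_continuous ?L \<nu>" unfolding d\<nu> by (rule absolutely_continuousI_density) measurable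
  have "AE y in ?L. ennreal (\<rho> y) = RN_deriv ?L \<nu> y"
    by (rule L.RN_deriv_unique) (auto simp: d\<nu>)
  then have RN: "AE y in ?L. enn2real (RN_deriv ?L \<nu> y) = \<rho> y"
    using AE_space by eventually_elim (metis \<rho>0 enn2real_ennreal less_imp_le space_leb)
  define h where "h y = \<rho> y * ln (\<rho> y)" for y
  have ih: "integrable ?L h" unfolding h_def by (intro integrable_leb_bounded_measurable W.B_mult b\<rho>)
  have "Ent ?L \<nu> = enn2ereal (\<integral>\<^sup>+ x. ennreal (h x) \<partial>?L) - enn2ereal (\<integral>\<^sup>+ x. ennreal (- h x) \<partial>?L)"
  proof -
    have "(\<integral>\<^sup>+ x. ennreal (enn2real (RN_deriv ?L \<nu> x) * ln (enn2real (RN_deriv ?L \<nu> x))) \<partial>?L) = (\<integral>\<^sup>+ x. ennreal (h x) \<partial>?L)"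
      "(\<integral>\<^sup>+ x. ennreal (- (enn2real (RN_deriv ?L \<nu> x) * ln (enn2real (RN_deriv ?L \<nu> x)))) \<partial>?L) = (\<integral>\<^sup>+ x. ennreal (- h x) \<partial>?L)"
      by (rule nn_integral_cong_AE, use RN in eventually_elim, simp add: h_def)+
    then show ?thesis using ac by (simp add: Ent_def Let_def)
  qed
  also have "\<dots> = ereal (\<integral>y. h y \<partial>?L)" by (rule integral_pos_neg_parts[OF ih])
  also have "(\<integral>y. h y \<partial>?L) = (\<integral>y. ln (\<rho> y) \<partial>\<nu>)"
    unfolding d\<nu> h_def using \<rho>0 bounded_measurable_measurable[OF b\<rho>(2)] by (subst integral_density) (auto intro!: AE_I2 less_imp_le)
  also have "\<dots> = (\<integral>x. ln (\<rho> (minimizer x)) \<partial>\<mu>)"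
    unfolding \<nu>_def using bounded_measurable_measurable[OF b\<rho>(2)]
    by (intro integral_distr) (auto simp: \<mu>_measurable helly_measurable[OF ab minimizer_helly])
  also have "\<dots> = (\<integral>x. ln (q_of t p x) \<partial>\<mu>)"
    by (rule Bochner_Integration.integral_cong) (auto simp: \<mu>_sets \<rho>_def X_minimizer minimizer_eq)
  also have "\<dots> = (\<integral>x. m x * ln (q_of t p x) \<partial>?L)" by (rule integral_\<mu>[OF bml])
  finally show ?thesis by (simp add: \<nu>_def)
qed

text \<open>The linear term of the dual bound at the solution itself: since \<open>\<Phi>' q = m\<close>, integrating \<open>(\<Phi> q)'\<close> gives the
total mass \<open>1\<close>. Consequently the dual bound is attained there.\<close>

lemma minimizer_mass: "b * q_of t p b - a * q_of t p a - (\<integral>x. q1 x * minimizer x \<partial>leb a b) = 1"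
proof -
  have cmq: "continuous_on {a..b} (\<lambda>x. m x / q_of t p x)"
    using el(3) by (intro continuous_intros cont_m cont_q_of) force
  have p\<Phi>: "primitive a b \<Phi> (\<lambda>x. m x / q_of t p x)"
    by (rule primitive_of_deriv[OF el(4) cmq])
  obtain K where K: "\<And>x. x \<in> {a..b} \<Longrightarrow> \<bar>q1 x\<bar> \<le> K" using bounded_measurable_bound[OF bm_q1] by blast
  have pm: "primitive a b (\<lambda>x. \<Phi> x * q_of t p x) (\<lambda>x. m x / q_of t p x * q_of t p x + q1 x * \<Phi> x)"
    by (rule primitive_mult[OF p\<Phi> primitive_q K])
  have "\<Phi> b * q_of t p b - \<Phi> a * q_of t p a = (\<integral>x. m x / q_of t p x * q_of t p x + q1 x * \<Phi> x \<partial>leb a b)"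
    using integral_leb_eq_integral[OF primitive_set_integrable[OF pm]] primitive_increment[OF pm, of a b] ab by simp
  also have "\<dots> = (\<integral>x. m x + q1 x * minimizer x \<partial>leb a b)"
  proof (rule Bochner_Integration.integral_cong[OF refl])
    fix x assume "x \<in> space (leb a b)"
    then show "m x / q_of t p x * q_of t p x + q1 x * \<Phi> x = m x + q1 x * minimizer x"
      using el(3)[of x] by (simp add: minimizer_eq)
  qed
  also have "\<dots> = 1 + (\<integral>x. q1 x * minimizer x \<partial>leb a b)"
    unfolding mass[symmetric]
    by (intro Bochner_Integration.integral_add integrable_leb_bounded_measurable W.B_mult bm_m bm_q1 helly_bounded_measurable[OF minimizer_helly])
  finally show ?thesis using el(1,2) by (simp add: mult.commute)
qed

definition E :: "(real \<Rightarrow> real) \<Rightarrow> ereal" where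
  "E = energy a b \<alpha> (velocity_functional a b \<alpha> \<mu> m (\<lambda>x. t * u0 x)) \<mu>"

text \<open>The minimal energy, with all terms that do not depend on the competitor collected.\<close>

definition E0 :: real where
  "E0 = (\<integral>x. m x * ((x\<^sup>2 - (\<Phi> x)\<^sup>2) / 2) \<partial>leb a b)
     + \<alpha> * ((\<integral>x. m x * ln (q_of t p x) \<partial>leb a b) + 1 - (b * q_of t p b - a * q_of t p a)) - \<alpha> * (\<eta> t b * b - \<eta> t a * a)"

text \<open>With the entropy replaced by its dual bound, the energy is a perfect square plus a constant.\<close>

lemma energy_bound_identity:
  assumes \<Psi>: "\<Psi> \<in> helly a b"
  shows "(\<integral>x. (\<Psi> x - x)\<^sup>2 / 2 \<partial>\<mu>)
      + \<alpha> * ((\<integral>x. m x * ln (q_of t p x) \<partial>leb a b) + 1 - (b * q_of t p b - a * q_of t p a - (\<integral>x. q1 x * \<Psi> x \<partial>leb a b)))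
      - velocity_functional a b \<alpha> \<mu> m (\<lambda>x. t * u0 x) \<Psi>
    = E0 + (\<integral>x. m x * ((\<Psi> x - \<Phi> x)\<^sup>2 / 2) \<partial>leb a b)"
proof -
  let ?L = "leb a b"
  note bm = helly_bounded_measurable[OF \<Psi>] W.B_cont[OF cont_\<Phi>] bm_m bm_q1 bm_\<eta>1 W.B_cont[OF cont_u0] W.B_cont[OF continuous_on_id]
  have sq: "bounded_measurable a b (\<lambda>x. (f x)\<^sup>2 / 2)" if "bounded_measurable a b f" for f
    using W.B_mult[OF W.B_const[of "1/2"] W.B_mult[OF that that]] by (simp add: power2_eq_square)
  have b1: "bounded_measurable a b (\<lambda>x. (\<Psi> x - x)\<^sup>2 / 2)" and b2: "bounded_measurable a b (\<lambda>x. (\<Psi> x - \<Phi> x)\<^sup>2 / 2)"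
    by (rule sq W.B_diff bm)+
  have b3: "bounded_measurable a b (\<lambda>x. (x\<^sup>2 - (\<Phi> x)\<^sup>2) / 2)"
    using W.B_diff[OF sq[OF bm(7)] sq[OF bm(2)]] by (simp add: diff_divide_distrib)
  have b4: "bounded_measurable a b (\<lambda>x. \<Psi> x * (t * u0 x * m x - \<alpha> * \<eta>1 t x))"
    by (intro W.B_mult W.B_diff W.B_const bm)
  have "(\<integral>x. m x * ((\<Psi> x - x)\<^sup>2 / 2) \<partial>?L) + \<alpha> * (\<integral>x. q1 x * \<Psi> x \<partial>?L) - (\<integral>x. \<Psi> x * (t * u0 x * m x - \<alpha> * \<eta>1 t x) \<partial>?L)
     = (\<integral>x. m x * ((\<Psi> x - x)\<^sup>2 / 2) + \<alpha> * (q1 x * \<Psi> x) - \<Psi> x * (t * u0 x * m x - \<alpha> * \<eta>1 t x) \<partial>?L)"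
    by (subst Bochner_Integration.integral_diff, (intro integrable_leb_bounded_measurable W.B_add W.B_mult W.B_const b1 b4 bm)+,
        subst Bochner_Integration.integral_add, (intro integrable_leb_bounded_measurable W.B_mult W.B_const b1 bm)+, simp)
  also have "\<dots> = (\<integral>x. m x * ((x\<^sup>2 - (\<Phi> x)\<^sup>2) / 2) + m x * ((\<Psi> x - \<Phi> x)\<^sup>2 / 2) \<partial>?L)"
  proof (rule Bochner_Integration.integral_cong[OF refl])
    fix x
    have "\<alpha> * q1 x = - (m x * (\<Phi> x - x - t * u0 x)) - \<alpha> * \<eta>1 t x"
      using \<alpha> by (simp add: q1_def algebra_simps)
    then have "\<alpha> * (q1 x * \<Psi> x) = (- (m x * (\<Phi> x - x - t * u0 x)) - \<alpha> * \<eta>1 t x) * \<Psi> x" by (metis mult.assoc)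
    then show "m x * ((\<Psi> x - x)\<^sup>2 / 2) + \<alpha> * (q1 x * \<Psi> x) - \<Psi> x * (t * u0 x * m x - \<alpha> * \<eta>1 t x)
      = m x * ((x\<^sup>2 - (\<Phi> x)\<^sup>2) / 2) + m x * ((\<Psi> x - \<Phi> x)\<^sup>2 / 2)"
      by (simp add: power2_eq_square field_simps)
  qed
  also have "\<dots> = (\<integral>x. m x * ((x\<^sup>2 - (\<Phi> x)\<^sup>2) / 2) \<partial>?L) + (\<integral>x. m x * ((\<Psi> x - \<Phi> x)\<^sup>2 / 2) \<partial>?L)"
    by (intro Bochner_Integration.integral_add integrable_leb_bounded_measurable W.B_mult bm b2 b3)
  finally have E: "(\<integral>x. m x * ((\<Psi> x - x)\<^sup>2 / 2) \<partial>?L) + \<alpha> * (\<integral>x. q1 x * \<Psi> x \<partial>?L) - (\<integral>x. \<Psi> x * (t * u0 x * m x - \<alpha> * \<eta>1 t x) \<partial>?L)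
     = (\<integral>x. m x * ((x\<^sup>2 - (\<Phi> x)\<^sup>2) / 2) \<partial>?L) + (\<integral>x. m x * ((\<Psi> x - \<Phi> x)\<^sup>2 / 2) \<partial>?L)" .
  show ?thesis unfolding velocity_functional_eq[OF \<Psi>] integral_\<mu>[OF b1] E0_def
    using E by (simp add: algebra_simps)
qed

lemma E_lower:
  assumes \<Psi>: "\<Psi> \<in> helly a b"
  shows "ereal (E0 + (\<integral>x. m x * ((\<Psi> x - \<Phi> x)\<^sup>2 / 2) \<partial>leb a b)) \<le> E \<Psi>"
proof -
  define l where "l = (\<integral>x. m x * ln (q_of t p x) \<partial>leb a b) + 1 - (b * q_of t p b - a * q_of t p a - (\<integral>x. q1 x * \<Psi> x \<partial>leb a b))"
  have "ereal l \<le> Ent (leb a b) (distr \<mu> (leb a b) \<Psi>)"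
    unfolding l_def by (rule entropy_lower_bound[OF \<Psi> primitive_q bm_q1 el(3)])
  then have "ereal \<alpha> * ereal l \<le> ereal \<alpha> * Ent (leb a b) (distr \<mu> (leb a b) \<Psi>)"
    using \<alpha> by (intro ereal_mult_left_mono) auto
  then show ?thesis
    unfolding energy_bound_identity[OF \<Psi>, symmetric] l_def[symmetric] E_def energy_def
    by (simp only: ereal_minus(1)[symmetric] plus_ereal.simps(1)[symmetric] times_ereal.simps(1)[symmetric])
       (intro ereal_minus_mono add_left_mono, auto)
qed

lemma E_minimizer: "E minimizer = ereal E0"
proof -
  have "(\<integral>x. m x * ((minimizer x - \<Phi> x)\<^sup>2 / 2) \<partial>leb a b) = (\<integral>x. 0 \<partial>leb a b)"
    by (rule Bochner_Integration.integral_cong) (auto simp: minimizer_eq)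
  then show ?thesis using energy_bound_identity[OF minimizer_helly] unfolding minimizer_mass
    by (simp add: E_def energy_def entropy_minimizer)
qed

text \<open>Equal energy forces \<open>\<Psi> = \<Phi>\<close> almost everywhere, hence on a dense set; a monotone function that agrees with a
continuous one on a dense set agrees with it everywhere.\<close>

lemma minimizer_unique:
  assumes \<Psi>: "\<Psi> \<in> helly a b" and le: "E \<Psi> \<le> E minimizer"
  shows "\<Psi> = minimizer"
proof -
  let ?L = "leb a b"
  have b2: "bounded_measurable a b (\<lambda>x. m x * ((\<Psi> x - \<Phi> x)\<^sup>2 / 2))"
    using W.B_mult[OF bm_m W.B_mult[OF W.B_const[of "1/2"] W.B_mult[OF W.B_diff[OF helly_bounded_measurable[OF \<Psi>] W.B_cont[OF cont_\<Phi>]] W.B_diff[OF helly_bounded_measurable[OF \<Psi>] W.B_cont[OF cont_\<Phi>]]]]]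
    by (simp add: power2_eq_square)
  have nn: "AE x in ?L. 0 \<le> m x * ((\<Psi> x - \<Phi> x)\<^sup>2 / 2)"
    using m_nonneg_AE by eventually_elim simp
  have "ereal (E0 + (\<integral>x. m x * ((\<Psi> x - \<Phi> x)\<^sup>2 / 2) \<partial>?L)) \<le> ereal E0"
    using order_trans[OF E_lower[OF \<Psi>] le] by (simp only: E_minimizer)
  then have "(\<integral>x. m x * ((\<Psi> x - \<Phi> x)\<^sup>2 / 2) \<partial>?L) \<le> 0" by simp
  moreover have "0 \<le> (\<integral>x. m x * ((\<Psi> x - \<Phi> x)\<^sup>2 / 2) \<partial>?L)" by (rule integral_nonneg_AE[OF nn])
  ultimately have "(\<integral>x. m x * ((\<Psi> x - \<Phi> x)\<^sup>2 / 2) \<partial>?L) = 0" by simp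
  then have "AE x in ?L. m x * ((\<Psi> x - \<Phi> x)\<^sup>2 / 2) = 0"
    by (subst (asm) integral_nonneg_eq_0_iff_AE[OF integrable_leb_bounded_measurable[OF b2] nn])
  then have ae: "AE x in lborel. x \<in> {a..b} \<longrightarrow> \<Psi> x = \<Phi> x"
    unfolding AE_leb_iff
  proof eventually_elim
    case (elim x)
    then show ?case using m_pos[of x] by auto
  qed
  have close: "\<exists>y. u < y \<and> y < v \<and> \<Psi> y = \<Phi> y" if uv: "a \<le> u" "u < v" "v \<le> b" for u v
  proof (rule ccontr)
    assume "\<not> ?thesis"
    then have "AE y in lborel. y \<notin> {u<..<v}" using ae uv by (auto elim!: eventually_mono)
    then have "emeasure lborel {u<..<v} = 0"
      by (subst (asm) AE_iff_measurable[where N = "{u<..<v}"]) auto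
    then show False using uv by simp
  qed
  have mono: "\<Psi> x \<le> \<Psi> y" if "x \<in> {a..b}" "y \<in> {a..b}" "x \<le> y" for x y
    using hellyD(1)[OF \<Psi>] that by (auto simp: mono_on_def)
  have "\<Psi> x = \<Phi> x" if x: "x \<in> {a..b}" for x
  proof (cases "x = a \<or> x = b")
    case True
    then show ?thesis using hellyD(2,3)[OF \<Psi>] el(1,2) by auto
  next
    case False
    then have xi: "a < x" "x < b" using x by auto
    have c: "isCont \<Phi> x"
      using continuous_on_interior[OF cont_\<Phi>, of x] xi by simp
    show ?thesis
    proof (rule antisym; rule field_le_epsilon)
      fix e :: real assume e: "0 < e"
      obtain \<delta> where \<delta>: "0 < \<delta>" "\<And>y. \<bar>y - x\<bar> < \<delta> \<Longrightarrow> \<bar>\<Phi> y - \<Phi> x\<bar> < e"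
        using c e unfolding continuous_at_real_range by (auto simp: )
      \<comment> \<open>Points of equality to the right and to the left of \<open>x\<close> squeeze \<open>\<Psi>(x)\<close>.\<close>
      obtain y where y: "x < y" "y < min b (x + \<delta>)" "\<Psi> y = \<Phi> y" using close[of x "min b (x + \<delta>)"] xi \<delta> by auto
      show "\<Psi> x \<le> \<Phi> x + e" using mono[of x y] \<delta>(2)[of y] y x by auto
      obtain z where z: "max a (x - \<delta>) < z" "z < x" "\<Psi> z = \<Phi> z" using close[of "max a (x - \<delta>)" x] xi \<delta> by auto
      show "\<Phi> x \<le> \<Psi> x + e" using mono[of z x] \<delta>(2)[of z] z x by auto
    qed
  qed
  then show ?thesis using hellyD(5)[OF \<Psi>] hellyD(5)[OF minimizer_helly]
    by (intro extensionalityI[of _ "{a..b}"]) (auto simp: minimizer_eq simp del: atLeastAtMost_iff)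
qed

lemma minimizer_iff: "is_minimizer_at a b \<alpha> \<mu> m u0 t \<Psi> \<longleftrightarrow> \<Psi> = minimizer"
proof
  assume "is_minimizer_at a b \<alpha> \<mu> m u0 t \<Psi>"
  then have "\<Psi> \<in> helly a b" "\<not> E minimizer < E \<Psi>"
    using minimizer_helly by (auto simp: is_minimizer_at_def is_arg_min_def E_def)
  then show "\<Psi> = minimizer" by (intro minimizer_unique) auto
next
  assume [simp]: "\<Psi> = minimizer"
  have "\<not> E \<Psi>' < E minimizer" if "\<Psi>' \<in> helly a b" for \<Psi>'
    using minimizer_unique[OF that] by (metis less_imp_le less_irrefl)
  then show "is_minimizer_at a b \<alpha> \<mu> m u0 t \<Psi>"
    using minimizer_helly by (auto simp: is_minimizer_at_def is_arg_min_def E_def)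
qed

end

end

section \<open>The equation of motion of the minimizers\<close>

context base_class
begin

text \<open>Bounds on all derivatives control the norm, so the difference quotients converge in norm.\<close>

lemma curve_derivs_C2_curve:
  assumes c: "curve_derivs j u v w"
    and N: "\<And>r f. small r j f \<Longrightarrow> N f \<le> ennreal (real (j + 1) * r)"
    and X: "\<And>f. regular j f \<Longrightarrow> f \<in> X"
  shows "C2_curve X N {0..} u v w"
proof -
  have lim: "((\<lambda>s. N (g s)) \<longlongrightarrow> 0) (at t within {0..})"
    if t: "0 \<le> t" and g: "\<And>s. s \<in> {0..t+1} \<Longrightarrow> s \<noteq> t \<Longrightarrow> small (K * \<bar>s - t\<bar>) j (g s)" for t K and g :: "real \<Rightarrow> real \<Rightarrow> real"
  proof (rule tendsto_sandwich[OF _ _ tendsto_const])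
    show "\<forall>\<^sub>F s in at t within {0..}. 0 \<le> N (g s)" by simp
    show "\<forall>\<^sub>F s in at t within {0..}. N (g s) \<le> ennreal (real (j + 1) * (K * \<bar>s - t\<bar>))"
      unfolding eventually_at by (intro exI[of _ 1] conjI ballI impI N g) (auto simp: dist_real_def)
    have "((\<lambda>s. ennreal (real (j + 1) * (K * \<bar>s - t\<bar>))) \<longlongrightarrow> ennreal (real (j + 1) * (K * \<bar>t - t\<bar>))) (at t within {0..})"
      by (intro tendsto_ennrealI tendsto_intros)
    then show "((\<lambda>s. ennreal (real (j + 1) * (K * \<bar>s - t\<bar>))) \<longlongrightarrow> 0) (at t within {0..})" by simp
  qed
  have K: "\<exists>K. \<forall>s\<in>{0..t+1}. s \<noteq> t \<longrightarrow>
     small (K * \<bar>s - t\<bar>) j (\<lambda>x. (u s x - u t x) / (s - t) - v t x) \<and>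
     small (K * \<bar>s - t\<bar>) j (\<lambda>x. (v s x - v t x) / (s - t) - w t x) \<and>
     small (K * \<bar>s - t\<bar>) j (\<lambda>x. w s x - w t x)" if "0 \<le> t" for t
    using small_quotient[OF _ c, of "t + 1"] that by fastforce
  show ?thesis
    unfolding C2_curve_def has_curve_deriv_def
  proof (intro conjI ballI)
    fix t :: real assume "t \<in> {0..}"
    then have t: "0 \<le> t" by simp
    show "u t \<in> X" "v t \<in> X" "w t \<in> X" using curve_derivs_regular[OF c t] X by auto
    obtain K where K: "\<forall>s\<in>{0..t+1}. s \<noteq> t \<longrightarrow>
     small (K * \<bar>s - t\<bar>) j (\<lambda>x. (u s x - u t x) / (s - t) - v t x) \<and>
     small (K * \<bar>s - t\<bar>) j (\<lambda>x. (v s x - v t x) / (s - t) - w t x) \<and>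
     small (K * \<bar>s - t\<bar>) j (\<lambda>x. w s x - w t x)" using K[OF t] by blast
    show "((\<lambda>s. N (\<lambda>x. (u s x - u t x) / (s - t) - v t x)) \<longlongrightarrow> 0) (at t within {0..})"
      "((\<lambda>s. N (\<lambda>x. (v s x - v t x) / (s - t) - w t x)) \<longlongrightarrow> 0) (at t within {0..})"
      "((\<lambda>s. N (\<lambda>x. w s x - w t x)) \<longlongrightarrow> 0) (at t within {0..})"
      by (rule lim[OF t, of K]; use K in blast)+
  qed
qed

end

context igr_acceleration
begin

text \<open>The equation for an abstract derivative \<open>d\<close>, space \<open>Y\<close> and quantifier \<open>Q\<close>. The derivatives of \<open>\<Phi>\<close>, \<open>V\<close> and \<open>A\<close> are continuous, so
that \<open>d\<close> is known at every point; the derivatives of the fluxes are base functions and are known only in the sense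
of \<open>Q\<close>.\<close>

lemma solves_igr_equation:
  assumes cls: "base_class a b P" and m: "base_class.regular a b P (Suc k) m" and u1: "base_class.regular a b P (Suc k) u1"
    and d_cont: "\<And>f g x. primitive a b f g \<Longrightarrow> continuous_on {a..b} g \<Longrightarrow> x \<in> {a..b} \<Longrightarrow> d f x = g x"
    and d_base: "\<And>f g. primitive a b f g \<Longrightarrow> P g \<Longrightarrow> Q (\<lambda>x. d f x = g x)"
    and Y: "\<And>f. base_class.regular a b P 1 f \<Longrightarrow> f \<in> Y"
    and Q: "\<And>R R' S. Q R \<Longrightarrow> Q R' \<Longrightarrow> (\<And>x. x \<in> {a..b} \<Longrightarrow> R x \<Longrightarrow> R' x \<Longrightarrow> S x) \<Longrightarrow> Q S"
    and Q_all: "\<And>S. (\<And>x. x \<in> {a..b} \<Longrightarrow> S x) \<Longrightarrow> Q S"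
  shows "solves_igr d Y Q a b \<alpha> m u0 \<Phi> V A"
  unfolding solves_igr_def
proof (intro conjI allI impI ballI)
  interpret K: base_class a b P by (rule cls)
  show "V 0 x = u0 x" "\<Phi> 0 x = x" if "x \<in> {a..b}" for x by (rule initial_values[OF that])+
  fix t :: real assume t: "0 \<le> t"
  show "\<Phi> t a = a" "\<Phi> t b = b" by (rule flow[OF t])+
  let ?F = "\<lambda>x. Z t x * Z t x * (1 / q t x)" and ?G = "\<lambda>x. 2 * (Z t x * Z t x * (1 / q t x)) + - 1 * B t x"
  have d\<Phi>: "d (\<Phi> t) x = m x / q t x" and dV: "d (V t) x = - c t x * Z t x"
    and dA: "d (A t) x = - c_dot t x * Z t x - c t x * B t x" if "x \<in> {a..b}" for x
    by (rule d_cont[OF primitive_\<Phi>[OF t] cont_\<Phi>[OF t] that] d_cont[OF primitive_V[OF t] cont_V[OF t] that]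
        d_cont[OF primitive_A[OF t] cont_A[OF t] that])+
  define p where "p y = inverse (d (\<Phi> t) y) ^ 2 * d (A t) y * m y" for y
  define r where "r y = inverse (d (\<Phi> t) y) ^ 3 * (d (V t) y)\<^sup>2 * m y" for y
  have pG: "?G x = p x" and rF: "?F x = r x" if "x \<in> {a..b}" for x
    unfolding p_def r_def d\<Phi>[OF that] dV[OF that] dA[OF that] using flux_identities[OF t that] by auto
  obtain g where g: "primitive a b ?F g" "P g" using flux_regular[OF cls m u1 t] by auto
  have pr: "primitive a b r g" by (rule primitive_cong[OF g(1)]; (erule rF | rule refl))
  have pp: "primitive a b p (\<lambda>x. 2 * g x + m x / \<alpha> * A t x)"
    by (rule primitive_cong[OF primitive_flux[OF t g(1)]]; (erule pG | rule refl))
  have cA: "continuous_on {a..b} (A t)" by (rule DERIV_continuous_on[OF A_deriv[OF t]])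
  have Pp: "P (\<lambda>x. 2 * g x + m x / \<alpha> * A t x)"
    by (intro K.B_add K.B_mult K.B_const g K.B_cont continuous_intros cont_m cA) (use \<alpha> in auto)
  have "r \<in> Y" "p \<in> Y" using Y pr pp g(2) Pp by auto
  moreover have "Q (\<lambda>x. d (\<Phi> t) x \<noteq> 0)"
    by (rule Q_all) (use d\<Phi> flow(3)[OF t] m_pos in force)
  moreover have "Q (\<lambda>x. A t x * m x - \<alpha> * d p x + 2 * \<alpha> * d r x = 0)"
    by (rule Q[OF d_base[OF pp Pp] d_base[OF pr g(2)]]) (use \<alpha> in \<open>simp add: algebra_simps\<close>)
  ultimately show "igr_equation d Y Q \<alpha> m (\<Phi> t) (V t) (A t)"
    unfolding igr_equation_def Let_def p_def r_def by blast
qed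

end

text \<open>By continuity, an almost everywhere lower bound holds at every point.\<close>

lemma essinf_pos_imp_lower_bound:
  assumes ab: "a < b" and m: "continuous_on {a..b} m" and e: "0 < essinf (leb a b) (\<lambda>x. ereal (m x))"
  shows "\<exists>c>0. \<forall>x\<in>{a..b}. c \<le> m x"
proof -
  have "esssup (leb a b) (\<lambda>x. - ereal (m x)) < 0"
    using e by (simp add: essinf_def ereal_less_uminus_reorder)
  then obtain r where r: "esssup (leb a b) (\<lambda>x. - ereal (m x)) < ereal r" "ereal r < 0"
    using ereal_dense2 by blast
  have "AE x in leb a b. - ereal (m x) \<le> esssup (leb a b) (\<lambda>x. - ereal (m x))" by (rule esssup_AE)
  then have ae: "AE x in lborel. x \<in> {a..b} \<longrightarrow> - r \<le> m x"
    unfolding AE_leb_iff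
  proof eventually_elim
    case (elim x)
    show ?case
    proof
      assume "x \<in> {a..b}"
      then have "- ereal (m x) < ereal r" using elim r(1) by (meson le_less_trans)
      then show "- r \<le> m x" by simp
    qed
  qed
  have "max (- r) (m x) = m x" if x: "x \<in> {a..b}" for x
  proof (rule continuous_AE_eq[OF ab _ m _ x, of "\<lambda>x. max (- r) (m x)"])
    show "continuous_on {a..b} (\<lambda>x. max (- r) (m x))" by (intro continuous_intros m)
    show "AE x in lborel. x \<in> {a<..<b} \<longrightarrow> max (- r) (m x) = m x"
      using ae by eventually_elim auto
  qed
  then have "\<forall>x\<in>{a..b}. - r \<le> m x" by (metis max.cobounded1)
  then show ?thesis using r(2) by (intro exI[of _ "- r"]) simp
qed

lemma igr_variational_exists:
  assumes ab: "a < b" and \<alpha>: "0 < \<alpha>" and prob: "prob_space \<mu>"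
    and \<mu>: "\<mu> = density (leb a b) (\<lambda>x. ennreal (m x))"
    and e: "0 < essinf (leb a b) (\<lambda>x. ereal (m x))"
    and bc: "u0 a = 0" "u0 b = 0"
    and m: "primitive a b m m1" "bounded_measurable a b m1"
    and u: "primitive a b u0 u1" "primitive a b u1 u2" "bounded_measurable a b u2"
  shows "\<exists>c0 M U L. igr_variational a b \<alpha> m u0 u1 c0 M U L m1 u2 \<mu>"
proof -
  obtain c0 where c0: "0 < c0" "\<And>x. x \<in> {a..b} \<Longrightarrow> c0 \<le> m x"
    using essinf_pos_imp_lower_bound[OF ab primitive_continuous[OF m(1)] e] by blast
  obtain M where M: "\<And>x. x \<in> {a..b} \<Longrightarrow> \<bar>m x\<bar> \<le> M" using compact_bound[OF primitive_continuous[OF m(1)]] by blast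
  obtain U where U: "\<And>x. x \<in> {a..b} \<Longrightarrow> \<bar>u0 x\<bar> \<le> U" using compact_bound[OF primitive_continuous[OF u(1)]] by blast
  obtain U' where U': "\<And>x. x \<in> {a..b} \<Longrightarrow> \<bar>u1 x\<bar> \<le> U'" using compact_bound[OF primitive_continuous[OF u(2)]] by blast
  obtain K where K: "\<And>x. x \<in> {a..b} \<Longrightarrow> \<bar>m1 x\<bar> \<le> K" using bounded_measurable_bound[OF m(2)] by blast
  obtain J where J: "\<And>x. x \<in> {a..b} \<Longrightarrow> \<bar>u2 x\<bar> \<le> J" using bounded_measurable_bound[OF u(3)] by blast
  have lip: "\<bar>f x - f y\<bar> \<le> (\<bar>K\<bar> + \<bar>J\<bar>) * \<bar>x - y\<bar>"
    if p: "primitive a b f g" and g: "\<And>x. x \<in> {a..b} \<Longrightarrow> \<bar>g x\<bar> \<le> \<bar>K\<bar> + \<bar>J\<bar>" and xy: "x \<in> {a..b}" "y \<in> {a..b}" for f g x y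
    using primitive_lipschitz[OF p g, of x y] primitive_lipschitz[OF p g, of y x] xy by (cases "x \<le> y") (auto simp: abs_minus_commute)
  have "igr_variational a b \<alpha> m u0 u1 c0 M (max \<bar>U\<bar> \<bar>U'\<bar>) (\<bar>K\<bar> + \<bar>J\<bar>) m1 u2 \<mu>"
  proof (intro igr_variational.intro igr_data.intro igr_variational_axioms.intro)
    fix x assume x: "x \<in> {a..b}"
    show "c0 \<le> m x \<and> m x \<le> M" using c0(2)[OF x] M[OF x] by auto
    show "\<bar>u0 x\<bar> \<le> max \<bar>U\<bar> \<bar>U'\<bar> \<and> \<bar>u1 x\<bar> \<le> max \<bar>U\<bar> \<bar>U'\<bar>" using U[OF x] U'[OF x] by auto
    show "(u0 has_real_derivative u1 x) (at x within {a..b})" by (rule primitive_imp_deriv[OF u(1) primitive_continuous[OF u(2)] x])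
    fix y assume y: "y \<in> {a..b}"
    show "\<bar>m x - m y\<bar> \<le> (\<bar>K\<bar> + \<bar>J\<bar>) * \<bar>x - y\<bar> \<and> \<bar>u1 x - u1 y\<bar> \<le> (\<bar>K\<bar> + \<bar>J\<bar>) * \<bar>x - y\<bar>"
      using lip[OF m(1) _ x y] lip[OF u(2) _ x y] K J by (meson abs_ge_self add_increasing add_increasing2 abs_ge_zero order_trans)
  qed (fact ab \<alpha> c0(1) bc m u \<mu> prob | simp)+
  then show ?thesis by blast
qed

context igr_variational
begin

lemma minimizer_exists_unique:
  assumes t: "0 \<le> t"
  shows "\<exists>!\<Psi>. is_minimizer_at a b \<alpha> \<mu> m u0 t \<Psi>"
proof -
  obtain \<Phi> p where "euler_lagrange t \<Phi> p" using euler_lagrange_exists[OF t] by blast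
  then show ?thesis using minimizer_iff[OF t] by simp
qed

lemma minimizer_euler_lagrange:
  assumes t: "0 \<le> t" and m: "is_minimizer_at a b \<alpha> \<mu> m u0 t \<Psi>"
  shows "\<exists>p. euler_lagrange t \<Psi> p"
proof -
  obtain \<Phi> p where el: "euler_lagrange t \<Phi> p" using euler_lagrange_exists[OF t] by blast
  have eq: "\<Psi> x = \<Phi> x" if "x \<in> {a..b}" for x
    using m minimizer_iff[OF t el] minimizer_eq[OF t el that] by simp
  have "euler_lagrange t \<Psi> p"
    unfolding euler_lagrange_def
  proof (intro conjI ballI)
    show "\<Psi> a = a" "\<Psi> b = b" using eq[of a] eq[of b] ab el by (auto simp: euler_lagrange_def)
    fix x assume x: "x \<in> {a..b}"
    have d: "0 < q_of t p x" "(\<Phi> has_real_derivative m x / q_of t p x) (at x within {a..b})"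
      "(p has_real_derivative - (m x / \<alpha> * (\<Phi> x - x - t * u0 x))) (at x within {a..b})"
      using el x by (auto simp: euler_lagrange_def)
    show "0 < q_of t p x" by (rule d)
    show "(\<Psi> has_real_derivative m x / q_of t p x) (at x within {a..b})"
      by (rule has_field_derivative_transform_within[OF d(2) zero_less_one x]) (simp add: eq)
    show "(p has_real_derivative - (m x / \<alpha> * (\<Psi> x - x - t * u0 x))) (at x within {a..b})"
      using d(3) by (simp add: eq[OF x])
  qed
  then show ?thesis by blast
qed

lemma minimizers_flow:
  assumes "\<And>t. 0 \<le> t \<Longrightarrow> is_minimizer_at a b \<alpha> \<mu> m u0 t (\<Phi> t)"
  shows "\<exists>p V R A B. igr_acceleration a b \<alpha> m u0 u1 c0 M U L \<Phi> p V R A B"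
proof -
  obtain p where "\<And>t. 0 \<le> t \<Longrightarrow> euler_lagrange t (\<Phi> t) (p t)"
    using minimizer_euler_lagrange[OF _ assms] by metis
  then interpret F: igr_flow a b \<alpha> m u0 u1 c0 M U L \<Phi> p by unfold_locales
  obtain V R where "igr_velocity a b \<alpha> m u0 u1 c0 M U L \<Phi> p V R" using F.velocity_exists by blast
  then interpret V: igr_velocity a b \<alpha> m u0 u1 c0 M U L \<Phi> p V R .
  show ?thesis using V.acceleration_exists by blast
qed

end

theorem theorem5p8:
  fixes a b \<alpha> :: real and k :: nat and \<mu> :: "real measure" and m u0 :: "real \<Rightarrow> real"
  assumes "a < b" and "\<alpha> > 0"
    and "prob_space \<mu>"
    and "\<mu> = density (leb a b) (\<lambda>x. ennreal (m x))"
    and "0 < essinf (leb a b) (\<lambda>x. ereal (m x))"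
    and "esssup (leb a b) (\<lambda>x. ereal (m x)) < \<infinity>"
    and "u0 a = 0" and "u0 b = 0"
  shows
    "(m \<in> sobolev_inf a b (k + 1) \<and> u0 \<in> sobolev_inf a b (k + 2) \<longrightarrow>
       (\<forall>t\<ge>0. \<exists>!\<Psi>. is_minimizer_at a b \<alpha> \<mu> m u0 t \<Psi>) \<and>
       (\<forall>\<Phi>. (\<forall>t\<ge>0. is_minimizer_at a b \<alpha> \<mu> m u0 t (\<Phi> t)) \<longrightarrow>
          (\<exists>V A. C2_curve (sobolev_inf a b (k + 2)) (sobolev_inf_norm a b (k + 2)) {0..} \<Phi> V A \<and>
             solves_igr (wderiv a b 1) (sobolev_inf a b 1) (\<lambda>P. AE x in leb a b. P x)
               a b \<alpha> m u0 \<Phi> V A)))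
     \<and>
     (m \<in> C_space a b (k + 1) \<and> u0 \<in> C_space a b (k + 2) \<longrightarrow>
       (\<forall>t\<ge>0. \<exists>!\<Psi>. is_minimizer_at a b \<alpha> \<mu> m u0 t \<Psi>) \<and>
       (\<forall>\<Phi>. (\<forall>t\<ge>0. is_minimizer_at a b \<alpha> \<mu> m u0 t (\<Phi> t)) \<longrightarrow>
          (\<exists>V A. C2_curve (C_space a b (k + 2)) (C_norm a b (k + 2)) {0..} \<Phi> V A \<and>
             solves_igr (cderiv a b) (C_space a b 1) (\<lambda>P. \<forall>x\<in>{a..b}. P x)
               a b \<alpha> m u0 \<Phi> V A)))"
proof -
  \<comment> \<open>Both statements are instances of one statement for a base class \<open>P\<close>, a derivative \<open>d\<close> and a quantifier \<open>Q\<close>.\<close>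
  interpret interval a b by unfold_locales (rule assms(1))
  have main: "(\<forall>t\<ge>0. \<exists>!\<Psi>. is_minimizer_at a b \<alpha> \<mu> m u0 t \<Psi>) \<and>
       (\<forall>\<Phi>. (\<forall>t\<ge>0. is_minimizer_at a b \<alpha> \<mu> m u0 t (\<Phi> t)) \<longrightarrow>
          (\<exists>V A. C2_curve X N {0..} \<Phi> V A \<and> solves_igr d Y Q a b \<alpha> m u0 \<Phi> V A))"
    if cls: "base_class a b P" and PW: "\<And>f. P f \<Longrightarrow> bounded_measurable a b f"
      and m: "base_class.regular a b P (Suc k) m" and u0: "base_class.regular a b P (Suc (Suc k)) u0"
      and N: "\<And>r f. base_class.small a b P r (Suc (Suc k)) f \<Longrightarrow> N f \<le> ennreal (real (Suc (Suc k) + 1) * r)"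
      and X: "\<And>f. base_class.regular a b P (Suc (Suc k)) f \<Longrightarrow> f \<in> X"
      and d_cont: "\<And>f g x. primitive a b f g \<Longrightarrow> continuous_on {a..b} g \<Longrightarrow> x \<in> {a..b} \<Longrightarrow> d f x = g x"
      and d_base: "\<And>f g. primitive a b f g \<Longrightarrow> P g \<Longrightarrow> Q (\<lambda>x. d f x = g x)"
      and Y: "\<And>f. base_class.regular a b P 1 f \<Longrightarrow> f \<in> Y"
      and Q: "\<And>R R' S. Q R \<Longrightarrow> Q R' \<Longrightarrow> (\<And>x. x \<in> {a..b} \<Longrightarrow> R x \<Longrightarrow> R' x \<Longrightarrow> S x) \<Longrightarrow> Q S"
      and Q_all: "\<And>S. (\<And>x. x \<in> {a..b} \<Longrightarrow> S x) \<Longrightarrow> Q S" for P X N d Y and Q :: "(real \<Rightarrow> bool) \<Rightarrow> bool"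
  proof -
    interpret K: base_class a b P by (rule cls)
    obtain m1 where m1: "primitive a b m m1" "K.regular k m1" using m by auto
    obtain u1 where u1: "primitive a b u0 u1" "K.regular (Suc k) u1" using u0 unfolding K.regular.simps(2)[of "Suc k"] by blast
    obtain u2 where u2: "primitive a b u1 u2" "K.regular k u2" using u1(2) by auto
    obtain c0 M U L where iv: "igr_variational a b \<alpha> m u0 u1 c0 M U L m1 u2 \<mu>"
      using igr_variational_exists[OF assms(1-5,7,8) m1(1) PW[OF K.regular_B[OF m1(2)]] u1(1) u2(1) PW[OF K.regular_B[OF u2(2)]]] by blast
    interpret I: igr_variational a b \<alpha> m u0 u1 c0 M U L m1 u2 \<mu> by (rule iv)
    show ?thesis
    proof (intro conjI allI impI)
      show "\<exists>!\<Psi>. is_minimizer_at a b \<alpha> \<mu> m u0 t \<Psi>" if "0 \<le> t" for t by (rule I.minimizer_exists_unique[OF that])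
      fix \<Phi> assume "\<forall>t\<ge>0. is_minimizer_at a b \<alpha> \<mu> m u0 t (\<Phi> t)"
      then obtain p V R A B where "igr_acceleration a b \<alpha> m u0 u1 c0 M U L \<Phi> p V R A B"
        using I.minimizers_flow[of \<Phi>] by blast
      then interpret F: igr_acceleration a b \<alpha> m u0 u1 c0 M U L \<Phi> p V R A B .
      have "C2_curve X N {0..} \<Phi> V A"
        by (rule K.curve_derivs_C2_curve[OF conjunct1[OF F.bootstrap[OF cls m u1(2)]] N X])
      moreover have "solves_igr d Y Q a b \<alpha> m u0 \<Phi> V A"
      proof (rule F.solves_igr_equation[where P = P, OF cls m u1(2)])
        show "d f x = g x" if "primitive a b f g" "continuous_on {a..b} g" "x \<in> {a..b}" for f g x by (rule d_cont[OF that])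
        show "Q (\<lambda>x. d f x = g x)" if "primitive a b f g" "P g" for f g by (rule d_base[OF that])
        show "Q S" if "Q R" "Q R'" "\<And>x. x \<in> {a..b} \<Longrightarrow> R x \<Longrightarrow> R' x \<Longrightarrow> S x" for R R' S by (rule Q[OF that])
        show "Q S" if "\<And>x. x \<in> {a..b} \<Longrightarrow> S x" for S by (rule Q_all[OF that])
      qed (rule Y)
      ultimately show "\<exists>V A. C2_curve X N {0..} \<Phi> V A \<and> solves_igr d Y Q a b \<alpha> m u0 \<Phi> V A" by blast
    qed
  qed
  show ?thesis
  proof (intro conjI[of "_ \<longrightarrow> _"] impI)
    assume "m \<in> sobolev_inf a b (k + 1) \<and> u0 \<in> sobolev_inf a b (k + 2)"
    then have "m \<in> sobolev_inf a b (Suc k)" "u0 \<in> sobolev_inf a b (Suc (Suc k))" by auto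
    then have mu: "W.regular (Suc k) m" "W.regular (Suc (Suc k)) u0" by (simp_all only: sobolev_iff_regular)
    show "(\<forall>t\<ge>0. \<exists>!\<Psi>. is_minimizer_at a b \<alpha> \<mu> m u0 t \<Psi>) \<and>
       (\<forall>\<Phi>. (\<forall>t\<ge>0. is_minimizer_at a b \<alpha> \<mu> m u0 t (\<Phi> t)) \<longrightarrow>
          (\<exists>V A. C2_curve (sobolev_inf a b (k + 2)) (sobolev_inf_norm a b (k + 2)) {0..} \<Phi> V A \<and>
             solves_igr (wderiv a b 1) (sobolev_inf a b 1) (\<lambda>P. AE x in leb a b. P x) a b \<alpha> m u0 \<Phi> V A))"
    proof (rule main[OF W.base_class_axioms _ mu])
      show "sobolev_inf_norm a b (k + 2) f \<le> ennreal (real (Suc (Suc k) + 1) * r)" if "W.small r (Suc (Suc k)) f" for r f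
        using small_sobolev_norm[OF that] by simp
      show "f \<in> sobolev_inf a b (k + 2)" if "W.regular (Suc (Suc k)) f" for f
        using that sobolev_iff_regular[of f "Suc k"] by simp
      show "wderiv a b 1 f x = g x" if "primitive a b f g" "continuous_on {a..b} g" "x \<in> {a..b}" for f g x
        by (rule wderiv_primitive(2)[OF that])
      show "AE x in leb a b. wderiv a b 1 f x = g x" if "primitive a b f g" for f g
        unfolding AE_leb_iff by (rule wderiv_primitive(1)[OF that])
      show "f \<in> sobolev_inf a b 1" if "W.regular 1 f" for f
        using that sobolev_iff_regular[of f 0] by simp
      show "AE x in leb a b. S x" if "AE x in leb a b. R x" "AE x in leb a b. R' x"
        "\<And>x. x \<in> {a..b} \<Longrightarrow> R x \<Longrightarrow> R' x \<Longrightarrow> S x" for R R' S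
        using that(1,2) AE_space by eventually_elim (use that(3) in simp)
      show "AE x in leb a b. S x" if "\<And>x. x \<in> {a..b} \<Longrightarrow> S x" for S
        by (rule AE_I2) (use that in simp)
    qed
  next
    assume "m \<in> C_space a b (k + 1) \<and> u0 \<in> C_space a b (k + 2)"
    then have mu: "C.regular (Suc k) m" "C.regular (Suc (Suc k)) u0"
      using C_space_C_regular[of m "Suc k"] C_space_C_regular[of u0 "Suc (Suc k)"] by auto
    show "(\<forall>t\<ge>0. \<exists>!\<Psi>. is_minimizer_at a b \<alpha> \<mu> m u0 t \<Psi>) \<and>
       (\<forall>\<Phi>. (\<forall>t\<ge>0. is_minimizer_at a b \<alpha> \<mu> m u0 t (\<Phi> t)) \<longrightarrow>
          (\<exists>V A. C2_curve (C_space a b (k + 2)) (C_norm a b (k + 2)) {0..} \<Phi> V A \<and>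
             solves_igr (cderiv a b) (C_space a b 1) (\<lambda>P. \<forall>x\<in>{a..b}. P x) a b \<alpha> m u0 \<Phi> V A))"
    proof (rule main[OF C.base_class_axioms W.B_cont mu])
      show "C_norm a b (k + 2) f \<le> ennreal (real (Suc (Suc k) + 1) * r)" if "C.small r (Suc (Suc k)) f" for r f
        using C_small_norm[OF that] by simp
      show "f \<in> C_space a b (k + 2)" if "C.regular (Suc (Suc k)) f" for f
        using C_regular_C_space[OF that] by simp
      show "cderiv a b f x = g x" if "primitive a b f g" "continuous_on {a..b} g" "x \<in> {a..b}" for f g x
        by (rule cderiv_primitive[OF that])
      show "\<forall>x\<in>{a..b}. cderiv a b f x = g x" if "primitive a b f g" "continuous_on {a..b} g" for f g
        using cderiv_primitive[OF that] by blast
      show "f \<in> C_space a b 1" if "C.regular 1 f" for f by (rule C_regular_C_space[OF that])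
    qed auto
  qed
qed

end
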